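(* Let $M$ be a $G_r$-equivariant $R_r$-module with a $G_r$-equivariant presentation $0\to N_r\to R_r\otimes V\to M\to0$, where $V$ is a finite dimensional representation of $T$ on which $\mathrm{GL}_r(\mathbf{k})$ acts trivially, and let $\rho(M)$ be a stabilization of $M$. Then $$\mathcal{K}(\rho(M))=\rho\,\mathcal{K}(M),$$ where on the right side $\rho=\sum_{k=0}^n(-1)^ke_k(t_1,\dots,t_n)\,\rho_k$ is the operator on symmetric polynomials defined in the context.
   Context: $\mathbf{k}$ is an algebraically closed field of characteristic zero, $n$ is fixed, $T=(\mathbf{k}^\times)^n$, $G_r=\mathrm{GL}_r(\mathbf{k})\times T$, and $R_r=\mathbf{k}[x_{ij}:1\le i\le r,\ 1\le j\le n]$ is the coordinate ring of the space of $r$-by-$n$ matrices, with action $((g,t)\cdot f)(v)=f(g^{-1}vt)$. We regard $R_r\subset R_{r+1}$ by adding a row of variables, and $G_r\subset G_{r+1}$ by direct sum with a $1$-by-$1$ identity matrix. $R_r$ is graded by $\mathbb{Z}^r\times\mathbb{Z}^n$ with $\deg x_{ij}=a_i+b_j$ (standard basis vectors). Equivariant modules are graded so that the piece of degree $(\mathbf{a},\mathbf{b})$ has $\mathrm{GL}_r$-weight $-\mathbf{a}$ and $T$-weight $\mathbf{b}$, and $\operatorname{Hilb}(M)=\sum\dim_{\mathbf{k}}(M_{(\mathbf{a},\mathbf{b})})u^{\mathbf{a}}t^{\mathbf{b}}$. The $K$-polynomial is the Laurent polynomial $\mathcal{K}(M)$ with $\operatorname{Hilb}(M)=\mathcal{K}(M)/\prod_{i=1}^r\prod_{j=1}^n(1-u_it_j)$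 for $R_r$-modules $M$ (and with $r+1$ in place of $r$ for $R_{r+1}$-modules). Stabilization: $V$ is also regarded as a $G_{r+1}$-representation with $\mathrm{GL}_{r+1}(\mathbf{k})$ acting trivially. Let $N_{r+1}$ be the smallest $G_{r+1}$-equivariant $R_{r+1}$-submodule of $R_{r+1}\otimes V$ containing $N_r$, and let $J_{r+1}\subset R_{r+1}$ be the ideal generated by the size $r+1$ minors of $[x_{ij}]$. Then $\rho(M)=(R_{r+1}\otimes V)/(N_{r+1}+(J_{r+1}\otimes V))$. Operators: for any integer tuple $\lambda\in\mathbb{Z}^m$ put $s_\lambda(x_1,\dots,x_m)=\det(x_i^{\lambda_j+m-j})_{i,j}/\det(x_i^{m-j})_{i,j}$. The map $\rho_k:\mathbb{Z}[u_1,\dots,u_r,t^{\pm1}]^{\mathfrak{S}_r}\to\mathbb{Z}[u_1,\dots,u_{r+1},t^{\pm1}]^{\mathfrak{S}_{r+1}}$ (symmetric groups permuting the $u$ variables) is the $\mathbb{Z}[t^{\pm1}]$-linear map with $\rho_k\,s_\lambda(u_1,\dots,u_r)=s_{(\lambda_1,\dots,\lambda_r,k)}(u_1,\dots,u_{r+1})$ for every partition $\lambda=(\lambda_1\ge\dots\ge\lambda_r\ge0)$. $e_k$ is the elementary symmetric polynomial. *)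

theory Defs
  imports
    "HOL-Library.Poly_Mapping"
    "HOL-Library.Product_Plus"
    "HOL-Library.FuncSet"
    "HOL-Combinatorics.Permutations"
    "HOL-Algebra.Group_Action"
    "HOL-Algebra.Generated_Groups"
    "HOL-Algebra.Ideal"
    "HOL-Algebra.Module"
    "Jordan_Normal_Form.Determinant"
    "Jordan_Normal_Form.DL_Submatrix"
    "Jordan_Normal_Form.VS_Connect"
begin

text \<open>All indices are 0-based: rows \<open>i < r\<close> and columns \<open>j < n\<close>.\<close>

section \<open>The coordinate rings\<close>

text \<open>
  Polynomials in variables \<open>x\<^sub>i\<^sub>j\<close> indexed by all pairs \<open>(i, j)\<close> live in one type; \<open>R\<^sub>r\<close> is the
  subring of those that involve only the variables with \<open>i < r\<close> and \<open>j < n\<close>.  In this way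
  \<open>R\<^sub>r\<close> is literally contained in \<open>R\<^sub>r\<^sub>+\<^sub>1\<close>.
\<close>

type_synonym xmonom = "(nat \<times> nat) \<Rightarrow>\<^sub>0 nat"
type_synonym 'k xpoly = "xmonom \<Rightarrow>\<^sub>0 'k"

definition monoms :: "nat \<Rightarrow> nat \<Rightarrow> xmonom set" where
  "monoms r n = {m. Poly_Mapping.keys m \<subseteq> {..<r} \<times> {..<n}}"

definition coord_ring :: "nat \<Rightarrow> nat \<Rightarrow> 'k::comm_ring_1 xpoly ring" where
  "coord_ring r n =
     \<lparr>carrier = {f. Poly_Mapping.keys f \<subseteq> monoms r n},
      monoid.mult = (*), one = 1, zero = 0, add = (+)\<rparr>"

definition xconst :: "'k::comm_ring_1 \<Rightarrow> 'k xpoly" where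
  "xconst c = Poly_Mapping.single 0 c"

definition xvar :: "nat \<Rightarrow> nat \<Rightarrow> 'k::comm_ring_1 xpoly" where
  "xvar i j = Poly_Mapping.single (Poly_Mapping.single (i, j) 1) 1"

definition xsubst :: "(nat \<times> nat \<Rightarrow> 'k xpoly) \<Rightarrow> 'k::comm_ring_1 xpoly \<Rightarrow> 'k xpoly" where
  "xsubst \<sigma> f = (\<Sum>m\<in>Poly_Mapping.keys f.
     xconst (Poly_Mapping.lookup f m) * (\<Prod>x\<in>Poly_Mapping.keys m. \<sigma> x ^ Poly_Mapping.lookup m x))"

definition minors :: "nat \<Rightarrow> 'a::comm_ring_1 mat \<Rightarrow> 'a set" where
  "minors q A = {det (submatrix A I J) | I J.
     I \<subseteq> {..<dim_row A} \<and> J \<subseteq> {..<dim_col A} \<and> card I = q \<and> card J = q}"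


section \<open>The groups and their actions\<close>

definition GL :: "nat \<Rightarrow> 'k::field mat monoid" where
  "GL r = units_of (ring_mat TYPE('k) r ())"

definition torus :: "nat \<Rightarrow> 'k::field vec monoid" where
  "torus n = \<lparr>carrier = {t \<in> carrier_vec n. \<forall>j<n. t $ j \<noteq> 0},
     monoid.mult = (\<lambda>s t. vec n (\<lambda>j. s $ j * t $ j)), one = vec n (\<lambda>_. 1)\<rparr>"

definition GLT :: "nat \<Rightarrow> nat \<Rightarrow> ('k::field mat \<times> 'k vec) monoid" where
  "GLT r n = GL r \<times>\<times> torus n"

text \<open>
  \<open>((g, t) \<cdot> f)(v) = f (g\<inverse> v t)\<close>: the \<open>(i, j)\<close> entry of \<open>g\<inverse> v t\<close> is
  \<open>\<Sum>l. (g\<inverse>)\<^sub>i\<^sub>l v\<^sub>l\<^sub>j t\<^sub>j\<close>, which is what \<open>x\<^sub>i\<^sub>j\<close> is replaced by.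
\<close>
definition poly_act :: "nat \<Rightarrow> 'k::field mat \<times> 'k vec \<Rightarrow> 'k xpoly \<Rightarrow> 'k xpoly" where
  "poly_act r = (\<lambda>(g, t).
     xsubst (\<lambda>(i, j). \<Sum>l<r. xconst ((inv\<^bsub>GL r\<^esub> g) $$ (i, l) * t $ j) * xvar l j))"

text \<open>The character \<open>t \<mapsto> t\<^sup>b\<close> of the \<open>m\<close>-dimensional torus.\<close>
definition torus_char :: "nat \<Rightarrow> (nat \<Rightarrow>\<^sub>0 int) \<Rightarrow> 'k::field vec \<Rightarrow> 'k" where
  "torus_char m b t = (\<Prod>j<m. (t $ j) powi (Poly_Mapping.lookup b j))"

text \<open>
  A finite dimensional rational representation of \<open>T\<close> on the space \<open>'v\<close> with scalar
  multiplication \<open>sV\<close>.  The last conjunct is rationality: each orbit map \<open>T \<rightarrow> V\<close> is regular,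
  that is, given by a Laurent polynomial with coefficients in \<open>V\<close>.
\<close>
definition torus_rep ::
  "nat \<Rightarrow> ('k::field \<Rightarrow> 'v::ab_group_add \<Rightarrow> 'v) \<Rightarrow> ('k vec \<Rightarrow> 'v \<Rightarrow> 'v) \<Rightarrow> bool" where
  "torus_rep n sV \<pi> \<longleftrightarrow>
     (\<exists>B. finite_dimensional_vector_space sV B) \<and>
     (\<forall>t\<in>carrier (torus n). Vector_Spaces.linear sV sV (\<pi> t)) \<and>
     (\<forall>v. \<pi> \<one>\<^bsub>torus n\<^esub> v = v) \<and>
     (\<forall>s\<in>carrier (torus n). \<forall>t\<in>carrier (torus n). \<forall>v. \<pi> (s \<otimes>\<^bsub>torus n\<^esub> t) v = \<pi> s (\<pi> t v)) \<and>
     (\<forall>v. \<exists>c :: (nat \<Rightarrow>\<^sub>0 int) \<Rightarrow>\<^sub>0 'v. \<forall>t\<in>carrier (torus n).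
        \<pi> t v = (\<Sum>b\<in>Poly_Mapping.keys c. sV (torus_char n b t) (Poly_Mapping.lookup c b)))"


section \<open>Equivariant modules\<close>

text \<open>
  The fields \<open>mult\<close> and \<open>one\<close>, which module records inherit from ring records, carry no meaning.
\<close>
record ('g, 'a, 'b) gmodule = "('a, 'b) module" +
  act :: "'g \<Rightarrow> 'b \<Rightarrow> 'b"

type_synonym ('k, 'm) equiv_mod = "('k mat \<times> 'k vec, 'k xpoly, 'm) gmodule"

text \<open>
  Rationality of the action is not demanded: it is automatic for equivariant quotients of the
  modules \<open>R\<^sub>r \<otimes> V\<close> below, and no others are considered.
\<close>
definition equivariant_module :: "nat \<Rightarrow> nat \<Rightarrow> ('k::field, 'm) equiv_mod \<Rightarrow> bool" where
  "equivariant_module r n M \<longleftrightarrow>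
     Module.module (coord_ring r n) M \<and>
     group_action (GLT r n) (carrier M) (\<lambda>\<gamma>. restrict (act M \<gamma>) (carrier M)) \<and>
     (\<forall>\<gamma>\<in>carrier (GLT r n). act M \<gamma> \<in> hom (add_monoid M) (add_monoid M)) \<and>
     (\<forall>\<gamma>\<in>carrier (GLT r n). \<forall>f\<in>carrier (coord_ring r n). \<forall>x\<in>carrier M.
        act M \<gamma> (f \<odot>\<^bsub>M\<^esub> x) = poly_act r \<gamma> f \<odot>\<^bsub>M\<^esub> act M \<gamma> x)"

definition equivariant_hom ::
  "nat \<Rightarrow> nat \<Rightarrow> ('k::field, 'a) equiv_mod \<Rightarrow> ('k, 'b) equiv_mod \<Rightarrow> ('a \<Rightarrow> 'b) set" where
  "equivariant_hom r n A B = {\<phi> \<in> hom (add_monoid A) (add_monoid B).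
     (\<forall>f\<in>carrier (coord_ring r n). \<forall>x\<in>carrier A. \<phi> (f \<odot>\<^bsub>A\<^esub> x) = f \<odot>\<^bsub>B\<^esub> \<phi> x) \<and>
     (\<forall>\<gamma>\<in>carrier (GLT r n). \<forall>x\<in>carrier A. \<phi> (act A \<gamma> x) = act B \<gamma> (\<phi> x))}"

definition equivariant_submodule ::
  "nat \<Rightarrow> nat \<Rightarrow> 'm set \<Rightarrow> ('k::field, 'm) equiv_mod \<Rightarrow> bool" where
  "equivariant_submodule r n N M \<longleftrightarrow> Module.submodule N (coord_ring r n) M \<and>
     (\<forall>\<gamma>\<in>carrier (GLT r n). \<forall>x\<in>N. act M \<gamma> x \<in> N)"

text \<open>
  The quotient by an equivariant submodule, with additive cosets as elements; as \<open>\<gamma>\<close> maps \<open>N\<close>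
  onto itself, the coset of \<open>\<gamma> x\<close> is the image under \<open>\<gamma>\<close> of the coset of \<open>x\<close>.
\<close>
definition quotient_module :: "('k, 'm) equiv_mod \<Rightarrow> 'm set \<Rightarrow> ('k, 'm set) equiv_mod" where
  "quotient_module M N =
     \<lparr>carrier = a_rcosets\<^bsub>M\<^esub> N, monoid.mult = undefined, one = undefined, zero = N, add = set_add M,
      smult = (\<lambda>f X. \<Union>x\<in>X. N +>\<^bsub>M\<^esub> (f \<odot>\<^bsub>M\<^esub> x)), act = (\<lambda>\<gamma> X. act M \<gamma> ` X)\<rparr>"

text \<open>
  \<open>R\<^sub>r \<otimes> V\<close> is realised as the space of polynomials in the \<open>x\<^sub>i\<^sub>j\<close> with coefficients in \<open>V\<close>.  The
  pure tensor \<open>f \<otimes> v\<close> has coefficients \<open>f\<^sub>m v\<close>, and \<open>(g, t) \<cdot> (f \<otimes> v) = ((g, t) \<cdot> f) \<otimes> \<pi> t v\<close>,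
  so that the general linear group acts trivially on \<open>V\<close>.
\<close>
definition tensor ::
  "('k::field \<Rightarrow> 'v::ab_group_add \<Rightarrow> 'v) \<Rightarrow> 'k xpoly \<Rightarrow> 'v \<Rightarrow> xmonom \<Rightarrow>\<^sub>0 'v" where
  "tensor sV f v = (\<Sum>m\<in>Poly_Mapping.keys f. Poly_Mapping.single m (sV (Poly_Mapping.lookup f m) v))"

definition free_module ::
  "nat \<Rightarrow> nat \<Rightarrow> ('k::field \<Rightarrow> 'v::ab_group_add \<Rightarrow> 'v) \<Rightarrow> ('k vec \<Rightarrow> 'v \<Rightarrow> 'v)
     \<Rightarrow> ('k, xmonom \<Rightarrow>\<^sub>0 'v) equiv_mod" where
  "free_module r n sV \<pi> =
     \<lparr>carrier = {p. Poly_Mapping.keys p \<subseteq> monoms r n},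
      monoid.mult = undefined, one = undefined, zero = 0, add = (+),
      smult = (\<lambda>f p. \<Sum>m\<in>Poly_Mapping.keys p.
        tensor sV (f * Poly_Mapping.single m 1) (Poly_Mapping.lookup p m)),
      act = (\<lambda>(g, t) p. \<Sum>m\<in>Poly_Mapping.keys p.
        tensor sV (poly_act r (g, t) (Poly_Mapping.single m 1)) (\<pi> t (Poly_Mapping.lookup p m)))\<rparr>"

text \<open>\<open>0 \<rightarrow> N \<rightarrow> R\<^sub>r \<otimes> V \<rightarrow> M \<rightarrow> 0\<close> is exact, with second map \<open>\<phi>\<close> and \<open>N \<subseteq> R\<^sub>r \<otimes> V\<close>.\<close>
definition equivariant_presentation ::
  "nat \<Rightarrow> nat \<Rightarrow> ('k::field \<Rightarrow> 'v::ab_group_add \<Rightarrow> 'v) \<Rightarrow> ('k vec \<Rightarrow> 'v \<Rightarrow> 'v)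
     \<Rightarrow> (xmonom \<Rightarrow>\<^sub>0 'v) set \<Rightarrow> ((xmonom \<Rightarrow>\<^sub>0 'v) \<Rightarrow> 'm) \<Rightarrow> ('k, 'm) equiv_mod \<Rightarrow> bool" where
  "equivariant_presentation r n sV \<pi> N \<phi> M \<longleftrightarrow>
     \<phi> \<in> equivariant_hom r n (free_module r n sV \<pi>) M \<and>
     \<phi> ` carrier (free_module r n sV \<pi>) = carrier M \<and>
     N = a_kernel (free_module r n sV \<pi>) M \<phi>"


section \<open>Stabilization\<close>

definition stab_submodule ::
  "nat \<Rightarrow> nat \<Rightarrow> ('k::field \<Rightarrow> 'v::ab_group_add \<Rightarrow> 'v) \<Rightarrow> ('k vec \<Rightarrow> 'v \<Rightarrow> 'v)
     \<Rightarrow> (xmonom \<Rightarrow>\<^sub>0 'v) set \<Rightarrow> (xmonom \<Rightarrow>\<^sub>0 'v) set" where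
  "stab_submodule r n sV \<pi> N =
     \<Inter>{N'. equivariant_submodule (r + 1) n N' (free_module (r + 1) n sV \<pi>) \<and> N \<subseteq> N'}"

definition minor_ideal :: "nat \<Rightarrow> nat \<Rightarrow> 'k::field xpoly set" where
  "minor_ideal r n = Idl\<^bsub>coord_ring (r + 1) n\<^esub>
     (minors (r + 1) (mat (r + 1) n (\<lambda>(i, j). xvar i j)))"

definition ideal_tensor ::
  "nat \<Rightarrow> nat \<Rightarrow> ('k::field \<Rightarrow> 'v::ab_group_add \<Rightarrow> 'v) \<Rightarrow> ('k vec \<Rightarrow> 'v \<Rightarrow> 'v)
     \<Rightarrow> 'k xpoly set \<Rightarrow> (xmonom \<Rightarrow>\<^sub>0 'v) set" where
  "ideal_tensor r n sV \<pi> J =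
     generate (add_monoid (free_module r n sV \<pi>)) {tensor sV f v | f v. f \<in> J}"

definition stabilization ::
  "nat \<Rightarrow> nat \<Rightarrow> ('k::field \<Rightarrow> 'v::ab_group_add \<Rightarrow> 'v) \<Rightarrow> ('k vec \<Rightarrow> 'v \<Rightarrow> 'v)
     \<Rightarrow> (xmonom \<Rightarrow>\<^sub>0 'v) set \<Rightarrow> ('k, (xmonom \<Rightarrow>\<^sub>0 'v) set) equiv_mod" where
  "stabilization r n sV \<pi> N =
     quotient_module (free_module (r + 1) n sV \<pi>)
       (stab_submodule r n sV \<pi> N <+>\<^bsub>free_module (r + 1) n sV \<pi>\<^esub>
        ideal_tensor (r + 1) n sV \<pi> (minor_ideal r n))"


section \<open>Hilbert series and K-polynomials\<close>

text \<open>
  Integral Laurent polynomials in \<open>u\<^sub>0, u\<^sub>1, \<dots>\<close> and \<open>t\<^sub>0, t\<^sub>1, \<dots>\<close>; the monomial \<open>u\<^sup>a t\<^sup>b\<close>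
  has exponent \<open>(a, b)\<close>.
\<close>
type_synonym laurent = "((nat \<Rightarrow>\<^sub>0 int) \<times> (nat \<Rightarrow>\<^sub>0 int)) \<Rightarrow>\<^sub>0 int"

definition upow :: "nat \<Rightarrow> int \<Rightarrow> laurent" where
  "upow i e = Poly_Mapping.single (Poly_Mapping.single i e, 0) 1"

definition tvar :: "nat \<Rightarrow> laurent" where
  "tvar j = Poly_Mapping.single (0, Poly_Mapping.single j 1) 1"

text \<open>
  The degree \<open>(a, b)\<close> piece: weight \<open>-a\<close> for the diagonal torus of the general linear group and
  weight \<open>b\<close> for \<open>T\<close>.  It is a vector space over \<open>k\<close> by restriction along \<open>k \<subseteq> R\<^sub>r\<close>.
\<close>
definition graded_piece ::
  "nat \<Rightarrow> nat \<Rightarrow> ('k::field, 'm) equiv_mod \<Rightarrow> (nat \<Rightarrow>\<^sub>0 int) \<Rightarrow> (nat \<Rightarrow>\<^sub>0 int) \<Rightarrow> ('k, 'm) module" where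
  "graded_piece r n M a b =
     \<lparr>carrier = {x \<in> carrier M. \<forall>d\<in>carrier (torus r). \<forall>t\<in>carrier (torus n).
        act M (mat_diag r (\<lambda>i. d $ i), t) x
          = xconst (torus_char r (- a) d * torus_char n b t) \<odot>\<^bsub>M\<^esub> x},
      monoid.mult = undefined, one = undefined, zero = \<zero>\<^bsub>M\<^esub>, add = add M,
      smult = (\<lambda>c x. xconst c \<odot>\<^bsub>M\<^esub> x)\<rparr>"

text \<open>The coefficients of the Hilbert series, supported in \<open>\<int>\<^sup>r \<times> \<int>\<^sup>n\<close>.\<close>
definition Hilb ::
  "nat \<Rightarrow> nat \<Rightarrow> ('k::field, 'm) equiv_mod \<Rightarrow> (nat \<Rightarrow>\<^sub>0 int) \<times> (nat \<Rightarrow>\<^sub>0 int) \<Rightarrow> int" where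
  "Hilb r n M = (\<lambda>(a, b). if Poly_Mapping.keys a \<subseteq> {..<r} \<and> Poly_Mapping.keys b \<subseteq> {..<n}
     then int (vectorspace.dim class_ring (graded_piece r n M a b)) else 0)"

text \<open>
  \<open>Hilb M = K / P\<close> with \<open>P = \<Prod>i. \<Prod>j. (1 - u\<^sub>i t\<^sub>j)\<close>, read as \<open>P \<cdot> Hilb M = K\<close>: the sum is the
  coefficient at \<open>d\<close> of the product of the Laurent polynomial \<open>P\<close> and the formal series \<open>Hilb M\<close>.
\<close>
definition K_polynomial :: "nat \<Rightarrow> nat \<Rightarrow> ('k::field, 'm) equiv_mod \<Rightarrow> laurent" where
  "K_polynomial r n M = (THE K. \<forall>d.
     (let P = (\<Prod>i<r. \<Prod>j<n. 1 - upow i 1 * tvar j)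
      in \<Sum>e\<in>Poly_Mapping.keys P. Poly_Mapping.lookup P e * Hilb r n M (d - e))
     = Poly_Mapping.lookup K d)"


section \<open>Operators on symmetric polynomials\<close>

text \<open>
  \<open>s\<^sub>\<nu>(u\<^sub>0, \<dots>, u\<^sub>m\<^sub>-\<^sub>1)\<close> for \<open>\<nu> \<in> \<int>\<^sup>m\<close>, given as a list of length \<open>m\<close>: the quotient of the two
  alternants in the Laurent polynomial ring.
\<close>
definition alternant :: "int list \<Rightarrow> laurent" where
  "alternant es = det (mat (length es) (length es) (\<lambda>(i, j). upow i (es ! j)))"

definition schur :: "int list \<Rightarrow> laurent" where
  "schur \<nu> = (let m = length \<nu> in
     THE s. s * alternant (map (\<lambda>j. int m - 1 - int j) [0..<m])
              = alternant (map (\<lambda>j. \<nu> ! j + int m - 1 - int j) [0..<m]))"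

definition tring :: "nat \<Rightarrow> laurent set" where
  "tring n = {c. \<forall>(a, b)\<in>Poly_Mapping.keys c. a = 0 \<and> Poly_Mapping.keys b \<subseteq> {..<n}}"

text \<open>\<open>\<int>[u\<^sub>0, \<dots>, u\<^sub>r\<^sub>-\<^sub>1, t\<^sup>\<plusminus>\<^sup>1]\<close> and its invariants under permutation of the \<open>u\<^sub>i\<close>.\<close>
definition utring :: "nat \<Rightarrow> nat \<Rightarrow> laurent set" where
  "utring r n = {f. \<forall>(a, b)\<in>Poly_Mapping.keys f.
     Poly_Mapping.keys a \<subseteq> {..<r} \<and> (\<forall>i. Poly_Mapping.lookup a i \<ge> 0) \<and>
     Poly_Mapping.keys b \<subseteq> {..<n}}"

definition sym_utring :: "nat \<Rightarrow> nat \<Rightarrow> laurent set" where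
  "sym_utring r n = {f \<in> utring r n. \<forall>p. p permutes {..<r} \<longrightarrow>
     (\<forall>a b. Poly_Mapping.lookup f (Poly_Mapping.map_key p a, b) = Poly_Mapping.lookup f (a, b))}"

definition rho_k :: "nat \<Rightarrow> nat \<Rightarrow> nat \<Rightarrow> laurent \<Rightarrow> laurent" where
  "rho_k r n k = (THE F. F \<in> sym_utring r n \<rightarrow>\<^sub>E sym_utring (r + 1) n \<and>
     (\<forall>f\<in>sym_utring r n. \<forall>g\<in>sym_utring r n. F (f + g) = F f + F g) \<and>
     (\<forall>c\<in>tring n. \<forall>f\<in>sym_utring r n. F (c * f) = c * F f) \<and>
     (\<forall>\<nu>. length \<nu> = r \<and> sorted_wrt (\<ge>) \<nu> \<and> (\<forall>x\<in>set \<nu>. x \<ge> 0) \<longrightarrow>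
        F (schur \<nu>) = schur (\<nu> @ [int k])))"

definition elem_sym_t :: "nat \<Rightarrow> nat \<Rightarrow> laurent" where
  "elem_sym_t n k = (\<Sum>S | S \<subseteq> {..<n} \<and> card S = k. \<Prod>j\<in>S. tvar j)"

definition rho :: "nat \<Rightarrow> nat \<Rightarrow> laurent \<Rightarrow> laurent" where
  "rho r n f = (\<Sum>k\<le>n. (- 1) ^ k * elem_sym_t n k * rho_k r n k f)"

end

theory Submission
  imports Defs "HOL-Library.Function_Algebras" "HOL-Library.Nat_Bijection" "Jordan_Normal_Form.Char_Poly"
begin

text \<open>
  Write \<open>H\<close> and \<open>H'\<close> for the Hilbert series of \<open>M\<close> and of its stabilization.  Both are symmetric in the
  \<open>u\<close> variables, and two properties determine \<open>H'\<close> from \<open>H\<close>: they agree in the degrees that do not involve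
  the last \<open>u\<close> variable, and the Schur expansion of \<open>H'\<close> has no partition of length \<open>r + 1\<close>.  The first
  holds because substitution of linear forms in the first \<open>r\<close> rows maps the stabilized relations back into the original ones,
  and kills the maximal minors.  For the second, a highest weight vector (modulo the relations) whose weight
  has \<open>r + 1\<close> positive parts is a multiple of its image under the Capelli operator, hence lies in the ideal
  of maximal minors; to read this off from dimensions alone, the Casimir operator is used to bound
  the weights of the Weyl numerator of the character, so that no complete reducibility is needed.
  On the combinatorial side, multiplication by \<open>\<Prod>j. 1 - u\<^sub>r t\<^sub>j\<close> turns the passage from \<open>H\<close> to \<open>H'\<close>
  into the alternating sum of the operators \<open>\<rho>\<^sub>k\<close>.
\<close>

section \<open>Laurent polynomials acting on formal series\<close>

text \<open>Only dimensions of weight spaces are at hand, while the claim concerns Schur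
  coefficients. Multiplication by the Vandermonde determinant (the Weyl denominator) turns Schur
  coefficients into coefficients at exponents \<open>\<lambda> + \<delta>\<close>; but a nonzero
  coefficient of this signed sum does not by itself exhibit a vector of weight
  \<open>\<lambda>\<close>. So one takes, among the pairs \<open>K \<subseteq> L\<close> of
  gl-stable subspaces whose quotient has that coefficient nonzero, a pair of minimal dimension. On
  its quotient the Casimir operator is a scalar, and the trace identity puts all exponents of the
  numerator with the same total degree and torus weight on one sphere. The half-space beyond
  \<open>\<mu> = \<lambda> + \<delta>\<close> touches that sphere only at \<open>\<mu>\<close>,
  hence \<open>\<lambda>\<close> is the extreme weight of \<open>L / K\<close> and its vectors are
  highest. Lie algebra operators enter by differentiating one-parameter families of substitutions,
  and singular substitutions by density; both use that the field is infinite. The K-polynomial of a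
  quotient exists because leading monomials of the relations form finitely generated
  up-sets.\<close>

abbreviation lk :: "('a \<Rightarrow>\<^sub>0 'b::zero) \<Rightarrow> 'a \<Rightarrow> 'b" where "lk \<equiv> Poly_Mapping.lookup"
abbreviation ky :: "('a \<Rightarrow>\<^sub>0 'b::zero) \<Rightarrow> 'a set" where "ky \<equiv> Poly_Mapping.keys"
abbreviation sg :: "'a \<Rightarrow> 'b \<Rightarrow> ('a \<Rightarrow>\<^sub>0 'b::zero)" where "sg \<equiv> Poly_Mapping.single"

type_synonym expo = "(nat \<Rightarrow>\<^sub>0 int) \<times> (nat \<Rightarrow>\<^sub>0 int)"

lemma sum_keys_superset:
  assumes "finite S" "ky f \<subseteq> S" "\<And>e. h e 0 = 0"
  shows "(\<Sum>e\<in>ky f. h e (lk f e)) = (\<Sum>e\<in>S. h e (lk f e))"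
  by (rule sum.mono_neutral_left) (use assms in \<open>auto simp: in_keys_iff\<close>)

lemma sum_keys_add:
  assumes "\<And>e. h e 0 = 0" "\<And>e x y. h e (x + y) = h e x + h e y"
  shows "(\<Sum>e\<in>ky (f + g). h e (lk (f + g) e)) = (\<Sum>e\<in>ky f. h e (lk f e)) + (\<Sum>e\<in>ky g. h e (lk g e))"
proof -
  let ?S = "ky f \<union> ky g"
  have "(\<Sum>e\<in>ky (f + g). h e (lk (f + g) e)) = (\<Sum>e\<in>?S. h e (lk (f + g) e))"
    by (rule sum_keys_superset) (use Poly_Mapping.keys_add[of f g] assms(1) in auto)
  also have "\<dots> = (\<Sum>e\<in>?S. h e (lk f e)) + (\<Sum>e\<in>?S. h e (lk g e))"
    by (simp add: lookup_add assms(2) sum.distrib)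
  also have "(\<Sum>e\<in>?S. h e (lk f e)) = (\<Sum>e\<in>ky f. h e (lk f e))"
    by (rule sum_keys_superset[symmetric]) (auto simp: assms(1))
  also have "(\<Sum>e\<in>?S. h e (lk g e)) = (\<Sum>e\<in>ky g. h e (lk g e))"
    by (rule sum_keys_superset[symmetric]) (auto simp: assms(1))
  finally show ?thesis .
qed

lemma sum_keys_single:
  assumes "\<And>e. h e 0 = 0"
  shows "(\<Sum>e\<in>ky (sg x c). h e (lk (sg x c) e)) = h x c"
  using assms by auto

lemma poly_mapping_sum_single: "f = (\<Sum>e\<in>ky f. sg e (lk f e))"
proof (rule poly_mapping_eqI)
  fix k
  have "lk (\<Sum>e\<in>ky f. sg e (lk f e)) k = (\<Sum>e\<in>ky f. if e = k then lk f e else 0)"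
    by (simp add: lookup_sum lookup_single when_def)
  also have "\<dots> = lk f k" by (auto simp: in_keys_iff)
  finally show "lk f k = lk (\<Sum>e\<in>ky f. sg e (lk f e)) k" by simp
qed

lemma poly_mapping_single_induct [case_names zero single add]:
  fixes f :: "'a \<Rightarrow>\<^sub>0 'b::comm_monoid_add"
  assumes "P 0" "\<And>e c. c \<noteq> 0 \<Longrightarrow> P (sg e c)" "\<And>f g. P f \<Longrightarrow> P g \<Longrightarrow> P (f + g)"
  shows "P f"
proof -
  have "finite S \<Longrightarrow> (\<forall>e\<in>S. c e \<noteq> 0) \<Longrightarrow> P (\<Sum>e\<in>S. sg e (c e))" for S c
    by (induction S rule: finite_induct) (use assms in auto)
  from this[of "ky f" "lk f"] show ?thesis
    by (simp flip: poly_mapping_sum_single add: in_keys_iff)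
qed

text \<open>Series with exponents unbounded in all directions cannot be multiplied with each other,
  so they are treated as a module over Laurent polynomials; \<open>conv_mult\<close> is the module
  law. The values lie in an arbitrary commutative ring because traces with values in the field occur
  besides integer dimensions.\<close>

definition conv :: "laurent \<Rightarrow> (expo \<Rightarrow> 'a::comm_ring_1) \<Rightarrow> expo \<Rightarrow> 'a" where
  "conv P H d = (\<Sum>e\<in>ky P. of_int (lk P e) * H (d - e))"

lemma conv_0 [simp]: "conv 0 H = (\<lambda>d. 0)"
  by (simp add: conv_def fun_eq_iff)

lemma conv_add: "conv (P + Q) H d = conv P H d + conv Q H d"
  unfolding conv_def
  by (rule sum_keys_add[where h = "\<lambda>e c. of_int c * H (d - e)"]) (auto simp: algebra_simps)

lemma conv_single: "conv (sg e c) H d = of_int c * H (d - e)"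
  unfolding conv_def by (rule sum_keys_single[where h = "\<lambda>e c. of_int c * H (d - e)"]) auto

lemma conv_one [simp]: "conv 1 H = H"
  by (auto simp: fun_eq_iff conv_single simp flip: single_one)

lemma conv_sum: "conv (\<Sum>x\<in>S. P x) H d = (\<Sum>x\<in>S. conv (P x) H d)"
  by (induction S rule: infinite_finite_induct) (auto simp: conv_add)

lemma conv_right_add: "conv P (\<lambda>e. H e + G e) d = conv P H d + conv P G d"
  by (simp add: conv_def sum.distrib algebra_simps)

lemma conv_right_sum: "conv P (\<lambda>e. \<Sum>x\<in>S. H x e) d = (\<Sum>x\<in>S. conv P (H x) d)"
  unfolding conv_def by (subst sum.swap) (simp add: sum_distrib_left)

lemma conv_right_scale: "conv P (\<lambda>e. c * H e) d = c * conv P H d"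
  by (simp add: conv_def sum_distrib_left mult_ac)

lemma conv_right_diff: "conv P (\<lambda>e. H e - G e) d = conv P H d - conv P G d"
  by (simp add: conv_def sum_subtractf algebra_simps)

lemma conv_mult: "conv (P * Q) H = conv P (conv Q H)"
proof (induction P rule: poly_mapping_single_induct)
  case (single e c)
  show ?case
  proof (induction Q rule: poly_mapping_single_induct)
    case (single e' c')
    show ?case by (auto simp: mult_single conv_single fun_eq_iff algebra_simps)
  next
    case (add f g)
    then show ?case by (auto simp: distrib_left conv_add conv_right_add fun_eq_iff conv_single)
  qed (simp add: conv_single fun_eq_iff)
qed (auto simp: distrib_right conv_add fun_eq_iff)

text \<open>A Laurent polynomial is itself a series of finite support, and on these the module
  action is the ring product; coefficients of products are computed through this identity.\<close>

lemma conv_lookup: "conv P (lk Q) = lk (P * Q)"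
proof -
  have "conv P (conv Q (lk 1)) = conv (P * Q) (lk (1 :: laurent))" by (simp add: conv_mult)
  moreover have "conv R (lk 1) = lk R" for R :: laurent
  proof
    fix d
    have "conv R (lk 1) d = (\<Sum>e\<in>ky R. if e = d then lk R e else 0)"
      unfolding conv_def by (rule sum.cong) (auto simp: lookup_one when_def)
    also have "\<dots> = lk R d" by (auto simp: in_keys_iff)
    finally show "conv R (lk 1) d = lk R d" .
  qed
  ultimately show ?thesis by simp
qed

lemma conv_of_int: "conv P (\<lambda>e. of_int (H e)) d = (of_int (conv P H d) :: 'a::comm_ring_1)"
  by (simp add: conv_def)

section \<open>Permuting the first family of variables\<close>

text \<open>Precomposition on exponents is contravariant (\<open>pe_comp\<close>); the induced
  operation \<open>pact\<close> on Laurent polynomials is a left action and sends \<open>u_i\<close>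
  to \<open>u_(p i)\<close> (\<open>pact_comp\<close>, \<open>pact_upow\<close>).\<close>

definition pe :: "(nat \<Rightarrow> nat) \<Rightarrow> expo \<Rightarrow> expo" where
  "pe p = (\<lambda>(a, b). (Poly_Mapping.map_key p a, b))"

lemma pe_pair [simp]: "pe p (a, b) = (Poly_Mapping.map_key p a, b)"
  by (simp add: pe_def)

lemma snd_pe [simp]: "snd (pe p d) = snd d"
  by (cases d) simp

lemma lookup_map_key_inj: "inj f \<Longrightarrow> lk (Poly_Mapping.map_key f a) i = lk a (f i)"
  by (simp add: map_key.rep_eq)

lemma pe_diff: "inj p \<Longrightarrow> pe p (d - e) = pe p d - pe p e"
  by (cases d; cases e) (auto intro!: poly_mapping_eqI simp: lookup_map_key_inj lookup_minus)

lemma pe_add: "inj p \<Longrightarrow> pe p (d + e) = pe p d + pe p e"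
  by (cases d; cases e) (auto intro!: poly_mapping_eqI simp: lookup_map_key_inj lookup_add)

lemma pe_comp: "inj p \<Longrightarrow> inj q \<Longrightarrow> pe p (pe q d) = pe (q \<circ> p) d"
  by (cases d) (auto intro!: poly_mapping_eqI simp: lookup_map_key_inj inj_compose)

lemma pe_id [simp]: "pe id d = d"
  by (cases d) (auto intro!: poly_mapping_eqI simp: lookup_map_key_inj)

lemma pe_inv:
  assumes "p permutes S"
  shows "pe (inv_into UNIV p) (pe p d) = d" "pe p (pe (inv_into UNIV p) d) = d"
  using assms permutes_inv[OF assms]
  by (simp_all add: pe_comp permutes_inj permutes_inv_o)

lemma bij_pe: "p permutes S \<Longrightarrow> bij (pe p)"
  by (rule o_bij[of "pe (inv_into UNIV p)"]) (auto simp: pe_inv fun_eq_iff)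

lemma inj_pe: "p permutes S \<Longrightarrow> inj (pe p)"
  by (rule bij_is_inj[OF bij_pe])

definition pact :: "(nat \<Rightarrow> nat) \<Rightarrow> laurent \<Rightarrow> laurent" where
  "pact p f = Poly_Mapping.map_key (pe p) f"

lemma lookup_pact: "p permutes S \<Longrightarrow> lk (pact p f) d = lk f (pe p d)"
  by (simp add: pact_def lookup_map_key_inj inj_pe)

lemma conv_pact:
  assumes "p permutes S"
  shows "conv (pact p f) (H \<circ> pe p) = conv f H \<circ> pe p"
proof
  fix d
  have bij: "bij_betw (pe p) (ky (pact p f)) (ky f)"
    using bij_pe[OF assms]
    by (intro bij_betwI[where g = "pe (inv_into UNIV p)"]) (auto simp: in_keys_iff lookup_pact[OF assms] pe_inv[OF assms])
  have "conv f H (pe p d) = (\<Sum>e\<in>ky (pact p f). of_int (lk f (pe p e)) * H (pe p d - pe p e))"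
    unfolding conv_def by (rule sum.reindex_bij_betw[OF bij, symmetric])
  also have "\<dots> = conv (pact p f) (H \<circ> pe p) d"
    by (simp add: conv_def lookup_pact[OF assms] pe_diff[OF permutes_inj[OF assms]])
  finally show "conv (pact p f) (H \<circ> pe p) d = (conv f H \<circ> pe p) d" by simp
qed

lemma pact_mult: "p permutes S \<Longrightarrow> pact p (f * g) = pact p f * pact p g"
proof (rule poly_mapping_eqI)
  fix d assume p: "p permutes S"
  have *: "lk (pact p h) = lk h \<circ> pe p" for h by (auto simp: lookup_pact[OF p])
  have "lk (pact p (f * g)) = conv f (lk g) \<circ> pe p" by (simp add: * conv_lookup)
  also have "\<dots> = lk (pact p f * pact p g)" by (simp add: conv_pact[OF p, symmetric] * flip: conv_lookup)
  finally show "lk (pact p (f * g)) d = lk (pact p f * pact p g) d" by simp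
qed

lemma pact_add: "p permutes S \<Longrightarrow> pact p (f + g) = pact p f + pact p g"
  by (rule poly_mapping_eqI) (simp add: lookup_pact lookup_add)

lemma pact_uminus: "p permutes S \<Longrightarrow> pact p (- f) = - pact p f"
  by (rule poly_mapping_eqI) (simp add: lookup_pact)

lemma pact_0 [simp]: "p permutes S \<Longrightarrow> pact p 0 = 0"
  by (rule poly_mapping_eqI) (simp add: lookup_pact)

lemma pact_sum: "p permutes S \<Longrightarrow> pact p (\<Sum>x\<in>A. f x) = (\<Sum>x\<in>A. pact p (f x))"
  by (induction A rule: infinite_finite_induct) (auto simp: pact_add)

lemma pact_single: "p permutes S \<Longrightarrow> pact p (sg (pe p e) c) = sg e c"
  by (rule poly_mapping_eqI)
     (auto simp: lookup_pact lookup_single when_def inj_eq[OF inj_pe])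

lemma pe_zero_fst [simp]: "inj p \<Longrightarrow> pe p (0, b) = (0, b)"
  by (auto intro!: poly_mapping_eqI simp: lookup_map_key_inj)

lemma pact_one: "p permutes S \<Longrightarrow> pact p 1 = 1"
proof -
  assume p: "p permutes S"
  have "pe p 0 = 0" using p by (simp add: zero_prod_def permutes_inj del: pe_pair)
  with pact_single[OF p, of 0 1] show ?thesis by (simp only: single_one)
qed

lemma pact_prod: "p permutes S \<Longrightarrow> pact p (\<Prod>x\<in>A. f x) = (\<Prod>x\<in>A. pact p (f x))"
  by (induction A rule: infinite_finite_induct) (auto simp: pact_mult pact_one)

lemma pact_upow:
  assumes "p permutes S"
  shows "pact p (upow i e) = upow (p i) e"
proof -
  have "pe p (sg (p i) e, 0) = (sg i e, 0)"
    using permutes_inj[OF assms] by (auto intro!: poly_mapping_eqI simp: lookup_map_key_inj lookup_single when_def inj_eq)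
  then show ?thesis using pact_single[OF assms, of "(sg (p i) e, 0)" 1] unfolding upow_def by simp
qed

lemma pact_comp:
  assumes "p permutes S" "q permutes S"
  shows "pact p (pact q f) = pact (p \<circ> q) f"
proof -
  have "lk (pact p (pact q f)) d = lk (pact (p \<circ> q) f) d" for d
    using assms by (simp add: lookup_pact[OF assms(1)] lookup_pact[OF assms(2)] lookup_pact[OF permutes_compose[OF assms(2,1)]]
       pe_comp permutes_inj)
  then show ?thesis by (rule poly_mapping_eqI)
qed

lemma pact_tring: "c \<in> tring n \<Longrightarrow> p permutes S \<Longrightarrow> pact p c = c"
proof (rule poly_mapping_eqI)
  fix d assume c: "c \<in> tring n" and p: "p permutes S"
  have *: "lk c e \<noteq> 0 \<Longrightarrow> fst e = 0" for e
    using c unfolding tring_def by (cases e) (fastforce simp: in_keys_iff)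
  have "lk c (pe p d) = lk c d"
  proof (cases "fst d = 0")
    case True then show ?thesis using p by (cases d) (auto simp: permutes_inj)
  next
    case False
    have "fst (pe p d) \<noteq> 0"
    proof
      assume "fst (pe p d) = 0"
      then have "pe p d = (0, snd d)" by (metis prod.collapse snd_pe)
      then have "pe (inv_into UNIV p) (pe p d) = (0, snd d)"
        using permutes_inj[OF permutes_inv[OF p]] by (metis pe_zero_fst)
      then have "d = (0, snd d)" by (simp only: pe_inv[OF p])
      with False show False by (metis fst_conv)
    qed
    with False * show ?thesis by metis
  qed
  then show "lk (pact p c) d = lk c d" by (simp add: lookup_pact[OF p])
qed

section \<open>Alternants\<close>

text \<open>Antisymmetrization over the first \<open>m\<close> variables without division by
  \<open>m!\<close>, since coefficients are integers. This is the origin of the factor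
  \<open>fact r\<close> in \<open>alternant_extend\<close> and \<open>rho_formula\<close>.\<close>

definition Alt :: "nat \<Rightarrow> laurent \<Rightarrow> laurent" where
  "Alt m f = (\<Sum>p | p permutes {..<m}. of_int (sign p) * pact p f)"

definition AltF :: "nat \<Rightarrow> (expo \<Rightarrow> int) \<Rightarrow> expo \<Rightarrow> int" where
  "AltF m H d = (\<Sum>p | p permutes {..<m}. sign p * H (pe p d))"

lemma lookup_of_int_mult: "lk (of_int c * (f :: laurent)) d = c * lk f d"
proof -
  have "lk (of_int c * f) d = conv (sg 0 c) (lk f) d" by (simp add: conv_lookup flip: single_of_int)
  then show ?thesis by (simp add: conv_single)
qed

lemma lookup_Alt: "lk (Alt m f) = AltF m (lk f)"
  by (auto simp: Alt_def AltF_def lookup_sum lookup_of_int_mult lookup_pact intro!: sum.cong)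

lemma sum_sign_reindex:
  fixes m :: nat
  assumes q: "q permutes {..<m}"
  shows "(\<Sum>p | p permutes {..<m}. of_int (sign p) * g (p \<circ> q)) = of_int (sign q) * (\<Sum>p | p permutes {..<m}. of_int (sign p) * (g p :: 'a::comm_ring_1))"
    "(\<Sum>p | p permutes {..<m}. of_int (sign p) * g (q \<circ> p)) = of_int (sign q) * (\<Sum>p | p permutes {..<m}. of_int (sign p) * (g p :: 'a::comm_ring_1))"
proof -
  have sq: "sign q * sign q = 1" by (simp add: sign_def)
  have *: "of_int (sign q) * (of_int (sign q) * (x::'a)) = x" for x
    by (metis (no_types, lifting) mult.assoc mult_1 of_int_1 of_int_mult sq)
  have s: "sign (p \<circ> q) = sign p * sign q" "sign (q \<circ> p) = sign p * sign q" if "p permutes {..<m}" for p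
    using permutes_imp_permutation[OF finite_lessThan that] permutes_imp_permutation[OF finite_lessThan q]
    by (simp_all add: sign_compose)
  have "(\<Sum>p | p permutes {..<m}. of_int (sign p) * g p) = (\<Sum>p | p permutes {..<m}. of_int (sign (p \<circ> q)) * g (p \<circ> q))"
    by (rule sum_permutations_compose_right[OF q])
  also have "\<dots> = of_int (sign q) * (\<Sum>p | p permutes {..<m}. of_int (sign p) * g (p \<circ> q))"
    by (simp add: sum_distrib_left s mult_ac)
  finally show "(\<Sum>p | p permutes {..<m}. of_int (sign p) * g (p \<circ> q)) = of_int (sign q) * (\<Sum>p | p permutes {..<m}. of_int (sign p) * g p)"
    by (simp add: *)
  have "(\<Sum>p | p permutes {..<m}. of_int (sign p) * g p) = (\<Sum>p | p permutes {..<m}. of_int (sign (q \<circ> p)) * g (q \<circ> p))"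
    by (rule setum_permutations_compose_left[OF q])
  also have "\<dots> = of_int (sign q) * (\<Sum>p | p permutes {..<m}. of_int (sign p) * g (q \<circ> p))"
    by (simp add: sum_distrib_left s mult_ac)
  finally show "(\<Sum>p | p permutes {..<m}. of_int (sign p) * g (q \<circ> p)) = of_int (sign q) * (\<Sum>p | p permutes {..<m}. of_int (sign p) * g p)"
    by (simp add: *)
qed

lemma sum_sign_inverse:
  fixes m :: nat
  shows   "(\<Sum>p | p permutes {..<m}. of_int (sign p) * g (inv_into UNIV p)) = (\<Sum>p | p permutes {..<m}. of_int (sign p) * (g p :: 'a::comm_ring_1))"
proof -
  have "(\<Sum>p | p permutes {..<m}. of_int (sign p) * g p) =
    (\<Sum>p | p permutes {..<m}. of_int (sign (inv_into UNIV p)) * g (inv_into UNIV p))"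
    by (rule sum_permutations_inverse)
  also have "\<dots> = (\<Sum>p | p permutes {..<m}. of_int (sign p) * g (inv_into UNIV p))"
    by (intro sum.cong refl arg_cong2[where f="(*)"] arg_cong[where f=of_int])
       (auto intro!: sign_inverse permutes_imp_permutation[OF finite_lessThan])
  finally show ?thesis by simp
qed

lemma pact_of_int_mult: "p permutes S \<Longrightarrow> pact p (of_int c * f) = of_int c * pact p f"
  by (rule poly_mapping_eqI) (simp add: lookup_pact lookup_of_int_mult)

lemma pact_Alt: "q permutes {..<m} \<Longrightarrow> pact q (Alt m f) = of_int (sign q) * Alt m f"
  unfolding Alt_def using sum_sign_reindex(2)[of q m "\<lambda>p. pact p f"]
  by (simp add: pact_sum pact_of_int_mult pact_comp)

lemma Alt_pact: "q permutes {..<m} \<Longrightarrow> Alt m (pact q f) = of_int (sign q) * Alt m f"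
  unfolding Alt_def using sum_sign_reindex(1)[of q m "\<lambda>p. pact p f"]
  by (simp add: pact_comp)

lemma Alt_add: "Alt m (f + g) = Alt m f + Alt m g"
  by (simp add: Alt_def pact_add sum.distrib distrib_left)

lemma Alt_0 [simp]: "Alt m 0 = 0"
  by (simp add: Alt_def)

lemma Alt_sum: "Alt m (\<Sum>x\<in>S. f x) = (\<Sum>x\<in>S. Alt m (f x))"
  by (induction S rule: infinite_finite_induct) (auto simp: Alt_add)

lemma Alt_mult:
  assumes "\<And>p. p permutes {..<m} \<Longrightarrow> pact p c = c"
  shows "Alt m (c * f) = c * Alt m f"
  using assms by (simp add: Alt_def pact_mult sum_distrib_left mult_ac)

lemma Alt_of_int_mult: "Alt m (of_int c * f) = of_int c * Alt m f"
  unfolding Alt_def sum_distrib_left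
  by (intro sum.cong refl) (simp add: pact_of_int_mult mult.left_commute)

lemma conv_AltF:
  assumes "\<And>p. p permutes {..<m} \<Longrightarrow> pact p c = c"
  shows "conv c (AltF m H) = AltF m (conv c H)"
proof
  fix d
  have "conv c (H \<circ> pe p) d = conv c H (pe p d)" if "p permutes {..<m}" for p
    using conv_pact[OF that, of c H] assms[OF that] by simp
  then show "conv c (AltF m H) d = AltF m (conv c H) d"
    unfolding AltF_def by (simp add: conv_right_sum conv_right_scale comp_def)
qed

definition ev :: "int list \<Rightarrow> (nat \<Rightarrow>\<^sub>0 int)" where
  "ev es = (\<Sum>i<length es. sg i (es ! i))"

lemma lookup_ev: "lk (ev es) i = (if i < length es then es ! i else 0)"
proof -
  have "lk (ev es) i = (\<Sum>j<length es. if j = i then es ! j else 0)"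
    by (simp add: ev_def lookup_sum lookup_single when_def)
  then show ?thesis by simp
qed

lemma prod_single: "finite S \<Longrightarrow> (\<Prod>i\<in>S. sg (x i) 1) = (sg (\<Sum>i\<in>S. x i) 1 :: laurent)"
  by (induction S rule: finite_induct) (auto simp: mult_single)

lemma sum_pair_zero: "(\<Sum>i\<in>S. (x i, 0)) = ((\<Sum>i\<in>S. x i, 0) :: expo)"
  by (induction S rule: infinite_finite_induct) (auto simp: zero_prod_def)

lemma alternant_eq_sum:
  "alternant es = (\<Sum>p | p permutes {..<length es}. of_int (sign p) * sg (pe p (ev es, 0)) 1)"
proof -
  let ?m = "length es"
  have "(\<Prod>i = 0..<?m. mat ?m ?m (\<lambda>(i, j). upow i (es ! j)) $$ (i, p i)) = sg (pe p (ev es, 0)) 1"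
    if p: "p permutes {0..<?m}" for p
  proof -
    have pi: "p i < ?m \<longleftrightarrow> i < ?m" for i using permutes_in_image[OF p] by auto
    have "(\<Prod>i = 0..<?m. mat ?m ?m (\<lambda>(i, j). upow i (es ! j)) $$ (i, p i)) = (\<Prod>i = 0..<?m. sg (sg i (es ! p i), 0) 1)"
      by (rule prod.cong) (auto simp: upow_def pi)
    also have "\<dots> = sg (\<Sum>i = 0..<?m. (sg i (es ! p i), 0)) 1" by (rule prod_single) simp
    also have "(\<Sum>i = 0..<?m. (sg i (es ! p i), 0)) = pe p (ev es, 0)"
    proof -
      have "lk (\<Sum>i = 0..<?m. sg i (es ! p i)) k = lk (Poly_Mapping.map_key p (ev es)) k" for k
      proof -
        have "lk (\<Sum>i = 0..<?m. sg i (es ! p i)) k = (\<Sum>i = 0..<?m. if i = k then es ! p i else 0)"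
          by (simp add: lookup_sum lookup_single when_def)
        then show ?thesis using permutes_inj[OF p] by (simp add: lookup_map_key_inj lookup_ev pi)
      qed
      then show ?thesis by (simp add: sum_pair_zero poly_mapping_eqI)
    qed
    finally show ?thesis .
  qed
  then have "(\<Sum>p | p permutes {0..<?m}. signof p * (\<Prod>i = 0..<?m. mat ?m ?m (\<lambda>(i, j). upow i (es ! j)) $$ (i, p i)))
     = (\<Sum>p | p permutes {0..<?m}. of_int (sign p) * sg (pe p (ev es, 0)) 1)"
    by (intro sum.cong refl) (simp only: mem_Collect_eq)
  then show ?thesis by (simp only: alternant_def det_def dim_row_mat dim_col_mat if_True simp_thms atLeast0LessThan)
qed

text \<open>The sign is invariant under inversion, which turns the exponents \<open>pe p\<close> of
  the Leibniz formula into the action \<open>pact p\<close>.\<close>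

lemma alternant_eq_Alt: "alternant es = Alt (length es) (sg (ev es, 0) 1)"
proof -
  have "pact (inv_into UNIV p) (sg (ev es, 0) 1) = sg (pe p (ev es, 0)) 1" if "p permutes {..<length es}" for p
    using pact_single[OF permutes_inv[OF that], of "pe p (ev es, 0)" 1] by (simp only: pe_inv[OF that])
  then have "alternant es = (\<Sum>p | p permutes {..<length es}. of_int (sign p) * pact (inv_into UNIV p) (sg (ev es, 0) 1))"
    by (simp add: alternant_eq_sum del: pe_pair)
  then show ?thesis unfolding Alt_def by (simp only: sum_sign_inverse[where g = "\<lambda>p. pact p (sg (ev es, 0) 1)"])
qed

lemma pact_alternant: "q permutes {..<length es} \<Longrightarrow> pact q (alternant es) = of_int (sign q) * alternant es"
  by (simp add: alternant_eq_Alt pact_Alt)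

lemma conv_of_int_mult: "conv (of_int c * P) H d = of_int c * conv P H d"
proof -
  have "conv (of_int c * P) H d = conv (sg 0 c) (conv P H) d"
    by (simp flip: single_of_int add: conv_mult)
  then show ?thesis by (simp add: conv_single)
qed

lemma conv_alternant:
  "conv (alternant es) H d = (\<Sum>p | p permutes {..<length es}. of_int (sign p) * H (d - pe p (ev es, 0)))"
  by (simp add: alternant_eq_sum conv_sum conv_of_int_mult conv_single del: pe_pair)

text \<open>The staircase \<open>\<delta> = (m-1, ..., 1, 0)\<close>, so that \<open>vand m\<close>
  is the Vandermonde determinant, i.e. the Weyl denominator of \<open>GL_m\<close>, and
  \<open>dlt m\<close> its leading exponent.\<close>

definition dl :: "nat \<Rightarrow> int list" where
  "dl m = map (\<lambda>j. int m - 1 - int j) [0..<m]"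

abbreviation vand :: "nat \<Rightarrow> laurent" where "vand m \<equiv> alternant (dl m)"

abbreviation dlt :: "nat \<Rightarrow> expo" where "dlt m \<equiv> (ev (dl m), 0)"

lemma length_dl [simp]: "length (dl m) = m" by (simp add: dl_def)

lemma lookup_ev_dl: "lk (ev (dl m)) i = (if i < m then int m - 1 - int i else 0)"
  by (simp add: lookup_ev dl_def)

definition wt :: "nat \<Rightarrow> expo \<Rightarrow> int" where
  "wt m d = (\<Sum>i<m. (int m - 1 - int i) * lk (fst d) i)"

lemma wt_diff: "wt m (d - e) = wt m d - wt m e" and wt_add: "wt m (d + e) = wt m d + wt m e"
  by (simp_all add: wt_def lookup_minus lookup_add algebra_simps sum_subtractf sum.distrib)

text \<open>\<open>\<delta>\<close> and its rearrangement have equal norm, so twice the difference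
  of the two weights is the sum of the squared differences of their entries, which is positive as
  soon as one index moves.\<close>

lemma wt_delta_less:
  assumes p: "p permutes {..<m}" and "p \<noteq> id"
  shows "wt m (pe p (dlt m)) < wt m (dlt m)"
proof -
  let ?D = "\<lambda>i. int m - 1 - int i"
  have pi: "p i < m \<longleftrightarrow> i < m" for i using permutes_in_image[OF p] by auto
  have 1: "wt m (pe p (dlt m)) = (\<Sum>i<m. ?D i * ?D (p i))"
    unfolding wt_def by (rule sum.cong) (auto simp: lookup_map_key_inj[OF permutes_inj[OF p]] lookup_ev_dl pi)
  have 2: "wt m (dlt m) = (\<Sum>i<m. ?D i * ?D i)"
    unfolding wt_def by (rule sum.cong) (auto simp: lookup_ev_dl)
  have 3: "(\<Sum>i<m. ?D (p i) * ?D (p i)) = (\<Sum>i<m. ?D i * ?D i)"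
    using sum.permute[OF p, of "\<lambda>i. ?D i * ?D i"] by (simp add: comp_def)
  obtain i where i: "p i \<noteq> i" using assms(2) by (auto simp: fun_eq_iff)
  then have "i < m" using p by (meson lessThan_iff permutes_not_in)
  have "0 < (\<Sum>i<m. (?D i - ?D (p i))\<^sup>2)"
    by (rule sum_pos2[of _ i]) (use i \<open>i < m\<close> in auto)
  also have "\<dots> = 2 * (\<Sum>i<m. ?D i * ?D i) - 2 * (\<Sum>i<m. ?D i * ?D (p i))"
  proof -
    have "(\<Sum>i<m. (f i - g i)\<^sup>2) = (\<Sum>i<m. f i * f i) + (\<Sum>i<m. g i * g i) - 2 * (\<Sum>i<m. f i * g i)" for f g :: "nat \<Rightarrow> int"
      by (simp add: power2_eq_square algebra_simps sum.distrib sum_subtractf sum_distrib_left)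
    then show ?thesis by (simp only: 3)
  qed
  finally show ?thesis using 1 2 by linarith
qed

text \<open>The identity permutation contributes \<open>H d\<close>; the hypothesis removes all
  other terms. It is applied at exponents that are extreme for a linear form on which
  \<open>\<delta>\<close> strictly exceeds its rearrangements: \<open>wt\<close>, and later
  \<open>ip\<close> in \<open>no_long_components\<close>.\<close>

lemma conv_vand_lead:
  assumes "\<And>p. p permutes {..<m} \<Longrightarrow> p \<noteq> id \<Longrightarrow> H (d + dlt m - pe p (dlt m)) = 0"
  shows "conv (vand m) H (d + dlt m) = H d"
proof -
  have "conv (vand m) H (d + dlt m) = (\<Sum>p | p permutes {..<m}. of_int (sign p) * H (d + dlt m - pe p (dlt m)))"
    by (simp add: conv_alternant del: pe_pair)
  also have "\<dots> = (\<Sum>p | p permutes {..<m}. if p = id then H d else 0)"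
    by (rule sum.cong) (use assms in \<open>auto simp del: pe_pair simp: pe_id\<close>)
  also have "\<dots> = H d" by (simp add: permutes_id finite_permutations)
  finally show ?thesis .
qed

section \<open>Finiteness of degree slices and cancellation of the Weyl denominator\<close>

lemma finite_bounded_poly_mapping:
  assumes "finite I" "finite B"
  shows "finite {a :: 'x \<Rightarrow>\<^sub>0 'b::zero. ky a \<subseteq> I \<and> (\<forall>i\<in>I. lk a i \<in> B)}"
proof (rule inj_on_finite[of "\<lambda>a. restrict (lk a) I" _ "PiE I (\<lambda>_. B)"])
  show "inj_on (\<lambda>a. restrict (lk a) I) {a :: 'x \<Rightarrow>\<^sub>0 'b. ky a \<subseteq> I \<and> (\<forall>i\<in>I. lk a i \<in> B)}"
  proof (rule inj_onI)
    fix a a' :: "'x \<Rightarrow>\<^sub>0 'b"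
    assume a: "a \<in> {a. ky a \<subseteq> I \<and> (\<forall>i\<in>I. lk a i \<in> B)}" "a' \<in> {a. ky a \<subseteq> I \<and> (\<forall>i\<in>I. lk a i \<in> B)}"
      and eq: "restrict (lk a) I = restrict (lk a') I"
    show "a = a'"
    proof (rule poly_mapping_eqI)
      fix i show "lk a i = lk a' i"
        using a fun_cong[OF eq, of i] by (cases "i \<in> I") (auto simp: subset_iff in_keys_iff, metis)
    qed
  qed
qed (use assms in \<open>auto intro: finite_PiE\<close>)

definition nnexp :: "nat \<Rightarrow> expo \<Rightarrow> bool" where
  "nnexp m d \<longleftrightarrow> ky (fst d) \<subseteq> {..<m} \<and> (\<forall>i. lk (fst d) i \<ge> 0)"

definition tot :: "nat \<Rightarrow> expo \<Rightarrow> int" where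
  "tot m d = (\<Sum>i<m. lk (fst d) i)"

lemma tot_diff: "tot m (d - e) = tot m d - tot m e" and tot_add: "tot m (d + e) = tot m d + tot m e"
  by (simp_all add: tot_def lookup_minus lookup_add sum_subtractf sum.distrib)

lemma tot_pe:
  assumes "p permutes {..<m}" shows "tot m (pe p d) = tot m d"
proof (cases d)
  case (Pair a b)
  then show ?thesis using sum.permute[OF assms, of "lk a"]
    by (simp add: tot_def comp_def lookup_map_key_inj[OF permutes_inj[OF assms]])
qed

lemma finite_nnexp_tot: "finite {d. nnexp m d \<and> tot m d = N \<and> snd d = b}"
proof -
  have "fst d \<in> {a. ky a \<subseteq> {..<m} \<and> (\<forall>i\<in>{..<m}. lk a i \<in> {0..N})}" if "nnexp m d" "tot m d = N" for d
  proof -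
    have "lk (fst d) i \<le> N" if "i < m" for i
      using \<open>nnexp m d\<close> \<open>tot m d = N\<close> member_le_sum[of i "{..<m}" "lk (fst d)"] that
      by (auto simp: nnexp_def tot_def)
    then show ?thesis using that by (auto simp: nnexp_def)
  qed
  then have "{d. nnexp m d \<and> tot m d = N \<and> snd d = b} \<subseteq> {a. ky a \<subseteq> {..<m} \<and> (\<forall>i\<in>{..<m}. lk a i \<in> {0..N})} \<times> {b}"
    by (auto simp: nnexp_def)
  then show ?thesis
    by (rule finite_subset) (intro finite_cartesian_product finite_bounded_poly_mapping, auto)
qed

lemma finite_arg_max:
  fixes f :: "'a \<Rightarrow> int"
  assumes "finite S" "S \<noteq> {}"
  obtains x where "x \<in> S" "\<And>y. y \<in> S \<Longrightarrow> f y \<le> f x"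
proof -
  have "Max (f ` S) \<in> f ` S" using assms by simp
  then obtain x where "x \<in> S" "f x = Max (f ` S)" by auto
  then show ?thesis using that assms by auto
qed

text \<open>Multiplication by \<open>vand m\<close> shifts total degree by a constant and keeps the
  \<open>t\<close> exponent, and nonnegative support leaves finitely many exponents in each such
  slice. A support point of largest \<open>wt\<close> in its slice survives by
  \<open>conv_vand_lead\<close>.\<close>

lemma conv_vand_cancel:
  fixes H :: "expo \<Rightarrow> 'a::comm_ring_1"
  assumes supp: "\<And>d. H d \<noteq> 0 \<Longrightarrow> nnexp m d" and z: "\<And>d. conv (vand m) H d = 0"
  shows "H d = 0"
proof (rule ccontr)
  assume nz: "H d \<noteq> 0"
  define S where "S = {e. nnexp m e \<and> tot m e = tot m d \<and> snd e = snd d} \<inter> {e. H e \<noteq> 0}"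
  have "finite S" unfolding S_def using finite_nnexp_tot by (rule finite_subset[OF Int_lower1])
  moreover have "d \<in> S" using nz supp by (simp add: S_def)
  ultimately obtain e where e: "e \<in> S" and mx: "\<And>y. y \<in> S \<Longrightarrow> wt m y \<le> wt m e"
    using finite_arg_max[of S "wt m"] by (metis empty_iff)
  have "conv (vand m) H (e + dlt m) = H e"
  proof (rule conv_vand_lead, rule ccontr)
    fix p assume p: "p permutes {..<m}" "p \<noteq> id" and nz': "H (e + dlt m - pe p (dlt m)) \<noteq> 0"
    have "e + dlt m - pe p (dlt m) \<in> S"
      using e nz' supp[OF nz'] unfolding S_def by (simp add: tot_diff tot_add tot_pe[OF p(1)] del: pe_pair)
    from mx[OF this] wt_delta_less[OF p] show False by (simp add: wt_diff wt_add del: pe_pair)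
  qed
  with z e show False by (simp add: S_def)
qed

section \<open>Schur polynomials\<close>

definition gdeg :: "nat \<Rightarrow> nat \<Rightarrow> expo \<Rightarrow> bool" where
  "gdeg m n d \<longleftrightarrow> nnexp m d \<and> ky (snd d) \<subseteq> {..<n}"

lemma gdeg_zero [simp]: "gdeg m n 0"
  by (simp add: gdeg_def nnexp_def)

lemma gdeg_add: "gdeg m n d \<Longrightarrow> gdeg m n e \<Longrightarrow> gdeg m n (d + e)"
  using Poly_Mapping.keys_add[of "fst d" "fst e"] Poly_Mapping.keys_add[of "snd d" "snd e"]
  by (auto simp: gdeg_def nnexp_def lookup_add)

lemma utring_iff: "f \<in> utring m n \<longleftrightarrow> (\<forall>d\<in>ky f. gdeg m n d)"
  by (simp add: utring_def gdeg_def nnexp_def case_prod_unfold conj_assoc)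

lemma utring_add: "f \<in> utring m n \<Longrightarrow> g \<in> utring m n \<Longrightarrow> f + g \<in> utring m n"
  using Poly_Mapping.keys_add[of f g] by (auto simp: utring_iff)

lemma utring_mult: "f \<in> utring m n \<Longrightarrow> g \<in> utring m n \<Longrightarrow> f * g \<in> utring m n"
  unfolding utring_iff using Poly_Mapping.keys_mult[of f g] by (blast intro: gdeg_add)

lemma utring_single: "c = 0 \<or> gdeg m n d \<Longrightarrow> sg d c \<in> utring m n"
  by (auto simp: utring_iff)

lemma utring_of_int: "of_int c \<in> utring m n"
  using utring_single[of c m n 0] by (simp flip: single_of_int)

lemma utring_sum: "(\<And>x. x \<in> S \<Longrightarrow> f x \<in> utring m n) \<Longrightarrow> (\<Sum>x\<in>S. f x) \<in> utring m n"
  by (induction S rule: infinite_finite_induct) (use utring_of_int[of 0] in \<open>auto intro: utring_add\<close>)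

lemma utring_prod: "(\<And>x. x \<in> S \<Longrightarrow> f x \<in> utring m n) \<Longrightarrow> (\<Prod>x\<in>S. f x) \<in> utring m n"
  by (induction S rule: infinite_finite_induct) (use utring_of_int[of 1] in \<open>auto intro: utring_mult\<close>)

lemma sym_utring_iff:
  "f \<in> sym_utring m n \<longleftrightarrow> f \<in> utring m n \<and> (\<forall>p. p permutes {..<m} \<longrightarrow> pact p f = f)"
proof -
  have "pact p f = f \<longleftrightarrow> (\<forall>a b. lk f (Poly_Mapping.map_key p a, b) = lk f (a, b))" if "p permutes {..<m}" for p
    by (auto simp: poly_mapping_eq_iff lookup_pact[OF that] fun_eq_iff)
  then show ?thesis by (auto simp: sym_utring_def)
qed

lemma pact_of_int: "p permutes S \<Longrightarrow> pact p (of_int c) = of_int c"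
  using pact_of_int_mult[of p S c 1] by (simp add: pact_one)

lemma sym_utring_add: "f \<in> sym_utring m n \<Longrightarrow> g \<in> sym_utring m n \<Longrightarrow> f + g \<in> sym_utring m n"
  by (auto simp: sym_utring_iff utring_add pact_add)

lemma sym_utring_mult: "f \<in> sym_utring m n \<Longrightarrow> g \<in> sym_utring m n \<Longrightarrow> f * g \<in> sym_utring m n"
  by (auto simp: sym_utring_iff utring_mult pact_mult)

lemma sym_utring_of_int: "of_int c \<in> sym_utring m n"
  by (simp add: sym_utring_iff utring_of_int pact_of_int)

lemma sym_utring_sum: "(\<And>x. x \<in> S \<Longrightarrow> f x \<in> sym_utring m n) \<Longrightarrow> (\<Sum>x\<in>S. f x) \<in> sym_utring m n"
  by (induction S rule: infinite_finite_induct) (use sym_utring_of_int[of 0] in \<open>auto intro: sym_utring_add\<close>)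

lemma sym_utring_prod: "(\<And>x. x \<in> S \<Longrightarrow> f x \<in> sym_utring m n) \<Longrightarrow> (\<Prod>x\<in>S. f x) \<in> sym_utring m n"
  by (induction S rule: infinite_finite_induct) (use sym_utring_of_int[of 1] in \<open>auto intro: sym_utring_mult\<close>)

lemma tring_subset_sym_utring: "c \<in> tring n \<Longrightarrow> c \<in> sym_utring m n"
  by (simp add: sym_utring_iff pact_tring) (simp add: utring_iff tring_def gdeg_def nnexp_def case_prod_unfold)

section \<open>Powers of one variable over the ring of symmetric polynomials\<close>

lemma upow_mult: "upow i a * upow i b = upow i (a + b)"
  by (simp add: upow_def mult_single single_add)

lemma upow_0 [simp]: "upow i 0 = 1"
  by (simp add: upow_def flip: zero_prod_def)

lemma upow_power: "upow i a ^ k = upow i (int k * a)"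
  by (induction k) (auto simp: upow_mult algebra_simps)

lemma upow_in_utring: "i < m \<Longrightarrow> 0 \<le> a \<Longrightarrow> upow i a \<in> utring m n"
  unfolding upow_def by (rule utring_single) (auto simp: gdeg_def nnexp_def lookup_single when_def)

text \<open>The sign is built in: these are \<open>(-1)^k e_k(u)\<close>, the coefficients of the
  monic polynomial with roots \<open>u_0, ..., u_(m-1)\<close>.\<close>

definition esym :: "nat \<Rightarrow> nat \<Rightarrow> laurent" where
  "esym m k = (\<Sum>X | X \<subseteq> {..<m} \<and> card X = k. \<Prod>i\<in>X. - upow i 1)"

lemma esym_sym: "esym m k \<in> sym_utring m n"
proof -
  have "esym m k \<in> utring m n" unfolding esym_def
  proof (intro utring_sum utring_prod)
    fix X i assume "X \<in> {X. X \<subseteq> {..<m} \<and> card X = k}" "i \<in> X"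
    then have "upow i 1 \<in> utring m n" by (intro upow_in_utring) auto
    then show "- upow i 1 \<in> utring m n" using utring_mult[OF utring_of_int[of "-1"]] by fastforce
  qed
  moreover have "pact p (esym m k) = esym m k" if p: "p permutes {..<m}" for p
  proof -
    let ?S = "{X. X \<subseteq> {..<m} \<and> card X = k}"
    have inj: "inj p" using p by (rule permutes_inj)
    have bij: "bij_betw ((`) p) ?S ?S"
    proof (rule bij_betwI[where g = "(`) (inv_into UNIV p)"])
      show "(`) p \<in> ?S \<rightarrow> ?S"
        using permutes_subset permutes_in_image[OF p] inj by (auto simp: card_image inj_on_subset)
      show "(`) (inv_into UNIV p) \<in> ?S \<rightarrow> ?S"
        using permutes_in_image[OF permutes_inv[OF p]] permutes_inj[OF permutes_inv[OF p]] by (auto simp: card_image inj_on_subset)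
    qed (use permutes_surj[OF p] permutes_inj[OF p] in \<open>auto simp: image_image surj_f_inv_f\<close>)
    have "pact p (esym m k) = (\<Sum>X\<in>?S. \<Prod>i\<in>X. - upow (p i) 1)"
      by (simp add: esym_def pact_sum[OF p] pact_prod[OF p] pact_uminus[OF p] pact_upow[OF p])
    also have "\<dots> = (\<Sum>X\<in>?S. \<Prod>i\<in>p ` X. - upow i 1)"
      by (intro sum.cong refl) (simp add: prod.reindex inj_on_subset[OF inj])
    also have "\<dots> = esym m k" unfolding esym_def by (rule sum.reindex_bij_betw[OF bij])
    finally show ?thesis .
  qed
  ultimately show ?thesis by (simp add: sym_utring_iff)
qed

lemma sum_subsets_by_card:
  "(\<Sum>X\<in>Pow {..<m::nat}. f X) = (\<Sum>k\<le>m. \<Sum>X | X \<subseteq> {..<m} \<and> card X = k. (f X :: 'a::comm_monoid_add))"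
proof -
  have "(\<Sum>X\<in>Pow {..<m}. f X) = (\<Sum>k\<le>m. \<Sum>X\<in>{X\<in>Pow {..<m}. card X = k}. f X)"
    by (rule sum.group[symmetric]) (auto intro: subset_eq_atLeast0_lessThan_card simp: card_mono[of "{..<m}", simplified])
  then show ?thesis by simp
qed

text \<open>Expansion by subsets of the product of \<open>u_j - u_i\<close> over all
  \<open>i\<close>, which contains the zero factor \<open>i = j\<close>.\<close>

lemma esym_root:
  assumes "j < m"
  shows "(\<Sum>k\<le>m. esym m k * upow j (int m - int k)) = 0"
proof -
  have "(\<Prod>i<m. - upow i 1 + upow j 1) = 0"
    using assms by (intro prod_zero) (auto intro: exI[of _ j])
  also have "(\<Prod>i<m. - upow i 1 + upow j 1) = (\<Sum>X\<in>Pow {..<m}. (\<Prod>i\<in>X. - upow i 1) * (\<Prod>i\<in>{..<m} - X. upow j 1))"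
    by (rule prod_add) simp
  also have "\<dots> = (\<Sum>k\<le>m. \<Sum>X | X \<subseteq> {..<m} \<and> card X = k. (\<Prod>i\<in>X. - upow i 1) * (\<Prod>i\<in>{..<m} - X. upow j 1))"
    by (rule sum_subsets_by_card)
  also have "\<dots> = (\<Sum>k\<le>m. esym m k * upow j (int m - int k))"
    unfolding esym_def sum_distrib_right
  proof (intro sum.cong refl)
    fix k X assume k: "k \<in> {..m}" and X: "X \<in> {X. X \<subseteq> {..<m} \<and> card X = k}"
    then have "card ({..<m} - X) = m - k" by (auto simp: card_Diff_subset finite_subset)
    then show "(\<Prod>i\<in>X. - upow i 1) * (\<Prod>i\<in>{..<m} - X. upow j 1) = (\<Prod>i\<in>X. - upow i 1) * upow j (int m - int k)"
      using k by (simp add: upow_power of_nat_diff)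
  qed
  finally show ?thesis by simp
qed

text \<open>Division with remainder of \<open>X^\<mu>\<close> by the monic polynomial with roots
  \<open>u_0, ..., u_(m-1)\<close>: its coefficients are symmetric, hence so are those of the
  remainder, and the remainder is the same for all roots.\<close>

lemma upow_reduce:
  "\<exists>c. (\<forall>k<m. c k \<in> sym_utring m n) \<and> (\<forall>i<m. upow i (int \<mu>) = (\<Sum>k<m. upow i (int m - 1 - int k) * c k))"
proof (induction \<mu>)
  case 0
  have "(\<Sum>k<m. upow i (int m - 1 - int k) * of_int (if k = m - 1 then 1 else 0)) = 1" if "i < m" for i
  proof -
    have "(\<Sum>k<m. upow i (int m - 1 - int k) * of_int (if k = m - 1 then 1 else 0)) = (\<Sum>k<m. if k = m - 1 then 1 else 0)"
      by (rule sum.cong) (use that in \<open>auto simp: of_nat_diff\<close>)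
    then show ?thesis using that by simp
  qed
  then show ?case
    by (intro exI[of _ "\<lambda>k. of_int (if k = m - 1 then 1 else 0)"]) (auto simp: sym_utring_of_int simp del: of_int_1 of_int_0)
next
  case (Suc \<mu>)
  then obtain c where c: "\<And>k. k < m \<Longrightarrow> c k \<in> sym_utring m n"
    and eq: "\<And>i. i < m \<Longrightarrow> upow i (int \<mu>) = (\<Sum>k<m. upow i (int m - 1 - int k) * c k)" by blast
  \<comment> \<open>Multiplication by \<open>X\<close> shifts the coefficients; the overflow term
    \<open>c 0\<close> times \<open>X^m\<close> is rewritten by \<open>esym_root\<close>.\<close>
  define c' where "c' k = (if Suc k < m then c (Suc k) else 0) + of_int (-1) * (c 0 * esym m (Suc k))" for k
  have "c' k \<in> sym_utring m n" if "k < m" for k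
    unfolding c'_def using c that sym_utring_of_int[of 0 m n]
    by (auto intro!: sym_utring_add sym_utring_mult sym_utring_of_int esym_sym simp del: of_int_minus)
  moreover have "upow i (int (Suc \<mu>)) = (\<Sum>k<m. upow i (int m - 1 - int k) * c' k)" if i: "i < m" for i
  proof -
    obtain m' where m: "m = Suc m'" using i by (cases m) auto
    have esym0: "esym m 0 = 1"
    proof -
      have "{X. X \<subseteq> {..<m} \<and> card X = 0} = {{}}" by (auto simp: finite_subset)
      then show ?thesis by (simp add: esym_def)
    qed
    have root: "upow i (int m) = - (\<Sum>k<m. esym m (Suc k) * upow i (int m - 1 - int k))"
    proof -
      have "(\<Sum>k\<le>m. esym m k * upow i (int m - int k)) = upow i (int m) + (\<Sum>k<m. esym m (Suc k) * upow i (int m - 1 - int k))"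
        by (subst lessThan_Suc_atMost[symmetric], subst sum.lessThan_Suc_shift) (simp add: esym0 algebra_simps)
      then show ?thesis using esym_root[OF i] by (simp add: eq_neg_iff_add_eq_0)
    qed
    have "upow i (int (Suc \<mu>)) = upow i 1 * upow i (int \<mu>)" by (simp add: upow_mult)
    also have "\<dots> = (\<Sum>k<m. upow i (int m - int k) * c k)"
      by (simp add: eq[OF i] sum_distrib_left mult.assoc[symmetric] upow_mult)
    also have "\<dots> = upow i (int m) * c 0 + (\<Sum>k<m'. upow i (int m - 1 - int k) * c (Suc k))"
      unfolding m by (subst sum.lessThan_Suc_shift) (simp add: algebra_simps)
    also have "(\<Sum>k<m'. upow i (int m - 1 - int k) * c (Suc k)) = (\<Sum>k<m. upow i (int m - 1 - int k) * (if Suc k < m then c (Suc k) else 0))"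
      by (simp add: m)
    also have "upow i (int m) * c 0 = (\<Sum>k<m. upow i (int m - 1 - int k) * (of_int (-1) * (c 0 * esym m (Suc k))))"
      by (simp add: root sum_distrib_right sum_distrib_left sum_negf mult_ac)
    finally show ?thesis by (simp only: c'_def distrib_left sum.distrib add.commute)
  qed
  ultimately show ?case by blast
qed

definition sh :: "int list \<Rightarrow> int list" where
  "sh \<nu> = map (\<lambda>j. \<nu> ! j + int (length \<nu>) - 1 - int j) [0..<length \<nu>]"

lemma length_sh [simp]: "length (sh \<nu>) = length \<nu>" by (simp add: sh_def)

lemma det_in_sym_utring:
  assumes "A \<in> carrier_mat m m" "\<And>i j. i < m \<Longrightarrow> j < m \<Longrightarrow> A $$ (i, j) \<in> sym_utring k n"
  shows "det A \<in> sym_utring k n"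
proof -
  have "det A = (\<Sum>p | p permutes {0..<m}. signof p * (\<Prod>i = 0..<m. A $$ (i, p i)))"
    using assms(1) by (simp add: det_def)
  also have "\<dots> \<in> sym_utring k n"
  proof (intro sym_utring_sum sym_utring_mult sym_utring_prod)
    fix p i assume p: "p \<in> {p. p permutes {0..<m}}" and "i \<in> {0..<m}"
    then show "A $$ (i, p i) \<in> sym_utring k n" using permutes_in_image[of p "{0..<m}" i] by (auto intro!: assms(2))
  next
    fix p show "signof p \<in> sym_utring k n" by (rule sym_utring_of_int)
  qed
  finally show ?thesis .
qed

text \<open>By \<open>upow_reduce\<close> the matrix of the numerator is the Vandermonde matrix
  times a matrix \<open>C\<close> of symmetric polynomials, so \<open>det C\<close> is the quotient
  of alternants; symmetry and nonnegative exponents come for free. The bound on \<open>sh\<close>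
  admits tuples that are not partitions.\<close>

lemma schur_exists:
  assumes "\<And>j. j < length \<nu> \<Longrightarrow> 0 \<le> sh \<nu> ! j"
  obtains s where "s \<in> sym_utring (length \<nu>) n" "s * vand (length \<nu>) = alternant (sh \<nu>)"
proof -
  define m where "m = length \<nu>"
  have "\<exists>C. \<forall>j<m. (\<forall>k<m. C j k \<in> sym_utring m n) \<and> (\<forall>i<m. upow i (sh \<nu> ! j) = (\<Sum>k<m. upow i (int m - 1 - int k) * C j k))"
  proof (rule exI[of _ "\<lambda>j. SOME c. (\<forall>k<m. c k \<in> sym_utring m n) \<and> (\<forall>i<m. upow i (int (nat (sh \<nu> ! j))) = (\<Sum>k<m. upow i (int m - 1 - int k) * c k))"], intro allI impI)
    fix j assume "j < m"
    then have j: "int (nat (sh \<nu> ! j)) = sh \<nu> ! j" using assms by (simp add: m_def)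
    show "(\<forall>k<m. (SOME c. (\<forall>k<m. c k \<in> sym_utring m n) \<and> (\<forall>i<m. upow i (int (nat (sh \<nu> ! j))) = (\<Sum>k<m. upow i (int m - 1 - int k) * c k))) k \<in> sym_utring m n) \<and>
      (\<forall>i<m. upow i (sh \<nu> ! j) = (\<Sum>k<m. upow i (int m - 1 - int k) * (SOME c. (\<forall>k<m. c k \<in> sym_utring m n) \<and> (\<forall>i<m. upow i (int (nat (sh \<nu> ! j))) = (\<Sum>k<m. upow i (int m - 1 - int k) * c k))) k))"
      using someI_ex[OF upow_reduce[of m n "nat (sh \<nu> ! j)"]] by (simp only: j)
  qed
  then obtain C where C: "\<And>j k. j < m \<Longrightarrow> k < m \<Longrightarrow> C j k \<in> sym_utring m n"
    and eq: "\<And>i j. i < m \<Longrightarrow> j < m \<Longrightarrow> upow i (sh \<nu> ! j) = (\<Sum>k<m. upow i (int m - 1 - int k) * C j k)" by blast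
  let ?V = "mat m m (\<lambda>(i, j). upow i (dl m ! j))" and ?C = "mat m m (\<lambda>(k, j). C j k)"
  have "mat m m (\<lambda>(i, j). upow i (sh \<nu> ! j)) = ?V * ?C"
    by (rule eq_matI) (auto simp: eq scalar_prod_def dl_def atLeast0LessThan intro!: sum.cong)
  then have "alternant (sh \<nu>) = det ?V * det ?C"
    unfolding alternant_def length_sh m_def[symmetric] by (simp add: det_mult[of _ m])
  then have "det ?C * vand m = alternant (sh \<nu>)" by (simp add: alternant_def mult.commute)
  moreover have "det ?C \<in> sym_utring m n" by (rule det_in_sym_utring[of _ m]) (auto intro: C)
  ultimately show ?thesis using that m_def by blast
qed

text \<open>Finite support already supplies an exponent of maximal \<open>wt\<close>, so negative
  exponents are allowed here; the definite description in \<open>schur\<close> ranges over all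
  Laurent polynomials.\<close>

lemma vand_cancel_all:
  fixes f :: laurent
  assumes z: "f * vand m = 0" shows "f = 0"
proof (rule ccontr)
  assume "f \<noteq> 0"
  then have "ky f \<noteq> {}" by simp
  then obtain e where e: "e \<in> ky f" and mx: "\<And>y. y \<in> ky f \<Longrightarrow> wt m y \<le> wt m e"
    using finite_arg_max[of "ky f" "wt m"] by (metis finite_keys)
  have "conv (vand m) (lk f) (e + dlt m) = lk f e"
  proof (rule conv_vand_lead, rule ccontr)
    fix p assume p: "p permutes {..<m}" "p \<noteq> id" and nz': "lk f (e + dlt m - pe p (dlt m)) \<noteq> 0"
    then have "e + dlt m - pe p (dlt m) \<in> ky f" by (simp add: in_keys_iff)
    from mx[OF this] wt_delta_less[OF p] show False by (simp add: wt_diff wt_add del: pe_pair)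
  qed
  then show False using e z by (simp add: conv_lookup mult.commute in_keys_iff)
qed

lemma schur_props:
  assumes "\<And>j. j < length \<nu> \<Longrightarrow> 0 \<le> sh \<nu> ! j"
  shows "schur \<nu> \<in> sym_utring (length \<nu>) n" "schur \<nu> * vand (length \<nu>) = alternant (sh \<nu>)"
proof -
  obtain s where s: "s \<in> sym_utring (length \<nu>) n" "s * vand (length \<nu>) = alternant (sh \<nu>)"
    using schur_exists[OF assms] by blast
  have "schur \<nu> = s"
    unfolding schur_def Let_def
  proof (rule the_equality)
    show "s * alternant (map (\<lambda>j. int (length \<nu>) - 1 - int j) [0..<length \<nu>]) =
      alternant (map (\<lambda>j. \<nu> ! j + int (length \<nu>) - 1 - int j) [0..<length \<nu>])"
      using s(2) by (simp add: dl_def sh_def)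
  next
    fix s' assume "s' * alternant (map (\<lambda>j. int (length \<nu>) - 1 - int j) [0..<length \<nu>]) =
      alternant (map (\<lambda>j. \<nu> ! j + int (length \<nu>) - 1 - int j) [0..<length \<nu>])"
    then have "s' * vand (length \<nu>) = alternant (sh \<nu>)" by (simp add: dl_def sh_def)
    then have "(s' - s) * vand (length \<nu>) = 0" using s(2) by (simp add: left_diff_distrib)
    then show "s' = s" using vand_cancel_all by fastforce
  qed
  then show "schur \<nu> \<in> sym_utring (length \<nu>) n" "schur \<nu> * vand (length \<nu>) = alternant (sh \<nu>)" using s by auto
qed

section \<open>Expansion of antisymmetric polynomials in alternants\<close>

text \<open>The exponents \<open>\<nu> + \<delta>\<close> for partitions \<open>\<nu>\<close>:
  representatives of the free orbits of the symmetric group on nonnegative exponents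
  (\<open>Dec_unique\<close>, \<open>Dec_exists\<close>).\<close>

definition Dec :: "nat \<Rightarrow> int list set" where
  "Dec r = {\<mu>. length \<mu> = r \<and> sorted_wrt (>) \<mu> \<and> (\<forall>x\<in>set \<mu>. 0 \<le> x)}"

text \<open>The multiset of entries determines the sorted list, and distinctness of the entries
  determines the permutation.\<close>

lemma Dec_unique:
  assumes "\<mu> \<in> Dec r" "\<mu>' \<in> Dec r" "p permutes {..<r}" "p' permutes {..<r}"
    and eq: "pe p (ev \<mu>, c) = pe p' (ev \<mu>', c)"
  shows "\<mu> = \<mu>'" "p = p'"
proof -
  have len: "length \<mu> = r" "length \<mu>' = r" using assms by (auto simp: Dec_def)
  have p: "p i < r \<longleftrightarrow> i < r" "p' i < r \<longleftrightarrow> i < r" for i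
    using permutes_in_image[OF assms(3)] permutes_in_image[OF assms(4)] by auto
  have e: "\<mu> ! p i = \<mu>' ! p' i" if "i < r" for i
  proof -
    have "lk (fst (pe p (ev \<mu>, c))) i = lk (fst (pe p' (ev \<mu>', c))) i" using eq by simp
    then show ?thesis
      using that by (simp add: lookup_map_key_inj permutes_inj[OF assms(3)] permutes_inj[OF assms(4)] lookup_ev p len)
  qed
  have "permute_list p \<mu> = permute_list p' \<mu>'"
    by (rule nth_equalityI) (use e in \<open>auto simp: permute_list_def len\<close>)
  then have "mset \<mu> = mset \<mu>'"
    using assms(3,4) len by (metis mset_permute_list)
  then have "mset (rev \<mu>) = mset (rev \<mu>')" by simp
  moreover have "sorted (rev \<mu>)" "sorted (rev \<mu>')"
    using assms(1,2) by (auto simp: Dec_def sorted_wrt_rev intro: sorted_wrt_mono_rel[of _ "(>)"])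
  ultimately have "rev \<mu> = rev \<mu>'" by (metis properties_for_sort)
  then show "\<mu> = \<mu>'" by simp
  have "sorted_wrt (<) (rev \<mu>)" using assms(1) by (simp add: Dec_def sorted_wrt_rev)
  then have "distinct \<mu>" by (simp add: strict_sorted_iff)
  then have "p i = p' i" if "i < r" for i
    using e[OF that] \<open>\<mu> = \<mu>'\<close> p that len nth_eq_iff_index_eq by metis
  then show "p = p'" using assms(3,4) by (metis ext lessThan_iff permutes_not_in)
qed

lemma Dec_exists:
  assumes "nnexp r (a, b)" "inj_on (lk a) {..<r}"
  obtains \<mu> p where "\<mu> \<in> Dec r" "p permutes {..<r}" "(a, b) = pe p (ev \<mu>, b)"
proof -
  define xs where "xs = map (lk a) [0..<r]"
  define \<mu> where "\<mu> = rev (sort xs)"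
  have dist: "distinct xs" using assms(2) by (simp add: xs_def distinct_map atLeast0LessThan)
  have len: "length \<mu> = r" by (simp add: \<mu>_def xs_def)
  have "sorted_wrt (<) (sort xs)" using dist by (simp add: strict_sorted_iff)
  then have "\<mu> \<in> Dec r" using assms(1) len by (auto simp: Dec_def \<mu>_def sorted_wrt_rev xs_def nnexp_def)
  moreover have "mset xs = mset \<mu>" by (simp add: \<mu>_def)
  then obtain p where p: "p permutes {..<length \<mu>}" "permute_list p \<mu> = xs" by (rule mset_eq_permutation)
  moreover have "a = Poly_Mapping.map_key p (ev \<mu>)"
  proof (rule poly_mapping_eqI)
    fix i
    have pi: "p i < r \<longleftrightarrow> i < r" using permutes_in_image[OF p(1)] len by auto
    have "\<mu> ! p i = lk a i" if "i < r"
    proof -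
      have "permute_list p \<mu> ! i = xs ! i" using p(2) by simp
      then show ?thesis using that by (simp add: permute_list_def len xs_def)
    qed
    moreover have "lk a i = 0" if "\<not> i < r" using assms(1) that by (auto simp: nnexp_def in_keys_iff subset_iff)
    ultimately show "lk a i = lk (Poly_Mapping.map_key p (ev \<mu>)) i"
      using permutes_inj[OF p(1)] by (auto simp: lookup_map_key_inj lookup_ev len pi)
  qed
  ultimately show ?thesis using that len by auto
qed

text \<open>The coefficient of \<open>u^\<mu>\<close>, kept as a Laurent polynomial in
  \<open>t\<close> placed at \<open>u\<close>-exponent 0.\<close>

definition cf :: "int list \<Rightarrow> laurent \<Rightarrow> laurent" where
  "cf \<mu> g = (\<Sum>b\<in>snd ` ky g. sg (0, b) (lk g (ev \<mu>, b)))"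

lemma lookup_cf: "lk (cf \<mu> g) (a, b) = (if a = 0 then lk g (ev \<mu>, b) else 0)"
proof -
  have "lk (cf \<mu> g) (a, b) = (\<Sum>b'\<in>snd ` ky g. if b' = b then (if a = 0 then lk g (ev \<mu>, b) else 0) else 0)"
    unfolding cf_def lookup_sum by (rule sum.cong) (auto simp: lookup_single when_def)
  also have "\<dots> = (if b \<in> snd ` ky g then (if a = 0 then lk g (ev \<mu>, b) else 0) else 0)"
    by simp
  also have "\<dots> = (if a = 0 then lk g (ev \<mu>, b) else 0)"
  proof -
    have "lk g (ev \<mu>, b) = 0" if "b \<notin> snd ` ky g"
      using that by (metis image_eqI in_keys_iff snd_conv)
    then show ?thesis by auto
  qed
  finally show ?thesis .
qed

lemma cf_add: "cf \<mu> (f + g) = cf \<mu> f + cf \<mu> g"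
  by (rule poly_mapping_eqI, rename_tac d, case_tac d) (simp add: lookup_cf lookup_add)

lemma tring_fst: "c \<in> tring n \<Longrightarrow> e \<in> ky c \<Longrightarrow> fst e = 0"
  by (auto simp: tring_def)

lemma cf_mult:
  assumes "c \<in> tring n"
  shows "cf \<mu> (c * g) = c * cf \<mu> g"
proof (rule poly_mapping_eqI)
  fix d :: expo
  obtain a b where d: "d = (a, b)" by (cases d)
  have fst0: "fst e = 0" if "e \<in> ky c" for e by (rule tring_fst[OF assms that])
  have "lk (c * cf \<mu> g) (a, b) = (\<Sum>e\<in>ky c. lk c e * lk (cf \<mu> g) ((a, b) - e))"
    by (simp add: conv_def flip: conv_lookup)
  also have "\<dots> = (\<Sum>e\<in>ky c. if a = 0 then lk c e * lk g ((ev \<mu>, b) - e) else 0)"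
  proof (rule sum.cong[OF refl])
    fix e assume "e \<in> ky c"
    then have "e = (0, snd e)" using fst0 by (metis prod.collapse)
    then have "(a, b) - e = (a, b - snd e)" "(ev \<mu>, b) - e = (ev \<mu>, b - snd e)"
      by (metis diff_Pair diff_zero)+
    then show "lk c e * lk (cf \<mu> g) ((a, b) - e) = (if a = 0 then lk c e * lk g ((ev \<mu>, b) - e) else 0)"
      by (simp add: lookup_cf)
  qed
  also have "\<dots> = lk (cf \<mu> (c * g)) (a, b)"
    by (auto simp: lookup_cf conv_def simp flip: conv_lookup)
  finally show "lk (cf \<mu> (c * g)) d = lk (c * cf \<mu> g) d" using d by simp
qed

lemma cf_tring: "g \<in> utring r n \<Longrightarrow> cf \<mu> g \<in> tring n"
proof -
  assume g: "g \<in> utring r n"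
  have "a = 0 \<and> ky b \<subseteq> {..<n}" if "(a, b) \<in> ky (cf \<mu> g)" for a b
  proof -
    have "a = 0 \<and> lk g (ev \<mu>, b) \<noteq> 0" using that by (auto simp: in_keys_iff lookup_cf split: if_splits)
    then have "(ev \<mu>, b) \<in> ky g" by (simp add: in_keys_iff)
    then have "gdeg r n (ev \<mu>, b)" using g by (simp add: utring_iff)
    then show ?thesis using \<open>a = 0 \<and> _\<close> by (simp add: gdeg_def)
  qed
  then show ?thesis by (auto simp: tring_def)
qed

lemma lookup_cf_alternant:
  "lk (cf \<mu> g * alternant es) (a, b) =
     (\<Sum>p | p permutes {..<length es}. sign p * (if (a, b) = pe p (ev es, b) then lk g (ev \<mu>, b) else 0))"
proof -
  have "lk (cf \<mu> g * alternant es) (a, b) = conv (alternant es) (lk (cf \<mu> g)) (a, b)"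
    by (simp add: conv_lookup mult.commute)
  also have "\<dots> = (\<Sum>p | p permutes {..<length es}. sign p * lk (cf \<mu> g) ((a, b) - pe p (ev es, 0)))"
    by (simp add: conv_alternant del: pe_pair)
  finally show ?thesis by (auto simp: lookup_cf intro!: sum.cong)
qed

text \<open>An exponent with two equal entries is fixed by a transposition, so its coefficient
  equals its own negative; every other exponent is a unique rearrangement of a unique strictly
  decreasing \<open>\<mu>\<close>.\<close>

lemma antisym_expansion:
  assumes g: "g \<in> utring r n" and anti: "\<And>p. p permutes {..<r} \<Longrightarrow> pact p g = of_int (sign p) * g"
    and M: "finite M" "M \<subseteq> Dec r" "\<And>\<mu>. \<mu> \<in> Dec r \<Longrightarrow> cf \<mu> g \<noteq> 0 \<Longrightarrow> \<mu> \<in> M"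
  shows "g = (\<Sum>\<mu>\<in>M. cf \<mu> g * alternant \<mu>)"
proof (rule poly_mapping_eqI)
  fix d :: expo
  obtain a b where d: "d = (a, b)" by (cases d)
  have rhs: "lk (\<Sum>\<mu>\<in>M. cf \<mu> g * alternant \<mu>) (a, b) =
    (\<Sum>\<mu>\<in>M. \<Sum>p | p permutes {..<r}. sign p * (if (a, b) = pe p (ev \<mu>, b) then lk g (ev \<mu>, b) else 0))"
    unfolding lookup_sum lookup_cf_alternant using M(2) by (intro sum.cong) (auto simp: Dec_def)
  have g_pe: "lk g (pe p e) = sign p * lk g e" if "p permutes {..<r}" for p e
    using anti[OF that] by (metis lookup_pact[OF that] lookup_of_int_mult)
  show "lk g d = lk (\<Sum>\<mu>\<in>M. cf \<mu> g * alternant \<mu>) d"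
  proof (cases "\<exists>\<mu>\<in>Dec r. \<exists>p. p permutes {..<r} \<and> (a, b) = pe p (ev \<mu>, b)")
    case True
    then obtain \<mu>0 p0 where 0: "\<mu>0 \<in> Dec r" "p0 permutes {..<r}" "(a, b) = pe p0 (ev \<mu>0, b)" by blast
    have uniq: "(a, b) = pe p (ev \<mu>, b) \<longleftrightarrow> \<mu> = \<mu>0 \<and> p = p0" if "\<mu> \<in> M" "p permutes {..<r}" for \<mu> p
    proof
      assume "(a, b) = pe p (ev \<mu>, b)"
      then have "pe p (ev \<mu>, b) = pe p0 (ev \<mu>0, b)" using 0(3) by metis
      then show "\<mu> = \<mu>0 \<and> p = p0" using Dec_unique[OF _ 0(1) that(2) 0(2)] that(1) M(2) by blast
    qed (use 0(3) in metis)
    have "(\<Sum>\<mu>\<in>M. \<Sum>p | p permutes {..<r}. sign p * (if (a, b) = pe p (ev \<mu>, b) then lk g (ev \<mu>, b) else 0))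
      = (\<Sum>\<mu>\<in>M. \<Sum>p | p permutes {..<r}. if p = p0 then (if \<mu> = \<mu>0 then sign p0 * lk g (ev \<mu>0, b) else 0) else 0)"
      by (intro sum.cong refl) (use uniq in \<open>auto simp del: pe_pair\<close>)
    also have "\<dots> = (\<Sum>\<mu>\<in>M. if \<mu> = \<mu>0 then sign p0 * lk g (ev \<mu>0, b) else 0)"
      using 0(2) by (simp add: finite_permutations)
    also have "\<dots> = sign p0 * lk g (ev \<mu>0, b)"
    proof (cases "\<mu>0 \<in> M")
      case False
      then have "cf \<mu>0 g = 0" using M(3) 0(1) by blast
      then have "lk (cf \<mu>0 g) (0, b) = 0" by simp
      then show ?thesis using False by (simp add: lookup_cf)
    qed (use M(1) in simp)
    also have "\<dots> = lk g (a, b)" using g_pe[OF 0(2), of "(ev \<mu>0, b)"] 0(3) by simp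
    finally show ?thesis using rhs d by simp
  next
    case False
    have "lk g (a, b) = 0"
    proof (rule ccontr)
      assume nz: "lk g (a, b) \<noteq> 0"
      then have nn: "nnexp r (a, b)" using g by (auto simp: utring_iff gdeg_def in_keys_iff)
      have "inj_on (lk a) {..<r}"
      proof (rule inj_onI, rule ccontr)
        fix i j assume ij: "i \<in> {..<r}" "j \<in> {..<r}" "lk a i = lk a j" "i \<noteq> j"
        let ?t = "transpose i j"
        have t: "?t permutes {..<r}" using ij by (simp add: permutes_swap_id)
        have "pe ?t (a, b) = (a, b)"
          using ij by (auto intro!: poly_mapping_eqI simp: lookup_map_key_inj permutes_inj[OF t] transpose_def)
        then have "lk g (a, b) = - lk g (a, b)" using g_pe[OF t, of "(a, b)"] ij(4) by (simp add: sign_swap_id)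
        then show False using nz by simp
      qed
      from Dec_exists[OF nn this] False show False by metis
    qed
    moreover have "(\<Sum>\<mu>\<in>M. \<Sum>p | p permutes {..<r}. sign p * (if (a, b) = pe p (ev \<mu>, b) then lk g (ev \<mu>, b) else 0)) = 0"
      using False M(2) by (intro sum.neutral ballI) (auto simp del: pe_pair)
    ultimately show ?thesis using rhs d by simp
  qed
qed

lemma finite_cf: "finite {\<mu> \<in> Dec r. cf \<mu> g \<noteq> 0}"
proof (rule inj_on_finite[of ev _ "fst ` ky g"])
  show "inj_on ev {\<mu> \<in> Dec r. cf \<mu> g \<noteq> 0}"
    using Dec_unique(1)[OF _ _ permutes_id permutes_id] by (auto intro!: inj_onI)
  show "ev ` {\<mu> \<in> Dec r. cf \<mu> g \<noteq> 0} \<subseteq> fst ` ky g"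
  proof safe
    fix \<mu> assume "cf \<mu> g \<noteq> 0"
    then obtain a b where "lk (cf \<mu> g) (a, b) \<noteq> 0" by (metis lookup_zero poly_mapping_eqI surj_pair)
    then have "(ev \<mu>, b) \<in> ky g" by (simp add: lookup_cf in_keys_iff split: if_splits)
    then show "ev \<mu> \<in> fst ` ky g" by (metis fst_conv image_eqI)
  qed
qed simp

section \<open>The operators on symmetric polynomials\<close>

definition unsh :: "int list \<Rightarrow> int list" where
  "unsh \<mu> = map (\<lambda>j. \<mu> ! j - (int (length \<mu>) - 1 - int j)) [0..<length \<mu>]"

lemma length_unsh [simp]: "length (unsh \<mu>) = length \<mu>" by (simp add: unsh_def)

lemma sh_unsh: "sh (unsh \<mu>) = \<mu>" and unsh_sh: "unsh (sh \<nu>) = \<nu>"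
  by (auto simp: sh_def unsh_def intro!: nth_equalityI)

definition part :: "nat \<Rightarrow> int list \<Rightarrow> bool" where
  "part r \<nu> \<longleftrightarrow> length \<nu> = r \<and> sorted_wrt (\<ge>) \<nu> \<and> (\<forall>x\<in>set \<nu>. x \<ge> 0)"

lemma sh_Dec: "part r \<nu> \<Longrightarrow> sh \<nu> \<in> Dec r"
proof -
  assume "part r \<nu>"
  then have len: "length \<nu> = r" and s: "\<And>i j. i < j \<Longrightarrow> j < r \<Longrightarrow> \<nu> ! i \<ge> \<nu> ! j" and nn: "\<And>i. i < r \<Longrightarrow> \<nu> ! i \<ge> 0"
    by (auto simp: part_def sorted_wrt_iff_nth_less)
  have "sh \<nu> ! j < sh \<nu> ! i" if "i < j" "j < r" for i j using s[OF that] that by (simp add: sh_def len)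
  moreover have "0 \<le> sh \<nu> ! i" if "i < r" for i using nn[OF that] that by (simp add: sh_def len)
  ultimately show ?thesis by (auto simp: Dec_def sorted_wrt_iff_nth_less len in_set_conv_nth)
qed

lemma unsh_part: "\<mu> \<in> Dec r \<Longrightarrow> part r (unsh \<mu>)"
proof -
  assume "\<mu> \<in> Dec r"
  then have len: "length \<mu> = r" and s: "\<And>i j. i < j \<Longrightarrow> j < r \<Longrightarrow> \<mu> ! i > \<mu> ! j" and nn: "\<And>i. i < r \<Longrightarrow> \<mu> ! i \<ge> 0"
    by (auto simp: Dec_def sorted_wrt_iff_nth_less)
  have gap: "\<mu> ! i \<ge> \<mu> ! (i + k) + int k" if "i + k < r" for i k using that
  proof (induction k)
    case (Suc k) then show ?case using s[of "i + k" "i + Suc k"] by simp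
  qed simp
  have "unsh \<mu> ! j \<le> unsh \<mu> ! i" if "i < j" "j < r" for i j
    using gap[of i "j - i"] that by (simp add: unsh_def len of_nat_diff)
  moreover have "0 \<le> unsh \<mu> ! i" if "i < r" for i
    using gap[of i "r - 1 - i"] nn[of "r - 1"] that by (simp add: unsh_def len of_nat_diff)
  ultimately show ?thesis by (auto simp: part_def sorted_wrt_iff_nth_less len in_set_conv_nth)
qed

text \<open>Appending \<open>k\<close> adds 1 to the first \<open>r\<close> entries of
  \<open>\<nu> + \<delta>\<close> and puts \<open>k\<close> last. The result has nonnegative entries
  for every \<open>k\<close>, although \<open>\<nu> @ [int k]\<close> is a partition only for small
  \<open>k\<close>, so \<open>schur_props\<close> applies.\<close>

lemma schur_part:
  assumes "part r \<nu>"
  shows "schur \<nu> \<in> sym_utring r n" "schur \<nu> * vand r = alternant (sh \<nu>)"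
    "schur (\<nu> @ [int k]) \<in> sym_utring (r + 1) n" "schur (\<nu> @ [int k]) * vand (r + 1) = alternant (map ((+) 1) (sh \<nu>) @ [int k])"
proof -
  have len: "length \<nu> = r" and nn: "\<And>i. i < r \<Longrightarrow> \<nu> ! i \<ge> 0" using assms by (auto simp: part_def)
  have 1: "0 \<le> sh \<nu> ! j" if "j < length \<nu>" for j using nn[of j] that len by (simp add: sh_def)
  show "schur \<nu> \<in> sym_utring r n" "schur \<nu> * vand r = alternant (sh \<nu>)" using schur_props[of \<nu>, OF 1] len by auto
  have eq: "sh (\<nu> @ [int k]) = map ((+) 1) (sh \<nu>) @ [int k]"
    by (rule nth_equalityI) (auto simp: sh_def nth_append less_Suc_eq)
  have 2: "0 \<le> sh (\<nu> @ [int k]) ! j" if "j < length (\<nu> @ [int k])" for j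
    using that 1[of j] by (auto simp: eq nth_append less_Suc_eq)
  show "schur (\<nu> @ [int k]) \<in> sym_utring (r + 1) n" "schur (\<nu> @ [int k]) * vand (r + 1) = alternant (map ((+) 1) (sh \<nu>) @ [int k])"
    using schur_props[of "\<nu> @ [int k]", OF 2] len by (auto simp: eq)
qed

definition Msupp :: "nat \<Rightarrow> laurent \<Rightarrow> int list set" where
  "Msupp r f = {\<mu> \<in> Dec r. cf \<mu> (f * vand r) \<noteq> 0}"

lemma finite_Msupp: "finite (Msupp r f)"
  unfolding Msupp_def by (rule finite_cf)

text \<open>The coefficient of \<open>f * vand r\<close> at \<open>\<mu> = \<nu> + \<delta>\<close>
  is the coefficient of \<open>s_\<nu>\<close> in \<open>f\<close>. This explicit form of
  \<open>rho_k\<close> makes linearity easy: \<open>Rk_superset\<close> provides a common summation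
  range for several arguments.\<close>

definition Rk :: "nat \<Rightarrow> nat \<Rightarrow> laurent \<Rightarrow> laurent" where
  "Rk r k f = (\<Sum>\<mu>\<in>Msupp r f. cf \<mu> (f * vand r) * schur (unsh \<mu> @ [int k]))"

lemma Rk_superset:
  assumes "finite M" "Msupp r f \<subseteq> M" "M \<subseteq> Dec r"
  shows "Rk r k f = (\<Sum>\<mu>\<in>M. cf \<mu> (f * vand r) * schur (unsh \<mu> @ [int k]))"
  unfolding Rk_def by (rule sum.mono_neutral_left) (use assms in \<open>auto simp: Msupp_def\<close>)

lemma Msupp_Dec: "Msupp r f \<subseteq> Dec r" by (auto simp: Msupp_def)

lemma alternant_utring: "\<forall>x\<in>set es. 0 \<le> x \<Longrightarrow> alternant es \<in> utring (length es) n"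
  unfolding alternant_eq_sum
proof (intro utring_sum utring_mult utring_of_int utring_single disjI2)
  fix p assume es: "\<forall>x\<in>set es. 0 \<le> x" and "p \<in> {p. p permutes {..<length es}}"
  then have p: "p permutes {..<length es}" by simp
  have "p i < length es \<longleftrightarrow> i < length es" for i using permutes_in_image[OF p] by auto
  then show "gdeg (length es) n (pe p (ev es, 0))"
    using es by (auto simp: gdeg_def nnexp_def lookup_map_key_inj permutes_inj[OF p] in_keys_iff lookup_ev split: if_splits)
qed

lemma vand_utring: "vand r \<in> utring r n"
  using alternant_utring[of "dl r" n] by (auto simp: dl_def)

lemma sym_mult_vand:
  assumes "f \<in> sym_utring r n"
  shows "f * vand r \<in> utring r n" "\<And>p. p permutes {..<r} \<Longrightarrow> pact p (f * vand r) = of_int (sign p) * (f * vand r)"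
  using assms by (auto simp: sym_utring_iff utring_mult vand_utring pact_mult pact_alternant)

lemma sym_expansion:
  assumes "f \<in> sym_utring r n"
  shows "f * vand r = (\<Sum>\<mu>\<in>Msupp r f. cf \<mu> (f * vand r) * alternant \<mu>)"
    "f = (\<Sum>\<mu>\<in>Msupp r f. cf \<mu> (f * vand r) * schur (unsh \<mu>))"
proof -
  show 1: "f * vand r = (\<Sum>\<mu>\<in>Msupp r f. cf \<mu> (f * vand r) * alternant \<mu>)"
    by (rule antisym_expansion[OF sym_mult_vand[OF assms]]) (auto simp: Msupp_def finite_cf)
  have "(\<Sum>\<mu>\<in>Msupp r f. cf \<mu> (f * vand r) * schur (unsh \<mu>)) * vand r = f * vand r"
    by (subst (2) 1) (auto simp: sum_distrib_right mult.assoc schur_part(2)[OF unsh_part] sh_unsh Msupp_def intro!: sum.cong)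
  then have "(f - (\<Sum>\<mu>\<in>Msupp r f. cf \<mu> (f * vand r) * schur (unsh \<mu>))) * vand r = 0"
    by (simp add: left_diff_distrib)
  from vand_cancel_all[OF this] show "f = (\<Sum>\<mu>\<in>Msupp r f. cf \<mu> (f * vand r) * schur (unsh \<mu>))" by simp
qed

text \<open>The property under the definite description of \<open>rho_k\<close>; existence is
  \<open>rho_spec_Rk\<close>, uniqueness on symmetric polynomials is
  \<open>rho_spec_unique\<close>.\<close>

definition rho_spec :: "nat \<Rightarrow> nat \<Rightarrow> nat \<Rightarrow> (laurent \<Rightarrow> laurent) \<Rightarrow> bool" where
  "rho_spec r n k F \<longleftrightarrow> F \<in> sym_utring r n \<rightarrow>\<^sub>E sym_utring (r + 1) n \<and>
     (\<forall>f\<in>sym_utring r n. \<forall>g\<in>sym_utring r n. F (f + g) = F f + F g) \<and>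
     (\<forall>c\<in>tring n. \<forall>f\<in>sym_utring r n. F (c * f) = c * F f) \<and>
     (\<forall>\<nu>. length \<nu> = r \<and> sorted_wrt (\<ge>) \<nu> \<and> (\<forall>x\<in>set \<nu>. x \<ge> 0) \<longrightarrow>
        F (schur \<nu>) = schur (\<nu> @ [int k]))"

lemma cf_sym_tring: "f \<in> sym_utring r n \<Longrightarrow> cf \<mu> (f * vand r) \<in> tring n"
  using sym_mult_vand(1) cf_tring by blast

lemma rho_spec_unique:
  assumes F: "rho_spec r n k F" and f: "f \<in> sym_utring r n"
  shows "F f = Rk r k f"
proof -
  have add: "F (f + g) = F f + F g" if "f \<in> sym_utring r n" "g \<in> sym_utring r n" for f g
    using F that by (auto simp: rho_spec_def)
  have F0: "F 0 = 0" using add[of 0 0] sym_utring_of_int[of 0 r n] by simp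
  have sum: "F (\<Sum>x\<in>S. g x) = (\<Sum>x\<in>S. F (g x))" if "\<And>x. x \<in> S \<Longrightarrow> g x \<in> sym_utring r n" for S and g :: "int list \<Rightarrow> laurent"
    using that by (induction S rule: infinite_finite_induct) (auto simp: F0 add sym_utring_sum)
  have mem: "cf \<mu> (f * vand r) \<in> tring n" "schur (unsh \<mu>) \<in> sym_utring r n" if "\<mu> \<in> Msupp r f" for \<mu>
    using that f cf_sym_tring schur_part(1)[OF unsh_part, of \<mu> r n] by (auto simp: Msupp_def)
  have "F f = F (\<Sum>\<mu>\<in>Msupp r f. cf \<mu> (f * vand r) * schur (unsh \<mu>))" using sym_expansion(2)[OF f] by simp
  also have "\<dots> = (\<Sum>\<mu>\<in>Msupp r f. F (cf \<mu> (f * vand r) * schur (unsh \<mu>)))"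
    by (rule sum, rule sym_utring_mult[OF tring_subset_sym_utring[OF mem(1)] mem(2)])
  also have "\<dots> = Rk r k f" unfolding Rk_def
  proof (rule sum.cong[OF refl])
    fix \<mu> assume \<mu>: "\<mu> \<in> Msupp r f"
    have "part r (unsh \<mu>)" using \<mu> by (auto simp: Msupp_def unsh_part)
    then have "F (schur (unsh \<mu>)) = schur (unsh \<mu> @ [int k])" using F by (auto simp: rho_spec_def part_def)
    then show "F (cf \<mu> (f * vand r) * schur (unsh \<mu>)) = cf \<mu> (f * vand r) * schur (unsh \<mu> @ [int k])"
      using F mem[OF \<mu>] by (simp add: rho_spec_def)
  qed
  finally show ?thesis .
qed

lemma rho_spec_Rk: "rho_spec r n k (restrict (Rk r k) (sym_utring r n))"
proof -
  have "Rk r k f \<in> sym_utring (r + 1) n" if "f \<in> sym_utring r n" for f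
    unfolding Rk_def
    by (intro sym_utring_sum sym_utring_mult tring_subset_sym_utring cf_sym_tring[OF that] schur_part(3)[OF unsh_part])
       (simp add: Msupp_def)
  moreover have "Rk r k (f + g) = Rk r k f + Rk r k g" for f g
  proof -
    let ?M = "Msupp r f \<union> Msupp r g \<union> Msupp r (f + g)"
    have M: "finite ?M" "?M \<subseteq> Dec r" using finite_Msupp Msupp_Dec by auto
    show ?thesis
      by (subst (1 2 3) Rk_superset[OF M(1) _ M(2)]) (auto simp: distrib_right cf_add sum.distrib)
  qed
  moreover have "Rk r k (c * f) = c * Rk r k f" if "c \<in> tring n" for c f
  proof -
    let ?M = "Msupp r f \<union> Msupp r (c * f)"
    have M: "finite ?M" "?M \<subseteq> Dec r" using finite_Msupp Msupp_Dec by auto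
    show ?thesis
      by (subst (1 2) Rk_superset[OF M(1) _ M(2)]) (auto simp: mult.assoc cf_mult[OF that] sum_distrib_left)
  qed
  moreover have "Rk r k (schur \<nu>) = schur (\<nu> @ [int k])" if "part r \<nu>" for \<nu>
  proof -
    have len: "length \<nu> = r" using that by (simp add: part_def)
    \<comment> \<open>Among strictly decreasing exponents only \<open>sh \<nu>\<close> occurs in its
      own alternant, with coefficient 1 from the identity: the linear independence of Schur
      polynomials.\<close>
    have c: "cf \<mu> (alternant (sh \<nu>)) = of_int (if \<mu> = sh \<nu> then 1 else 0)" if \<mu>: "\<mu> \<in> Dec r" for \<mu>
    proof (rule poly_mapping_eqI)
      fix d :: expo
      obtain a b where d: "d = (a, b)" by (cases d)
      have "lk (alternant (sh \<nu>)) (ev \<mu>, b) = (\<Sum>p | p permutes {..<r}. sign p * (if (ev \<mu>, b) = pe p (ev (sh \<nu>), 0) then 1 else 0))"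
        by (auto simp: alternant_eq_sum lookup_sum lookup_of_int_mult lookup_single when_def len intro!: sum.cong)
      also have "\<dots> = (\<Sum>p | p permutes {..<r}. if p = id then (if \<mu> = sh \<nu> \<and> b = 0 then 1 else 0) else 0)"
      proof (rule sum.cong[OF refl])
        fix p assume "p \<in> {p. p permutes {..<r}}"
        then have p: "p permutes {..<r}" by simp
        have "(ev \<mu>, b) = pe p (ev (sh \<nu>), 0) \<longleftrightarrow> \<mu> = sh \<nu> \<and> b = 0 \<and> p = id"
        proof
          assume eq: "(ev \<mu>, b) = pe p (ev (sh \<nu>), 0)"
          then have "b = 0" by simp
          with eq have "pe id (ev \<mu>, 0) = pe p (ev (sh \<nu>), 0)" by (simp only: pe_id)
          from Dec_unique[OF \<mu> sh_Dec[OF \<open>part r \<nu>\<close>] permutes_id p this] \<open>b = 0\<close>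
          show "\<mu> = sh \<nu> \<and> b = 0 \<and> p = id" by simp
        qed (simp only: pe_id)
        then show "sign p * (if (ev \<mu>, b) = pe p (ev (sh \<nu>), 0) then 1 else 0) = (if p = id then (if \<mu> = sh \<nu> \<and> b = 0 then 1 else 0) else 0)"
          by (auto simp del: pe_pair)
      qed
      also have "\<dots> = (if \<mu> = sh \<nu> \<and> b = 0 then 1 else 0)" by (simp add: permutes_id finite_permutations)
      finally show "lk (cf \<mu> (alternant (sh \<nu>))) d = lk (of_int (if \<mu> = sh \<nu> then 1 else 0)) d"
        by (auto simp: d lookup_cf lookup_one when_def zero_prod_def)
    qed
    have "Rk r k (schur \<nu>) = (\<Sum>\<mu>\<in>{sh \<nu>}. cf \<mu> (schur \<nu> * vand r) * schur (unsh \<mu> @ [int k]))"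
      by (rule Rk_superset) (auto simp: sh_Dec[OF that] Msupp_def schur_part(2)[OF that] c split: if_splits)
    then show ?thesis by (simp add: schur_part(2)[OF that] c sh_Dec[OF that] unsh_sh)
  qed
  ultimately show ?thesis
    unfolding rho_spec_def
    by (auto simp: sym_utring_add sym_utring_mult tring_subset_sym_utring part_def schur_part(1)[of r _ n])
qed

lemma rho_k_eq: "f \<in> sym_utring r n \<Longrightarrow> rho_k r n k f = Rk r k f"
proof -
  assume f: "f \<in> sym_utring r n"
  have "rho_k r n k = (THE F. rho_spec r n k F)"
    unfolding rho_k_def rho_spec_def ..
  also have "\<dots> = restrict (Rk r k) (sym_utring r n)"
  proof (rule the_equality)
    fix F assume F: "rho_spec r n k F"
    \<comment> \<open>Outside the symmetric polynomials extensionality fixes the value, so agreement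
      on them is enough.\<close>
    then have "F \<in> extensional (sym_utring r n)" by (auto simp: rho_spec_def PiE_def)
    then show "F = restrict (Rk r k) (sym_utring r n)"
      using rho_spec_unique[OF F] by (auto simp: fun_eq_iff extensional_def)
  qed (rule rho_spec_Rk)
  finally show ?thesis using f by simp
qed

section \<open>The operator on formal series\<close>

definition Uprod :: "nat \<Rightarrow> laurent" where "Uprod r = (\<Prod>i<r. upow i 1)"

lemma Uprod_single: "Uprod r = sg (\<Sum>i<r. sg i 1, 0) 1"
  by (simp add: Uprod_def upow_def prod_single sum_pair_zero)

lemma lookup_sum_sg: "lk (\<Sum>i<r::nat. sg i 1) j = (if j < r then 1 else (0::int))"
proof -
  have "lk (\<Sum>i<r. sg i 1) j = (\<Sum>i<r. if i = j then 1 else (0::int))"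
    by (simp add: lookup_sum lookup_single when_def)
  then show ?thesis by simp
qed

lemma Uprod_utring: "Uprod r \<in> utring r n"
  unfolding Uprod_def by (intro utring_prod upow_in_utring) auto

lemma pact_Uprod: "p permutes {..<r} \<Longrightarrow> pact p (Uprod r) = Uprod r"
  using prod.permute[of p "{..<r}" "\<lambda>i. upow i 1", symmetric] by (simp add: Uprod_def pact_prod pact_upow comp_def)

lemma permutes_Suc: "p permutes {..<r::nat} \<Longrightarrow> p permutes {..<r + 1}"
  by (rule permutes_subset) auto

lemmas permutes_Suc' = permutes_Suc[unfolded Suc_eq_plus1[symmetric]]

lemma card_perms: "card {p. p permutes {..<r::nat}} = fact r"
  by (rule card_permutations) auto

lemma sign_mult_self: "of_int (sign p) * of_int (sign p) = (1::'a::comm_ring_1)"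
  by (simp add: sign_def)

text \<open>\<open>Uprod r * upow r (int k)\<close> is invariant under permutations of the first
  \<open>r\<close> variables, so each of the \<open>r!\<close> signed terms of the alternant of
  \<open>\<mu>\<close> antisymmetrizes to the same alternant in \<open>r + 1\<close>
  variables.\<close>

lemma alternant_extend:
  assumes "length \<mu> = r"
  shows "of_int (fact r) * alternant (map ((+) 1) \<mu> @ [int k]) = Alt (r + 1) (Uprod r * upow r (int k) * alternant \<mu>)"
proof -
  let ?U = "Uprod r * upow r (int k)" and ?X = "sg (ev \<mu>, 0) 1 :: laurent"
  have U: "pact p ?U = ?U" if "p permutes {..<r}" for p
    using pact_upow[OF that, of r "int k"] permutes_not_in[OF that, of r] by (simp add: pact_mult[OF that] pact_Uprod[OF that])
  have ev: "?U * ?X = sg (ev (map ((+) 1) \<mu> @ [int k]), 0) 1"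
  proof -
    have "(\<Sum>i<r. sg i 1) + sg r (int k) + ev \<mu> = ev (map ((+) 1) \<mu> @ [int k])"
      by (rule poly_mapping_eqI) (auto simp: lookup_add lookup_sum_sg lookup_ev lookup_single when_def nth_append assms)
    then show ?thesis by (simp add: Uprod_single upow_def mult_single)
  qed
  have "Alt (r + 1) (?U * alternant \<mu>) = (\<Sum>p | p permutes {..<r}. of_int (sign p) * Alt (r + 1) (pact p (?U * ?X)))"
    unfolding alternant_eq_Alt[of \<mu>] assms Alt_def[of r] sum_distrib_left Alt_sum
    by (rule sum.cong[OF refl]) (simp add: pact_mult[of _ "{..<r}" "?U"] U mult.left_commute Alt_of_int_mult)
  also have "\<dots> = (\<Sum>p | p permutes {..<r}. Alt (r + 1) (?U * ?X))"
    by (rule sum.cong[OF refl]) (simp add: Alt_pact[OF permutes_Suc'] mult.assoc[symmetric] sign_mult_self)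
  also have "\<dots> = of_int (fact r) * Alt (r + 1) (?U * ?X)"
    by (simp add: card_perms)
  finally show ?thesis by (simp add: ev alternant_eq_Alt assms)
qed

lemma tvar_sym: "j < n \<Longrightarrow> tvar j \<in> sym_utring m n"
  by (rule tring_subset_sym_utring) (auto simp: tring_def tvar_def)

lemma pact_tvar: "p permutes S \<Longrightarrow> pact p (tvar j) = tvar j"
  by (rule pact_tring[of _ "Suc j"]) (auto simp: tring_def tvar_def)

lemma elem_sym_t_sym: "elem_sym_t n k \<in> sym_utring m n"
  unfolding elem_sym_t_def by (intro sym_utring_sum sym_utring_prod tvar_sym) auto

text \<open>The factors of the denominator that belong to one \<open>u\<close> variable: their
  expansion is the source of the coefficients \<open>(-1)^k e_k(t)\<close> in \<open>rho\<close>,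
  the power \<open>u^k\<close> matching the entry appended by \<open>rho_k\<close>.\<close>

lemma prod_tvar_expand:
  "(\<Prod>j<n. 1 - upow i 1 * tvar j) = (\<Sum>k\<le>n. (- 1) ^ k * elem_sym_t n k * upow i (int k))"
proof -
  have "(\<Prod>j<n. 1 - upow i 1 * tvar j) = (\<Prod>j<n. - (upow i 1 * tvar j) + 1)" by simp
  also have "\<dots> = (\<Sum>X\<in>Pow {..<n}. (\<Prod>j\<in>X. - (upow i 1 * tvar j)) * (\<Prod>j\<in>{..<n} - X. 1))"
    by (rule prod_add) simp
  also have "\<dots> = (\<Sum>k\<le>n. \<Sum>X | X \<subseteq> {..<n} \<and> card X = k. (\<Prod>j\<in>X. - (upow i 1 * tvar j)) * (\<Prod>j\<in>{..<n} - X. 1))"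
    by (rule sum_subsets_by_card)
  also have "\<dots> = (\<Sum>k\<le>n. (- 1) ^ k * elem_sym_t n k * upow i (int k))"
    unfolding elem_sym_t_def sum_distrib_left sum_distrib_right
  proof (intro sum.cong refl)
    fix k X assume "X \<in> {X. X \<subseteq> {..<n} \<and> card X = k}"
    then have "(\<Prod>j\<in>X. - (upow i 1 * tvar j)) = (- upow i 1) ^ k * (\<Prod>j\<in>X. tvar j)"
      by (auto simp: prod.distrib simp flip: mult_minus_left)
    then show "(\<Prod>j\<in>X. - (upow i 1 * tvar j)) * (\<Prod>j\<in>{..<n} - X. 1) = (- 1) ^ k * (\<Prod>j\<in>X. tvar j) * upow i (int k)"
      by (simp add: power_minus[of "upow i 1"] upow_power mult_ac)
  qed
  finally show ?thesis .
qed

definition Pr :: "nat \<Rightarrow> nat \<Rightarrow> laurent" where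
  "Pr r n = (\<Prod>i<r. \<Prod>j<n. 1 - upow i 1 * tvar j)"

lemma pact_Pr:
  assumes p: "p permutes {..<r}" shows "pact p (Pr r n) = Pr r n"
proof -
  have "pact p (1 - upow i 1 * tvar j) = 1 - upow (p i) 1 * tvar j" for i j
    using pact_add[OF p, of 1 "- (upow i 1 * tvar j)"]
    by (simp add: pact_one[OF p] pact_uminus[OF p] pact_mult[OF p] pact_upow[OF p] pact_tvar[OF p])
  then show ?thesis
    using prod.permute[OF p, of "\<lambda>i. \<Prod>j<n. 1 - upow i 1 * tvar j", symmetric]
    by (simp add: Pr_def pact_prod[OF p] comp_def)
qed

lemma Pr_utring: "Pr r n \<in> utring r n"
  unfolding Pr_def
proof (intro utring_prod)
  fix i j assume "i \<in> {..<r}" "j \<in> {..<n}"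
  then have "1 + of_int (-1) * (upow i 1 * tvar j) \<in> utring r n"
    using utring_of_int[of 1 r n] tvar_sym[of j n r]
    by (intro utring_add utring_mult utring_of_int upow_in_utring) (auto simp: sym_utring_iff)
  then show "1 - upow i 1 * tvar j \<in> utring r n" by simp
qed

lemma Pr_Suc: "Pr (r + 1) n = Pr r n * (\<Sum>k\<le>n. (- 1) ^ k * elem_sym_t n k * upow r (int k))"
  by (simp add: Pr_def prod_tvar_expand)

lemma conv_gdeg:
  assumes "P \<in> utring m n" "\<And>d. H d \<noteq> 0 \<Longrightarrow> gdeg m n d" "conv P H d \<noteq> 0"
  shows "gdeg m n d"
proof -
  obtain e where e: "e \<in> ky P" "of_int (lk P e) * H (d - e) \<noteq> 0"
    using assms(3) unfolding conv_def by (rule sum.not_neutral_contains_not_neutral)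
  then have "gdeg m n e" "H (d - e) \<noteq> 0" using assms(1) by (auto simp: utring_iff)
  note this(1) assms(2)[OF this(2)]
  from gdeg_add[OF this] show ?thesis by simp
qed

text \<open>A closed form of \<open>rho\<close> after multiplication by the Weyl denominator: by
  \<open>alternant_extend\<close> the Schur functions disappear, and what remains of the sum over
  \<open>k\<close> is the product of the factors \<open>1 - u_r t_j\<close>.\<close>

lemma rho_formula:
  assumes f: "f \<in> sym_utring r n"
  shows "rho r n f \<in> sym_utring (r + 1) n"
    and "of_int (fact r) * (rho r n f * vand (r + 1)) =
      Alt (r + 1) ((\<Sum>k\<le>n. (- 1) ^ k * elem_sym_t n k * upow r (int k)) * Uprod r * (f * vand r))"
proof -
  have Rk_in: "Rk r k f \<in> sym_utring (r + 1) n" for k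
    using rho_spec_Rk[of r n k] f unfolding rho_spec_def by fastforce
  have rho: "rho r n f = (\<Sum>k\<le>n. of_int ((- 1) ^ k) * elem_sym_t n k * Rk r k f)"
    by (simp add: rho_def rho_k_eq[OF f])
  show "rho r n f \<in> sym_utring (r + 1) n"
    unfolding rho by (intro sym_utring_sum sym_utring_mult sym_utring_of_int elem_sym_t_sym Rk_in)
  have inv: "pact p (of_int ((- 1) ^ k) * elem_sym_t n k) = of_int ((- 1) ^ k) * elem_sym_t n k"
    if "p permutes {..<r + 1}" for k p
  proof -
    have "of_int ((- 1) ^ k) * elem_sym_t n k \<in> sym_utring (r + 1) n"
      by (intro sym_utring_mult sym_utring_of_int elem_sym_t_sym)
    then show ?thesis using that unfolding sym_utring_iff by blast
  qed
  have cinv: "pact p (cf \<mu> (f * vand r)) = cf \<mu> (f * vand r)" if "p permutes {..<r + 1}" for p \<mu>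
    using pact_tring[OF cf_sym_tring[OF f] that] .
  have 1: "of_int (fact r) * (Rk r k f * vand (r + 1)) = Alt (r + 1) (Uprod r * upow r (int k) * (f * vand r))" for k
  proof -
    have "Alt (r + 1) (Uprod r * upow r (int k) * (f * vand r))
      = (\<Sum>\<mu>\<in>Msupp r f. Alt (r + 1) (cf \<mu> (f * vand r) * (Uprod r * upow r (int k) * alternant \<mu>)))"
      by (subst sym_expansion(1)[OF f]) (simp add: sum_distrib_left Alt_sum mult_ac)
    also have "\<dots> = (\<Sum>\<mu>\<in>Msupp r f. cf \<mu> (f * vand r) * (of_int (fact r) * alternant (map ((+) 1) \<mu> @ [int k])))"
      by (rule sum.cong[OF refl], subst Alt_mult[OF cinv], assumption, subst alternant_extend)
         (auto simp: Msupp_def Dec_def)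
    also have "\<dots> = (\<Sum>\<mu>\<in>Msupp r f. of_int (fact r) * (cf \<mu> (f * vand r) * schur (unsh \<mu> @ [int k]) * vand (r + 1)))"
    proof (rule sum.cong[OF refl])
      fix \<mu> assume "\<mu> \<in> Msupp r f"
      then have "part r (unsh \<mu>)" by (auto simp: Msupp_def unsh_part)
      then show "cf \<mu> (f * vand r) * (of_int (fact r) * alternant (map ((+) 1) \<mu> @ [int k])) =
         of_int (fact r) * (cf \<mu> (f * vand r) * schur (unsh \<mu> @ [int k]) * vand (r + 1))"
        using schur_part(4)[of r "unsh \<mu>" k] by (simp add: sh_unsh mult.assoc mult.left_commute)
    qed
    also have "\<dots> = of_int (fact r) * (Rk r k f * vand (r + 1))"
      by (simp add: Rk_def sum_distrib_left sum_distrib_right)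
    finally show ?thesis by simp
  qed
  have "Alt (r + 1) ((\<Sum>k\<le>n. (- 1) ^ k * elem_sym_t n k * upow r (int k)) * Uprod r * (f * vand r))
    = (\<Sum>k\<le>n. Alt (r + 1) (of_int ((- 1) ^ k) * elem_sym_t n k * (Uprod r * upow r (int k) * (f * vand r))))"
    by (simp add: sum_distrib_left sum_distrib_right Alt_sum mult_ac)
  also have "\<dots> = (\<Sum>k\<le>n. of_int ((- 1) ^ k) * elem_sym_t n k * (of_int (fact r) * (Rk r k f * vand (r + 1))))"
    by (rule sum.cong[OF refl], subst Alt_mult[OF inv], assumption) (simp only: 1)
  also have "\<dots> = of_int (fact r) * (rho r n f * vand (r + 1))"
    by (simp add: rho sum_distrib_left sum_distrib_right mult_ac)
  finally show "of_int (fact r) * (rho r n f * vand (r + 1)) =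
      Alt (r + 1) ((\<Sum>k\<le>n. (- 1) ^ k * elem_sym_t n k * upow r (int k)) * Uprod r * (f * vand r))" by simp
qed

lemma conv_antisym:
  assumes "\<And>p d. p permutes {..<m} \<Longrightarrow> H (pe p d) = H d" and q: "q permutes {..<m}"
  shows "conv (vand m) H (pe q d) = of_int (sign q) * conv (vand m) H d"
proof -
  have "H \<circ> pe q = H" using assms by auto
  then have "conv (vand m) H (pe q d) = conv (pact q (vand m)) H d"
    using fun_cong[OF conv_pact[OF q, of "vand m" H], of d] by simp
  then show ?thesis using q by (simp add: pact_alternant conv_of_int_mult)
qed

text \<open>Composition with the transposition of \<open>r\<close> and \<open>i\<close> reduces to
  permutations fixing \<open>r\<close>.\<close>

lemma card_perms_fixing_value:
  assumes "i \<le> r"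
  shows "card {\<sigma>. \<sigma> permutes {..<r + 1} \<and> \<sigma> r = i} = fact r"
proof -
  let ?t = "transpose r i"
  have t: "?t permutes {..<r + 1}" using assms by (intro permutes_swap_id) auto
  have "bij_betw ((\<circ>) ?t) {\<sigma>. \<sigma> permutes {..<r + 1} \<and> \<sigma> r = i} {p. p permutes {..<r}}"
  proof (rule bij_betwI[where g = "(\<circ>) ?t"])
    show "(\<circ>) ?t \<in> {\<sigma>. \<sigma> permutes {..<r + 1} \<and> \<sigma> r = i} \<rightarrow> {p. p permutes {..<r}}"
    proof
      fix \<sigma> assume "\<sigma> \<in> {\<sigma>. \<sigma> permutes {..<r + 1} \<and> \<sigma> r = i}"
      then have s: "\<sigma> permutes {..<r + 1}" "\<sigma> r = i" by auto
      have "?t \<circ> \<sigma> permutes {..<r + 1}" by (rule permutes_compose[OF s(1) t])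
      then have "?t \<circ> \<sigma> permutes {..<r}"
        by (rule permutes_superset) (use s in \<open>auto simp: less_Suc_eq\<close>)
      then show "?t \<circ> \<sigma> \<in> {p. p permutes {..<r}}" by simp
    qed
    show "(\<circ>) ?t \<in> {p. p permutes {..<r}} \<rightarrow> {\<sigma>. \<sigma> permutes {..<r + 1} \<and> \<sigma> r = i}"
    proof safe
      fix p assume p: "p permutes {..<r}"
      then show "?t \<circ> p permutes {..<r + 1}" by (rule permutes_compose[OF permutes_Suc t])
      show "(?t \<circ> p) r = i" using permutes_not_in[OF p, of r] by simp
    qed
  qed (auto simp: fun_eq_iff)
  from bij_betw_same_card[OF this] show ?thesis by (simp add: card_perms)
qed

text \<open>Let \<open>A'\<close> be \<open>vand (r + 1)\<close> times \<open>H'\<close>. Its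
  exponents are nonnegative; \<open>pos\<close> forces a zero entry and antisymmetry excludes two,
  so \<open>A'\<close> is recovered by antisymmetrizing its part \<open>G\<close> with last entry 0.
  By \<open>restr\<close> that part depends on \<open>H\<close> alone.\<close>

theorem stable_series:
  fixes H H' :: "expo \<Rightarrow> int"
  assumes supp: "\<And>d. H d \<noteq> 0 \<Longrightarrow> gdeg r n d" and supp': "\<And>d. H' d \<noteq> 0 \<Longrightarrow> gdeg (r + 1) n d"
    and sym: "\<And>p d. p permutes {..<r} \<Longrightarrow> H (pe p d) = H d"
    and sym': "\<And>p d. p permutes {..<r + 1} \<Longrightarrow> H' (pe p d) = H' d"
    and K: "lk K = conv (Pr r n) H"
    and restr: "\<And>d. ky (fst d) \<subseteq> {..<r} \<Longrightarrow> H' d = H d"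
    and pos: "\<And>d. (\<And>i. i < r + 1 \<Longrightarrow> 0 < lk (fst d) i) \<Longrightarrow> conv (vand (r + 1)) H' d = 0"
  shows "conv (Pr (r + 1) n) H' = lk (rho r n K)"
proof -
  let ?V = "vand (r + 1)" and ?Q = "\<Sum>k\<le>n. (- 1) ^ k * elem_sym_t n k * upow r (int k)"
  define A' where "A' = conv ?V H'"
  define G where "G = conv (Uprod r * vand r) H"
  have Ksym: "K \<in> sym_utring r n"
  proof -
    have "gdeg r n d" if "d \<in> ky K" for d
      using that conv_gdeg[OF Pr_utring supp, where d = d] by (simp add: in_keys_iff K)
    moreover have "pact p K = K" if p: "p permutes {..<r}" for p
    proof (rule poly_mapping_eqI)
      fix d
      have "H \<circ> pe p = H" using sym[OF p] by auto
      then show "lk (pact p K) d = lk K d"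
        using fun_cong[OF conv_pact[OF p, of "Pr r n" H], of d] by (simp add: lookup_pact[OF p] K pact_Pr[OF p])
    qed
    ultimately show ?thesis by (simp add: sym_utring_iff utring_iff)
  qed
  have HH: "H' d = H d" if "lk (fst d) r = 0" for d
  proof (cases "ky (fst d) \<subseteq> {..<r}")
    case False
    then have "H d = 0" using supp[of d] by (auto simp: gdeg_def nnexp_def)
    moreover have "\<not> ky (fst d) \<subseteq> {..<r + 1}"
    proof -
      obtain i where i: "i \<in> ky (fst d)" "\<not> i < r" using False by auto
      then have "i \<noteq> r" using that by (auto simp: in_keys_iff)
      then show ?thesis using i by (auto simp: subset_iff)
    qed
    then have "H' d = 0" using supp'[of d] by (auto simp: gdeg_def nnexp_def)
    ultimately show ?thesis by simp
  qed (rule restr)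
  have Ud: "conv (Uprod r) F d = F (d - (\<Sum>i<r. sg i 1, 0))" for F :: "expo \<Rightarrow> int" and d
    by (simp add: Uprod_single conv_single)
  have G: "G d = (if lk (fst d) r = 0 then A' d else 0)" for d
  proof (cases "lk (fst d) r = 0")
    case False
    have "G d = 0"
    proof (rule ccontr)
      assume "G d \<noteq> 0"
      then have "gdeg r n d" unfolding G_def
        by (rule conv_gdeg[OF utring_mult[OF Uprod_utring vand_utring] supp, rotated])
      then show False using False by (auto simp: gdeg_def nnexp_def in_keys_iff subset_iff)
    qed
    then show ?thesis using False by simp
  next
    case True
    have "A' d = (\<Sum>p | p permutes {..<r + 1}. sign p * H' (d - pe p (dlt (r + 1))))"
      by (simp add: A'_def conv_alternant del: pe_pair)
    \<comment> \<open>A permutation moving \<open>r\<close> puts a positive entry of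
      \<open>\<delta>\<close> into the last slot; subtracted from 0 it gives a negative exponent,
      where \<open>H'\<close> vanishes.\<close>
    also have "\<dots> = (\<Sum>p | p permutes {..<r}. sign p * H' (d - pe p (dlt (r + 1))))"
    proof (rule sum.mono_neutral_right)
      show "\<forall>p\<in>{p. p permutes {..<r + 1}} - {p. p permutes {..<r}}. sign p * H' (d - pe p (dlt (r + 1))) = 0"
      proof
        fix p assume p: "p \<in> {p. p permutes {..<r + 1}} - {p. p permutes {..<r}}"
        then have p1: "p permutes {..<r + 1}" by simp
        have "p r \<noteq> r"
        proof
          assume "p r = r"
          then have "p permutes {..<r}" by (intro permutes_superset[OF p1]) (auto simp: less_Suc_eq)
          then show False using p by simp
        qed
        moreover have "p r < r + 1" using permutes_in_image[OF p1, of r] by simp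
        ultimately have "lk (fst (d - pe p (dlt (r + 1)))) r < 0"
          using True by (simp add: lookup_minus lookup_map_key_inj[OF permutes_inj[OF p1]] lookup_ev_dl)
        then have "H' (d - pe p (dlt (r + 1))) = 0"
          using supp'[of "d - pe p (dlt (r + 1))"] by (auto simp: gdeg_def nnexp_def not_le[symmetric] simp del: pe_pair)
        then show "sign p * H' (d - pe p (dlt (r + 1))) = 0" by simp
      qed
    qed (auto simp: finite_permutations permutes_Suc[simplified])
    also have "\<dots> = (\<Sum>p | p permutes {..<r}. sign p * H (d - (\<Sum>i<r. sg i 1, 0) - pe p (dlt r)))"
    proof (rule sum.cong[OF refl])
      fix p assume "p \<in> {p. p permutes {..<r}}"
      then have p: "p permutes {..<r}" by simp
      have pi: "p i < r \<longleftrightarrow> i < r" "p i < Suc r \<longleftrightarrow> i < Suc r" for i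
        using permutes_in_image[OF p, of i] permutes_in_image[OF permutes_Suc[OF p], of i] by auto
      have pr: "i \<ge> r \<Longrightarrow> p i = i" for i using permutes_not_in[OF p, of i] by simp
      \<comment> \<open>On the first \<open>r\<close> slots the longer staircase is the shorter one
        raised by 1; this is where \<open>Uprod r\<close> comes from.\<close>
      have "pe p (dlt (r + 1)) = (\<Sum>i<r. sg i 1, 0) + pe p (dlt r)"
        by (auto intro!: poly_mapping_eqI simp: lookup_add lookup_map_key_inj[OF permutes_inj[OF p]] lookup_ev_dl lookup_sum_sg pi pr not_less)
      then have eq: "d - pe p (dlt (r + 1)) = d - (\<Sum>i<r. sg i 1, 0) - pe p (dlt r)" by (simp add: diff_diff_eq)
      have "lk (fst (d - pe p (dlt (r + 1)))) r = 0"
        using True by (simp add: lookup_minus lookup_map_key_inj[OF permutes_inj[OF p]] lookup_ev_dl pr)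
      then show "sign p * H' (d - pe p (dlt (r + 1))) = sign p * H (d - (\<Sum>i<r. sg i 1, 0) - pe p (dlt r))"
        using HH eq by metis
    qed
    also have "\<dots> = G d" by (simp add: G_def conv_mult Ud conv_alternant del: pe_pair)
    finally show ?thesis using True by simp
  qed
  have A'_anti: "A' (pe q d) = sign q * A' d" if "q permutes {..<r + 1}" for q d
    using conv_antisym[of "r + 1" H', OF sym' that] by (simp add: A'_def)
  have A'_Alt: "fact r * A' d = AltF (r + 1) G d" for d
  proof (cases "A' d = 0")
    case True
    have "G (pe p d) = 0" if "p permutes {..<r + 1}" for p using A'_anti[OF that, of d] True by (simp add: G)
    then show ?thesis using True by (simp add: AltF_def)
  next
    case False
    have "gdeg (r + 1) n d" using False unfolding A'_def by (rule conv_gdeg[OF vand_utring supp', rotated])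
    then have nn: "lk (fst d) i \<ge> 0" for i by (simp add: gdeg_def nnexp_def)
    obtain i where i: "i < r + 1" "lk (fst d) i = 0"
      using pos[of d] False nn by (metis A'_def order_le_less)
    have uniq: "j = i" if "j < r + 1" "lk (fst d) j = 0" for j
    proof (rule ccontr)
      assume "j \<noteq> i"
      let ?t = "transpose i j"
      have t: "?t permutes {..<r + 1}" using i that by (intro permutes_swap_id) auto
      have "pe ?t d = d"
        using i that by (cases d) (auto intro!: poly_mapping_eqI simp: lookup_map_key_inj permutes_inj[OF t] transpose_def)
      then have "A' d = - A' d" using A'_anti[OF t, of d] \<open>j \<noteq> i\<close> by (simp add: sign_swap_id)
      then show False using False by simp
    qed
    \<comment> \<open>Since \<open>i\<close> is the only zero entry of \<open>d\<close>, the last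
      entry of the rearranged exponent is 0 exactly for the \<open>r!\<close> permutations with
      \<open>p r = i\<close>; for these the sign of the sum cancels the sign from
      antisymmetry.\<close>
    have "AltF (r + 1) G d = (\<Sum>p | p permutes {..<r + 1}. if p r = i then A' d else 0)"
      unfolding AltF_def
    proof (rule sum.cong[OF refl])
      fix p assume "p \<in> {p. p permutes {..<r + 1}}"
      then have p: "p permutes {..<r + 1}" by simp
      have "p r < r + 1" using permutes_in_image[OF p, of r] by simp
      moreover have "lk (fst (pe p d)) r = lk (fst d) (p r)"
        by (cases d) (simp add: lookup_map_key_inj permutes_inj[OF p])
      ultimately have "lk (fst (pe p d)) r = 0 \<longleftrightarrow> p r = i" using uniq[of "p r"] i(2) by metis
      then show "sign p * G (pe p d) = (if p r = i then A' d else 0)"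
        using sign_mult_self[of p, where 'a = int] by (simp add: G A'_anti[OF p] mult.assoc[symmetric])
    qed
    also have "\<dots> = A' d * int (card {p. p permutes {..<r + 1} \<and> p r = i})"
      by (simp add: sum.If_cases finite_permutations Int_def)
    finally show ?thesis using card_perms_fixing_value[of i r] i by (simp add: mult.commute)
  qed
  \<comment> \<open>The larger denominator contains \<open>Pr r n\<close>, which turns
    \<open>H\<close> into \<open>K\<close>; the remaining factor is the one in
    \<open>rho_formula\<close>.\<close>
  have PG: "conv (Pr (r + 1) n) G = lk (?Q * Uprod r * (K * vand r))"
  proof -
    have "conv (Pr (r + 1) n) G = conv (Pr (r + 1) n * (Uprod r * vand r)) H" by (simp add: G_def conv_mult)
    also have "Pr (r + 1) n * (Uprod r * vand r) = (?Q * Uprod r * vand r) * Pr r n" by (simp only: Pr_Suc mult_ac)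
    also have "conv \<dots> H = conv (?Q * Uprod r * vand r) (lk K)" by (simp only: conv_mult K)
    also have "\<dots> = lk (?Q * Uprod r * (K * vand r))" by (simp add: conv_lookup mult_ac)
    finally show ?thesis .
  qed
  have main: "conv ?V (conv (Pr (r + 1) n) H') d = conv ?V (lk (rho r n K)) d" for d
  proof -
    have "fact r * conv ?V (conv (Pr (r + 1) n) H') d = fact r * conv (Pr (r + 1) n) A' d"
      by (simp add: A'_def mult.commute flip: conv_mult)
    also have "\<dots> = conv (Pr (r + 1) n) (AltF (r + 1) G) d"
      using conv_right_scale[of "Pr (r + 1) n" "fact r" A' d] A'_Alt by (simp add: fun_eq_iff)
    also have "\<dots> = AltF (r + 1) (conv (Pr (r + 1) n) G) d"
      by (simp add: conv_AltF[OF pact_Pr])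
    also have "\<dots> = lk (of_int (fact r) * (rho r n K * ?V)) d"
      by (simp only: PG rho_formula(2)[OF Ksym] lookup_Alt)
    also have "\<dots> = fact r * conv ?V (lk (rho r n K)) d"
      by (simp only: lookup_of_int_mult conv_lookup mult.commute[of "rho r n K"])
    finally show ?thesis by simp
  qed
  show ?thesis
  proof
    fix d
    have "conv (Pr (r + 1) n) H' d - lk (rho r n K) d = 0"
    proof (rule conv_vand_cancel[where m = "r + 1" and H = "\<lambda>d. conv (Pr (r + 1) n) H' d - lk (rho r n K) d"])
      fix d assume nz: "conv (Pr (r + 1) n) H' d - lk (rho r n K) d \<noteq> 0"
      show "nnexp (r + 1) d"
      proof (cases "conv (Pr (r + 1) n) H' d = 0")
        case True
        then have "d \<in> ky (rho r n K)" using nz by (simp add: in_keys_iff)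
        then show ?thesis using rho_formula(1)[OF Ksym] by (auto simp: sym_utring_iff utring_iff gdeg_def)
      next
        case False
        then have "gdeg (r + 1) n d" by (rule conv_gdeg[OF Pr_utring supp', rotated])
        then show ?thesis by (simp add: gdeg_def)
      qed
    qed (simp only: conv_right_diff main diff_self)
    then show "conv (Pr (r + 1) n) H' d = lk (rho r n K) d" by simp
  qed
qed

section \<open>Evaluation homomorphisms and derivations\<close>

definition mon_eval :: "('x \<Rightarrow> 'a::comm_ring_1) \<Rightarrow> ('x \<Rightarrow>\<^sub>0 nat) \<Rightarrow> 'a" where
  "mon_eval \<sigma> m = (\<Prod>x\<in>ky m. \<sigma> x ^ lk m x)"

lemma mon_eval_superset: "finite S \<Longrightarrow> ky m \<subseteq> S \<Longrightarrow> mon_eval \<sigma> m = (\<Prod>x\<in>S. \<sigma> x ^ lk m x)"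
  unfolding mon_eval_def by (rule prod.mono_neutral_left) (auto simp: in_keys_iff)

lemma mon_eval_add: "mon_eval \<sigma> (m + m') = mon_eval \<sigma> m * mon_eval \<sigma> m'"
  using Poly_Mapping.keys_add[of m m']
  by (simp add: mon_eval_superset[of "ky m \<union> ky m'"] lookup_add power_add prod.distrib)

lemma mon_eval_single [simp]: "mon_eval \<sigma> (sg x k) = \<sigma> x ^ k"
  by (simp add: mon_eval_def)

lemma mon_eval_0 [simp]: "mon_eval \<sigma> 0 = 1"
  by (simp add: mon_eval_def)

definition chom :: "('k::comm_ring_1 \<Rightarrow> 'a::comm_ring_1) \<Rightarrow> bool" where
  "chom c \<longleftrightarrow> c 0 = 0 \<and> c 1 = 1 \<and> (\<forall>x y. c (x + y) = c x + c y) \<and> (\<forall>x y. c (x * y) = c x * c y)"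

text \<open>The coefficient map is a parameter: \<open>xconst\<close> gives substitutions, and
  constant polynomials \<open>[:xconst a:]\<close> give families with a formal parameter, from which
  derivatives and limits are read off.\<close>

definition peval :: "('k::comm_ring_1 \<Rightarrow> 'a::comm_ring_1) \<Rightarrow> (nat \<times> nat \<Rightarrow> 'a) \<Rightarrow> 'k xpoly \<Rightarrow> 'a" where
  "peval c \<sigma> f = (\<Sum>m\<in>ky f. c (lk f m) * mon_eval \<sigma> m)"

lemma xsubst_peval: "xsubst \<sigma> = peval xconst \<sigma>"
  by (simp add: xsubst_def peval_def mon_eval_def fun_eq_iff)

context
  fixes c :: "'k::comm_ring_1 \<Rightarrow> 'a::comm_ring_1"
  assumes c: "chom c"
begin

lemma peval_add: "peval c \<sigma> (f + g) = peval c \<sigma> f + peval c \<sigma> g"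
  unfolding peval_def using c
  by (intro sum_keys_add[where h = "\<lambda>m a. c a * mon_eval \<sigma> m"]) (auto simp: chom_def algebra_simps)

lemma peval_single: "peval c \<sigma> (sg m a) = c a * mon_eval \<sigma> m"
  unfolding peval_def using c by (intro sum_keys_single[where h = "\<lambda>m a. c a * mon_eval \<sigma> m"]) (auto simp: chom_def)

lemma peval_0 [simp]: "peval c \<sigma> 0 = 0"
  by (simp add: peval_def)

lemma peval_sum: "peval c \<sigma> (\<Sum>x\<in>S. f x) = (\<Sum>x\<in>S. peval c \<sigma> (f x))"
  by (induction S rule: infinite_finite_induct) (auto simp: peval_add)

lemma peval_mult: "peval c \<sigma> (f * g) = peval c \<sigma> f * peval c \<sigma> g"
proof (induction f rule: poly_mapping_single_induct)
  case (single m a)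
  show ?case
  proof (induction g rule: poly_mapping_single_induct)
    case (single m' a')
    show ?case using c by (simp add: mult_single peval_single mon_eval_add chom_def mult_ac)
  qed (auto simp: distrib_left peval_add)
qed (auto simp: distrib_right peval_add)

lemma peval_const: "peval c \<sigma> (xconst a) = c a"
  by (simp add: xconst_def peval_single)

lemma peval_var: "peval c \<sigma> (xvar i j) = \<sigma> (i, j)"
  using c by (simp add: xvar_def peval_single chom_def)

end

lemma xconst_hom: "chom xconst"
  by (auto simp: chom_def xconst_def single_add mult_single)

lemma xconst_simps [simp]: "xconst 0 = 0" "xconst 1 = 1"
  and xconst_add: "xconst (a + b) = xconst a + xconst b"
  and xconst_mult: "xconst (a * b) = xconst a * xconst b"
  using xconst_hom by (auto simp: chom_def)

lemma xconst_minus: "xconst (- a) = - xconst a"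
  by (simp add: xconst_def single_uminus)

lemma xconst_diff: "xconst (a - b) = xconst a - xconst b"
  by (simp add: xconst_def single_diff)

lemma xconst_sum: "xconst (\<Sum>x\<in>S. f x) = (\<Sum>x\<in>S. xconst (f x))"
  by (induction S rule: infinite_finite_induct) (auto simp: xconst_add)

lemma lookup_xconst_mult: "lk (xconst a * f) m = a * lk f m"
proof (induction f rule: poly_mapping_single_induct)
  case (single e c)
  then show ?case by (simp add: xconst_def mult_single lookup_single when_def)
qed (auto simp: lookup_add distrib_left)

lemma xconst_of_nat: "xconst (of_nat k) = of_nat k"
  by (induction k) (auto simp: xconst_add)

lemma xconst_of_int: "xconst (of_int k) = of_int k"
  by (cases k) (auto simp: xconst_minus xconst_of_nat xconst_add xconst_diff)

lemma xvar_times_single: "xvar i j * sg m a = sg (sg (i, j) 1 + m) a"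
  by (simp add: xvar_def mult_single)

section \<open>Polynomials in the variables of \<open>m\<close> rows and \<open>n\<close>
  columns\<close>

definition cin :: "nat \<Rightarrow> nat \<Rightarrow> 'k::comm_ring_1 xpoly \<Rightarrow> bool" where
  "cin m n f \<longleftrightarrow> ky f \<subseteq> monoms m n"

lemma cin_carrier: "f \<in> carrier (coord_ring m n) \<longleftrightarrow> cin m n f"
  by (simp add: coord_ring_def cin_def)

lemma monoms_add: "a \<in> monoms m n \<Longrightarrow> b \<in> monoms m n \<Longrightarrow> a + b \<in> monoms m n"
  using Poly_Mapping.keys_add[of a b] by (auto simp: monoms_def)

lemma cin_add: "cin m n f \<Longrightarrow> cin m n g \<Longrightarrow> cin m n (f + g)"
  using Poly_Mapping.keys_add[of f g] by (auto simp: cin_def)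

lemma cin_mult: "cin m n f \<Longrightarrow> cin m n g \<Longrightarrow> cin m n (f * g)"
  unfolding cin_def using Poly_Mapping.keys_mult[of f g] by (blast intro: monoms_add)

lemma cin_const [simp]: "cin m n (xconst a)"
  by (auto simp: cin_def xconst_def monoms_def)

lemma cin_0 [simp]: "cin m n 0" and cin_1 [simp]: "cin m n 1"
  using cin_const[of m n 0] cin_const[of m n 1] by simp_all

lemma cin_uminus: "cin m n f \<Longrightarrow> cin m n (- f)"
  using cin_mult[OF cin_const[of m n "-1"], of f] by (simp add: xconst_minus)

lemma cin_var: "i < m \<Longrightarrow> j < n \<Longrightarrow> cin m n (xvar i j)"
  by (auto simp: cin_def xvar_def monoms_def)

lemma cin_sum: "(\<And>x. x \<in> S \<Longrightarrow> cin m n (f x)) \<Longrightarrow> cin m n (\<Sum>x\<in>S. f x)"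
  by (induction S rule: infinite_finite_induct) (auto intro: cin_add)

lemma cin_prod: "(\<And>x. x \<in> S \<Longrightarrow> cin m n (f x)) \<Longrightarrow> cin m n (\<Prod>x\<in>S. f x)"
  by (induction S rule: infinite_finite_induct) (auto intro: cin_mult)

lemma cin_single: "mm \<in> monoms m n \<Longrightarrow> cin m n (sg mm a)"
  by (auto simp: cin_def)

lemma monom_induct [consumes 1, case_names zero add]:
  assumes "mm \<in> monoms m n" "P 0" "\<And>i j mm. i < m \<Longrightarrow> j < n \<Longrightarrow> mm \<in> monoms m n \<Longrightarrow> P mm \<Longrightarrow> P (sg (i, j) 1 + mm)"
  shows "P mm"
  using assms(1)
proof (induction "\<Sum>x\<in>ky mm. lk mm x" arbitrary: mm)
  case 0
  have "lk mm x = 0" for x using 0 by (cases x; cases "x \<in> ky mm") (auto simp: in_keys_iff)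
  then have "mm = 0" by (intro poly_mapping_eqI) simp
  then show ?case using assms(2) by simp
next
  case (Suc k)
  have "ky mm \<noteq> {}" using Suc(2) by (metis nat.distinct(1) sum.empty)
  then obtain x where x: "x \<in> ky mm" by blast
  obtain i j where ij: "x = (i, j)" by (cases x)
  define mm' where "mm' = mm - sg x 1"
  have eq: "mm = sg (i, j) 1 + mm'"
    using x by (intro poly_mapping_eqI) (auto simp: mm'_def ij lookup_add lookup_minus lookup_single when_def in_keys_iff)
  have k': "ky mm' \<subseteq> ky mm" by (auto simp: in_keys_iff mm'_def lookup_minus)
  have "(\<Sum>y\<in>ky mm'. lk mm' y) = (\<Sum>y\<in>ky mm. lk mm' y)"
    by (rule sum.mono_neutral_left) (use k' in \<open>auto simp: in_keys_iff\<close>)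
  moreover have "(\<Sum>y\<in>ky mm. lk mm y) = Suc (\<Sum>y\<in>ky mm. lk mm' y)"
    using x by (simp add: eq lookup_add sum.distrib lookup_single when_def ij)
  ultimately have "P mm'" using Suc k' by (intro Suc(1)) (auto simp: monoms_def)
  moreover have "i < m" "j < n" using x Suc(3) by (auto simp: monoms_def ij)
  ultimately show ?case using Suc(3) k' assms(3)[of i j mm'] unfolding eq[symmetric] by (auto simp: monoms_def)
qed

lemma cin_induct [consumes 1, case_names const var add]:
  assumes "cin m n f" "\<And>a. P (xconst a)"
    "\<And>i j g. i < m \<Longrightarrow> j < n \<Longrightarrow> cin m n g \<Longrightarrow> P g \<Longrightarrow> P (xvar i j * g)"
    "\<And>f g. cin m n f \<Longrightarrow> cin m n g \<Longrightarrow> P f \<Longrightarrow> P g \<Longrightarrow> P (f + g)"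
  shows "P f"
proof -
  have single: "P (sg mm a)" if "mm \<in> monoms m n" for mm a
    using that
  proof (induction mm rule: monom_induct)
    case zero then show ?case using assms(2)[of a] by (simp add: xconst_def)
  next
    case (add i j mm)
    then show ?case using assms(3)[of i j "sg mm a"] by (simp add: xvar_times_single cin_single)
  qed
  have "finite S \<Longrightarrow> S \<subseteq> monoms m n \<Longrightarrow> P (\<Sum>e\<in>S. sg e (lk f e))" for S
  proof (induction S rule: finite_induct)
    case empty then show ?case using assms(2)[of 0] by simp
  next
    case (insert x F)
    then have "cin m n (sg x (lk f x))" "cin m n (\<Sum>e\<in>F. sg e (lk f e))" by (auto intro!: cin_single cin_sum)
    from assms(4)[OF this] show ?case using insert single by simp
  qed
  from this[of "ky f"] show ?thesis using assms(1) by (simp flip: poly_mapping_sum_single add: cin_def)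
qed

lemma ex_cin: "\<exists>m n. cin m n f"
proof -
  let ?S = "\<Union>mm\<in>ky f. ky mm"
  have "finite ?S" by simp
  then obtain N where N: "\<And>x. x \<in> fst ` ?S \<union> snd ` ?S \<Longrightarrow> x < N"
    by (metis finite_Un finite_imageI finite_nat_set_iff_bounded)
  have "cin N N f" unfolding cin_def monoms_def
  proof safe
    fix mm a b assume "mm \<in> ky f" "(a, b) \<in> ky mm"
    then have "(a, b) \<in> ?S" by blast
    then have "fst (a, b) \<in> fst ` ?S" "snd (a, b) \<in> snd ` ?S" by (rule imageI)+
    then show "a < N" "b < N" using N by auto
  qed
  then show ?thesis by blast
qed

lemma xpoly_induct [case_names const var add]:
  assumes "\<And>a. P (xconst a)" "\<And>i j g. P g \<Longrightarrow> P (xvar i j * g)" "\<And>f g. P f \<Longrightarrow> P g \<Longrightarrow> P (f + g)"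
  shows "P f"
proof -
  obtain m n where "cin m n f" using ex_cin by blast
  then show ?thesis by (induction rule: cin_induct) (use assms in auto)
qed

lemma hom_unique:
  assumes "\<And>f g. A (f + g) = A f + A g" "\<And>f g. A (f * g) = A f * A g"
    "\<And>f g. B (f + g) = B f + B g" "\<And>f g. B (f * g) = B f * B g"
    "\<And>a. A (xconst a) = B (xconst a)" "\<And>i j. i < m \<Longrightarrow> j < n \<Longrightarrow> A (xvar i j) = B (xvar i j)" "cin m n f"
  shows "A f = (B f :: 'a::comm_ring_1)"
  using assms(7) by (induction rule: cin_induct) (use assms(1-6) in auto)

lemma cin_peval:
  assumes "\<And>i j. i < m \<Longrightarrow> j < n \<Longrightarrow> cin m' n' (\<sigma> (i, j))" "cin m n f"
  shows "cin m' n' (peval xconst \<sigma> f)"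
  using assms(2)
  by (induction rule: cin_induct)
     (use assms(1) in \<open>auto simp: peval_const peval_add peval_mult peval_var xconst_hom intro: cin_add cin_mult\<close>)

section \<open>Derivations and the polarization operators\<close>

definition derivation :: "('k::comm_ring_1 xpoly \<Rightarrow> 'k xpoly) \<Rightarrow> bool" where
  "derivation D \<longleftrightarrow> (\<forall>f g. D (f + g) = D f + D g) \<and> (\<forall>f g. D (f * g) = D f * g + f * D g) \<and> (\<forall>a. D (xconst a) = 0)"

lemma derivation_unique:
  assumes "derivation D" "derivation D'" "\<And>i j. D (xvar i j) = D' (xvar i j)"
  shows "D f = D' f"
  by (induction f rule: xpoly_induct) (use assms in \<open>auto simp: derivation_def\<close>)

lemma derivation_add: "derivation D \<Longrightarrow> D (f + g) = D f + D g"
  and derivation_mult: "derivation D \<Longrightarrow> D (f * g) = D f * g + f * D g"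
  and derivation_const: "derivation D \<Longrightarrow> D (xconst a) = 0"
  by (auto simp: derivation_def)

lemma derivation_0: "derivation D \<Longrightarrow> D 0 = 0"
  using derivation_const[of D 0] by simp

lemma derivation_scale: "derivation D \<Longrightarrow> D (xconst a * f) = xconst a * D f"
  by (simp add: derivation_def)

lemma derivation_minus: "derivation D \<Longrightarrow> D (- f) = - D f"
  using derivation_scale[of D "-1" f] by (simp add: xconst_minus)

lemma derivation_sum: "derivation D \<Longrightarrow> D (\<Sum>x\<in>S. f x) = (\<Sum>x\<in>S. D (f x))"
  by (induction S rule: infinite_finite_induct) (auto simp: derivation_0 derivation_add)

lemma derivation_commutator:
  assumes "derivation D" "derivation D'"
  shows "derivation (\<lambda>f. D (D' f) - D' (D f))"
  using assms derivation_0[OF assms(1)] derivation_0[OF assms(2)] by (simp add: derivation_def algebra_simps)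

lemma derivation_smult: "derivation D \<Longrightarrow> derivation (\<lambda>f. h * D f)"
  by (simp add: derivation_def algebra_simps)

lemma derivation_plus: "derivation D \<Longrightarrow> derivation D' \<Longrightarrow> derivation (\<lambda>f. D f + D' f)"
  by (simp add: derivation_def algebra_simps)

lemma derivation_zero: "derivation (\<lambda>f. 0)"
  by (simp add: derivation_def)

lemma derivation_Sum: "(\<And>x. x \<in> S \<Longrightarrow> derivation (D x)) \<Longrightarrow> derivation (\<lambda>f. \<Sum>x\<in>S. D x f)"
  by (induction S rule: infinite_finite_induct) (auto simp: derivation_zero derivation_plus)

text \<open>The perturbation of each variable by a formal parameter times its value under
  \<open>\<tau>\<close>. It is a ring homomorphism with constant term the identity, so its linear
  coefficient is the derivation with prescribed values \<open>\<tau>\<close>.\<close>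

definition pev1 :: "(nat \<times> nat \<Rightarrow> 'k::comm_ring_1 xpoly) \<Rightarrow> 'k xpoly \<Rightarrow> 'k xpoly poly" where
  "pev1 \<tau> = peval (\<lambda>a. [:xconst a:]) (\<lambda>(i, j). [:xvar i j, \<tau> (i, j):])"

lemma pconst_hom: "chom (\<lambda>a. [:xconst a:])"
  by (auto simp: chom_def xconst_add xconst_mult one_pCons)

definition Dv :: "(nat \<times> nat \<Rightarrow> 'k::comm_ring_1 xpoly) \<Rightarrow> 'k xpoly \<Rightarrow> 'k xpoly" where
  "Dv \<tau> f = coeff (pev1 \<tau> f) 1"

lemma coeff0_pev1: "coeff (pev1 \<tau> f) 0 = f"
  by (induction f rule: xpoly_induct)
     (auto simp: pev1_def peval_const peval_add peval_mult peval_var pconst_hom coeff_mult_0)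

lemma coeff_mult_1: "coeff (p * q) 1 = coeff p 1 * coeff q 0 + coeff p 0 * coeff q 1"
  by (simp add: coeff_mult add.commute)

lemma Dv_derivation: "derivation (Dv \<tau>)"
  unfolding derivation_def Dv_def
proof (intro conjI allI)
  fix f g
  show "coeff (pev1 \<tau> (f * g)) 1 = coeff (pev1 \<tau> f) 1 * g + f * coeff (pev1 \<tau> g) 1"
    by (simp only: pev1_def peval_mult[OF pconst_hom]) (simp only: coeff_mult_1 coeff0_pev1 flip: pev1_def)
qed (simp_all add: pev1_def peval_add peval_const pconst_hom)

lemma Dv_var: "Dv \<tau> (xvar i j) = \<tau> (i, j)"
  by (simp add: Dv_def pev1_def peval_var pconst_hom)

text \<open>The polarization operator \<open>\<Sum>l. x_il d/dx_jl\<close>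
  (\<open>Eop_eq_pd\<close>): the matrix unit \<open>E_ij\<close> of gl acting on polynomials. It is
  defined by its values on variables, so identities need only be checked there.\<close>

definition Eop :: "nat \<Rightarrow> nat \<Rightarrow> nat \<Rightarrow> 'k::comm_ring_1 xpoly \<Rightarrow> 'k xpoly" where
  "Eop n i j = Dv (\<lambda>(a, l). if a = j \<and> l < n then xvar i l else 0)"

definition pd :: "nat \<Rightarrow> nat \<Rightarrow> 'k::comm_ring_1 xpoly \<Rightarrow> 'k xpoly" where
  "pd i j = Dv (\<lambda>x. if x = (i, j) then 1 else 0)"

lemma Eop_derivation: "derivation (Eop n i j)" and pd_derivation: "derivation (pd i j)"
  by (simp_all add: Eop_def pd_def Dv_derivation)

lemma Eop_var: "Eop n i j (xvar a l) = (if a = j \<and> l < n then xvar i l else 0)"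
  and pd_var: "pd i j (xvar a l) = (if a = i \<and> l = j then 1 else 0)"
  by (auto simp: Eop_def pd_def Dv_var)

lemma pd_0 [simp]: "pd i j 0 = 0" and pd_1 [simp]: "pd i j 1 = 0"
  using derivation_const[OF pd_derivation, of i j 0] derivation_const[OF pd_derivation, of i j 1] by simp_all

lemma pd_commute: "pd i j (pd a b f) = pd a b (pd i j f)"
proof -
  have "pd i j (pd a b f) - pd a b (pd i j f) = (\<lambda>f. 0) f"
    by (rule derivation_unique[OF derivation_commutator[OF pd_derivation pd_derivation] derivation_zero])
       (auto simp: pd_var)
  then show ?thesis by simp
qed

lemma Eop_eq_pd: "Eop n i j f = (\<Sum>l<n. xvar i l * pd j l f)"
proof (rule derivation_unique[OF Eop_derivation])
  show "derivation (\<lambda>f. \<Sum>l<n. xvar i l * pd j l f)"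
    by (intro derivation_Sum derivation_smult pd_derivation)
  show "Eop n i j (xvar a b) = (\<Sum>l<n. xvar i l * pd j l (xvar a b))" for a b
  proof -
    have "(\<Sum>l<n. xvar i l * pd j l (xvar a b)) = (\<Sum>l<n. if b = l then (if a = j then xvar i b else 0) else 0)"
      by (rule sum.cong) (auto simp: pd_var)
    also have "\<dots> = (if a = j \<and> b < n then xvar i b else 0)" by simp
    finally show ?thesis unfolding Eop_var by (rule sym)
  qed
qed

text \<open>Both sides are derivations and agree on variables; these are the relations of matrix
  units.\<close>

lemma Eop_commutator:
  "Eop n i j (Eop n k l f) - Eop n k l (Eop n i j f) = (if j = k then Eop n i l f else 0) - (if l = i then Eop n k j f else 0)"
proof -
  have "derivation (\<lambda>f. (if j = k then Eop n i l f else 0) - (if l = i then Eop n k j f else 0))"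
    using derivation_plus[OF Eop_derivation derivation_smult[OF Eop_derivation, of "-1"]]
      derivation_smult[OF Eop_derivation, of "-1"] Eop_derivation derivation_zero
    by (cases "j = k"; cases "l = i") simp_all
  then show ?thesis
    by (rule derivation_unique[OF derivation_commutator[OF Eop_derivation Eop_derivation]])
       (auto simp: Eop_var derivation_0[OF Eop_derivation])
qed

lemma Eop_xvar_mult: "l < n \<Longrightarrow> Eop n a b (xvar i l * g) = (if i = b then xvar a l * g else 0) + xvar i l * Eop n a b g"
  by (simp add: derivation_mult[OF Eop_derivation] Eop_var)

lemma Eop_cin: "cin m n f \<Longrightarrow> i < m \<Longrightarrow> cin m n (Eop n i j f)"
  by (induction rule: cin_induct)
     (auto simp: derivation_const[OF Eop_derivation] derivation_add[OF Eop_derivation] Eop_xvar_mult intro!: cin_add cin_mult cin_var)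

lemma pd_cin: "cin m n f \<Longrightarrow> cin m n (pd i j f)"
  by (induction rule: cin_induct)
     (auto simp: derivation_const[OF pd_derivation] derivation_add[OF pd_derivation] derivation_mult[OF pd_derivation]
        pd_var intro!: cin_add cin_mult cin_var)

section \<open>The bigrading\<close>

definition mdeg :: "xmonom \<Rightarrow> expo" where
  "mdeg m = (\<Sum>x\<in>ky m. (sg (fst x) (int (lk m x)), sg (snd x) (int (lk m x))))"

lemma mdeg_add: "mdeg (m + m') = mdeg m + mdeg m'"
  unfolding mdeg_def
  by (rule sum_keys_add[where h = "\<lambda>x c. (sg (fst x) (int c), sg (snd x) (int c))"]) (auto simp: zero_prod_def single_add)

lemma mdeg_0 [simp]: "mdeg 0 = 0" by (simp add: mdeg_def)

lemma mdeg_single [simp]: "mdeg (sg x k) = (sg (fst x) (int k), sg (snd x) (int k))"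
  by (cases "k = 0") (auto simp: mdeg_def zero_prod_def)

lemma mdeg_gdeg: "mm \<in> monoms m n \<Longrightarrow> gdeg m n (mdeg mm)"
proof (induction rule: monom_induct)
  case (add i j mm)
  then have "gdeg m n (sg i 1, sg j 1)"
    by (auto simp: gdeg_def nnexp_def lookup_single when_def)
  then show ?case using add by (simp only: mdeg_add mdeg_single fst_conv snd_conv gdeg_add of_nat_1)
qed simp

definition shift :: "nat \<Rightarrow> nat \<Rightarrow> expo" where
  "shift i j = (sg i 1 - sg j 1, 0)"

definition hg :: "expo \<Rightarrow> 'k::comm_ring_1 xpoly \<Rightarrow> bool" where
  "hg d f \<longleftrightarrow> (\<forall>m\<in>ky f. mdeg m = d)"

lemma hg_add: "hg d f \<Longrightarrow> hg d g \<Longrightarrow> hg d (f + g)"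
  using Poly_Mapping.keys_add[of f g] by (auto simp: hg_def)

lemma hg_mult: "hg d f \<Longrightarrow> hg e g \<Longrightarrow> hg (d + e) (f * g)"
  using Poly_Mapping.keys_mult[of f g] by (auto simp: hg_def mdeg_add)

lemma hg_0 [simp]: "hg d 0" by (simp add: hg_def)

lemma hg_const: "hg 0 (xconst a)" by (simp add: hg_def xconst_def)

lemma hg_scale: "hg d f \<Longrightarrow> hg d (xconst a * f)"
  using hg_mult[OF hg_const] by fastforce

lemma hg_var: "hg (sg i 1, sg j 1) (xvar i j)" by (simp add: hg_def xvar_def)

lemma hg_single: "hg (mdeg m) (sg m a)" by (simp add: hg_def)

lemma hg_induct_single:
  assumes "hg d f" "cin m n f" "\<And>mm a. mm \<in> monoms m n \<Longrightarrow> mdeg mm = d \<Longrightarrow> P (sg mm a)" "P 0" "\<And>f g. P f \<Longrightarrow> P g \<Longrightarrow> P (f + g)"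
  shows "P f"
proof -
  have "finite S \<Longrightarrow> S \<subseteq> ky f \<Longrightarrow> P (\<Sum>e\<in>S. sg e (lk f e))" for S
    by (induction S rule: finite_induct) (use assms in \<open>auto simp: hg_def cin_def\<close>)
  from this[of "ky f"] show ?thesis by (simp flip: poly_mapping_sum_single)
qed

lemma Eop_hg:
  assumes "hg d f" "cin m n f"
  shows "hg (d + shift i j) (Eop n i j f)"
  using assms
proof (rule hg_induct_single)
  fix mm and a :: 'a assume mm: "mm \<in> monoms m n" "mdeg mm = d"
  from mm(1) have "hg (mdeg mm + shift i j) (Eop n i j (sg mm a))"
  proof (induction mm rule: monom_induct)
    case zero
    then show ?case using derivation_const[OF Eop_derivation, of n i j a] by (simp add: xconst_def)
  next
    case (add k l mm)
    have *: "(sg i 1, sg l 1) = (sg j 1, sg l 1) + shift i j" by (simp add: shift_def)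
    have "hg (mdeg (sg (j, l) 1 + mm) + shift i j) (xvar i l * sg mm a)"
      using hg_mult[OF hg_var[of i l] hg_single[of mm a]] unfolding * by (simp add: mdeg_add add_ac del: add_Pair)
    moreover have "hg (mdeg (sg (k, l) 1 + mm) + shift i j) (xvar k l * Eop n i j (sg mm a))"
      using hg_mult[OF hg_var[of k l] add(4)] by (simp add: mdeg_add add_ac del: add_Pair)
    ultimately show ?case using add(2) unfolding xvar_times_single[symmetric]
      by (auto simp: Eop_xvar_mult intro: hg_add)
  qed
  then show "hg (d + shift i j) (Eop n i j (sg mm a))" using mm by simp
qed (auto simp: derivation_0[OF Eop_derivation] derivation_add[OF Eop_derivation] intro: hg_add)

text \<open>The diagonal operators are Euler operators counting the variables of a row, so the
  bigrading is the grading by gl-weights.\<close>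

lemma Eop_diag:
  assumes "hg d f" "cin m n f"
  shows "Eop n i i f = xconst (of_int (lk (fst d) i)) * f"
  using assms
proof (rule hg_induct_single)
  fix mm and a :: 'a assume mm: "mm \<in> monoms m n" "mdeg mm = d"
  from mm(1) have "Eop n i i (sg mm a) = xconst (of_int (lk (fst (mdeg mm)) i)) * sg mm a"
  proof (induction mm rule: monom_induct)
    case zero
    then show ?case using derivation_const[OF Eop_derivation, of n i i a] by (simp add: xconst_def)
  next
    case (add k l mm)
    then show ?case unfolding xvar_times_single[symmetric]
      by (simp add: Eop_xvar_mult mdeg_add lookup_add lookup_single when_def xconst_add algebra_simps)
  qed
  then show "Eop n i i (sg mm a) = xconst (of_int (lk (fst d) i)) * sg mm a" using mm by simp
qed (auto simp: derivation_0[OF Eop_derivation] derivation_add[OF Eop_derivation] distrib_left)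

section \<open>The free module in coordinates\<close>

text \<open>An element of \<open>R \<otimes> V\<close> after a choice of basis of \<open>V\<close>.
  In \<open>FM\<close>, \<open>q\<close> is the dimension of \<open>V\<close> and entries from
  \<open>q\<close> on vanish.\<close>

type_synonym 'k fvec = "nat \<Rightarrow> 'k xpoly"

definition scl :: "'k::comm_ring_1 \<Rightarrow> 'k fvec \<Rightarrow> 'k fvec" where
  "scl c p = (\<lambda>k. xconst c * p k)"

definition Eo :: "nat \<Rightarrow> nat \<Rightarrow> nat \<Rightarrow> 'k::comm_ring_1 fvec \<Rightarrow> 'k fvec" where
  "Eo n i j p = (\<lambda>k. Eop n i j (p k))"

definition FM :: "nat \<Rightarrow> nat \<Rightarrow> nat \<Rightarrow> 'k::comm_ring_1 fvec set" where
  "FM n q m = {p. (\<forall>k. cin m n (p k)) \<and> (\<forall>k\<ge>q. p k = 0)}"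

definition ksub :: "'k::comm_ring_1 fvec set \<Rightarrow> bool" where
  "ksub K \<longleftrightarrow> 0 \<in> K \<and> (\<forall>p\<in>K. \<forall>p'\<in>K. p + p' \<in> K) \<and> (\<forall>c. \<forall>p\<in>K. scl c p \<in> K)"

lemma ksub_0: "ksub K \<Longrightarrow> 0 \<in> K"
  and ksub_add: "ksub K \<Longrightarrow> p \<in> K \<Longrightarrow> p' \<in> K \<Longrightarrow> p + p' \<in> K"
  and ksub_scl: "ksub K \<Longrightarrow> p \<in> K \<Longrightarrow> scl c p \<in> K"
  by (auto simp: ksub_def)

lemma scl_minus1: "scl (- 1) p = - p"
  by (simp add: scl_def fun_eq_iff xconst_minus)

lemma ksub_uminus: "ksub K \<Longrightarrow> p \<in> K \<Longrightarrow> - p \<in> K"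
  using ksub_scl[of K p "-1"] by (simp add: scl_minus1)

lemma ksub_diff: "ksub K \<Longrightarrow> p \<in> K \<Longrightarrow> p' \<in> K \<Longrightarrow> p - p' \<in> K"
  using ksub_add[OF _ _ ksub_uminus, of K p p'] by simp

lemma ksub_sum: "ksub K \<Longrightarrow> (\<And>x. x \<in> S \<Longrightarrow> f x \<in> K) \<Longrightarrow> (\<Sum>x\<in>S. f x) \<in> K"
  by (induction S rule: infinite_finite_induct) (auto intro: ksub_add simp: ksub_0)

lemma fun_sum_apply: "(\<Sum>x\<in>S. f x) k = (\<Sum>x\<in>S. f x k)"
  by (induction S rule: infinite_finite_induct) auto

lemma scl_add: "scl (a + b) p = scl a p + scl b p" "scl c (p + p') = scl c p + scl c p'"
  and scl_scl: "scl a (scl b p) = scl (a * b) p" and scl_1 [simp]: "scl 1 p = p" and scl_0 [simp]: "scl 0 p = 0"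
  and scl_diff: "scl c (p - p') = scl c p - scl c p'" and scl_diff_left: "scl (a - b) p = scl a p - scl b p"
  by (auto simp: scl_def xconst_add xconst_mult xconst_diff algebra_simps fun_eq_iff)

lemma derivation_diff: "derivation D \<Longrightarrow> D (f - g) = D f - D g"
  using derivation_add[of D f "- g"] by (simp add: derivation_minus)

lemma Eo_add: "Eo n i j (p + p') = Eo n i j p + Eo n i j p'"
  and Eo_diff: "Eo n i j (p - p') = Eo n i j p - Eo n i j p'"
  and Eo_scl: "Eo n i j (scl c p) = scl c (Eo n i j p)"
  and Eo_0 [simp]: "Eo n i j 0 = 0"
  by (auto simp: Eo_def scl_def fun_eq_iff derivation_add[OF Eop_derivation] derivation_scale[OF Eop_derivation]
      derivation_0[OF Eop_derivation] derivation_diff[OF Eop_derivation])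

section \<open>The Capelli argument\<close>

text \<open>The normally ordered product of the operators \<open>E_ij\<close> over the paired index
  lists: all variables stand to the left of all derivatives (\<open>G_expand\<close>).\<close>

fun G :: "nat \<Rightarrow> nat list \<Rightarrow> nat list \<Rightarrow> 'k::comm_ring_1 xpoly \<Rightarrow> 'k xpoly" where
  "G n (i # is) (j # js) f = (\<Sum>l<n. xvar i l * G n is js (pd j l f))"
| "G n _ _ f = f"

text \<open>\<open>E_ab\<close> applied to an ordered product also differentiates the variables
  standing on the left, and each one in row \<open>b\<close> becomes a variable in row
  \<open>a\<close>. Subtracting these terms leaves the longer ordered product.\<close>

lemma G_Cons:
  "length is = length js \<Longrightarrow>
   G n (a # is) (b # js) f = Eop n a b (G n is js f) - (\<Sum>c<length is. if is ! c = b then G n (is[c := a]) js f else 0)"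
proof (induction "is" arbitrary: js f)
  case Nil
  then show ?case by (simp add: Eop_eq_pd)
next
  case (Cons i "is'")
  then obtain j js' where js: "js = j # js'" by (cases js) auto
  have len: "length is' = length js'" using Cons.prems js by simp
  have "G n (a # i # is') (b # js) f = (\<Sum>l<n. \<Sum>l'<n. xvar a l * (xvar i l' * G n is' js' (pd j l' (pd b l f))))"
    by (simp add: js sum_distrib_left)
  also have "\<dots> = (\<Sum>l'<n. \<Sum>l<n. xvar i l' * (xvar a l * G n is' js' (pd b l (pd j l' f))))"
    by (subst sum.swap) (simp add: pd_commute[of b] mult.left_commute)
  also have "\<dots> = (\<Sum>l'<n. xvar i l' * G n (a # is') (b # js') (pd j l' f))"
    by (simp add: sum_distrib_left)
  also have "\<dots> = (\<Sum>l'<n. xvar i l' * Eop n a b (G n is' js' (pd j l' f)))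
     - (\<Sum>l'<n. xvar i l' * (\<Sum>c<length is'. if is' ! c = b then G n (is'[c := a]) js' (pd j l' f) else 0))"
    by (simp only: Cons.IH[OF len] right_diff_distrib sum_subtractf)
  also have "(\<Sum>l'<n. xvar i l' * (\<Sum>c<length is'. if is' ! c = b then G n (is'[c := a]) js' (pd j l' f) else 0))
      = (\<Sum>c<length is'. if is' ! c = b then G n (i # is'[c := a]) (j # js') f else 0)"
    by (subst sum_distrib_left, subst sum.swap) (auto intro!: sum.cong)
  also have "(\<Sum>l'<n. xvar i l' * Eop n a b (G n is' js' (pd j l' f)))
     = Eop n a b (G n (i # is') js f) - (if i = b then G n (a # is') js f else 0)"
    by (simp add: js derivation_sum[OF Eop_derivation] Eop_xvar_mult sum.distrib)
  finally show ?case
    unfolding js by (simp add: sum.lessThan_Suc_shift list_update_code algebra_simps del: sum.lessThan_Suc G.simps cong: if_cong)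
qed

definition Gv :: "nat \<Rightarrow> nat list \<Rightarrow> nat list \<Rightarrow> 'k::comm_ring_1 fvec \<Rightarrow> 'k fvec" where
  "Gv n is js p = (\<lambda>k. G n is js (p k))"

lemma Gv_Cons_notin:
  fixes p :: "'k::comm_ring_1 fvec"
  assumes "length is = length js" "b \<notin> set is"
  shows "Gv n (a # is) (b # js) p = Eo n a b (Gv n is js p)"
proof -
  have "(\<Sum>c<length is. if is ! c = b then G n (is[c := a]) js f else 0) = 0" for f :: "'k xpoly"
    using assms(2) by (intro sum.neutral) (auto dest: nth_mem)
  then show ?thesis by (simp add: Gv_def Eo_def fun_eq_iff G_Cons[OF assms(1)] del: G.simps)
qed

lemma Gv_Cons_in:
  fixes p :: "'k::comm_ring_1 fvec"
  assumes "length is = length js" "distinct is" "c0 < length is" "is ! c0 = b"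
  shows "Gv n (a # is) (b # js) p = Eo n a b (Gv n is js p) - Gv n (is[c0 := a]) js p"
proof -
  have "(\<Sum>c<length is. if is ! c = b then G n (is[c := a]) js f else 0) = (\<Sum>c<length is. if c = c0 then G n (is[c0 := a]) js f else 0)" for f :: "'k xpoly"
    using assms(2-) by (intro sum.cong) (auto simp: nth_eq_iff_index_eq)
  then show ?thesis using assms(3) by (simp add: Gv_def Eo_def fun_eq_iff G_Cons[OF assms(1)] del: G.simps)
qed

fun PD :: "nat list \<Rightarrow> nat list \<Rightarrow> 'k::comm_ring_1 xpoly \<Rightarrow> 'k xpoly" where
  "PD (j # js) (l # ls) f = PD js ls (pd j l f)"
| "PD _ _ f = f"

lemma PD_cin: "cin m n f \<Longrightarrow> cin m n (PD js ls f)"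
  by (induction js ls f rule: PD.induct) (auto intro: pd_cin)

lemma PD_0 [simp]: "PD js ls 0 = 0"
  by (induction js ls "0 :: 'a xpoly" rule: PD.induct) auto

lemma G_expand:
  "length is = length js \<Longrightarrow>
   G n is js f = (\<Sum>ls | set ls \<subseteq> {..<n} \<and> length ls = length is. (\<Prod>c<length is. xvar (is ! c) (ls ! c)) * PD js ls f)"
proof (induction "is" arbitrary: js f)
  case Nil
  have "{ls. set ls \<subseteq> {..<n} \<and> length ls = length []} = {[]}" by auto
  then show ?case using Nil by simp
next
  case (Cons i "is'")
  then obtain j js' where js: "js = j # js'" by (cases js) auto
  have len: "length is' = length js'" using Cons.prems js by simp
  let ?L = "{ls. set ls \<subseteq> {..<n} \<and> length ls = length is'}"
  have S: "{ls. set ls \<subseteq> {..<n} \<and> length ls = length (i # is')} = (\<lambda>(l, ls). l # ls) ` ({..<n} \<times> ?L)"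
    by (auto simp: length_Suc_conv image_iff)
  have inj: "inj_on (\<lambda>(l, ls). l # ls) ({..<n} \<times> ?L)" by (auto intro: inj_onI)
  have "G n (i # is') js f = (\<Sum>l<n. \<Sum>ls\<in>?L. xvar i l * ((\<Prod>c<length is'. xvar (is' ! c) (ls ! c)) * PD js' ls (pd j l f)))"
    by (simp add: js Cons.IH[OF len] sum_distrib_left)
  also have "\<dots> = (\<Sum>(l, ls)\<in>{..<n} \<times> ?L. xvar i l * ((\<Prod>c<length is'. xvar (is' ! c) (ls ! c)) * PD js' ls (pd j l f)))"
    by (rule sum.cartesian_product)
  also have "\<dots> = (\<Sum>ls\<in>(\<lambda>(l, ls). l # ls) ` ({..<n} \<times> ?L). (\<Prod>c<length (i # is'). xvar ((i # is') ! c) (ls ! c)) * PD js ls f)"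
    by (subst sum.reindex[OF inj]) (auto simp: js prod.lessThan_Suc_shift mult.assoc simp del: prod.lessThan_Suc intro!: sum.cong)
  finally show ?case by (simp only: S)
qed

text \<open>Only the product of variables in \<open>G_expand\<close> depends on \<open>p\<close>, so
  the signed sum is a Leibniz formula. This side of the Capelli identity exhibits multiples of
  maximal minors.\<close>

lemma G_antisym:
  fixes f :: "'k::comm_ring_1 xpoly"
  shows
  "(\<Sum>p | p permutes {0..<m}. of_int (sign p) * G n (map p [0..<m]) [0..<m] f)
    = (\<Sum>ls | set ls \<subseteq> {..<n} \<and> length ls = m. det (mat m m (\<lambda>(c, i). xvar i (ls ! c))) * PD [0..<m] ls f)"
proof -
  let ?L = "{ls. set ls \<subseteq> {..<n} \<and> length ls = m}"
  have "(\<Sum>p | p permutes {0..<m}. of_int (sign p) * G n (map p [0..<m]) [0..<m] f)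
     = (\<Sum>p | p permutes {0..<m}. \<Sum>ls\<in>?L. of_int (sign p) * (\<Prod>c<m. xvar (p c) (ls ! c)) * PD [0..<m] ls f)"
    by (simp add: G_expand sum_distrib_left mult.assoc)
  also have "\<dots> = (\<Sum>ls\<in>?L. \<Sum>p | p permutes {0..<m}. of_int (sign p) * (\<Prod>c<m. xvar (p c) (ls ! c)) * PD [0..<m] ls f)"
    by (rule sum.swap)
  also have "\<dots> = (\<Sum>ls\<in>?L. det (mat m m (\<lambda>(c, i). xvar i (ls ! c))) * PD [0..<m] ls f)"
  proof (rule sum.cong[OF refl])
    fix ls
    have "(\<Prod>c = 0..<m. mat m m (\<lambda>(c, i). xvar i (ls ! c)) $$ (c, p c)) = (\<Prod>c<m. xvar (p c) (ls ! c) :: 'k xpoly)" if "p permutes {0..<m}" for p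
      using permutes_in_image[OF that] by (auto simp: atLeast0LessThan intro!: prod.cong)
    then have "(\<Sum>p | p permutes {0..<m}. signof p * (\<Prod>c = 0..<m. mat m m (\<lambda>(c, i). xvar i (ls ! c)) $$ (c, p c)))
      = (\<Sum>p | p permutes {0..<m}. of_int (sign p) * (\<Prod>c<m. xvar (p c) (ls ! c) :: 'k xpoly))"
      by (intro sum.cong refl) (simp only: mem_Collect_eq)
    then show "(\<Sum>p | p permutes {0..<m}. of_int (sign p) * (\<Prod>c<m. xvar (p c) (ls ! c)) * PD [0..<m] ls f)
      = det (mat m m (\<lambda>(c, i). xvar i (ls ! c))) * PD [0..<m] ls f"
      by (simp only: det_def dim_row_mat dim_col_mat if_True simp_thms sum_distrib_right)
  qed
  finally show ?thesis .
qed

lemma list_perm_exists: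
  assumes "distinct is" "set is = {b..<m}" "length is = m - b"
  obtains p where "p permutes {b..<m}" "is = map p [b..<m]"
proof -
  define p where "p x = (if x \<in> {b..<m} then is ! (x - b) else x)" for x
  have "inj_on p {b..<m}"
    by (rule inj_onI) (use assms in \<open>auto simp: p_def nth_eq_iff_index_eq\<close>)
  moreover have "p ` {b..<m} \<subseteq> {b..<m}"
    unfolding p_def using assms(2,3) nth_mem[of _ "is"] by auto
  ultimately have "bij_betw p {b..<m} {b..<m}" by (auto simp: bij_betw_def endo_inj_surj)
  then have "p permutes {b..<m}" by (rule bij_imp_permutes) (auto simp: p_def)
  moreover have "is = map p [b..<m]" by (rule nth_equalityI) (auto simp: assms p_def)
  ultimately show ?thesis using that by blast
qed

text \<open>Modulo \<open>K\<close> the vector \<open>v\<close> is a highest weight vector with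
  positive weights. Descending induction on \<open>b\<close> evaluates the ordered products with
  second indices \<open>b, ..., m - 1\<close>: zero unless the first indices are a permutation
  \<open>p\<close> of them, and then \<open>sign p\<close> times a natural number times
  \<open>v\<close>. Recording only that this number is positive for the identity avoids the shifted
  diagonal entries of the Capelli determinant.\<close>

lemma capelli_step:
  fixes v :: "'k::comm_ring_1 fvec" and \<mu> :: "nat \<Rightarrow> nat"
  assumes K: "ksub K" and KE: "\<And>i j p. i < m \<Longrightarrow> j < m \<Longrightarrow> p \<in> K \<Longrightarrow> Eo n i j p \<in> K"
    and up: "\<And>i j. i < j \<Longrightarrow> j < m \<Longrightarrow> Eo n i j v \<in> K"
    and diag: "\<And>i. i < m \<Longrightarrow> Eo n i i v = scl (of_nat (\<mu> i)) v" and pos: "\<And>i. i < m \<Longrightarrow> \<mu> i > 0"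
    and "b \<le> m"
  shows "(\<forall>is. length is = m - b \<longrightarrow> distinct is \<longrightarrow> set is \<subseteq> {..<m} \<longrightarrow> set is \<noteq> {b..<m} \<longrightarrow> Gv n is [b..<m] v \<in> K) \<and>
    (\<forall>p. p permutes {b..<m} \<longrightarrow> (\<exists>g::nat. Gv n (map p [b..<m]) [b..<m] v - scl (of_int (sign p * int g)) v \<in> K \<and> (p = id \<longrightarrow> 0 < g)))"
  using \<open>b \<le> m\<close>
proof (induction rule: inc_induct)
  case base
  have "Gv n [] [] v = v" by (simp add: Gv_def)
  moreover have "v - scl (of_int (sign id * int 1)) v = 0" by simp
  ultimately show ?case using ksub_0[OF K] by (auto intro!: exI[of _ "1::nat"] simp flip: zero_fun_def)
next
  case (step b)
  have b: "b < m" by fact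
  have upt: "[b..<m] = b # [Suc b..<m]" using b by (rule upt_conv_Cons)
  have IH1: "Gv n is [Suc b..<m] v \<in> K" if "length is = m - Suc b" "distinct is" "set is \<subseteq> {..<m}" "set is \<noteq> {Suc b..<m}" for "is"
    using step.IH that by blast
  have IH2: "\<exists>g::nat. Gv n (map p [Suc b..<m]) [Suc b..<m] v - scl (of_int (sign p * int g)) v \<in> K \<and> (p = id \<longrightarrow> 0 < g)"
    if "p permutes {Suc b..<m}" for p using step.IH that by blast
  show ?case
  proof (intro conjI allI impI)
    fix "is" assume il: "length is = m - b" "distinct is" "set is \<subseteq> {..<m}" "set is \<noteq> {b..<m}"
    obtain a is' where a: "is = a # is'" using b il(1) by (cases "is") auto
    have len: "length is' = m - Suc b" "length is' = length [Suc b..<m]" using il a by auto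
    have d: "distinct is'" "a \<notin> set is'" "a < m" "set is' \<subseteq> {..<m}" using il a by auto
    show "Gv n is [b..<m] v \<in> K"
    proof (cases "set is' = {Suc b..<m}")
      case True
      obtain p where p: "p permutes {Suc b..<m}" "is' = map p [Suc b..<m]"
        using list_perm_exists[OF d(1) True len(1)] by blast
      obtain g where g: "Gv n is' [Suc b..<m] v - scl (of_int (sign p * int g)) v \<in> K"
        using IH2[OF p(1)] p(2) by blast
      have "a \<noteq> b" using True il(4) b by (auto simp: a)
      \<comment> \<open>\<open>a\<close> lies outside \<open>{Suc b..<m}\<close> and differs from
        \<open>b\<close>, so \<open>Eo n a b\<close> is a raising operator and sends
        \<open>v\<close> into \<open>K\<close>.\<close>
      then have ab: "a < b" using d(2,3) True by auto
      have "Eo n a b (Gv n is' [Suc b..<m] v) - scl (of_int (sign p * int g)) (Eo n a b v) \<in> K"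
        using KE[OF d(3) b g] by (simp only: Eo_diff Eo_scl)
      from ksub_add[OF K this ksub_scl[OF K up[OF ab b], where c = "of_int (sign p * int g)"]]
      have "Eo n a b (Gv n is' [Suc b..<m] v) \<in> K" by fastforce
      moreover have "b \<notin> set is'" using True by simp
      ultimately show ?thesis unfolding a upt using Gv_Cons_notin[OF len(2)] by metis
    next
      case False
      have 1: "Eo n a b (Gv n is' [Suc b..<m] v) \<in> K"
        by (rule KE[OF d(3) b IH1[OF len(1) d(1) d(4) False]])
      show ?thesis
      proof (cases "b \<in> set is'")
        case False
        then show ?thesis using 1 unfolding a upt using Gv_Cons_notin[OF len(2)] by metis
      next
        case True
        then obtain c0 where c0: "c0 < length is'" "is' ! c0 = b" by (auto simp: in_set_conv_nth)
        have set: "set (is'[c0 := a]) = insert a (set is' - {b})"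
          using set_update_distinct[OF d(1) c0(1)] c0(2) by simp
        \<comment> \<open>Otherwise putting \<open>b\<close> back would show that \<open>is\<close>
          uses exactly the indices \<open>b, ..., m - 1\<close>.\<close>
        have "set (is'[c0 := a]) \<noteq> {Suc b..<m}"
        proof
          assume "set (is'[c0 := a]) = {Suc b..<m}"
          then have "insert b (insert a (set is' - {b})) = insert b {Suc b..<m}" using set by simp
          then have "insert a (set is') = {b..<m}" using True b by auto
          then show False using il(4) a by simp
        qed
        moreover have "distinct (is'[c0 := a])" using d by (auto intro: distinct_list_update)
        moreover have "set (is'[c0 := a]) \<subseteq> {..<m}" using set d by auto
        ultimately have "Gv n (is'[c0 := a]) [Suc b..<m] v \<in> K" by (intro IH1) (auto simp: len)
        then show ?thesis using 1 unfolding a upt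
          by (simp only: Gv_Cons_in[OF len(2) d(1) c0] ksub_diff[OF K])
      qed
    qed
  next
    fix p assume p: "p permutes {b..<m}"
    define a where "a = p b"
    let ?is = "map p [Suc b..<m]"
    have a: "a < m" using permutes_in_image[OF p, of b] b by (simp add: a_def)
    have mp: "map p [b..<m] = a # ?is" by (simp add: upt a_def)
    have inj: "inj p" using p by (rule permutes_inj)
    have len: "length ?is = length [Suc b..<m]" by simp
    have dist: "distinct ?is" by (simp add: distinct_map inj_on_subset[OF inj])
    have set: "set ?is = {b..<m} - {a}"
    proof -
      have "p ` {b..<m} = {b..<m}" using p by (rule permutes_image)
      moreover have "{b..<m} = insert b {Suc b..<m}" using b by auto
      ultimately have "insert a (p ` {Suc b..<m}) = {b..<m}" by (simp add: a_def)
      moreover have "a \<notin> p ` {Suc b..<m}" using inj by (auto simp: a_def inj_eq)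
      ultimately show ?thesis by auto
    qed
    show "\<exists>g::nat. Gv n (map p [b..<m]) [b..<m] v - scl (of_int (sign p * int g)) v \<in> K \<and> (p = id \<longrightarrow> 0 < g)"
    proof (cases "a = b")
      case True
      have "p permutes {Suc b..<m}"
      proof (rule permutes_superset[OF p])
        fix x assume "x \<in> {b..<m} - {Suc b..<m}"
        then have "x = b" by auto
        then show "p x = x" using True by (simp add: a_def)
      qed
      from IH2[OF this] obtain g where g: "Gv n ?is [Suc b..<m] v - scl (of_int (sign p * int g)) v \<in> K" "p = id \<longrightarrow> 0 < g" by blast
      have "b \<notin> set ?is" using True by (simp only: set) simp
      then have eq: "Gv n (map p [b..<m]) [b..<m] v = Eo n b b (Gv n ?is [Suc b..<m] v)"
        by (subst mp, subst upt, subst True) (rule Gv_Cons_notin[OF len])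
      \<comment> \<open>Here \<open>p\<close> fixes \<open>b\<close>, and the diagonal operator
        multiplies the constant by the positive weight \<open>\<mu> b\<close>.\<close>
      have "Eo n b b (Gv n ?is [Suc b..<m] v) - scl (of_int (sign p * int g)) (scl (of_nat (\<mu> b)) v) \<in> K"
        using KE[OF b b g(1)] by (simp only: Eo_diff Eo_scl diag[OF b])
      moreover have "scl (of_int (sign p * int g)) (scl (of_nat (\<mu> b)) v) = scl (of_int (sign p * int (g * \<mu> b))) v"
        by (simp add: scl_scl mult.assoc)
      ultimately show ?thesis using g(2) pos[OF b] by (intro exI[of _ "g * \<mu> b"]) (simp only: eq, simp)
    next
      case False
      have "b \<in> set ?is" using False b by (simp only: set) simp
      then obtain c0 where c0: "c0 < length ?is" "?is ! c0 = b" by (metis in_set_conv_nth)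
      have "set ?is \<noteq> {Suc b..<m}" using \<open>b \<in> set ?is\<close> by (metis atLeastLessThan_iff not_less_eq_eq order_refl)
      moreover have "set ?is \<subseteq> {..<m}" by (simp only: set) auto
      ultimately have 1: "Eo n a b (Gv n ?is [Suc b..<m] v) \<in> K"
        by (intro KE[OF a b IH1] dist) auto
      \<comment> \<open>The correction term has \<open>b\<close> replaced by \<open>a\<close>, which
        is a permutation of opposite sign; the minus sign in front of the term restores
        \<open>sign p\<close>.\<close>
      define p' where "p' = transpose a b \<circ> p"
      have ab: "a \<in> {b..<m}" "b \<in> {b..<m}" using permutes_in_image[OF p, of b] b by (auto simp: a_def)
      have p'1: "p' permutes {b..<m}" unfolding p'_def by (intro permutes_compose[OF p] permutes_swap_id ab)
      have "p' permutes {Suc b..<m}"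
      proof (rule permutes_superset[OF p'1])
        fix x assume "x \<in> {b..<m} - {Suc b..<m}"
        then have "x = b" by auto
        then show "p' x = x" by (simp add: p'_def a_def)
      qed
      from IH2[OF this] obtain g where g: "Gv n (map p' [Suc b..<m]) [Suc b..<m] v - scl (of_int (sign p' * int g)) v \<in> K" by blast
      have sign: "sign p' = - sign p"
        unfolding p'_def using permutes_imp_permutation[OF _ p] False
        by (simp add: sign_compose permutation_swap_id sign_swap_id)
      have "map p' [Suc b..<m] = ?is[c0 := a]"
      proof (rule nth_equalityI)
        fix i assume "i < length (map p' [Suc b..<m])"
        then have i: "i < length ?is" by simp
        have "?is ! i \<noteq> a" using i set nth_mem[OF i] by (metis Diff_iff singletonI)
        moreover have "?is ! i = b \<longleftrightarrow> i = c0" using nth_eq_iff_index_eq[OF dist i c0(1)] c0(2) by metis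
        moreover have "map p' [Suc b..<m] ! i = transpose a b (?is ! i)" using i by (simp add: p'_def)
        ultimately show "map p' [Suc b..<m] ! i = ?is[c0 := a] ! i"
          using i c0(1) by (metis nth_list_update_eq nth_list_update_neq transpose_apply_second transpose_apply_other)
      qed simp
      then have eq: "Gv n (map p [b..<m]) [b..<m] v = Eo n a b (Gv n ?is [Suc b..<m] v) - Gv n (map p' [Suc b..<m]) [Suc b..<m] v"
        by (subst mp, subst (1) upt) (simp only: Gv_Cons_in[OF len dist c0])
      have "Gv n (map p [b..<m]) [b..<m] v - scl (of_int (sign p * int g)) v
        = Eo n a b (Gv n ?is [Suc b..<m] v) - (Gv n (map p' [Suc b..<m]) [Suc b..<m] v - scl (of_int (sign p' * int g)) v)"
        unfolding eq sign by (simp add: scl_def xconst_minus fun_eq_iff)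
      also have "\<dots> \<in> K" by (rule ksub_diff[OF K 1 g])
      finally show ?thesis using False by (intro exI[of _ g]) (auto simp: a_def)
    qed
  qed
qed

text \<open>The signed sum of the ordered products lies in \<open>K\<close>, being a sum of
  multiples of maximal minors; by \<open>capelli_step\<close> it is also a natural number times
  \<open>v\<close> modulo \<open>K\<close>. No contribution is negative and the identity gives a
  positive one, so in characteristic zero the number is invertible.\<close>

theorem capelli:
  fixes v :: "'k::field_char_0 fvec" and \<mu> :: "nat \<Rightarrow> nat"
  assumes K: "ksub K" and KE: "\<And>i j p. i < m \<Longrightarrow> j < m \<Longrightarrow> p \<in> K \<Longrightarrow> Eo n i j p \<in> K"
    and minors: "\<And>ls g. length ls = m \<Longrightarrow> set ls \<subseteq> {..<n} \<Longrightarrow> g \<in> FM n q m \<Longrightarrow> (\<lambda>k. det (mat m m (\<lambda>(c, i). xvar i (ls ! c))) * g k) \<in> K"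
    and v: "v \<in> FM n q m" and up: "\<And>i j. i < j \<Longrightarrow> j < m \<Longrightarrow> Eo n i j v \<in> K"
    and diag: "\<And>i. i < m \<Longrightarrow> Eo n i i v = scl (of_nat (\<mu> i)) v" and pos: "\<And>i. i < m \<Longrightarrow> \<mu> i > 0"
  shows "v \<in> K"
proof -
  let ?S = "{p. p permutes {0..<m}}"
  have "\<exists>g::nat. Gv n (map p [0..<m]) [0..<m] v - scl (of_int (sign p * int g)) v \<in> K \<and> (p = id \<longrightarrow> 0 < g)" if "p \<in> ?S" for p
    using capelli_step[where K = K and m = m and n = n and v = v and \<mu> = \<mu> and b = 0] K KE up diag pos that by simp
  then obtain g :: "(nat \<Rightarrow> nat) \<Rightarrow> nat"
    where g: "\<And>p. p \<in> ?S \<Longrightarrow> Gv n (map p [0..<m]) [0..<m] v - scl (of_int (sign p * int (g p))) v \<in> K" and gid: "0 < g id"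
    using permutes_id[of "{0..<m}"] by (metis mem_Collect_eq)
  have det_in: "(\<Sum>p\<in>?S. scl (of_int (sign p)) (Gv n (map p [0..<m]) [0..<m] v)) \<in> K"
  proof -
    have "(\<Sum>p\<in>?S. scl (of_int (sign p)) (Gv n (map p [0..<m]) [0..<m] v))
      = (\<Sum>ls | set ls \<subseteq> {..<n} \<and> length ls = m. (\<lambda>k. det (mat m m (\<lambda>(c, i). xvar i (ls ! c))) * PD [0..<m] ls (v k)))"
      by (rule ext) (simp add: fun_sum_apply scl_def xconst_of_int Gv_def G_antisym)
    also have "\<dots> \<in> K"
      by (intro ksub_sum[OF K] minors) (use v in \<open>auto simp: FM_def intro: PD_cin\<close>)
    finally show ?thesis .
  qed
  have "(\<Sum>p\<in>?S. scl (of_int (sign p)) (Gv n (map p [0..<m]) [0..<m] v - scl (of_int (sign p * int (g p))) v)) \<in> K"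
    by (intro ksub_sum[OF K] ksub_scl[OF K] g)
  moreover have "(\<Sum>p\<in>?S. scl (of_int (sign p)) (Gv n (map p [0..<m]) [0..<m] v - scl (of_int (sign p * int (g p))) v))
     = (\<Sum>p\<in>?S. scl (of_int (sign p)) (Gv n (map p [0..<m]) [0..<m] v)) - scl (of_nat (\<Sum>p\<in>?S. g p)) v"
  proof -
    have "scl (of_int (sign p)) (scl (of_int (sign p * int (g p))) v) = scl (of_nat (g p)) v" for p
      using sign_mult_self[of p, where 'a = 'k] by (simp add: scl_scl mult.assoc[symmetric])
    moreover have "(\<Sum>p\<in>?S. scl (of_nat (g p)) v) = scl (of_nat (\<Sum>p\<in>?S. g p)) v"
      by (rule ext) (simp add: fun_sum_apply scl_def xconst_sum sum_distrib_right)
    ultimately show ?thesis by (simp add: scl_diff sum_subtractf)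
  qed
  ultimately have "scl (of_nat (\<Sum>p\<in>?S. g p)) v \<in> K" using ksub_diff[OF K det_in] by fastforce
  moreover have "0 < (\<Sum>p\<in>?S. g p)"
    by (rule sum_pos2[of _ id]) (use gid permutes_id in \<open>auto simp: finite_permutations\<close>)
  ultimately have "scl (inverse (of_nat (\<Sum>p\<in>?S. g p))) (scl (of_nat (\<Sum>p\<in>?S. g p)) v) \<in> K" "(of_nat (\<Sum>p\<in>?S. g p) :: 'k) \<noteq> 0"
    using ksub_scl[OF K] by (blast, linarith?, metis of_nat_eq_0_iff less_numeral_extra(3))
  then show ?thesis by (simp add: scl_scl)
qed

section \<open>Traces on finite dimensional subspaces\<close>

lemma finite_total_max:
  fixes less :: "'s \<Rightarrow> 's \<Rightarrow> bool"
  assumes "finite S" "S \<noteq> {}"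
    and tot: "\<And>s t. s \<in> S \<Longrightarrow> t \<in> S \<Longrightarrow> s \<noteq> t \<Longrightarrow> less s t \<noteq> less t s"
    and trans: "\<And>s t u. s \<in> S \<Longrightarrow> t \<in> S \<Longrightarrow> u \<in> S \<Longrightarrow> less s t \<Longrightarrow> less t u \<Longrightarrow> less s u"
  shows "\<exists>s\<in>S. \<forall>t\<in>S. t \<noteq> s \<longrightarrow> less t s"
proof -
  have "finite F \<Longrightarrow> F \<noteq> {} \<Longrightarrow> F \<subseteq> S \<Longrightarrow> \<exists>s\<in>F. \<forall>t\<in>F. t \<noteq> s \<longrightarrow> less t s" for F
  proof (induction F rule: finite_ne_induct)
    case (insert x F)
    have "F \<subseteq> S" using insert.prems by simp
    from insert.IH[OF this] obtain s where s: "s \<in> F" "\<forall>t\<in>F. t \<noteq> s \<longrightarrow> less t s" by (elim bexE)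
    have S: "x \<in> S" "s \<in> S" "x \<noteq> s" and F: "\<And>t. t \<in> F \<Longrightarrow> t \<in> S" using s(1) insert.hyps insert.prems by auto
    show ?case
    proof (cases "less s x")
      case True
      have "less t x" if "t \<in> F" for t
      proof (cases "t = s")
        case False
        then have "less t s" using s(2) that by simp
        then show ?thesis by (rule trans[OF F[OF that] S(2,1) _ True])
      qed (simp add: True)
      then show ?thesis by simp
    next
      case False
      then have "less x s" using tot[OF S(2,1)] S(3) by metis
      then show ?thesis using s by (intro bexI[of _ s]) auto
    qed
  qed auto
  from this[OF assms(1,2)] show ?thesis by simp
qed

text \<open>The spaces in question are infinite dimensional with finite dimensional graded pieces,
  so basis, dimension and trace are attached to subspaces.\<close>

locale vspace = vector_space scale for scale :: "'a::field \<Rightarrow> 'b::ab_group_add \<Rightarrow> 'b"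
begin

definition fd :: "'b set \<Rightarrow> bool" where
  "fd W \<longleftrightarrow> (\<exists>S. finite S \<and> W \<subseteq> span S)"

definition bas :: "'b set \<Rightarrow> 'b set" where
  "bas W = (SOME B. B \<subseteq> W \<and> independent B \<and> W \<subseteq> span B)"

definition trc :: "'b set \<Rightarrow> ('b \<Rightarrow> 'b) \<Rightarrow> 'a" where
  "trc W T = (\<Sum>b\<in>bas W. representation (bas W) (T b) b)"

lemma bas: "bas W \<subseteq> W" "independent (bas W)" "W \<subseteq> span (bas W)"
proof -
  obtain B where "B \<subseteq> W" "independent B" "W \<subseteq> span B" by (rule maximal_independent_subset[of W])
  then have ex: "\<exists>B. B \<subseteq> W \<and> independent B \<and> W \<subseteq> span B" by metis
  have "bas W \<subseteq> W \<and> independent (bas W) \<and> W \<subseteq> span (bas W)"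
    unfolding bas_def by (rule someI_ex[OF ex])
  then show "bas W \<subseteq> W" "independent (bas W)" "W \<subseteq> span (bas W)" by auto
qed

lemma span_bas: "subspace W \<Longrightarrow> span (bas W) = W"
  using bas(1,3)[of W] by (simp add: span_minimal subset_antisym)

lemma dim_bas: "dim W = card (bas W)"
  by (rule dim_unique[OF bas(1,3,2) refl])

lemma fd_subset: "fd W \<Longrightarrow> W' \<subseteq> W \<Longrightarrow> fd W'"
  by (auto simp: fd_def)

lemma finite_independent: "fd W \<Longrightarrow> independent B \<Longrightarrow> B \<subseteq> W \<Longrightarrow> finite B"
  unfolding fd_def by (meson independent_span_bound order_trans)

lemma finite_bas: "fd W \<Longrightarrow> finite (bas W)"
  by (rule finite_independent[OF _ bas(2,1)])

lemma dim_mono_fd: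
  assumes "fd W'" "W \<subseteq> W'"
  shows "dim W \<le> dim W'"
proof -
  have "independent (bas W)" "bas W \<subseteq> span (bas W')" using bas assms by blast+
  from independent_span_bound[OF finite_bas[OF assms(1)] this] show ?thesis by (simp add: dim_bas)
qed

lemma dim_eq_fd:
  assumes "fd W'" "W \<subseteq> W'" "subspace W" "dim W = dim W'"
  shows "W = W'"
proof (rule ccontr)
  assume "W \<noteq> W'"
  then obtain x where x: "x \<in> W'" "x \<notin> W" using assms(2) by blast
  then have x': "x \<notin> span (bas W)" by (simp add: span_bas[OF assms(3)])
  have ind: "independent (insert x (bas W))" using x' bas(2) by (simp add: independent_insert)
  have sub: "insert x (bas W) \<subseteq> span (bas W')" using x(1) bas assms(2) by blast
  have "card (insert x (bas W)) \<le> card (bas W')"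
    using independent_span_bound[OF finite_bas[OF assms(1)] ind sub] by simp
  moreover have "x \<notin> bas W" using x' span_base by blast
  moreover have "finite (bas W)" by (rule finite_bas[OF fd_subset[OF assms(1,2)]])
  ultimately show False using assms(4) by (simp add: dim_bas)
qed

text \<open>Both sides are the same double sum of products of matrix entries. It serves for traces
  of \<open>E_ij E_ji\<close> in neighbouring degrees and for comparing dimensions under an
  invertible map.\<close>

lemma trc_cyc:
  assumes W: "subspace W" "fd W" and W': "subspace W'" "fd W'"
    and T: "Vector_Spaces.linear scale scale T" "\<And>x. x \<in> W \<Longrightarrow> T x \<in> W'"
    and T': "Vector_Spaces.linear scale scale T'" "\<And>x. x \<in> W' \<Longrightarrow> T' x \<in> W"
  shows "trc W (\<lambda>x. T' (T x)) = trc W' (\<lambda>x. T (T' x))"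
proof -
  interpret T: Vector_Spaces.linear scale scale T by fact
  interpret T': Vector_Spaces.linear scale scale T' by fact
  have *: "representation (bas W) (S' (S b)) b = (\<Sum>b'\<in>bas W'. representation (bas W') (S b) b' * representation (bas W) (S' b') b)"
    if W: "subspace W" "fd W" and W': "subspace W'" "fd W'"
     and S: "Vector_Spaces.linear scale scale S" "\<And>x. x \<in> W \<Longrightarrow> S x \<in> W'"
     and S': "Vector_Spaces.linear scale scale S'" "\<And>x. x \<in> W' \<Longrightarrow> S' x \<in> W"
     and b: "b \<in> bas W" for S S' W W' b
  proof -
    interpret S': Vector_Spaces.linear scale scale S' by fact
    have bW: "b \<in> W" using bas(1) b by blast
    have "S b \<in> span (bas W')" using S(2)[OF bW] by (simp add: span_bas[OF W'(1)])
    then have "S b = (\<Sum>b'\<in>bas W'. scale (representation (bas W') (S b) b') b')"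
      using sum_representation_eq[OF bas(2) _ finite_bas[OF W'(2)] subset_refl] by metis
    then have "S' (S b) = (\<Sum>b'\<in>bas W'. scale (representation (bas W') (S b) b') (S' b'))"
      by (metis (no_types, lifting) S'.scale S'.sum sum.cong)
    moreover have mem: "S' b' \<in> span (bas W)" if "b' \<in> bas W'" for b'
      using S'(2) bas(1) that by (auto simp: span_bas[OF W(1)])
    ultimately show ?thesis
      by (simp add: representation_sum[OF bas(2)] span_scale representation_scale[OF bas(2)])
  qed
  have "trc W (\<lambda>x. T' (T x)) = (\<Sum>b\<in>bas W. \<Sum>b'\<in>bas W'. representation (bas W') (T b) b' * representation (bas W) (T' b') b)"
    unfolding trc_def by (rule sum.cong[OF refl], rule *) (use assms in auto)
  also have "\<dots> = (\<Sum>b'\<in>bas W'. \<Sum>b\<in>bas W. representation (bas W) (T' b') b * representation (bas W') (T b) b')"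
    by (subst sum.swap) (simp add: mult.commute)
  also have "\<dots> = trc W' (\<lambda>x. T (T' x))"
    unfolding trc_def by (rule sum.cong[OF refl], rule *[symmetric]) (use assms in auto)
  finally show ?thesis .
qed

lemma trc_add:
  assumes "subspace W" "\<And>x. x \<in> W \<Longrightarrow> T x \<in> W" "\<And>x. x \<in> W \<Longrightarrow> T' x \<in> W"
  shows "trc W (\<lambda>x. T x + T' x) = trc W T + trc W T'"
  unfolding trc_def sum.distrib[symmetric]
proof (rule sum.cong[OF refl])
  fix b assume "b \<in> bas W"
  then have "b \<in> W" using bas(1) by blast
  then show "representation (bas W) (T b + T' b) b = representation (bas W) (T b) b + representation (bas W) (T' b) b"
    using assms by (simp add: representation_add[OF bas(2)] span_bas)
qed

lemma trc_scale:
  assumes "subspace W" "\<And>x. x \<in> W \<Longrightarrow> T x = scale c x"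
  shows "trc W T = c * of_nat (dim W)"
proof -
  have "trc W T = (\<Sum>b\<in>bas W. c)"
    unfolding trc_def
  proof (rule sum.cong[OF refl])
    fix b assume b: "b \<in> bas W"
    then have "b \<in> W" using bas(1) by blast
    then show "representation (bas W) (T b) b = c"
      using b by (simp add: assms(2) representation_scale[OF bas(2)] span_base representation_basis[OF bas(2) b])
  qed
  then show ?thesis by (simp add: dim_bas)
qed

lemma trc_cong: "(\<And>x. x \<in> W \<Longrightarrow> T x = T' x) \<Longrightarrow> trc W T = trc W T'"
  unfolding trc_def
proof (rule sum.cong[OF refl])
  fix b assume T: "\<And>x. x \<in> W \<Longrightarrow> T x = T' x" and "b \<in> bas W"
  then have "b \<in> W" using bas(1) by blast
  then show "representation (bas W) (T b) b = representation (bas W) (T' b) b" by (simp add: T)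
qed

lemma trc_sum:
  assumes "subspace W" "\<And>i x. i \<in> I \<Longrightarrow> x \<in> W \<Longrightarrow> T i x \<in> W" "finite I"
  shows "trc W (\<lambda>x. \<Sum>i\<in>I. T i x) = (\<Sum>i\<in>I. trc W (T i))"
  using assms(3,2)
proof (induction I rule: finite_induct)
  case empty
  then show ?case using trc_scale[OF assms(1), of "\<lambda>x. 0" 0] by simp
next
  case (insert i I)
  have "trc W (\<lambda>x. T i x + (\<Sum>i\<in>I. T i x)) = trc W (T i) + trc W (\<lambda>x. \<Sum>i\<in>I. T i x)"
    by (rule trc_add[OF assms(1)]) (use insert in \<open>auto intro: subspace_sum[OF assms(1)]\<close>)
  then show ?case using insert by simp
qed

lemma trc_diff_scale:
  assumes "subspace W" "\<And>x. x \<in> W \<Longrightarrow> T x \<in> W"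
  shows "trc W (\<lambda>x. T x - scale c x) = trc W T - c * of_nat (dim W)"
proof -
  have "trc W (\<lambda>x. T x + scale (- c) x) = trc W T + trc W (\<lambda>x. scale (- c) x)"
    by (rule trc_add[OF assms]) (auto intro: subspace_scale[OF assms(1)] subspace_neg[OF assms(1)])
  also have "trc W (\<lambda>x. scale (- c) x) = - c * of_nat (dim W)" by (rule trc_scale[OF assms(1)]) simp
  finally show ?thesis by simp
qed

text \<open>Cyclicity applied to \<open>T\<close> and the inclusion of \<open>W'\<close> into
  \<open>W\<close>.\<close>

lemma trc_subspace:
  assumes "subspace W" "fd W" "subspace W'" "W' \<subseteq> W"
    and T: "Vector_Spaces.linear scale scale T" "\<And>x. x \<in> W \<Longrightarrow> T x \<in> W'"
  shows "trc W T = trc W' T"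
proof -
  have "Vector_Spaces.linear scale scale (\<lambda>x. x)" using linear_id by (simp add: id_def)
  from trc_cyc[OF assms(1,2,3) fd_subset[OF assms(2,4)] T this] assms(4) show ?thesis by auto
qed

lemma linearI_scale:
  assumes "\<And>x y. T (x + y) = T x + T y" "\<And>c x. T (scale c x) = scale c (T x)"
  shows "Vector_Spaces.linear scale scale T"
  by (unfold_locales) (use assms in auto)

text \<open>The dimension of a subspace is the number of its leading coordinates; for monomial coordinates
  these are the leading monomials of Groebner basis theory.\<close>

lemma dim_leading:
  fixes co :: "'s \<Rightarrow> 'b \<Rightarrow> 'a" and less :: "'s \<Rightarrow> 's \<Rightarrow> bool"
  assumes "finite S" "subspace W"
    and lin: "\<And>s x y. co s (x + y) = co s x + co s y" "\<And>s c x. co s (scale c x) = c * co s x"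
    and inj: "\<And>x. x \<in> W \<Longrightarrow> (\<And>s. s \<in> S \<Longrightarrow> co s x = 0) \<Longrightarrow> x = 0"
    and tot: "\<And>s t. s \<in> S \<Longrightarrow> t \<in> S \<Longrightarrow> s \<noteq> t \<Longrightarrow> less s t \<noteq> less t s"
    and trans: "\<And>s t u. s \<in> S \<Longrightarrow> t \<in> S \<Longrightarrow> u \<in> S \<Longrightarrow> less s t \<Longrightarrow> less t u \<Longrightarrow> less s u"
    and irrefl: "\<And>s. \<not> less s s"
  shows "dim W = card {s \<in> S. \<exists>x\<in>W. co s x \<noteq> 0 \<and> (\<forall>t\<in>S. less s t \<longrightarrow> co t x = 0)} \<and> fd W"
  using assms(1,2) inj tot trans
proof (induction S arbitrary: W rule: finite_psubset_induct)
  case (psubset S)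
  show ?case
  proof (cases "S = {}")
    case True
    then have "W = {0}" using psubset.prems(2) subspace_0[OF psubset.prems(1)] by auto
    moreover have "dim {0} = 0" by (rule dim_unique[of "{}"]) (auto simp: independent_empty)
    ultimately show ?thesis using True by (auto simp: fd_def intro!: exI[of _ "{}"])
  next
    case False
    have "\<exists>s\<in>S. \<forall>t\<in>S. t \<noteq> s \<longrightarrow> less t s"
      by (rule finite_total_max[OF psubset.hyps(1) False psubset.prems(3,4)])
    then obtain s where s: "s \<in> S" and mx: "\<And>t. t \<in> S \<Longrightarrow> t \<noteq> s \<Longrightarrow> less t s" by blast
    have smax: "\<not> less s t" if "t \<in> S" for t
      using mx[OF that] psubset.prems(3)[OF s that] irrefl[of s] by (cases "t = s") auto
    let ?L = "\<lambda>S W. {s \<in> S. \<exists>x\<in>W. co s x \<noteq> 0 \<and> (\<forall>t\<in>S. less s t \<longrightarrow> co t x = 0)}"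
    \<comment> \<open>\<open>s\<close> is the top coordinate and \<open>W'\<close> its kernel. The
      induction hypothesis covers \<open>W'\<close>; \<open>s\<close> is a leading coordinate
      exactly when \<open>W'\<close> is smaller than \<open>W\<close>, and then the codimension is
      1.\<close>
    define W' where "W' = {x \<in> W. co s x = 0}"
    have l0: "co t 0 = 0" for t using lin(2)[of t 0 0] by simp
    have sub: "subspace W'"
      using psubset.prems(1) by (auto simp: W'_def subspace_def lin l0)
    have IH: "dim W' = card (?L (S - {s}) W') \<and> fd W'"
    proof (rule psubset.IH)
      show "x = 0" if "x \<in> W'" "\<And>t. t \<in> S - {s} \<Longrightarrow> co t x = 0" for x
        using psubset.prems(2)[of x] that by (auto simp: W'_def)
      show "S - {s} \<subset> S" using s by blast
      show "subspace W'" by (rule sub)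
      show "less a b \<noteq> less b a" if "a \<in> S - {s}" "b \<in> S - {s}" "a \<noteq> b" for a b
        by (rule psubset.prems(3)) (use that in simp_all)
      show "less a c" if "a \<in> S - {s}" "b \<in> S - {s}" "c \<in> S - {s}" "less a b" "less b c" for a b c
        by (rule psubset.prems(4)[of a b c]) (use that in simp_all)
    qed
    have LL: "?L (S - {s}) W' = ?L S W - {s}"
    proof (intro equalityI subsetI)
      fix t assume "t \<in> ?L (S - {s}) W'"
      then obtain x where "t \<in> S" "t \<noteq> s" "x \<in> W" "co s x = 0" "co t x \<noteq> 0" "\<forall>u\<in>S - {s}. less t u \<longrightarrow> co u x = 0"
        by (auto simp: W'_def)
      then show "t \<in> ?L S W - {s}" by blast
    next
      fix t assume "t \<in> ?L S W - {s}"
      then obtain x where "t \<in> S" "t \<noteq> s" "x \<in> W" "co t x \<noteq> 0" "\<forall>u\<in>S. less t u \<longrightarrow> co u x = 0" by auto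
      then show "t \<in> ?L (S - {s}) W'" using mx[of t] s by (auto simp: W'_def)
    qed
    show ?thesis
    proof (cases "W' = W")
      case True
      then have "s \<notin> ?L S W" by (auto simp: W'_def)
      then show ?thesis using IH LL True by simp
    next
      case False
      then obtain w where w: "w \<in> W" "co s w \<noteq> 0" by (auto simp: W'_def)
      have sL: "s \<in> ?L S W" using s w smax by blast
      let ?B = "insert w (bas W')"
      have wn: "w \<notin> span (bas W')" using w(2) by (simp add: span_bas[OF sub]) (simp add: W'_def)
      have ind: "independent ?B" using wn bas(2) by (simp add: independent_insert)
      have span: "W \<subseteq> span ?B"
      proof
        fix x assume x: "x \<in> W"
        define c where "c = co s x / co s w"
        have "x + scale (- c) w \<in> W'"
        proof -
          have "x + scale (- c) w \<in> W" by (intro subspace_add subspace_scale psubset.prems(1) x w(1))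
          moreover have "co s (x + scale (- c) w) = co s x + - c * co s w" by (simp only: lin)
          then have "co s (x + scale (- c) w) = 0" using w(2) by (simp add: c_def)
          ultimately show ?thesis by (simp only: W'_def mem_Collect_eq simp_thms)
        qed
        then have "x + scale (- c) w \<in> span ?B"
          using bas(3) span_mono[of "bas W'" ?B] by blast
        moreover have "scale c w \<in> span ?B" by (intro span_scale span_base) simp
        ultimately have "x + scale (- c) w + scale c w \<in> span ?B" by (rule span_add)
        then show "x \<in> span ?B" by simp
      qed
      have fin: "finite ?B" using IH finite_bas by blast
      have "?B \<subseteq> W" using w(1) bas(1)[of W'] by (auto simp: W'_def)
      then have "dim W = card ?B" using dim_unique[OF _ span ind refl] by blast
      also have "\<dots> = Suc (card (bas W'))"
      proof (rule card_insert_disjoint)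
        show "w \<notin> bas W'" using wn by (metis span_base)
      qed (use fin in simp)
      also have "card (bas W') = card (?L S W - {s})"
        unfolding LL[symmetric] using IH dim_bas[of W'] by metis
      also have "Suc \<dots> = card (?L S W)"
        by (rule card_Suc_Diff1[OF _ sL]) (use psubset.hyps in simp)
      finally show ?thesis using fin span by (auto simp: fd_def)
    qed
  qed
qed

end

section \<open>The Vandermonde product\<close>

text \<open>The product over \<open>l > j\<close> is a monic polynomial of degree
  \<open>m - 1 - j\<close> in \<open>u_i\<close> whose coefficients do not depend on
  \<open>i\<close>; in descending powers its coefficient vector starts at position \<open>j\<close>
  with 1.\<close>

lemma vandermonde_coeffs:
  assumes "j < m"
  shows "\<exists>c. (\<forall>i. (\<Prod>l\<in>{j<..<m}. upow i 1 - upow l 1) = (\<Sum>k<m. upow i (int m - 1 - int k) * c k)) \<and> c j = 1 \<and> (\<forall>k<j. c k = 0)"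
proof -
  have "j \<le> m - 1" using assms by simp
  then show ?thesis
  proof (induction rule: inc_induct)
    case base
    have "{m - 1<..<m} = {}" by auto
    moreover have "(\<Sum>k<m. upow i (int m - 1 - int k) * (if k = m - 1 then 1 else 0)) = 1" for i
    proof -
      have "(\<Sum>k<m. upow i (int m - 1 - int k) * (if k = m - 1 then 1 else 0)) = (\<Sum>k<m. if k = m - 1 then 1 else 0)"
        by (rule sum.cong) (use assms in \<open>auto simp: of_nat_diff\<close>)
      then show ?thesis using assms by simp
    qed
    ultimately show ?case by (intro exI[of _ "\<lambda>k. if k = m - 1 then 1 else 0"]) auto
  next
    case (step j)
    then have j: "Suc j < m" by simp
    obtain c where c: "\<And>i. (\<Prod>l\<in>{Suc j<..<m}. upow i 1 - upow l 1) = (\<Sum>k<m. upow i (int m - 1 - int k) * c k)"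
      "c (Suc j) = 1" "\<And>k. k < Suc j \<Longrightarrow> c k = 0" using step.IH by blast
    define c' where "c' k = (if Suc k < m then c (Suc k) else 0) - upow (Suc j) 1 * c k" for k
    have "(\<Prod>l\<in>{j<..<m}. upow i 1 - upow l 1) = (\<Sum>k<m. upow i (int m - 1 - int k) * c' k)" for i
    proof -
      obtain m' where m: "m = Suc m'" using j by (cases m) auto
      have "{j<..<m} = insert (Suc j) {Suc j<..<m}" using j by auto
      then have "(\<Prod>l\<in>{j<..<m}. upow i 1 - upow l 1) = (upow i 1 - upow (Suc j) 1) * (\<Sum>k<m. upow i (int m - 1 - int k) * c k)"
        by (simp add: c(1))
      also have "\<dots> = (\<Sum>k<m. upow i (int m - int k) * c k) - (\<Sum>k<m. upow i (int m - 1 - int k) * (upow (Suc j) 1 * c k))"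
        by (simp add: left_diff_distrib sum_distrib_left mult.assoc[symmetric] upow_mult sum_subtractf) (simp add: mult_ac sum_subtractf)
      also have "(\<Sum>k<m. upow i (int m - int k) * c k) = (\<Sum>k<m'. upow i (int m - 1 - int k) * c (Suc k))"
        unfolding m by (subst sum.lessThan_Suc_shift) (simp add: c(3) algebra_simps)
      also have "\<dots> = (\<Sum>k<m. upow i (int m - 1 - int k) * (if Suc k < m then c (Suc k) else 0))"
        by (simp add: m)
      finally show ?thesis by (simp only: c'_def right_diff_distrib sum_subtractf)
    qed
    moreover have "c' j = 1" using c(2) c(3)[of j] j by (simp add: c'_def)
    moreover have "c' k = 0" if "k < j" for k using c(3)[of k] c(3)[of "Suc k"] that j by (simp add: c'_def)
    ultimately show ?case by blast
  qed
qed

definition Qs :: "nat \<Rightarrow> (nat \<times> nat) set" where "Qs m = (SIGMA i:{..<m}. {i<..<m})"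

text \<open>Multiplying the Vandermonde matrix by the unitriangular matrix from
  \<open>vandermonde_coeffs\<close> makes it upper triangular: an entry \<open>(i, j)\<close> with
  \<open>i > j\<close> contains the zero factor \<open>l = i\<close>.\<close>

lemma vand_product: "vand m = (\<Prod>(i, l)\<in>Qs m. upow i 1 - upow l 1)"
proof -
  have "\<forall>j\<in>{..<m}. \<exists>c. (\<forall>i. (\<Prod>l\<in>{j<..<m}. upow i 1 - upow l 1) = (\<Sum>k<m. upow i (int m - 1 - int k) * c k)) \<and> c j = 1 \<and> (\<forall>k<j. c k = 0)"
    by (intro ballI vandermonde_coeffs) simp
  from bchoice[OF this] obtain C where CC: "\<forall>j\<in>{..<m}. (\<forall>i. (\<Prod>l\<in>{j<..<m}. upow i 1 - upow l 1) = (\<Sum>k<m. upow i (int m - 1 - int k) * C j k)) \<and> C j j = 1 \<and> (\<forall>k<j. C j k = 0)"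
    by (elim exE)
  have CC': "(\<forall>i. (\<Prod>l\<in>{j<..<m}. upow i 1 - upow l 1) = (\<Sum>k<m. upow i (int m - 1 - int k) * C j k)) \<and> C j j = 1 \<and> (\<forall>k<j. C j k = 0)"
    if "j < m" for j by (rule bspec[OF CC]) (use that in simp)
  have C: "(\<Prod>l\<in>{j<..<m}. upow i 1 - upow l 1) = (\<Sum>k<m. upow i (int m - 1 - int k) * C j k)" if "j < m" for i j
    using conjunct1[OF CC'[OF that]] by (rule spec)
  have C1: "C j j = 1" if "j < m" for j
    by (rule conjunct1[OF conjunct2[OF CC'[OF that]]])
  have C0: "C j k = 0" if "j < m" "k < j" for j k
    using conjunct2[OF conjunct2[OF CC'[OF that(1)]]] that(2) by simp
  let ?V = "mat m m (\<lambda>(i, j). upow i (dl m ! j))" and ?C = "mat m m (\<lambda>(k, j). C j k)"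
  let ?U = "mat m m (\<lambda>(i, j). \<Prod>l\<in>{j<..<m}. upow i 1 - upow l 1)"
  have "?U = ?V * ?C"
    by (rule eq_matI) (auto simp: C scalar_prod_def dl_def atLeast0LessThan intro!: sum.cong)
  then have "det ?U = vand m * det ?C"
    unfolding alternant_def length_dl by (simp add: det_mult[of _ m])
  moreover have "det ?C = 1"
    by (subst det_lower_triangular[of m]) (auto simp: C0 C1 prod_list_diag_prod)
  moreover have "det ?U = (\<Prod>i<m. \<Prod>l\<in>{i<..<m}. upow i 1 - upow l 1)"
  proof -
    have "upper_triangular ?U" by (intro upper_triangularI) (auto intro!: prod_zero bexI)
    then show ?thesis by (subst det_upper_triangular[of _ m]) (auto simp: prod_list_diag_prod atLeast0LessThan)
  qed
  ultimately show ?thesis by (simp add: Qs_def prod.Sigma)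
qed

section \<open>Euler operators \<open>u_k d/du_k\<close> on the Weyl denominator\<close>

definition th :: "nat \<Rightarrow> laurent \<Rightarrow> laurent" where
  "th k P = Poly_Mapping.mapp (\<lambda>e c. lk (fst e) k * c) P"

lemma lookup_th: "lk (th k P) e = lk (fst e) k * lk P e"
  by (simp add: th_def lookup_mapp when_def in_keys_iff)

lemma conv_superset: "finite S \<Longrightarrow> ky P \<subseteq> S \<Longrightarrow> conv P H d = (\<Sum>e\<in>S. of_int (lk P e) * H (d - e))"
  unfolding conv_def by (rule sum_keys_superset[where h = "\<lambda>e c. of_int c * H (d - e)"]) auto

lemma th_conv:
  "of_int (lk (fst d) k) * conv P H d = conv (th k P) H d + conv P (\<lambda>e. of_int (lk (fst e) k) * H e) d"
proof -
  have "ky (th k P) \<subseteq> ky P" by (auto simp: in_keys_iff lookup_th)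
  then have "conv (th k P) H d = (\<Sum>e\<in>ky P. of_int (lk (th k P) e) * H (d - e))" by (rule conv_superset[OF finite_keys])
  then show ?thesis
    unfolding conv_def[of P] sum_distrib_left sum.distrib[symmetric]
    by (simp add: lookup_th lookup_minus sum.distrib[symmetric] algebra_simps)
qed

lemma th_mult: "th k (P * Q) = th k P * Q + P * th k Q"
proof (rule poly_mapping_eqI)
  fix d
  have *: "(\<lambda>e. of_int (lk (fst e) k) * lk Q e) = lk (th k Q)" by (simp add: lookup_th fun_eq_iff)
  have "lk (th k (P * Q)) d = of_int (lk (fst d) k) * conv P (lk Q) d" by (simp add: lookup_th conv_lookup)
  also have "\<dots> = conv (th k P) (lk Q) d + conv P (lk (th k Q)) d"
    by (simp only: th_conv *)
  finally show "lk (th k (P * Q)) d = lk (th k P * Q + P * th k Q) d" by (simp add: conv_lookup lookup_add)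
qed

lemma th_1 [simp]: "th k 1 = 0"
  by (rule poly_mapping_eqI) (auto simp: lookup_th lookup_one when_def)

lemma th_prod: "finite S \<Longrightarrow> th k (\<Prod>x\<in>S. f x) = (\<Sum>x\<in>S. th k (f x) * (\<Prod>y\<in>S - {x}. f y))"
proof (induction S rule: finite_induct)
  case (insert x S)
  have "(\<Sum>y\<in>S. th k (f y) * (\<Prod>z\<in>insert x S - {y}. f z)) = (\<Sum>y\<in>S. f x * (th k (f y) * (\<Prod>z\<in>S - {y}. f z)))"
  proof (rule sum.cong[OF refl])
    fix y assume "y \<in> S"
    then have "insert x S - {y} = insert x (S - {y})" using insert by auto
    then show "th k (f y) * (\<Prod>z\<in>insert x S - {y}. f z) = f x * (th k (f y) * (\<Prod>z\<in>S - {y}. f z))"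
      using insert by (simp add: mult_ac)
  qed
  moreover have "insert x S - {x} = S" using insert by auto
  ultimately show ?case using insert by (simp add: th_mult sum_distrib_left)
qed simp

lemma th_diff_upow: "th k (upow i 1 - upow j 1) = (if k = i then upow i 1 else 0) - (if k = j then upow j 1 else 0)"
  by (rule poly_mapping_eqI) (auto simp: lookup_th lookup_minus upow_def lookup_single when_def frag_of_eq)

text \<open>The Weyl denominator divided by \<open>u_i - u_j\<close>, for either order of
  \<open>i\<close> and \<open>j\<close> (\<open>Vq_mult\<close>).\<close>

definition Vq :: "nat \<Rightarrow> nat \<Rightarrow> nat \<Rightarrow> laurent" where
  "Vq m i j = (if i < j then \<Prod>(a, b)\<in>Qs m - {(i, j)}. upow a 1 - upow b 1
     else - (\<Prod>(a, b)\<in>Qs m - {(j, i)}. upow a 1 - upow b 1))"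

lemma finite_Qs [simp]: "finite (Qs m)" by (simp add: Qs_def)

lemma Vq_antisym: "i \<noteq> j \<Longrightarrow> Vq m j i = - Vq m i j"
  by (auto simp: Vq_def)

lemma Vq_mult: "i < m \<Longrightarrow> j < m \<Longrightarrow> i \<noteq> j \<Longrightarrow> Vq m i j * (upow i 1 - upow j 1) = vand m"
proof -
  have *: "(upow i 1 - upow j 1) * (\<Prod>(a, b)\<in>Qs m - {(i, j)}. upow a 1 - upow b 1) = vand m" if "i < j" "j < m" for i j
    using that prod.remove[of "Qs m" "(i, j)" "\<lambda>(a, b). upow a 1 - upow b 1"] by (simp add: vand_product Qs_def)
  assume a: "i < m" "j < m" "i \<noteq> j"
  show ?thesis
  proof (cases "i < j")
    case True then show ?thesis using *[of i j] a by (simp add: Vq_def mult.commute)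
  next
    case False then show ?thesis using *[of j i] a by (simp add: Vq_def algebra_simps)
  qed
qed

text \<open>Logarithmic derivative of the product formula: each factor containing \<open>u_k\<close>
  contributes \<open>u_k\<close> times the product of the other factors, with the sign that
  \<open>Vq\<close> records.\<close>

lemma th_vand:
  assumes "k < m"
  shows "th k (vand m) = (\<Sum>j\<in>{..<m} - {k}. upow k 1 * Vq m k j)"
proof -
  let ?P = "\<lambda>i j. \<Prod>(a, b)\<in>Qs m - {(i, j)}. upow a 1 - upow b 1"
  have "th k (vand m) = (\<Sum>(i, j)\<in>Qs m. ((if k = i then upow i 1 else 0) - (if k = j then upow j 1 else 0)) * ?P i j)"
    unfolding vand_product th_prod[OF finite_Qs] by (rule sum.cong) (auto simp: th_diff_upow)
  also have "\<dots> = (\<Sum>(i, j)\<in>Qs m. if k = i then upow k 1 * ?P k j else 0) - (\<Sum>(i, j)\<in>Qs m. if k = j then upow k 1 * ?P i k else 0)"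
    unfolding sum_subtractf[symmetric] by (rule sum.cong) (auto simp: left_diff_distrib)
  also have "(\<Sum>(i, j)\<in>Qs m. if k = i then upow k 1 * ?P k j else 0) = (\<Sum>j\<in>{k<..<m}. upow k 1 * ?P k j)"
  proof -
    have "(\<Sum>(i, j)\<in>Qs m. if k = i then upow k 1 * ?P k j else 0) = (\<Sum>i<m. \<Sum>j\<in>{i<..<m}. if k = i then upow k 1 * ?P k j else 0)"
      unfolding Qs_def by (subst sum.Sigma) auto
    also have "\<dots> = (\<Sum>i<m. if k = i then \<Sum>j\<in>{k<..<m}. upow k 1 * ?P k j else 0)"
      by (rule sum.cong) auto
    finally show ?thesis using assms by simp
  qed
  also have "(\<Sum>(i, j)\<in>Qs m. if k = j then upow k 1 * ?P i k else 0) = (\<Sum>i<k. upow k 1 * ?P i k)"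
  proof -
    have "(\<Sum>(i, j)\<in>Qs m. if k = j then upow k 1 * ?P i k else 0) = (\<Sum>i<m. \<Sum>j\<in>{i<..<m}. if k = j then upow k 1 * ?P i k else 0)"
      unfolding Qs_def by (subst sum.Sigma) auto
    also have "\<dots> = (\<Sum>i<m. if i < k then upow k 1 * ?P i k else 0)"
      using assms by (intro sum.cong) auto
    also have "\<dots> = (\<Sum>i<k. upow k 1 * ?P i k)"
      using assms by (subst sum.inter_filter[symmetric]) (auto intro!: sum.cong)
    finally show ?thesis .
  qed
  also have "(\<Sum>j\<in>{k<..<m}. upow k 1 * ?P k j) - (\<Sum>i<k. upow k 1 * ?P i k)
     = (\<Sum>j\<in>{k<..<m}. upow k 1 * Vq m k j) + (\<Sum>j<k. upow k 1 * Vq m k j)"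
    by (simp add: Vq_def sum_negf)
  also have "\<dots> = (\<Sum>j\<in>{k<..<m} \<union> {..<k}. upow k 1 * Vq m k j)"
    by (rule sum.union_disjoint[symmetric]) auto
  also have "{k<..<m} \<union> {..<k} = {..<m} - {k}" using assms by auto
  finally show ?thesis .
qed

lemma keys_vand: "e \<in> ky (vand m) \<Longrightarrow> \<exists>p. p permutes {..<m} \<and> e = pe p (dlt m)"
proof (rule ccontr)
  assume e: "e \<in> ky (vand m)" and n: "\<nexists>p. p permutes {..<m} \<and> e = pe p (dlt m)"
  have "lk (vand m) e = (\<Sum>p | p permutes {..<m}. sign p * (if e = pe p (dlt m) then 1 else 0))"
    by (auto simp: alternant_eq_sum lookup_sum lookup_of_int_mult lookup_single when_def intro!: sum.cong simp del: pe_pair)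
  also have "\<dots> = 0" using n by (intro sum.neutral) auto
  finally show False using e by (simp add: in_keys_iff)
qed

definition nsq :: "nat \<Rightarrow> expo \<Rightarrow> int" where "nsq m d = (\<Sum>i<m. (lk (fst d) i)\<^sup>2)"

lemma nsq_pe: assumes "p permutes {..<m}" shows "nsq m (pe p d) = nsq m d"
proof (cases d)
  case (Pair a b)
  then show ?thesis using sum.permute[OF assms, of "\<lambda>i. (lk a i)\<^sup>2"]
    by (simp add: nsq_def comp_def lookup_map_key_inj[OF permutes_inj[OF assms]])
qed

text \<open>All exponents of \<open>vand m\<close> are rearrangements of \<open>\<delta>\<close> and
  have the same norm, so the denominator is an eigenvector of the sum of the squared Euler
  operators.\<close>

lemma th_th_vand: "(\<Sum>i<m. th i (th i (vand m))) = of_int (nsq m (dlt m)) * vand m"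
proof (rule poly_mapping_eqI)
  fix e
  have "lk (\<Sum>i<m. th i (th i (vand m))) e = nsq m e * lk (vand m) e"
    by (simp add: lookup_sum lookup_th nsq_def sum_distrib_right power2_eq_square mult.assoc)
  also have "\<dots> = nsq m (dlt m) * lk (vand m) e"
  proof (cases "e \<in> ky (vand m)")
    case True
    then obtain p where "p permutes {..<m}" "e = pe p (dlt m)" using keys_vand by blast
    then show ?thesis using nsq_pe by metis
  qed (simp add: in_keys_iff)
  finally show "lk (\<Sum>i<m. th i (th i (vand m))) e = lk (of_int (nsq m (dlt m)) * vand m) e"
    by (simp only: lookup_of_int_mult)
qed

section \<open>The radial part of the quadratic Casimir operator\<close>

text \<open>For \<open>d = \<lambda> + \<delta>\<close> this equals
  \<open>\<Sum>i. \<lambda>_i (\<lambda>_i + m - 1 - 2 i)\<close>, the eigenvalue of the Casimir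
  operator \<open>\<Sum>i j. E_ij E_ji\<close> at highest weight \<open>\<lambda>\<close>.\<close>

definition Lam :: "nat \<Rightarrow> expo \<Rightarrow> int" where
  "Lam m d = nsq m d - nsq m (dlt m) - (int m - 1) * (tot m d - tot m (dlt m))"

lemma conv_upow: "conv (upow i 1) H d = H (d - (sg i 1, 0))"
  by (simp add: upow_def conv_single)

lemma conv_diff_left: "conv (P - Q) H d = conv P H d - conv Q H d"
  using conv_add[of P "- Q" H d] conv_of_int_mult[of "-1" Q H d] by simp

text \<open>Here \<open>h\<close> plays the role of a character and \<open>t i j d\<close> that of
  the trace of \<open>E_ij E_ji\<close> in degree \<open>d\<close>; \<open>cyc\<close> is cyclicity
  of the trace and \<open>com\<close> the commutator \<open>E_ii - E_jj\<close>. Together they give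
  \<open>(u_i - u_j) t_ij = u_i (\<theta>_i - \<theta>_j) h\<close> with Euler operators
  \<open>\<theta>\<close>, which can be solved after multiplication by the Weyl denominator. The
  outcome is Harish-Chandra's radial part: on numerators the Casimir operator is multiplication by a
  quadratic polynomial in the exponent.\<close>

lemma casimir_conv:
  fixes h :: "expo \<Rightarrow> 'a::comm_ring_1" and t :: "nat \<Rightarrow> nat \<Rightarrow> expo \<Rightarrow> 'a"
  assumes cyc: "\<And>i j d. i < m \<Longrightarrow> j < m \<Longrightarrow> i \<noteq> j \<Longrightarrow> t i j (d - (sg j 1, 0)) = t j i (d - (sg i 1, 0))"
    and com: "\<And>i j d. i < m \<Longrightarrow> j < m \<Longrightarrow> i \<noteq> j \<Longrightarrow> t i j d - t j i d = of_int (lk (fst d) i - lk (fst d) j) * h d"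
  shows "conv (vand m) (\<lambda>d. (\<Sum>i<m. of_int (lk (fst d) i) * (of_int (lk (fst d) i) * h d)) + (\<Sum>i<m. \<Sum>j\<in>{..<m} - {i}. t i j d)) d
    = of_int (Lam m d) * conv (vand m) h d"
proof -
  define \<theta> where "\<theta> i H = (\<lambda>d. of_int (lk (fst d) i) * (H d :: 'a))" for i and H :: "expo \<Rightarrow> 'a"
  have th_conv': "\<theta> k (conv P H) = (\<lambda>d. conv (th k P) H d + conv P (\<theta> k H) d)" for k P H
    by (auto simp: \<theta>_def th_conv)
  have key: "conv (vand m) (t i j) d = conv (Vq m i j * upow i 1) (\<theta> i h) d - conv (Vq m i j * upow i 1) (\<theta> j h) d"
    if ij: "i < m" "j < m" "i \<noteq> j" for i j d
  proof -
    have 1: "conv (upow i 1 - upow j 1) (t i j) = conv (upow i 1) (\<lambda>e. \<theta> i h e - \<theta> j h e)"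
    proof
      fix d
      have "conv (upow i 1 - upow j 1) (t i j) d = t i j (d - (sg i 1, 0)) - t j i (d - (sg i 1, 0))"
        using cyc[OF ij, of d] by (simp add: conv_diff_left conv_upow)
      then show "conv (upow i 1 - upow j 1) (t i j) d = conv (upow i 1) (\<lambda>e. \<theta> i h e - \<theta> j h e) d"
        using com[OF ij] by (simp add: conv_upow \<theta>_def left_diff_distrib)
    qed
    have "conv (vand m) (t i j) d = conv (Vq m i j) (conv (upow i 1 - upow j 1) (t i j)) d"
      by (simp only: Vq_mult[OF ij, symmetric] conv_mult)
    then show ?thesis by (simp only: 1 conv_mult[symmetric] conv_right_diff)
  qed
  have T: "(\<Sum>i<m. \<Sum>j\<in>{..<m} - {i}. conv (vand m) (t i j) d)
     = (\<Sum>i<m. \<Sum>j\<in>{..<m} - {i}. conv (Vq m i j * (upow i 1 + upow j 1)) (\<theta> i h) d)" for d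
  proof -
    have "(\<Sum>i<m. \<Sum>j\<in>{..<m} - {i}. conv (vand m) (t i j) d) =
      (\<Sum>i<m. \<Sum>j\<in>{..<m} - {i}. conv (Vq m i j * upow i 1) (\<theta> i h) d) - (\<Sum>i<m. \<Sum>j\<in>{..<m} - {i}. conv (Vq m i j * upow i 1) (\<theta> j h) d)"
      unfolding sum_subtractf[symmetric] by (intro sum.cong refl key) auto
    also have "(\<Sum>i<m. \<Sum>j\<in>{..<m} - {i}. conv (Vq m i j * upow i 1) (\<theta> j h) d)
      = (\<Sum>j<m. \<Sum>i\<in>{..<m} - {j}. conv (Vq m i j * upow i 1) (\<theta> j h) d)"
    proof -
      have "(\<Sum>i<m. \<Sum>j\<in>{..<m} - {i}. g i j) = (\<Sum>j<m. \<Sum>i\<in>{..<m} - {j}. g i j)" for g :: "nat \<Rightarrow> nat \<Rightarrow> 'a"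
      proof -
        have e1: "(\<Sum>j\<in>{..<m} - {i}. g i j) = (\<Sum>j<m. if i \<noteq> j then g i j else 0)" for i
          by (subst sum.inter_filter[symmetric]) (auto intro!: sum.cong)
        have e2: "(\<Sum>i\<in>{..<m} - {j}. g i j) = (\<Sum>i<m. if i \<noteq> j then g i j else 0)" for j
          by (subst sum.inter_filter[symmetric]) (auto intro!: sum.cong)
        show ?thesis unfolding e1 e2 by (rule sum.swap)
      qed
      then show ?thesis .
    qed
    also have "\<dots> = (\<Sum>i<m. \<Sum>j\<in>{..<m} - {i}. - conv (Vq m i j * upow j 1) (\<theta> i h) d)"
    proof (intro sum.cong refl)
      fix i j assume "j \<in> {..<m} - {i}"
      then have "Vq m j i * upow j 1 = of_int (-1) * (Vq m i j * upow j 1)" by (subst Vq_antisym[of i j]) auto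
      then show "conv (Vq m j i * upow j 1) (\<theta> i h) d = - conv (Vq m i j * upow j 1) (\<theta> i h) d"
        by (simp only: conv_of_int_mult) simp
    qed
    finally show ?thesis
      by (simp add: sum_negf distrib_left conv_add sum.distrib)
  qed
  have V2: "(\<Sum>j\<in>{..<m} - {i}. conv (Vq m i j * (upow i 1 + upow j 1)) H d) = 2 * conv (th i (vand m)) H d - (of_nat m - 1) * conv (vand m) H d"
    if i: "i < m" for i d and H :: "expo \<Rightarrow> 'a"
  proof -
    have "conv (Vq m i j * (upow i 1 + upow j 1)) H d = 2 * conv (upow i 1 * Vq m i j) H d - conv (vand m) H d"
      if "j \<in> {..<m} - {i}" for j
    proof -
      \<comment> \<open>Write \<open>u_i + u_j\<close> as \<open>2 u_i - (u_i - u_j)\<close>; the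
        last bracket cancels the divisor in \<open>Vq\<close>.\<close>
      have "Vq m i j * (upow i 1 + upow j 1) = upow i 1 * Vq m i j + upow i 1 * Vq m i j - vand m"
        using that i by (subst Vq_mult[of i m j, symmetric]) (auto simp: algebra_simps)
      then show ?thesis by (simp only: conv_diff_left conv_add mult_2)
    qed
    then have "(\<Sum>j\<in>{..<m} - {i}. conv (Vq m i j * (upow i 1 + upow j 1)) H d)
      = (\<Sum>j\<in>{..<m} - {i}. 2 * conv (upow i 1 * Vq m i j) H d - conv (vand m) H d)"
      by (intro sum.cong refl) auto
    also have "\<dots> = 2 * (\<Sum>j\<in>{..<m} - {i}. conv (upow i 1 * Vq m i j) H d) - of_nat (card ({..<m} - {i})) * conv (vand m) H d"
      by (simp add: sum_subtractf sum_distrib_left)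
    also have "(\<Sum>j\<in>{..<m} - {i}. conv (upow i 1 * Vq m i j) H d) = conv (th i (vand m)) H d"
      by (simp add: th_vand[OF i] conv_sum)
    finally show ?thesis using i by (simp add: of_nat_diff)
  qed
  \<comment> \<open>The Leibniz rule applied twice; the cross term is exactly what \<open>V2\<close>
    supplies from the off-diagonal traces.\<close>
  have sq: "\<theta> i (\<theta> i (conv (vand m) h)) d = conv (th i (th i (vand m))) h d + 2 * conv (th i (vand m)) (\<theta> i h) d + conv (vand m) (\<theta> i (\<theta> i h)) d" for i
  proof -
    have "\<theta> i (\<theta> i (conv (vand m) h)) d = \<theta> i (conv (th i (vand m)) h) d + \<theta> i (conv (vand m) (\<theta> i h)) d"
      by (subst th_conv') (simp add: \<theta>_def distrib_left)
    then show ?thesis by (simp add: th_conv')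
  qed
  \<comment> \<open>The Euler operators add up to multiplication by total degree, which is constant
    on the exponents of the denominator.\<close>
  have totsum: "(\<Sum>i<m. conv (vand m) (\<theta> i h) d) = of_int (tot m d - tot m (dlt m)) * conv (vand m) h d"
  proof -
    have "(\<Sum>i<m. conv (vand m) (\<theta> i h) d) = conv (vand m) (\<lambda>e. of_int (tot m e) * h e) d"
      by (simp add: conv_right_sum[symmetric] \<theta>_def tot_def sum_distrib_right)
    also have "\<dots> = (\<Sum>e\<in>ky (vand m). of_int (lk (vand m) e) * (of_int (tot m d - tot m (dlt m)) * h (d - e)))"
      unfolding conv_def
    proof (rule sum.cong[OF refl])
      fix e assume "e \<in> ky (vand m)"
      then obtain p where "p permutes {..<m}" "e = pe p (dlt m)" using keys_vand by blast
      then have "tot m e = tot m (dlt m)" using tot_pe by metis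
      then show "of_int (lk (vand m) e) * (of_int (tot m (d - e)) * h (d - e)) = of_int (lk (vand m) e) * (of_int (tot m d - tot m (dlt m)) * h (d - e))"
        by (simp add: tot_diff)
    qed
    also have "\<dots> = of_int (tot m d - tot m (dlt m)) * conv (vand m) h d"
      unfolding conv_def sum_distrib_left by (simp add: mult.left_commute)
    finally show ?thesis .
  qed
  have "conv (vand m) (\<lambda>d. (\<Sum>i<m. of_int (lk (fst d) i) * (of_int (lk (fst d) i) * h d)) + (\<Sum>i<m. \<Sum>j\<in>{..<m} - {i}. t i j d)) d
    = (\<Sum>i<m. conv (vand m) (\<theta> i (\<theta> i h)) d) + (\<Sum>i<m. \<Sum>j\<in>{..<m} - {i}. conv (vand m) (t i j) d)"
    by (simp only: conv_right_add conv_right_sum \<theta>_def)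
  also have "\<dots> = (\<Sum>i<m. conv (vand m) (\<theta> i (\<theta> i h)) d + 2 * conv (th i (vand m)) (\<theta> i h) d) - (of_nat m - 1) * (\<Sum>i<m. conv (vand m) (\<theta> i h) d)"
    by (simp add: T V2 sum_subtractf sum.distrib sum_distrib_left)
  also have "(\<Sum>i<m. conv (vand m) (\<theta> i (\<theta> i h)) d + 2 * conv (th i (vand m)) (\<theta> i h) d)
    = (\<Sum>i<m. \<theta> i (\<theta> i (conv (vand m) h)) d) - (\<Sum>i<m. conv (th i (th i (vand m))) h d)"
    unfolding sum_subtractf[symmetric] by (rule sum.cong) (simp_all add: sq)
  also have "(\<Sum>i<m. conv (th i (th i (vand m))) h d) = of_int (nsq m (dlt m)) * conv (vand m) h d"
    by (simp only: conv_sum[symmetric] th_th_vand conv_of_int_mult)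
  also have "(\<Sum>i<m. \<theta> i (\<theta> i (conv (vand m) h)) d) = of_int (nsq m d) * conv (vand m) h d"
    by (simp add: \<theta>_def nsq_def sum_distrib_right power2_eq_square mult.assoc)
  finally show ?thesis
    by (simp add: totsum Lam_def algebra_simps)
qed

section \<open>Graded pieces and the action of the Casimir operator\<close>

global_interpretation fv: vspace "scl :: 'k::field \<Rightarrow> 'k fvec \<Rightarrow> 'k fvec"
  by unfold_locales (simp_all add: scl_add scl_scl)

lemma ksub_subspace: "ksub K \<longleftrightarrow> fv.subspace K"
  by (auto simp: ksub_def fv.subspace_def)

text \<open>Among the nonzero polynomials \<open>p\<close> with \<open>p(T) v0\<close> in
  \<open>K\<close> take one of least degree; it is not constant because \<open>v0\<close> is outside
  \<open>K\<close>. Splitting off a root \<open>c\<close> leaves \<open>p1\<close> with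
  \<open>p1(T) v0\<close> outside \<open>K\<close>, an eigenvector modulo \<open>K\<close>.\<close>

lemma (in vspace) eigenvector_mod:
  assumes closed: "\<And>p :: 'a poly. degree p > 0 \<Longrightarrow> \<exists>x. poly p x = 0"
    and L: "subspace L" "fd L" and K: "subspace K"
    and T: "Vector_Spaces.linear scale scale T" and TL: "\<And>x. x \<in> L \<Longrightarrow> T x \<in> L"
    and v0: "v0 \<in> L" "v0 \<notin> K"
  obtains c v where "v \<in> L" "v \<notin> K" "T v - scale c v \<in> K"
proof -
  interpret T: Vector_Spaces.linear scale scale T by fact
  define pT where "pT p = (\<Sum>i\<le>degree p. scale (coeff p i) ((T ^^ i) v0))" for p :: "'a poly"
  have pT_bound: "pT p = (\<Sum>i\<le>N. scale (coeff p i) ((T ^^ i) v0))" if "degree p \<le> N" for p N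
    unfolding pT_def by (rule sum.mono_neutral_left) (use that in \<open>auto simp: coeff_eq_0\<close>)
  have pT_add: "pT (p + p') = pT p + pT p'" for p p'
  proof -
    let ?N = "max (degree p) (degree p')"
    have "degree (p + p') \<le> ?N" by (rule degree_add_le) auto
    then show ?thesis
      by (simp add: pT_bound[of _ ?N] scale_left_distrib sum.distrib)
  qed
  have pT_smult: "pT (Polynomial.smult c p) = scale c (pT p)" for c p
    by (simp add: pT_bound[OF degree_smult_le] scale_sum_right) (simp add: pT_def scale_sum_right)
  have pT_pCons: "pT (pCons 0 p) = T (pT p)" for p
  proof -
    have "pT (pCons 0 p) = (\<Sum>i\<le>Suc (degree p). scale (coeff (pCons 0 p) i) ((T ^^ i) v0))"
      by (rule pT_bound) (rule degree_pCons_le)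
    also have "\<dots> = (\<Sum>i\<le>degree p. scale (coeff p i) (T ((T ^^ i) v0)))"
      by (subst sum.atMost_Suc_shift) simp
    finally show ?thesis by (simp add: pT_def T.sum T.scale)
  qed
  have pow: "(T ^^ i) v0 \<in> L" for i by (induction i) (use v0 TL in auto)
  have "\<exists>p. p \<noteq> 0 \<and> pT p = 0"
  proof (cases "inj_on (\<lambda>i. (T ^^ i) v0) {..dim L}")
    \<comment> \<open>A repeated power gives the polynomial \<open>X^i - X^j\<close>; in the other
      case \<open>dim L + 1\<close> distinct vectors of \<open>L\<close> are linearly
      dependent.\<close>
    case False
    then obtain i j where ij: "i \<noteq> j" "(T ^^ i) v0 = (T ^^ j) v0" by (auto simp: inj_on_def)
    have m: "pT (monom c l) = scale c ((T ^^ l) v0)" for c l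
    proof -
      have "pT (monom c l) = (\<Sum>k\<le>l. if k = l then scale c ((T ^^ l) v0) else 0)"
        by (subst pT_bound[OF degree_monom_le]) (rule sum.cong, auto)
      then show ?thesis by simp
    qed
    have "pT (monom 1 i + monom (- 1) j) = 0" by (simp add: pT_add m ij)
    moreover have "coeff (monom 1 i + monom (- 1) j) i \<noteq> (0::'a)" using ij by simp
    then have "monom 1 i + monom (- 1) j \<noteq> (0 :: 'a poly)" by fastforce
    ultimately show ?thesis by blast
  next
    case True
    let ?f = "\<lambda>i. (T ^^ i) v0" and ?S = "(\<lambda>i. (T ^^ i) v0) ` {..dim L}"
    have "card ?S = Suc (dim L)" using True by (simp add: card_image)
    have "dependent ?S"
    proof (rule ccontr)
      assume ind: "independent ?S"
      have "?S \<subseteq> span (bas L)" using pow bas(3)[of L] by blast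
      from independent_span_bound[OF finite_bas[OF L(2)] ind this] show False
        using \<open>card ?S = Suc (dim L)\<close> by (simp add: dim_bas)
    qed
    then obtain u x where u: "x \<in> ?S" "u x \<noteq> 0" "(\<Sum>x\<in>?S. scale (u x) x) = 0"
      using dependent_finite[of ?S] by auto
    define p where "p = (\<Sum>i\<le>dim L. monom (u (?f i)) i)"
    have cp: "coeff p i = (if i \<le> dim L then u (?f i) else 0)" for i
      by (simp add: p_def coeff_sum)
    have "degree p \<le> dim L" by (rule degree_le) (simp add: cp)
    then have "pT p = (\<Sum>i\<le>dim L. scale (u (?f i)) (?f i))" by (simp add: pT_bound cp)
    also have "\<dots> = (\<Sum>x\<in>?S. scale (u x) x)" by (simp add: sum.reindex[OF True])
    finally have "pT p = 0" using u(3) by simp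
    moreover obtain i where "i \<le> dim L" "x = ?f i" using u(1) by (elim imageE) simp
    then have "coeff p i \<noteq> 0" using u(2) by (simp add: cp)
    then have "p \<noteq> 0" by (metis coeff_0)
    ultimately show ?thesis by blast
  qed
  then have ex: "\<exists>p. p \<noteq> 0 \<and> pT p \<in> K" using subspace_0[OF K] by metis
  obtain p where p: "p \<noteq> 0" "pT p \<in> K" and mn: "\<And>p'. p' \<noteq> 0 \<Longrightarrow> pT p' \<in> K \<Longrightarrow> degree p \<le> degree p'"
    using ex_has_least_nat[of "\<lambda>p. p \<noteq> 0 \<and> pT p \<in> K" _ degree] ex by metis
  have "degree p > 0"
  proof (rule ccontr)
    assume "\<not> degree p > 0"
    then obtain a where a: "p = [:a:]" using degree_eq_zeroE by blast
    then have "a \<noteq> 0" "scale a v0 \<in> K" using p by (auto simp: pT_def)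
    then show False using subspace_scale[OF K, of "scale a v0" "inverse a"] v0(2) by simp
  qed
  then obtain c where "poly p c = 0" using closed by blast
  then obtain p1 where p1: "p = [:- c, 1:] * p1" by (auto simp: poly_eq_0_iff_dvd)
  have "p1 \<noteq> 0" using p p1 by auto
  then have "degree p = Suc (degree p1)" unfolding p1 by (subst degree_mult_eq) auto
  then have "pT p1 \<notin> K" using mn[OF \<open>p1 \<noteq> 0\<close>] by auto
  moreover have "pT p1 \<in> L" unfolding pT_def by (intro subspace_sum[OF L(1)] subspace_scale[OF L(1)] pow)
  moreover have "pT p = T (pT p1) - scale c (pT p1)"
  proof -
    have "p = Polynomial.smult (- c) p1 + pCons 0 p1" by (simp add: p1)
    then have "pT p = scale (- c) (pT p1) + T (pT p1)" by (simp only: pT_add pT_smult pT_pCons)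
    then show ?thesis by simp
  qed
  ultimately show ?thesis using that[of "pT p1" c] p(2) by simp
qed

text \<open>\<open>R_m \<otimes> V\<close> in coordinates: \<open>q\<close> is the dimension of
  \<open>V\<close> and \<open>w k\<close> the torus weight of its \<open>k\<close>-th basis vector.
  The number \<open>m\<close> of rows is a parameter of each notion because \<open>r\<close> and
  \<open>r + 1\<close> occur together.\<close>

locale fmod =
  fixes n q :: nat and w :: "nat \<Rightarrow> (nat \<Rightarrow>\<^sub>0 int)"
  assumes w: "\<And>k. ky (w k) \<subseteq> {..<n}"
begin

definition HD :: "expo \<Rightarrow> 'k::comm_ring_1 fvec set" where
  "HD d = {p. \<forall>k. hg (d - (0, w k)) (p k)}"

definition hd :: "'k::field fvec set \<Rightarrow> expo \<Rightarrow> nat" where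
  "hd W d = fv.dim (W \<inter> HD d)"

definition Estab :: "nat \<Rightarrow> 'k::comm_ring_1 fvec set \<Rightarrow> bool" where
  "Estab m W \<longleftrightarrow> (\<forall>i<m. \<forall>j<m. \<forall>p\<in>W. Eo n i j p \<in> W)"

lemma ksub_HD: "ksub (HD d)"
  by (auto simp: ksub_def HD_def scl_def intro: hg_add hg_scale)

lemma subspace_piece: "ksub W \<Longrightarrow> fv.subspace (W \<inter> HD d)"
  by (intro fv.subspace_inter) (auto simp: ksub_HD simp flip: ksub_subspace)

lemma ksub_FM: "ksub (FM n q m)"
  by (auto simp: ksub_def FM_def scl_def intro: cin_add cin_mult)

definition Idx :: "nat \<Rightarrow> expo \<Rightarrow> (nat \<times> xmonom) set" where
  "Idx m d = {(k, mo). k < q \<and> mo \<in> monoms m n \<and> mdeg mo + (0, w k) = d}"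

lemma lookup_fst_mdeg_ge: "int (lk mo (i, j)) \<le> lk (fst (mdeg mo)) i"
proof -
  have "fst (\<Sum>x\<in>S. (sg (fst x) (int (lk mo x)), sg (snd x) (int (lk mo x)))) = (\<Sum>x\<in>S. sg (fst x) (int (lk mo x)))" for S
    by (induction S rule: infinite_finite_induct) auto
  then have "lk (fst (mdeg mo)) i = (\<Sum>x\<in>ky mo. if fst x = i then int (lk mo x) else 0)"
    by (simp add: mdeg_def lookup_sum lookup_single when_def)
  also have "\<dots> \<ge> int (lk mo (i, j))"
  proof (cases "(i, j) \<in> ky mo")
    case True
    then show ?thesis using member_le_sum[of "(i, j)" "ky mo" "\<lambda>x. if fst x = i then int (lk mo x) else 0"] by auto
  next
    case False
    then show ?thesis by (auto simp: in_keys_iff intro: sum_nonneg)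
  qed
  finally show ?thesis .
qed

text \<open>Each exponent in row \<open>i\<close> is at most the degree in \<open>u_i\<close>, so a
  bidegree contains finitely many monomials.\<close>

lemma finite_Idx: "finite (Idx m d)"
proof -
  let ?N = "\<Sum>i<m. nat (lk (fst d) i)"
  have "Idx m d \<subseteq> {..<q} \<times> {mo. ky mo \<subseteq> {..<m} \<times> {..<n} \<and> (\<forall>x\<in>{..<m} \<times> {..<n}. lk mo x \<in> {..?N})}"
  proof
    fix x assume "x \<in> Idx m d"
    then obtain k mo where x: "x = (k, mo)" "k < q" "mo \<in> monoms m n" "mdeg mo + (0, w k) = d" by (auto simp: Idx_def)
    have "lk mo (i, j) \<le> ?N" if "i < m" for i j
    proof -
      have "fst d = fst (mdeg mo)" using x(4) by (metis add.right_neutral fst_add fst_conv)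
      then have "lk mo (i, j) \<le> nat (lk (fst d) i)" using lookup_fst_mdeg_ge[of mo i j] by simp
      also have "\<dots> \<le> ?N" using that by (intro member_le_sum) auto
      finally show ?thesis .
    qed
    then show "x \<in> {..<q} \<times> {mo. ky mo \<subseteq> {..<m} \<times> {..<n} \<and> (\<forall>x\<in>{..<m} \<times> {..<n}. lk mo x \<in> {..?N})}"
      using x by (auto simp: monoms_def)
  qed
  then show ?thesis
    by (rule finite_subset) (intro finite_cartesian_product finite_bounded_poly_mapping, auto)
qed

lemma lookup_xconst_scl: "lk (scl c p k) mo = c * lk (p k) mo"
  by (simp add: scl_def lookup_xconst_mult)

lemma piece_eq_0:
  assumes "p \<in> FM n q m \<inter> HD d" "\<And>k mo. (k, mo) \<in> Idx m d \<Longrightarrow> lk (p k) mo = 0"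
  shows "p = 0"
proof (rule ext, rule poly_mapping_eqI)
  fix k mo
  have "(k, mo) \<in> Idx m d" if "lk (p k) mo \<noteq> 0"
  proof -
    have "k < q" using that assms(1) by (force simp: FM_def not_less[symmetric])
    moreover have "mo \<in> ky (p k)" using that by (simp add: in_keys_iff)
    then have "mo \<in> monoms m n" "mdeg mo = d - (0, w k)" using assms(1) by (auto simp: FM_def cin_def HD_def hg_def)
    ultimately show ?thesis by (simp add: Idx_def)
  qed
  then show "lk (p k) mo = lk ((0 :: 'a fvec) k) mo" using assms(2) by (cases "lk (p k) mo = 0") auto
qed

lemma dim_piece_leading:
  fixes less :: "nat \<times> xmonom \<Rightarrow> nat \<times> xmonom \<Rightarrow> bool"
  assumes "ksub W" "W \<subseteq> FM n q m"
    and ord: "\<And>s t. s \<in> Idx m d \<Longrightarrow> t \<in> Idx m d \<Longrightarrow> s \<noteq> t \<Longrightarrow> less s t \<noteq> less t s"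
      "\<And>s t u. less s t \<Longrightarrow> less t u \<Longrightarrow> less s u" "\<And>s. \<not> less s s"
  shows "fv.dim (W \<inter> HD d) = card {s \<in> Idx m d. \<exists>x\<in>W \<inter> HD d. lk (x (fst s)) (snd s) \<noteq> 0 \<and> (\<forall>t\<in>Idx m d. less s t \<longrightarrow> lk (x (fst t)) (snd t) = 0)}
     \<and> fv.fd (W \<inter> HD d)"
proof (rule fv.dim_leading[OF finite_Idx subspace_piece[OF assms(1)]])
  show "x = 0" if x: "x \<in> W \<inter> HD d" and z: "\<And>s. s \<in> Idx m d \<Longrightarrow> lk (x (fst s)) (snd s) = 0" for x
  proof (rule piece_eq_0[of x m d])
    show "x \<in> FM n q m \<inter> HD d" using x assms(2) by auto
    show "lk (x k) mo = 0" if "(k, mo) \<in> Idx m d" for k mo using z[OF that] by simp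
  qed
  show "less s u" if "less s t" "less t u" for s t u by (rule ord(2)[OF that])
qed (simp_all add: lookup_add lookup_xconst_scl ord)

lemma fd_piece:
  assumes "ksub W" "W \<subseteq> FM n q m"
  shows "fv.fd (W \<inter> HD d)"
proof -
  \<comment> \<open>Only finiteness of the dimension is at stake, so any injection into the naturals
    serves as the order.\<close>
  obtain f :: "nat \<times> xmonom \<Rightarrow> nat" where f: "inj_on f (Idx m d)"
    using finite_imp_inj_to_nat_seg[OF finite_Idx] by blast
  show ?thesis
  proof (rule dim_piece_leading[OF assms, of d "\<lambda>s t. f s < f t", THEN conjunct2])
    show "(f s < f t) \<noteq> (f t < f s)" if "s \<in> Idx m d" "t \<in> Idx m d" "s \<noteq> t" for s t
      using inj_on_eq_iff[OF f that(1,2)] that(3) by linarith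
  qed auto
qed

lemma hd_gdeg:
  assumes "W \<subseteq> FM n q m" "ksub W" "hd W d \<noteq> 0"
  shows "gdeg m n d"
proof (rule ccontr)
  assume ng: "\<not> gdeg m n d"
  have "Idx m d = {}"
  proof (rule ccontr)
    assume "Idx m d \<noteq> {}"
    then obtain k mo where km: "k < q" "mo \<in> monoms m n" "mdeg mo + (0, w k) = d" by (auto simp: Idx_def)
    have 1: "gdeg m n (mdeg mo)" by (rule mdeg_gdeg[OF km(2)])
    have 2: "gdeg m n (0, w k)" using w[of k] by (simp add: gdeg_def nnexp_def)
    show False using gdeg_add[OF 1 2] km(3) ng by simp
  qed
  then have "W \<inter> HD d \<subseteq> {0}" using piece_eq_0[of _ m d] assms(1) by blast
  then have "W \<inter> HD d = {0}" using fv.subspace_0[OF subspace_piece[OF assms(2), of d]] by blast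
  then have "hd W d = 0" unfolding hd_def by (simp only:) (rule fv.dim_unique[of "{}"], auto simp: fv.independent_empty)
  then show False using assms(3) by simp
qed

lemma Eo_HD:
  assumes "p \<in> FM n q m \<inter> HD d"
  shows "Eo n i j p \<in> HD (d + shift i j)"
proof -
  have "hg (d + shift i j - (0, w k)) (Eop n i j (p k))" for k
  proof -
    have "hg (d - (0, w k) + shift i j) (Eop n i j (p k))"
      by (rule Eop_hg[of _ _ m]) (use assms in \<open>auto simp: HD_def FM_def\<close>)
    then show ?thesis by (simp add: algebra_simps)
  qed
  then show ?thesis by (simp add: HD_def Eo_def)
qed

lemma Eo_piece:
  assumes "W \<subseteq> FM n q m" "Estab m W" "i < m" "j < m" "p \<in> W \<inter> HD d"
  shows "Eo n i j p \<in> W \<inter> HD (d + shift i j)"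
  using assms Eo_HD[of p m d i j] by (auto simp: Estab_def)

lemma Eo_diag:
  assumes "p \<in> FM n q m \<inter> HD d"
  shows "Eo n i i p = scl (of_int (lk (fst d) i)) p"
proof
  fix k
  have "Eop n i i (p k) = xconst (of_int (lk (fst (d - (0, w k))) i)) * p k"
    by (rule Eop_diag[of _ _ m]) (use assms in \<open>auto simp: HD_def FM_def\<close>)
  then show "Eo n i i p k = scl (of_int (lk (fst d) i)) p k" by (simp add: Eo_def scl_def)
qed

lemma Eo_linear: "Vector_Spaces.linear scl scl (Eo n i j)"
  by (rule fv.linearI_scale) (simp_all add: Eo_add Eo_scl)

definition Om :: "nat \<Rightarrow> 'k::comm_ring_1 fvec \<Rightarrow> 'k fvec" where
  "Om m p = (\<Sum>i<m. \<Sum>j<m. Eo n i j (Eo n j i p))"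

lemma Eo_sum: "Eo n i j (\<Sum>x\<in>S. f x) = (\<Sum>x\<in>S. Eo n i j (f x))"
  by (induction S rule: infinite_finite_induct) (simp_all add: Eo_add del: plus_fun_apply zero_fun_apply)

lemma scl_zero [simp]: "scl c 0 = 0"
  by (simp add: scl_def fun_eq_iff)

lemma scl_sum: "scl c (\<Sum>x\<in>S. f x) = (\<Sum>x\<in>S. scl c (f x))"
  by (induction S rule: infinite_finite_induct) (simp_all add: scl_add del: plus_fun_apply zero_fun_apply)

lemma Om_linear: "Vector_Spaces.linear scl scl (Om m)"
  by (rule fv.linearI_scale) (simp_all add: Om_def Eo_add Eo_scl sum.distrib scl_sum)

lemma Om_add: "Om m (p + p') = Om m p + Om m p'" and Om_scl: "Om m (scl c p) = scl c (Om m p)"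
  by (simp_all add: Om_def Eo_add Eo_scl sum.distrib scl_sum)

lemma Eo_commutator:
  "Eo n i j (Eo n k l p) = Eo n k l (Eo n i j p) + ((if j = k then Eo n i l p else 0) - (if l = i then Eo n k j p else 0))"
  using Eop_commutator[of n i j k l] by (auto simp: Eo_def fun_eq_iff algebra_simps split: if_splits)

text \<open>Centrality of the quadratic Casimir element: the four families of commutator terms
  cancel in pairs after summation over \<open>i\<close> and \<open>j\<close>.\<close>

lemma Om_commute:
  assumes "k < m" "l < m"
  shows "Eo n k l (Om m p) = Om m (Eo n k l p)"
proof -
  have 1: "Eo n k l (Eo n i j (Eo n j i p)) = Eo n i j (Eo n j i (Eo n k l p))
     + ((if j = l then Eo n i j (Eo n k i p) else 0) - (if i = k then Eo n i j (Eo n j l p) else 0)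
     + ((if i = l then Eo n k j (Eo n j i p) else 0) - (if j = k then Eo n i l (Eo n j i p) else 0)))" for i j
    by (subst Eo_commutator, subst Eo_commutator[of k l j i p]) (auto simp: Eo_add Eo_diff)
  have A: "(\<Sum>i<m. \<Sum>j<m. if j = l then f i j else 0) = (\<Sum>i<m. f i l)" "(\<Sum>i<m. \<Sum>j<m. if j = k then f i j else 0) = (\<Sum>i<m. f i k)"
    "(\<Sum>i<m. \<Sum>j<m. if i = l then f i j else 0) = (\<Sum>j<m. f l j)" "(\<Sum>i<m. \<Sum>j<m. if i = k then f i j else 0) = (\<Sum>j<m. f k j)"
    for f :: "nat \<Rightarrow> nat \<Rightarrow> 'a fvec"
  proof -
    have "(\<Sum>j<m. if i = l then f i j else 0) = (if i = l then \<Sum>j<m. f l j else 0)" for i l by auto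
    then show "(\<Sum>i<m. \<Sum>j<m. if i = l then f i j else 0) = (\<Sum>j<m. f l j)" "(\<Sum>i<m. \<Sum>j<m. if i = k then f i j else 0) = (\<Sum>j<m. f k j)"
      using assms by simp_all
  qed (use assms in simp_all)
  show ?thesis
    unfolding Om_def Eo_sum 1 sum.distrib sum_subtractf A by simp
qed

lemma Om_piece:
  fixes p :: "'k::field fvec"
  assumes "W \<subseteq> FM n q m" "ksub W" "Estab m W" "p \<in> W \<inter> HD d"
  shows "Om m p \<in> W \<inter> HD d"
  unfolding Om_def
proof (intro fv.subspace_sum[OF subspace_piece[OF assms(2)]])
  fix i j assume ij: "i \<in> {..<m}" "j \<in> {..<m}"
  have "Eo n i j (Eo n j i p) \<in> W \<inter> HD (d + shift j i + shift i j)"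
    by (intro Eo_piece[OF assms(1,3)]) (use ij assms(4) in auto)
  then show "Eo n i j (Eo n j i p) \<in> W \<inter> HD d" by (simp add: shift_def add.assoc flip: zero_prod_def)
qed

lemma Om_stab: "ksub W \<Longrightarrow> Estab m W \<Longrightarrow> p \<in> W \<Longrightarrow> Om m p \<in> W"
  unfolding Om_def by (intro ksub_sum) (auto simp: Estab_def)

text \<open>Instance of \<open>casimir_conv\<close>; cyclicity applies because \<open>E_ji\<close>
  and \<open>E_ij\<close> map the pieces of degrees \<open>d - e_j\<close> and
  \<open>d - e_i\<close> to each other.\<close>

lemma casimir_trace:
  assumes W: "W \<subseteq> FM n q m" "ksub W" "Estab m W"
  shows "conv (vand m) (\<lambda>d. fv.trc (W \<inter> HD d) (Om m)) d = of_int (Lam m d) * conv (vand m) (\<lambda>d. of_nat (hd W d)) d"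
proof -
  define t where "t i j d = fv.trc (W \<inter> HD d) (\<lambda>x. Eo n i j (Eo n j i x))" for i j d
  have sp: "fv.subspace (W \<inter> HD d)" for d by (rule subspace_piece[OF W(2)])
  have inFM: "x \<in> FM n q m \<inter> HD d" if "x \<in> W \<inter> HD d" for x d using that W(1) by auto
  have mem: "Eo n i j (Eo n j i x) \<in> W \<inter> HD d" if "x \<in> W \<inter> HD d" "i < m" "j < m" for i j d x
  proof -
    have "Eo n i j (Eo n j i x) \<in> W \<inter> HD (d + shift j i + shift i j)"
      by (intro Eo_piece[OF W(1,3)] that)
    then show ?thesis by (simp add: shift_def add.assoc flip: zero_prod_def)
  qed
  have cyc: "t i j (d - (sg j 1, 0)) = t j i (d - (sg i 1, 0))" if ij: "i < m" "j < m" "i \<noteq> j" for i j d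
    unfolding t_def
  proof (rule fv.trc_cyc[OF sp fd_piece[OF W(2,1)] sp fd_piece[OF W(2,1)] Eo_linear _ Eo_linear])
    show "Eo n j i x \<in> W \<inter> HD (d - (sg i 1, 0))" if x: "x \<in> W \<inter> HD (d - (sg j 1, 0))" for x
    proof -
      have "d - (sg j 1, 0) + shift j i = d - (sg i 1, 0)" by (cases d) (simp add: shift_def)
      then show ?thesis using Eo_piece[OF W(1,3) ij(2,1) x] by metis
    qed
    show "Eo n i j x \<in> W \<inter> HD (d - (sg j 1, 0))" if x: "x \<in> W \<inter> HD (d - (sg i 1, 0))" for x
    proof -
      have "d - (sg i 1, 0) + shift i j = d - (sg j 1, 0)" by (cases d) (simp add: shift_def)
      then show ?thesis using Eo_piece[OF W(1,3) ij(1,2) x] by metis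
    qed
  qed
  have com: "t i j d - t j i d = of_int (lk (fst d) i - lk (fst d) j) * of_nat (hd W d)" if ij: "i < m" "j < m" "i \<noteq> j" for i j d
  proof -
    let ?c = "of_int (lk (fst d) i - lk (fst d) j) :: 'a"
    have "t i j d = fv.trc (W \<inter> HD d) (\<lambda>x. Eo n j i (Eo n i j x) + scl ?c x)"
      unfolding t_def
    proof (rule fv.trc_cong)
      fix x assume "x \<in> W \<inter> HD d"
      from Eo_diag[OF inFM[OF this]]
      show "Eo n i j (Eo n j i x) = Eo n j i (Eo n i j x) + scl ?c x"
        by (subst Eo_commutator) (simp add: scl_diff_left)
    qed
    also have "\<dots> = t j i d + fv.trc (W \<inter> HD d) (scl ?c)"
      unfolding t_def by (rule fv.trc_add[OF sp mem fv.subspace_scale[OF sp]]) (use ij in auto)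
    also have "fv.trc (W \<inter> HD d) (scl ?c) = ?c * of_nat (hd W d)"
      unfolding hd_def by (rule fv.trc_scale[OF sp]) simp
    finally show ?thesis by simp
  qed
  have tr: "fv.trc (W \<inter> HD d) (Om m) = (\<Sum>i<m. of_int (lk (fst d) i) * (of_int (lk (fst d) i) * of_nat (hd W d))) + (\<Sum>i<m. \<Sum>j\<in>{..<m} - {i}. t i j d)" for d
  proof -
    have "fv.trc (W \<inter> HD d) (Om m) = (\<Sum>i<m. \<Sum>j<m. t i j d)"
    proof -
      have "fv.trc (W \<inter> HD d) (Om m) = (\<Sum>i<m. fv.trc (W \<inter> HD d) (\<lambda>x. \<Sum>j<m. Eo n i j (Eo n j i x)))"
        unfolding Om_def[abs_def] by (rule fv.trc_sum[OF sp]) (rule fv.subspace_sum[OF sp], rule mem, simp_all)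
      moreover have "fv.trc (W \<inter> HD d) (\<lambda>x. \<Sum>j<m. Eo n i j (Eo n j i x)) = (\<Sum>j<m. t i j d)" if "i < m" for i
        unfolding t_def by (rule fv.trc_sum[OF sp], rule mem) (use that in simp_all)
      ultimately show ?thesis by simp
    qed
    also have "\<dots> = (\<Sum>i<m. t i i d + (\<Sum>j\<in>{..<m} - {i}. t i j d))"
      by (intro sum.cong refl sum.remove) auto
    also have "\<dots> = (\<Sum>i<m. of_int (lk (fst d) i) * (of_int (lk (fst d) i) * of_nat (hd W d)) + (\<Sum>j\<in>{..<m} - {i}. t i j d))"
    proof (intro sum.cong refl arg_cong2[where f = "(+)"])
      fix i
      have "t i i d = (of_int (lk (fst d) i) * of_int (lk (fst d) i)) * of_nat (hd W d)"
        unfolding t_def hd_def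
      proof (rule fv.trc_scale[OF sp])
        fix x assume "x \<in> W \<inter> HD d"
        from Eo_diag[OF inFM[OF this]] show "Eo n i i (Eo n i i x) = scl (of_int (lk (fst d) i) * of_int (lk (fst d) i)) x"
          by (simp add: Eo_scl scl_scl)
      qed
      then show "t i i d = of_int (lk (fst d) i) * (of_int (lk (fst d) i) * of_nat (hd W d))" by (simp add: mult.assoc)
    qed
    finally show ?thesis by (simp add: sum.distrib)
  qed
  show ?thesis unfolding tr by (rule casimir_conv[OF cyc com])
qed

end

section \<open>Vanishing of the isotypic components with many rows\<close>

text \<open>Elements of \<open>S\<close> at or beyond \<open>k\<close> are exchanged for the equally
  many missing ones below \<open>k\<close>; the value \<open>l k\<close> separates the two
  kinds.\<close>

lemma sum_decreasing_subset:
  fixes l :: "nat \<Rightarrow> int"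
  assumes dec: "\<And>i j. i \<le> j \<Longrightarrow> j < m \<Longrightarrow> l j \<le> l i" and S: "S \<subseteq> {..<m}" "card S = k"
  shows "(\<Sum>i\<in>S. l i) \<le> (\<Sum>i<k. l i)"
proof (cases "k < m")
  case False
  have "card S \<le> m" using card_mono[OF _ S(1)] by simp
  then have "k = m" using False S(2) by simp
  then have "S = {..<m}" using S card_subset_eq[of "{..<m}" S] by simp
  then show ?thesis using \<open>k = m\<close> by simp
next
  case True
  have fin: "finite S" using S(1) by (rule finite_subset) simp
  have c: "card (S - {..<k}) = card ({..<k} - S)"
    using S(2) fin card_Diff_subset_Int[of S "{..<k}"] card_Diff_subset_Int[of "{..<k}" S] by (simp add: Int_commute)
  have "(\<Sum>i\<in>S. l i) = (\<Sum>i\<in>S \<inter> {..<k}. l i) + (\<Sum>i\<in>S - {..<k}. l i)"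
    using fin by (metis sum.Int_Diff)
  also have "(\<Sum>i\<in>S - {..<k}. l i) \<le> of_nat (card (S - {..<k})) * l k"
    by (rule sum_bounded_above) (use dec S(1) in auto)
  also have "\<dots> = of_nat (card ({..<k} - S)) * l k" using c by simp
  also have "\<dots> \<le> (\<Sum>i\<in>{..<k} - S. l i)"
    by (rule sum_bounded_below) (use dec True in auto)
  also have "(\<Sum>i\<in>S \<inter> {..<k}. l i) + (\<Sum>i\<in>{..<k} - S. l i) = (\<Sum>i<k. l i)"
    by (metis Int_commute finite_lessThan sum.Int_Diff)
  finally show ?thesis by simp
qed

text \<open>Writing \<open>\<delta>_j\<close> as the number of \<open>k\<close> with
  \<open>j < k < m\<close> cuts the pairing into sums of \<open>l\<close> over the
  \<open>k\<close>-element sets \<open>{i. p i < k}\<close>, each at most the sum of the first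
  \<open>k\<close> values.\<close>

lemma rearrangement:
  fixes l :: "nat \<Rightarrow> int"
  assumes dec: "\<And>i j. i \<le> j \<Longrightarrow> j < m \<Longrightarrow> l j \<le> l i" and p: "p permutes {..<m}"
  shows "(\<Sum>i<m. l i * lk (fst (pe p (dlt m))) i) \<le> (\<Sum>i<m. l i * lk (fst (dlt m)) i)"
proof -
  have pi: "p i < m \<longleftrightarrow> i < m" for i using permutes_in_image[OF p] by auto
  have d: "int m - 1 - int j = (\<Sum>k<m. if j < k then 1 else 0)" if "j < m" for j
  proof -
    have "(\<Sum>k<m. if j < k then 1 else 0) = int (card {k \<in> {..<m}. j < k})"
      by (simp add: sum.If_cases Int_def)
    also have "{k \<in> {..<m}. j < k} = {j<..<m}" by auto
    finally show ?thesis using that by (simp add: of_nat_diff)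
  qed
  have L: "(\<Sum>i<m. l i * lk (fst (pe p (dlt m))) i) = (\<Sum>k<m. \<Sum>i\<in>{i \<in> {..<m}. p i < k}. l i)"
    if p: "p permutes {..<m}" for p
  proof -
    have pi: "p i < m \<longleftrightarrow> i < m" for i using permutes_in_image[OF p] by auto
    have "(\<Sum>i<m. l i * lk (fst (pe p (dlt m))) i) = (\<Sum>i<m. \<Sum>k<m. if p i < k then l i else 0)"
    proof (rule sum.cong[OF refl])
      fix i assume "i \<in> {..<m}"
      then have "lk (fst (pe p (dlt m))) i = (\<Sum>k<m. if p i < k then 1 else 0)"
        by (simp add: lookup_map_key_inj[OF permutes_inj[OF p]] lookup_ev_dl pi d)
      then have "l i * lk (fst (pe p (dlt m))) i = (\<Sum>k<m. l i * (if p i < k then 1 else 0))"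
        by (simp only: sum_distrib_left)
      also have "\<dots> = (\<Sum>k<m. if p i < k then l i else 0)" by (rule sum.cong) auto
      finally show "l i * lk (fst (pe p (dlt m))) i = (\<Sum>k<m. if p i < k then l i else 0)" .
    qed
    also have "\<dots> = (\<Sum>k<m. \<Sum>i<m. if p i < k then l i else 0)" by (rule sum.swap)
    also have "\<dots> = (\<Sum>k<m. \<Sum>i\<in>{i \<in> {..<m}. p i < k}. l i)"
      by (intro sum.cong refl sum.inter_filter[symmetric]) simp
    finally show ?thesis .
  qed
  have "(\<Sum>k<m. \<Sum>i\<in>{i \<in> {..<m}. p i < k}. l i) \<le> (\<Sum>k<m. \<Sum>i\<in>{i \<in> {..<m}. id i < k}. l i)"
  proof (rule sum_mono)
    fix k assume k: "k \<in> {..<m}"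
    have "card {i \<in> {..<m}. p i < k} = card (p ` {i \<in> {..<m}. p i < k})"
      by (rule card_image[symmetric]) (rule inj_on_subset[OF permutes_inj[OF p]], simp)
    also have "p ` {i \<in> {..<m}. p i < k} = {..<k}"
    proof
      show "{..<k} \<subseteq> p ` {i \<in> {..<m}. p i < k}"
      proof
        fix x assume x: "x \<in> {..<k}"
        then have "x \<in> p ` {..<m}" using k permutes_image[OF p] by auto
        then show "x \<in> p ` {i \<in> {..<m}. p i < k}" using x by auto
      qed
    qed auto
    finally have "card {i \<in> {..<m}. p i < k} = k" by simp
    then have "(\<Sum>i\<in>{i \<in> {..<m}. p i < k}. l i) \<le> (\<Sum>i<k. l i)"
      by (intro sum_decreasing_subset[where m = m]) (use dec in auto)
    moreover have "{i \<in> {..<m}. id i < k} = {..<k}" using k by auto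
    ultimately show "(\<Sum>i\<in>{i \<in> {..<m}. p i < k}. l i) \<le> (\<Sum>i\<in>{i \<in> {..<m}. id i < k}. l i)" by simp
  qed
  then show ?thesis using L[OF p] L[OF permutes_id] by (simp only: pe_id)
qed

context fmod
begin

text \<open>The exponents with all entries positive are those of partitions with \<open>m\<close>
  positive parts. A nonzero coefficient there would yield, in a minimal subquotient
  \<open>L / K\<close>, a vector of weight \<open>\<lambda>\<close> that is highest modulo
  \<open>K\<close>; as all parts of \<open>\<lambda>\<close> are positive, \<open>capelli\<close>
  puts it into \<open>K\<close>.\<close>

theorem no_long_components:
  fixes K0 :: "'k::{alg_closed_field, field_char_0} fvec set"
  assumes K0: "ksub K0" "K0 \<subseteq> FM n q m" "Estab m K0"
    and minors: "\<And>ls g. length ls = m \<Longrightarrow> set ls \<subseteq> {..<n} \<Longrightarrow> g \<in> FM n q m \<Longrightarrow>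
       (\<lambda>k. det (mat m m (\<lambda>(c, i). xvar i (ls ! c))) * g k) \<in> K0"
    and symF: "\<And>p d. p permutes {..<m} \<Longrightarrow> hd (FM n q m :: 'k fvec set) (pe p d) = hd (FM n q m :: 'k fvec set) d"
    and symK: "\<And>p d. p permutes {..<m} \<Longrightarrow> hd K0 (pe p d) = hd K0 d"
    and pos: "\<And>i. i < m \<Longrightarrow> 0 < lk (fst d0) i"
  shows "conv (vand m) (\<lambda>d. int (hd (FM n q m :: 'k fvec set) d) - int (hd K0 d)) d0 = 0"
proof (rule ccontr)
  let ?F = "FM n q m :: 'k fvec set"
  define del where "del K L d = int (hd L d) - int (hd K d)" for K L :: "'k fvec set" and d
  define AA where "AA K L = conv (vand m) (del K L)" for K L
  define adm where "adm K L \<longleftrightarrow> K0 \<subseteq> K \<and> K \<subseteq> L \<and> L \<subseteq> ?F \<and> ksub K \<and> ksub L \<and> Estab m K \<and> Estab m L" for K L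
  assume "conv (vand m) (\<lambda>d. int (hd ?F d) - int (hd K0 d)) d0 \<noteq> 0"
  then have nz0: "AA K0 ?F d0 \<noteq> 0" by (simp add: AA_def del_def[abs_def])
  have FE: "Estab m ?F" by (auto simp: Estab_def FM_def Eo_def intro: Eop_cin derivation_0[OF Eop_derivation])
  have adm0: "adm K0 ?F" using K0 FE ksub_FM by (simp add: adm_def)
  have del_gdeg: "gdeg m n d" if "adm K L" "del K L d \<noteq> 0" for K L d
  proof -
    have "hd L d \<noteq> 0 \<or> hd K d \<noteq> 0" using that(2) by (auto simp: del_def)
    moreover have "K \<subseteq> ?F" "L \<subseteq> ?F" "ksub K" "ksub L" using that(1) by (auto simp: adm_def)
    ultimately show ?thesis using hd_gdeg by blast
  qed
  have AA_gdeg: "gdeg m n d" if "adm K L" "AA K L d \<noteq> 0" for K L d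
    using conv_gdeg[OF vand_utring del_gdeg[OF that(1)]] that(2) unfolding AA_def by blast
  have delsym: "del K0 ?F (pe p d) = del K0 ?F d" if "p permutes {..<m}" for p d
    using symF[OF that] symK[OF that] by (simp add: del_def)
  have anti: "AA K0 ?F (pe p d) = sign p * AA K0 ?F d" if "p permutes {..<m}" for p d
    using conv_antisym[of m "del K0 ?F", OF delsym that] by (simp add: AA_def)
  obtain a b where ab: "d0 = (a, b)" by (cases d0)
  have nn: "nnexp m (a, b)" using AA_gdeg[OF adm0 nz0] ab by (simp add: gdeg_def)
  have "inj_on (lk a) {..<m}"
  proof (rule inj_onI, rule ccontr)
    fix i j assume ij: "i \<in> {..<m}" "j \<in> {..<m}" "lk a i = lk a j" "i \<noteq> j"
    let ?t = "transpose i j"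
    have t: "?t permutes {..<m}" using ij by (simp add: permutes_swap_id)
    have "pe ?t d0 = d0"
      using ij by (auto intro!: poly_mapping_eqI simp: ab lookup_map_key_inj permutes_inj[OF t] transpose_def)
    then show False using anti[OF t, of d0] ij(4) nz0 by (simp add: sign_swap_id)
  qed
  from Dec_exists[OF nn this] obtain \<mu> p0 where \<mu>: "\<mu> \<in> Dec m" and p0: "p0 permutes {..<m}" and dp: "(a, b) = pe p0 (ev \<mu>, b)" by metis
  define md where "md = (ev \<mu>, b)"
  define ld where "ld = md - dlt m"
  have len: "length \<mu> = m" using \<mu> by (simp add: Dec_def)
  have lkmd: "lk (fst md) i = (if i < m then \<mu> ! i else 0)" for i by (simp add: md_def lookup_ev len)
  have nzm: "AA K0 ?F md \<noteq> 0"
    using anti[OF p0, of md] nz0 dp by (auto simp: ab md_def)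
  have mpos: "0 < \<mu> ! i" if "i < m" for i
  proof -
    have "i \<in> p0 ` {..<m}" using that permutes_image[OF p0] by simp
    then obtain j where j: "j < m" "i = p0 j" by auto
    have "lk (fst d0) j = \<mu> ! i" using dp j that by (simp add: ab lookup_map_key_inj[OF permutes_inj[OF p0]] lookup_ev len)
    then show ?thesis using pos[OF j(1)] by simp
  qed
  \<comment> \<open>\<open>\<lambda> = \<mu> - \<delta>\<close> is a partition, and its last part
    equals the last entry of \<open>\<mu>\<close>, which is positive.\<close>
  define lam where "lam i = unsh \<mu> ! i" for i
  have lam: "lk (fst ld) i = (if i < m then lam i else 0)" for i
    by (simp add: ld_def lookup_minus lkmd lookup_ev_dl lam_def unsh_def len)
  have lam_dec: "lam j \<le> lam i" if "i \<le> j" "j < m" for i j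
  proof -
    have "part m (unsh \<mu>)" by (rule unsh_part[OF \<mu>])
    then show ?thesis using that by (cases "i = j") (auto simp: part_def sorted_wrt_iff_nth_less lam_def)
  qed
  have lam_pos: "0 < lam i" if "i < m" for i
  proof -
    have "lam (m - 1) = \<mu> ! (m - 1)" using that by (simp add: lam_def unsh_def len of_nat_diff)
    then have "0 < lam (m - 1)" using mpos[of "m - 1"] that by simp
    also have "lam (m - 1) \<le> lam i" by (rule lam_dec) (use that in auto)
    finally show ?thesis .
  qed
  define N where "N = tot m ld"
  \<comment> \<open>The finitely many degrees that can contribute to the numerator at
    \<open>md\<close>.\<close>
  define Ds where "Ds = {d. nnexp m d \<and> tot m d = N \<and> snd d = b}"
  have finDs: "finite Ds" unfolding Ds_def by (rule finite_nnexp_tot)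
  have Ds_other: "del K L d = 0 \<or> d \<in> Ds" if "adm K L" "tot m d = N" "snd d = b" for K L d
    using del_gdeg[OF that(1), of d] that by (auto simp: Ds_def gdeg_def)
  have keysV: "tot m (e - x) = N \<and> snd (e - x) = b" if "x \<in> ky (vand m)" "tot m e = tot m md" "snd e = b" for e x
  proof -
    obtain p where p: "p permutes {..<m}" "x = pe p (dlt m)" using keys_vand[OF \<open>x \<in> _\<close>] by blast
    have t: "tot m x = tot m (dlt m)" unfolding p(2) by (rule tot_pe[OF p(1)])
    have "snd x = 0" unfolding p(2) by simp
    then show ?thesis using that(2,3) t by (simp add: tot_diff N_def ld_def)
  qed
  \<comment> \<open>A pair with nonzero coefficient at \<open>md\<close> is chosen so that its
    quotient has the least dimension over the degrees in \<open>Ds\<close>.\<close>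
  define P where "P KL \<longleftrightarrow> adm (fst KL) (snd KL) \<and> AA (fst KL) (snd KL) md \<noteq> 0" for KL
  define ms where "ms KL = nat (\<Sum>d\<in>Ds. del (fst KL) (snd KL) d)" for KL
  have "P (K0, ?F)" using adm0 nzm by (simp add: P_def)
  then obtain KL where KL: "P KL" and KLmin: "\<And>y. P y \<Longrightarrow> ms KL \<le> ms y"
    using ex_has_least_nat[of P "(K0, ?F)" ms] by metis
  obtain K L where KLeq: "KL = (K, L)" by (cases KL)
  have adm: "adm K L" and nz: "AA K L md \<noteq> 0" using KL by (auto simp: P_def KLeq)
  have K: "K0 \<subseteq> K" "K \<subseteq> L" "L \<subseteq> ?F" "K \<subseteq> ?F" "ksub K" "ksub L" "Estab m K" "Estab m L" using adm by (auto simp: adm_def)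
  have fdp: "fv.fd (W \<inter> HD d)" if "ksub W" "W \<subseteq> ?F" for W d by (rule fd_piece[OF that])
  have hd_mono: "hd W d \<le> hd W' d" if "ksub W'" "W' \<subseteq> ?F" "W \<subseteq> W'" for W W' d
    unfolding hd_def by (rule fv.dim_mono_fd[OF fdp[OF that(1,2)]]) (use that(3) in blast)
  have hd_eq: "W \<inter> HD d = W' \<inter> HD d" if "ksub W'" "W' \<subseteq> ?F" "W \<subseteq> W'" "ksub W" "hd W d = hd W' d" for W W' d
    by (rule fv.dim_eq_fd[OF fdp[OF that(1,2)] _ subspace_piece[OF that(4)] that(5)[unfolded hd_def]]) (use that(3) in blast)
  have del_nn: "0 \<le> del W W' d" if "adm W W'" for W W' d
    using hd_mono[of W' W d] that by (simp add: del_def adm_def)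
  have del_eq: "W \<inter> HD d = W' \<inter> HD d" if "adm W W'" "del W W' d = 0" for W W' d
    using hd_eq[of W' W d] that by (simp add: del_def adm_def)
  obtain d2 where d2: "d2 \<in> Ds" "del K L d2 \<noteq> 0"
  proof -
    obtain x where x: "x \<in> ky (vand m)" "of_int (lk (vand m) x) * del K L (md - x) \<noteq> 0"
      using nz unfolding AA_def conv_def by (rule sum.not_neutral_contains_not_neutral)
    have "tot m (md - x) = N \<and> snd (md - x) = b" by (rule keysV[OF x(1)]) (simp_all add: md_def)
    then show ?thesis using that[of "md - x"] Ds_other[OF adm, of "md - x"] x(2) by auto
  qed
  obtain v0 where v0: "v0 \<in> L \<inter> HD d2" "v0 \<notin> K \<inter> HD d2"
  proof -
    have "K \<inter> HD d2 \<noteq> L \<inter> HD d2" using d2(2) by (auto simp: del_def hd_def)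
    then show ?thesis using that K(2) by blast
  qed
  obtain c v where v: "v \<in> L \<inter> HD d2" "v \<notin> K \<inter> HD d2" "Om m v - scl c v \<in> K \<inter> HD d2"
  proof (rule fv.eigenvector_mod[OF _ subspace_piece[OF K(6)] fdp[OF K(6,3)] subspace_piece[OF K(5)] Om_linear _ v0])
    show "\<exists>x. poly p x = 0" if "0 < degree p" for p :: "'k poly" using alg_closed_imp_poly_has_root[OF that] .
    show "Om m x \<in> L \<inter> HD d2" if "x \<in> L \<inter> HD d2" for x by (rule Om_piece[OF K(3,6,8) that])
  qed
  \<comment> \<open>The eigenspace of the Casimir operator modulo \<open>K\<close>: stable because
    that operator is central, and larger than \<open>K\<close> in degree \<open>d2\<close> because
    it contains \<open>v\<close>.\<close>
  define L' where "L' = {x \<in> L. Om m x - scl c x \<in> K}"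
  have L': "ksub L'" "K \<subseteq> L'" "L' \<subseteq> L" "Estab m L'"
  proof -
    show "L' \<subseteq> L" by (auto simp: L'_def)
    show "ksub L'" unfolding ksub_def
    proof (intro conjI ballI allI)
      have "Om m 0 - scl c 0 = (0 :: 'k fvec)" using Om_scl[of m 0 0] by (simp del: zero_fun_apply)
      then show "0 \<in> L'" using ksub_0[OF K(5)] ksub_0[OF K(6)] by (simp add: L'_def)
    next
      fix p p' assume "p \<in> L'" "p' \<in> L'"
      then have *: "p \<in> L" "p' \<in> L" "(Om m p - scl c p) + (Om m p' - scl c p') \<in> K" using ksub_add[OF K(5)] by (auto simp: L'_def)
      have "Om m (p + p') - scl c (p + p') = (Om m p - scl c p) + (Om m p' - scl c p')"
        by (simp only: Om_add scl_add add_diff_add)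
      then show "p + p' \<in> L'" using * ksub_add[OF K(6)] by (simp only: L'_def mem_Collect_eq)
    next
      fix e p assume "p \<in> L'"
      then have *: "p \<in> L" "scl e (Om m p - scl c p) \<in> K" using ksub_scl[OF K(5)] by (auto simp: L'_def)
      have "Om m (scl e p) - scl c (scl e p) = scl e (Om m p - scl c p)"
        by (simp only: Om_scl scl_diff scl_scl mult.commute)
      then show "scl e p \<in> L'" using * ksub_scl[OF K(6)] by (simp only: L'_def mem_Collect_eq)
    qed
    show "K \<subseteq> L'" using K(2) ksub_diff[OF K(5) Om_stab[OF K(5,7)] ksub_scl[OF K(5)]] by (auto simp: L'_def)
    show "Estab m L'" unfolding Estab_def
    proof (intro allI impI ballI)
      fix i j p assume ij: "i < m" "j < m" and "p \<in> L'"
      then have *: "Eo n i j p \<in> L" "Eo n i j (Om m p - scl c p) \<in> K" using K(7,8) by (auto simp: L'_def Estab_def)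
      have "Om m (Eo n i j p) - scl c (Eo n i j p) = Eo n i j (Om m p - scl c p)"
        by (simp only: Om_commute[OF ij, symmetric] Eo_diff Eo_scl)
      then show "Eo n i j p \<in> L'" using * by (simp only: L'_def mem_Collect_eq)
    qed
  qed
  have admKL': "adm K L'" and admL'L: "adm L' L" using L' K by (auto simp: adm_def)
  have msum: "(\<Sum>d\<in>Ds. del K L d) = (\<Sum>d\<in>Ds. del K L' d) + (\<Sum>d\<in>Ds. del L' L d)"
    by (simp add: del_def sum.distrib[symmetric])
  have sum_nn: "0 \<le> (\<Sum>d\<in>Ds. del W W' d)" if "adm W W'" for W W' by (rule sum_nonneg) (rule del_nn[OF that])
  \<comment> \<open>The coefficient at \<open>md\<close> is additive along
    \<open>K \<subseteq> L' \<subseteq> L\<close>. If \<open>L / L'\<close> had a nonzero share,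
    minimality would make \<open>L'\<close> equal to \<open>K\<close> in the degrees of
    \<open>Ds\<close>, contrary to \<open>v\<close>. So \<open>L' / K\<close> carries it, and
    minimality makes \<open>L'\<close> equal to \<open>L\<close> there.\<close>
  have scalar: "L' \<inter> HD d = L \<inter> HD d" if "d \<in> Ds" for d
  proof -
    have "AA K L md = AA K L' md + AA L' L md"
    proof -
      have "del K L = (\<lambda>d. del K L' d + del L' L d)" by (auto simp: del_def)
      then show ?thesis unfolding AA_def by (simp only: conv_right_add)
    qed
    moreover have "AA L' L md = 0"
    proof (rule ccontr)
      assume "AA L' L md \<noteq> 0"
      then have "ms (K, L) \<le> ms (L', L)" using KLmin[of "(L', L)"] admL'L by (simp add: P_def KLeq)
      then have "(\<Sum>d\<in>Ds. del K L' d) \<le> 0" using msum sum_nn[OF admL'L] sum_nn[OF admKL'] by (simp add: ms_def)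
      then have "(\<Sum>d\<in>Ds. del K L' d) = 0" using sum_nn[OF admKL'] by simp
      then have "del K L' d2 = 0" using d2(1) finDs del_nn[OF admKL'] by (simp add: sum_nonneg_eq_0_iff)
      then have "K \<inter> HD d2 = L' \<inter> HD d2" by (rule del_eq[OF admKL'])
      moreover have "v \<in> L' \<inter> HD d2" using v by (simp add: L'_def)
      ultimately show False using v(2) by simp
    qed
    ultimately have "AA K L' md \<noteq> 0" using nz by simp
    then have "ms (K, L) \<le> ms (K, L')" using KLmin[of "(K, L')"] admKL' by (simp add: P_def KLeq)
    then have "(\<Sum>d\<in>Ds. del L' L d) \<le> 0" using msum sum_nn[OF admL'L] sum_nn[OF admKL'] by (simp add: ms_def)
    then have "(\<Sum>d\<in>Ds. del L' L d) = 0" using sum_nn[OF admL'L] by simp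
    then have "del L' L d = 0" using that finDs del_nn[OF admL'L] by (simp add: sum_nonneg_eq_0_iff)
    then show ?thesis by (rule del_eq[OF admL'L])
  qed
  define tau where "tau W d = fv.trc (W \<inter> HD d) (Om m)" for W :: "'k fvec set" and d
  \<comment> \<open>In the given total degree and torus weight \<open>Om m - c\<close> maps
    \<open>L\<close> into \<open>K\<close>, so it has the same trace on both: the trace of the
    Casimir operator on \<open>L / K\<close> is \<open>c\<close> times the dimension.\<close>
  have tau_diff: "tau L d - tau K d = c * of_int (del K L d)" if "tot m d = N" "snd d = b" for d
  proof -
    have "fv.trc (L \<inter> HD d) (\<lambda>x. Om m x - scl c x) = fv.trc (K \<inter> HD d) (\<lambda>x. Om m x - scl c x)"
    proof (rule fv.trc_subspace[OF subspace_piece[OF K(6)] fdp[OF K(6,3)] subspace_piece[OF K(5)]])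
      show "K \<inter> HD d \<subseteq> L \<inter> HD d" using K(2) by blast
      show "Vector_Spaces.linear scl scl (\<lambda>x. Om m x - scl c x)"
        by (rule fv.linearI_scale) (simp_all only: Om_add Om_scl scl_add add_diff_add scl_diff scl_scl mult.commute)
      fix x assume x: "x \<in> L \<inter> HD d"
      have "Om m x - scl c x \<in> L \<inter> HD d"
        by (rule fv.subspace_diff[OF subspace_piece[OF K(6)] Om_piece[OF K(3,6,8) x] fv.subspace_scale[OF subspace_piece[OF K(6)] x]])
      moreover have "Om m x - scl c x \<in> K"
      proof (cases "d \<in> Ds")
        case True
        then have "x \<in> L'" using scalar[OF True] x by blast
        then show ?thesis by (simp add: L'_def)
      next
        case False
        then have "del K L d = 0" using Ds_other[OF adm that] by blast
        from del_eq[OF adm this] calculation show ?thesis by blast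
      qed
      ultimately show "Om m x - scl c x \<in> K \<inter> HD d" by blast
    qed
    moreover have "fv.trc (L \<inter> HD d) (\<lambda>x. Om m x - scl c x) = tau L d - c * of_nat (hd L d)"
      unfolding tau_def hd_def by (rule fv.trc_diff_scale[OF subspace_piece[OF K(6)] Om_piece[OF K(3,6,8)]])
    moreover have "fv.trc (K \<inter> HD d) (\<lambda>x. Om m x - scl c x) = tau K d - c * of_nat (hd K d)"
      unfolding tau_def hd_def by (rule fv.trc_diff_scale[OF subspace_piece[OF K(5)] Om_piece[OF K(4,5,7)]])
    ultimately show ?thesis by (simp add: del_def algebra_simps)
  qed
  \<comment> \<open>Comparison of \<open>tau_diff\<close> with \<open>casimir_trace\<close>:
    \<open>Lam\<close> takes the value \<open>c\<close> wherever the numerator of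
    \<open>L / K\<close> is nonzero.\<close>
  have eig: "of_int (Lam m e) * of_int (AA K L e) = c * (of_int (AA K L e) :: 'k)" if "tot m e = tot m md" "snd e = b" for e
  proof -
    have A: "(of_int (AA K L e) :: 'k) = conv (vand m) (\<lambda>d. of_nat (hd L d)) e - conv (vand m) (\<lambda>d. of_nat (hd K d)) e"
      unfolding AA_def conv_of_int[symmetric] conv_right_diff[symmetric] by (simp add: del_def)
    have "of_int (Lam m e) * (of_int (AA K L e) :: 'k) = conv (vand m) (tau L) e - conv (vand m) (tau K) e"
      unfolding A right_diff_distrib tau_def
      by (simp only: casimir_trace[OF K(3,6,8)] casimir_trace[OF K(4,5,7)])
    also have "\<dots> = conv (vand m) (\<lambda>d. tau L d - tau K d) e" by (simp only: conv_right_diff)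
    also have "\<dots> = conv (vand m) (\<lambda>d. c * of_int (del K L d)) e"
      unfolding conv_def by (rule sum.cong[OF refl]) (use keysV[OF _ that] tau_diff in simp)
    also have "\<dots> = c * of_int (AA K L e)" by (simp only: conv_right_scale conv_of_int AA_def)
    finally show ?thesis .
  qed
  \<comment> \<open>For fixed total degree, equal values of \<open>Lam\<close> mean equal
    norms.\<close>
  have nsq: "nsq m e = nsq m md" if "tot m e = tot m md" "snd e = b" "AA K L e \<noteq> 0" for e
  proof -
    have "of_int (Lam m e) = c" using eig[OF that(1,2)] that(3) by simp
    moreover have "of_int (Lam m md) = c" using eig[of md] nz by (simp add: md_def)
    ultimately have "Lam m e = Lam m md" by (metis of_int_eq_iff)
    then show ?thesis using that(1) by (simp add: Lam_def)
  qed
  \<comment> \<open>Pairing with \<open>\<mu> = \<lambda> + \<delta>\<close>; being strictly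
    decreasing, \<open>\<mu>\<close> pairs with \<open>\<delta>\<close> more than with any other
    rearrangement of \<open>\<delta>\<close>.\<close>
  define ip where "ip d = (\<Sum>i<m. \<mu> ! i * lk (fst d) i)" for d :: expo
  have ip_add: "ip (d + e) = ip d + ip e" and ip_diff: "ip (d - e) = ip d - ip e" for d e
    by (simp_all add: ip_def lookup_add lookup_minus algebra_simps sum.distrib sum_subtractf)
  have ip_less: "ip (pe p (dlt m)) < ip (dlt m)" if p: "p permutes {..<m}" "p \<noteq> id" for p
  proof -
    have *: "ip d = (\<Sum>i<m. lam i * lk (fst d) i) + wt m d" for d
    proof -
      have "\<mu> ! i = lam i + (int m - 1 - int i)" if "i < m" for i using that by (simp add: lam_def unsh_def len)
      then show ?thesis by (simp add: ip_def wt_def sum.distrib[symmetric] distrib_right[symmetric])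
    qed
    have "(\<Sum>i<m. lam i * lk (fst (pe p (dlt m))) i) \<le> (\<Sum>i<m. lam i * lk (fst (dlt m)) i)"
      by (rule rearrangement[OF lam_dec p(1)])
    with wt_delta_less[OF p] show ?thesis unfolding * by linarith
  qed
  have lead: "AA K L (d + dlt m) = del K L d" if "d \<in> Ds" and mx: "\<And>e. e \<in> Ds \<Longrightarrow> del K L e \<noteq> 0 \<Longrightarrow> ip e \<le> ip d" for d
    unfolding AA_def
  proof (rule conv_vand_lead, rule ccontr)
    fix p assume p: "p permutes {..<m}" "p \<noteq> id" and nz': "del K L (d + dlt m - pe p (dlt m)) \<noteq> 0"
    have "tot m (d + dlt m - pe p (dlt m)) = N" "snd (d + dlt m - pe p (dlt m)) = b"
      using that(1) by (simp_all add: Ds_def tot_add tot_diff tot_pe[OF p(1)] del: pe_pair)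
    then have "d + dlt m - pe p (dlt m) \<in> Ds" using Ds_other[OF adm] nz' by blast
    from mx[OF this nz'] ip_less[OF p] show False by (simp add: ip_add ip_diff del: pe_pair)
  qed
  \<comment> \<open>Write \<open>d + \<delta> = \<mu> + g\<close>. Equal norms give
    \<open>2 <\<mu>, g> + |g|^2 = 0\<close>, while \<open><\<mu>, g>\<close> is nonnegative by
    assumption; hence \<open>g = 0\<close>.\<close>
  have top: "d = ld" if d: "d \<in> Ds" "del K L d \<noteq> 0" and ge: "ip ld \<le> ip d"
    and mx: "\<And>e. e \<in> Ds \<Longrightarrow> del K L e \<noteq> 0 \<Longrightarrow> ip e \<le> ip d" for d
  proof -
    have "AA K L (d + dlt m) \<noteq> 0" using lead[OF d(1) mx] d(2) by simp
    moreover have "tot m (d + dlt m) = tot m md" "snd (d + dlt m) = b"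
      using d(1) by (simp_all add: Ds_def tot_add N_def ld_def tot_diff)
    ultimately have eq: "nsq m (d + dlt m) = nsq m md" using nsq by blast
    define g where "g i = lk (fst d) i - lk (fst ld) i" for i
    have "nsq m (d + dlt m) = (\<Sum>i<m. (\<mu> ! i + g i)\<^sup>2)"
      unfolding nsq_def by (rule sum.cong[OF refl]) (simp add: g_def ld_def lookup_add lookup_minus lkmd)
    also have "\<dots> = nsq m md + 2 * (ip d - ip ld) + (\<Sum>i<m. (g i)\<^sup>2)"
    proof -
      have "ip d - ip ld = (\<Sum>i<m. \<mu> ! i * g i)" by (simp add: ip_def g_def sum_subtractf algebra_simps)
      moreover have "nsq m md = (\<Sum>i<m. (\<mu> ! i)\<^sup>2)" by (simp add: nsq_def lkmd)
      ultimately show ?thesis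
        by (simp add: power2_sum sum.distrib sum_distrib_left mult.assoc)
    qed
    finally have "(\<Sum>i<m. (g i)\<^sup>2) \<le> 0" using eq ge by simp
    moreover have "0 \<le> (\<Sum>i<m. (g i)\<^sup>2)" by (rule sum_nonneg) simp
    ultimately have "(\<Sum>i<m. (g i)\<^sup>2) = 0" by simp
    then have g0: "g i = 0" if "i < m" for i using that by (simp add: sum_nonneg_eq_0_iff)
    have "fst d = fst ld"
    proof (rule poly_mapping_eqI)
      fix i
      show "lk (fst d) i = lk (fst ld) i"
      proof (cases "i < m")
        case True then show ?thesis using g0 by (simp add: g_def)
      next
        case False
        then have "i \<notin> ky (fst d)" using d(1) by (auto simp: Ds_def nnexp_def)
        then show ?thesis using False by (simp add: lam in_keys_iff)
      qed
    qed
    moreover have "snd d = snd ld" using d(1) by (simp add: Ds_def ld_def md_def)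
    ultimately show ?thesis by (metis prod.collapse)
  qed
  \<comment> \<open>A weight \<open>e\<close> of maximal \<open>ip\<close> is
    \<open>\<lambda>\<close> by \<open>top\<close>; then \<open>d\<close> has the same
    \<open>ip\<close>, is itself maximal, and \<open>top\<close> applies to it.\<close>
  have Z: "d = ld" if d: "d \<in> Ds" "del K L d \<noteq> 0" and ge: "ip ld \<le> ip d" for d
  proof -
    let ?S = "{e \<in> Ds. del K L e \<noteq> 0}"
    have "finite ?S" using finDs by simp
    moreover have "?S \<noteq> {}" using d by blast
    ultimately obtain e where e: "e \<in> ?S" and emx: "\<And>y. y \<in> ?S \<Longrightarrow> ip y \<le> ip e" by (rule finite_arg_max[of ?S ip]) (rule that)
    have "ip d \<le> ip e" using emx d by simp
    have "e = ld" by (rule top) (use e emx ge \<open>ip d \<le> ip e\<close> in auto)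
    then have "ip d = ip e" using ge \<open>ip d \<le> ip e\<close> by simp
    show ?thesis by (rule top[OF d ge]) (use emx \<open>ip d = ip e\<close> in auto)
  qed
  have "nnexp m ld" using lam lam_pos by (auto simp: nnexp_def in_keys_iff less_imp_le split: if_splits)
  then have ldDs: "ld \<in> Ds" by (simp add: Ds_def N_def ld_def md_def)
  \<comment> \<open>If \<open>\<lambda>\<close> were no weight of \<open>L / K\<close>, every weight
    would lie strictly below it by \<open>Z\<close>, and \<open>lead\<close> would make the
    coefficient at \<open>md\<close> zero.\<close>
  have "del K L ld \<noteq> 0"
  proof
    assume z: "del K L ld = 0"
    have "ip e \<le> ip ld" if "e \<in> Ds" "del K L e \<noteq> 0" for e
      using Z[OF that] z that(2) by (cases "ip ld \<le> ip e") auto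
    from lead[OF ldDs this] z have "AA K L (ld + dlt m) = 0" by simp
    then show False using nz by (simp add: ld_def)
  qed
  then have "K \<inter> HD ld \<noteq> L \<inter> HD ld" by (auto simp: del_def hd_def)
  then obtain u where u: "u \<in> L \<inter> HD ld" "u \<notin> K" using K(2) by blast
  have uF: "u \<in> ?F \<inter> HD ld" using u K(3) by blast
  have "u \<in> K"
  proof (rule capelli[where m = m and n = n and q = q and \<mu> = "\<lambda>i. nat (lam i)"])
    show "ksub K" by (rule K(5))
    show "Eo n i j p \<in> K" if "i < m" "j < m" "p \<in> K" for i j p using K(7) that by (simp add: Estab_def)
    show "(\<lambda>k. det (mat m m (\<lambda>(c, i). xvar i (ls ! c))) * g k) \<in> K" if "length ls = m" "set ls \<subseteq> {..<n}" "g \<in> ?F" for ls g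
      using minors[OF that] K(1) by blast
    show "u \<in> FM n q m" using uF by blast
    show "Eo n i i u = scl (of_nat (nat (lam i))) u" if "i < m" for i
      using Eo_diag[OF uF, of i] lam_pos[OF that] that by (simp add: lam)
    show "0 < nat (lam i)" if "i < m" for i using lam_pos[OF that] by simp
    \<comment> \<open>Raising operators strictly increase \<open>ip\<close>, so by \<open>Z\<close>
      they lead to degrees in which \<open>L\<close> and \<open>K\<close> agree.\<close>
    show "Eo n i j u \<in> K" if ij: "i < j" "j < m" for i j
    proof -
      have Eu: "Eo n i j u \<in> L \<inter> HD (ld + shift i j)" by (rule Eo_piece[OF K(3,8) _ ij(2) u(1)]) (use ij in simp)
      have "del K L (ld + shift i j) = 0"
      proof (rule ccontr)
        assume nz': "del K L (ld + shift i j) \<noteq> 0"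
        have s: "lk (fst (shift i j)) k = (if k = i then 1 else 0) - (if k = j then 1 else 0)" for k
          by (simp add: shift_def lookup_minus lookup_single when_def)
        have "tot m (shift i j) = 0" using ij by (simp add: tot_def s sum_subtractf)
        then have "tot m (ld + shift i j) = N" by (simp add: tot_add N_def)
        moreover have "snd (ld + shift i j) = b" by (simp add: ld_def md_def shift_def)
        ultimately have D: "ld + shift i j \<in> Ds" using Ds_other[OF adm] nz' by blast
        have "ip (shift i j) = \<mu> ! i - \<mu> ! j"
        proof -
          have "ip (shift i j) = (\<Sum>k<m. (if k = i then \<mu> ! k else 0)) - (\<Sum>k<m. (if k = j then \<mu> ! k else 0))"
            unfolding ip_def sum_subtractf[symmetric] by (rule sum.cong) (auto simp: s)
          then show ?thesis using ij by simp
        qed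
        also have "\<dots> > 0" using \<mu> ij len by (auto simp: Dec_def sorted_wrt_iff_nth_less)
        finally have "ip ld \<le> ip (ld + shift i j)" by (simp add: ip_add)
        from Z[OF D nz' this] have "shift i j = 0" by simp
        then have "lk (fst (shift i j)) i = 0" by simp
        then show False using ij by (simp add: s)
      qed
      from del_eq[OF adm this] Eu show ?thesis by blast
    qed
  qed
  then show False using u(2) by blast
qed

end

section \<open>Existence of K-polynomials\<close>

text \<open>Induction on the variables: a finite set for the remaining variables works once the
  exponent of \<open>x\<close> is at least \<open>K\<close>; below \<open>K\<close> the finitely
  many slices with fixed exponent of \<open>x\<close> are treated separately.\<close>

lemma dickson:
  fixes U :: "('x \<Rightarrow> nat) set"
  assumes "finite X"
  shows "\<exists>G. finite G \<and> G \<subseteq> U \<and> (\<forall>f\<in>U. \<exists>g\<in>G. \<forall>x\<in>X. g x \<le> f x)"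
  using assms
proof (induction X arbitrary: U rule: finite_induct)
  case empty
  show ?case
  proof (cases "U = {}")
    case False
    then obtain f where "f \<in> U" by blast
    then show ?thesis by (intro exI[of _ "{f}"]) auto
  qed auto
next
  case (insert x X)
  obtain G0 where G0: "finite G0" "G0 \<subseteq> U" "\<And>f. f \<in> U \<Longrightarrow> \<exists>g\<in>G0. \<forall>x\<in>X. g x \<le> f x"
    using insert.IH[of U] by (elim exE conjE) simp
  define K where "K = (\<Sum>g\<in>G0. g x)"
  have K: "g x \<le> K" if "g \<in> G0" for g
    unfolding K_def using that G0(1) by (intro member_le_sum) auto
  have "\<forall>k. \<exists>G. finite G \<and> G \<subseteq> {f \<in> U. f x = k} \<and> (\<forall>f\<in>{f \<in> U. f x = k}. \<exists>g\<in>G. \<forall>x\<in>X. g x \<le> f x)"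
    by (intro allI insert.IH)
  from choice[OF this] obtain Gk where Gk: "\<forall>k. finite (Gk k) \<and> Gk k \<subseteq> {f \<in> U. f x = k} \<and> (\<forall>f\<in>{f \<in> U. f x = k}. \<exists>g\<in>Gk k. \<forall>x\<in>X. g x \<le> f x)"
    by (elim exE)
  show ?case
  proof (intro exI[of _ "G0 \<union> (\<Union>k<K. Gk k)"] conjI ballI)
    show "finite (G0 \<union> (\<Union>k<K. Gk k))" using G0(1) Gk by simp
    show "G0 \<union> (\<Union>k<K. Gk k) \<subseteq> U" using G0(2) Gk by fast
    fix f assume f: "f \<in> U"
    show "\<exists>g\<in>G0 \<union> (\<Union>k<K. Gk k). \<forall>x\<in>insert x X. g x \<le> f x"
    proof (cases "K \<le> f x")
      case True
      obtain g where g: "g \<in> G0" "\<forall>x\<in>X. g x \<le> f x" using G0(3)[OF f] by (elim bexE)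
      have "g x \<le> f x" using K[OF g(1)] True by simp
      then show ?thesis using g by (intro bexI[of _ g]) auto
    next
      case False
      have "\<exists>g\<in>Gk (f x). \<forall>y\<in>X. g y \<le> f y" using Gk f by simp
      then obtain g where g: "g \<in> Gk (f x)" "\<forall>y\<in>X. g y \<le> f y" by (elim bexE)
      have "g x = f x" using Gk g(1) by fast
      then show ?thesis using g False by (intro bexI[of _ g]) auto
    qed
  qed
qed

text \<open>The finitely many minimal elements have bounded exponents, and beyond the bound the
  exponent of \<open>x\<close> no longer influences membership. Quantification over all larger
  \<open>D'\<close> allows one bound for several up-sets.\<close>

lemma upset_stabilizes:
  fixes U :: "('x \<Rightarrow>\<^sub>0 nat) set"
  assumes X: "finite X" and U: "\<And>m. m \<in> U \<Longrightarrow> ky m \<subseteq> X" and up: "\<And>m x. m \<in> U \<Longrightarrow> x \<in> X \<Longrightarrow> sg x 1 + m \<in> U"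
  shows "\<exists>D. \<forall>D'\<ge>D. \<forall>m x. ky m \<subseteq> X \<longrightarrow> x \<in> X \<longrightarrow> D' \<le> lk m x \<longrightarrow> (sg x 1 + m \<in> U \<longleftrightarrow> m \<in> U)"
proof -
  obtain G where G: "finite G" "G \<subseteq> lk ` U" "\<forall>f\<in>lk ` U. \<exists>g\<in>G. \<forall>x\<in>X. g x \<le> f x"
    using dickson[OF X, of "lk ` U"] by (elim exE conjE)
  define D where "D = (\<Sum>g\<in>G. \<Sum>x\<in>X. g x)"
  have D: "g x \<le> D" if "g \<in> G" "x \<in> X" for g x
  proof -
    have "g x \<le> (\<Sum>x\<in>X. g x)" using that X by (intro member_le_sum) auto
    also have "\<dots> \<le> D" unfolding D_def using that G(1) by (intro member_le_sum[of g G "\<lambda>g. \<Sum>x\<in>X. g x"]) auto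
    finally show ?thesis .
  qed
  \<comment> \<open>Closure under single variables gives closure under all multiples, by induction
    on the total excess of \<open>m\<close> over \<open>u\<close>.\<close>
  have above: "m \<in> U" if "u \<in> U" "\<And>x. x \<in> X \<Longrightarrow> lk u x \<le> lk m x" "ky m \<subseteq> X" for u m
    using that
  proof (induction "\<Sum>x\<in>X. lk m x - lk u x" arbitrary: u)
    case 0
    have "lk m x = lk u x" for x
    proof (cases "x \<in> X")
      case True
      then have "lk m x - lk u x = 0" using 0(1) X by (metis sum_eq_0_iff)
      then show ?thesis using 0(3)[OF True] by simp
    next
      case False
      then have "x \<notin> ky m" "x \<notin> ky u" using 0(4) U[OF 0(2)] by auto
      then show ?thesis by (simp add: in_keys_iff)
    qed
    then have "m = u" by (rule poly_mapping_eqI)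
    then show ?case using 0(2) by simp
  next
    case (Suc k)
    then have "(\<Sum>x\<in>X. lk m x - lk u x) \<noteq> 0" by simp
    then obtain x where x: "x \<in> X" "lk m x - lk u x \<noteq> 0" by (meson sum.neutral)
    show ?case
    proof (rule Suc.hyps(1))
      show "sg x 1 + u \<in> U" by (rule up[OF Suc.prems(1) x(1)])
      show "lk (sg x 1 + u) y \<le> lk m y" if "y \<in> X" for y
        using Suc.prems(2)[OF that] x(2) by (auto simp: lookup_add lookup_single when_def)
      have "(\<Sum>y\<in>X. lk m y - lk u y) = (lk m x - lk u x) + (\<Sum>y\<in>X - {x}. lk m y - lk u y)"
        by (rule sum.remove[OF X x(1)])
      moreover have "(\<Sum>y\<in>X. lk m y - lk (sg x 1 + u) y) = (lk m x - lk (sg x 1 + u) x) + (\<Sum>y\<in>X - {x}. lk m y - lk (sg x 1 + u) y)"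
        by (rule sum.remove[OF X x(1)])
      moreover have "(\<Sum>y\<in>X - {x}. lk m y - lk (sg x 1 + u) y) = (\<Sum>y\<in>X - {x}. lk m y - lk u y)"
        by (rule sum.cong) (auto simp: lookup_add lookup_single when_def)
      moreover have "lk m x - lk u x = Suc (lk m x - lk (sg x 1 + u) x)"
        using x(2) by (simp add: lookup_add)
      ultimately show "k = (\<Sum>y\<in>X. lk m y - lk (sg x 1 + u) y)" using Suc.hyps(2) by simp
    qed (rule Suc.prems(3))
  qed
  show ?thesis
  proof (intro exI[of _ D] allI impI iffI)
    fix D' m x assume D': "D \<le> D'" and m: "ky m \<subseteq> X" "x \<in> X" "D' \<le> lk m x" and in_U: "sg x 1 + m \<in> U"
    obtain g where g: "g \<in> G" "\<forall>y\<in>X. g y \<le> lk (sg x 1 + m) y" using G(3) in_U by (metis imageI)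
    obtain u where u: "u \<in> U" "g = lk u" using g(1) G(2) by blast
    show "m \<in> U"
    proof (rule above[OF u(1) _ m(1)])
      fix y assume y: "y \<in> X"
      show "lk u y \<le> lk m y"
      proof (cases "y = x")
        case True then show ?thesis using D[OF g(1) m(2)] D' m(3) u(2) by simp
      next
        case False
        then have "lk (sg x 1 + m) y = lk m y" by (simp add: lookup_add lookup_single when_def)
        then show ?thesis using g(2) y u(2) by metis
      qed
    qed
  qed (rule up)
qed

lemma lookup_xvar_mult:
  "lk (xvar i j * f) mo = (if lk mo (i, j) = 0 then 0 else lk f (mo - sg (i, j) 1))"
proof (induction f rule: poly_mapping_single_induct)
  case (single m a)
  have "sg (i, j) 1 + m = mo \<longleftrightarrow> lk mo (i, j) \<noteq> 0 \<and> m = mo - sg (i, j) 1"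
  proof
    assume "sg (i, j) 1 + m = mo"
    then show "lk mo (i, j) \<noteq> 0 \<and> m = mo - sg (i, j) 1" by (auto simp: lookup_add)
  next
    assume a: "lk mo (i, j) \<noteq> 0 \<and> m = mo - sg (i, j) 1"
    show "sg (i, j) 1 + m = mo"
      by (rule poly_mapping_eqI) (use a in \<open>auto simp: lookup_add lookup_minus lookup_single when_def\<close>)
  qed
  then show ?case by (auto simp: xvar_times_single lookup_single when_def)
qed (auto simp: distrib_left lookup_add)

section \<open>Difference operators on functions of monomials\<close>

context fmod
begin

text \<open>Summation over each bidegree turns indicator functions of sets of basis monomials into
  Hilbert series.\<close>

definition push :: "nat \<Rightarrow> (nat \<Rightarrow> xmonom \<Rightarrow> int) \<Rightarrow> expo \<Rightarrow> int" where
  "push m c d = (\<Sum>(k, mo)\<in>Idx m d. c k mo)"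

definition vdeg :: "nat \<times> nat \<Rightarrow> expo" where "vdeg x = (sg (fst x) 1, sg (snd x) 1)"

lemma mdeg_sg_add: "mdeg (sg x 1 + mo) = vdeg x + mdeg mo"
  by (simp add: mdeg_add vdeg_def)

text \<open>The operator on functions of monomials that corresponds to multiplying the series by the
  factor \<open>1 - u_i t_j\<close> of the denominator (\<open>push_dstep\<close>).\<close>

definition dstep :: "nat \<times> nat \<Rightarrow> (nat \<Rightarrow> xmonom \<Rightarrow> int) \<Rightarrow> nat \<Rightarrow> xmonom \<Rightarrow> int" where
  "dstep x c k mo = c k mo - (if lk mo x = 0 then 0 else c k (mo - sg x 1))"

lemma sg_add_minus: "lk mo x \<noteq> 0 \<Longrightarrow> sg x 1 + (mo - sg x (1::nat)) = mo"
  by (rule poly_mapping_eqI) (auto simp: lookup_add lookup_minus lookup_single when_def)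

lemma Idx_add: "x \<in> {..<m} \<times> {..<n} \<Longrightarrow> (k, mo) \<in> Idx m d \<Longrightarrow> (k, sg x 1 + mo) \<in> Idx m (d + vdeg x)"
proof -
  assume x: "x \<in> {..<m} \<times> {..<n}" and km: "(k, mo) \<in> Idx m d"
  have "sg x 1 \<in> monoms m n" using x by (auto simp: monoms_def)
  then have "sg x 1 + mo \<in> monoms m n" using km by (intro monoms_add) (auto simp: Idx_def)
  moreover have "mdeg (sg x 1 + mo) + (0, w k) = d + vdeg x" using km unfolding mdeg_sg_add by (auto simp: Idx_def add_ac)
  ultimately show ?thesis using km by (simp add: Idx_def)
qed

lemma monoms_minus: "mo \<in> monoms m n \<Longrightarrow> mo - a \<in> monoms m n"
proof -
  assume "mo \<in> monoms m n"
  moreover have "ky (mo - a) \<subseteq> ky mo" by (auto simp: in_keys_iff lookup_minus)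
  ultimately show ?thesis by (auto simp: monoms_def)
qed

lemma Idx_minus:
  assumes "(k, mo) \<in> Idx m d" "lk mo x \<noteq> 0"
  shows "(k, mo - sg x 1) \<in> Idx m (d - vdeg x)"
proof -
  have "ky (mo - sg x 1) \<subseteq> ky mo" by (auto simp: in_keys_iff lookup_minus)
  moreover have "mdeg mo = vdeg x + mdeg (mo - sg x 1)" by (metis assms(2) mdeg_sg_add sg_add_minus)
  ultimately show ?thesis using assms(1) by (auto simp: Idx_def monoms_def add_ac)
qed

lemma push_dstep:
  assumes x: "x \<in> {..<m} \<times> {..<n}"
  shows "conv (1 - sg (vdeg x) 1) (push m c) = push m (dstep x c)"
proof
  fix d
  let ?A = "{s \<in> Idx m d. lk (snd s) x \<noteq> 0}"
  have "push m c (d - vdeg x) = (\<Sum>s\<in>Idx m (d - vdeg x). c (fst s) (snd s))" by (simp add: push_def case_prod_unfold)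
  also have "\<dots> = (\<Sum>s\<in>?A. c (fst s) (snd s - sg x 1))"
  proof (rule sum.reindex_bij_witness[where i = "\<lambda>s. (fst s, snd s - sg x 1)" and j = "\<lambda>s. (fst s, sg x 1 + snd s)"])
    fix s assume "s \<in> Idx m (d - vdeg x)"
    then have "(fst s, sg x 1 + snd s) \<in> Idx m (d - vdeg x + vdeg x)" by (intro Idx_add[OF x]) simp
    then show "(fst s, sg x 1 + snd s) \<in> ?A" by (simp add: lookup_add)
  next
    fix s assume "s \<in> ?A"
    then show "(fst s, snd s - sg x 1) \<in> Idx m (d - vdeg x)" by (intro Idx_minus) auto
  qed (auto simp: sg_add_minus simp del: One_nat_def)
  also have "\<dots> = (\<Sum>s\<in>Idx m d. if lk (snd s) x \<noteq> 0 then c (fst s) (snd s - sg x 1) else 0)"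
    by (rule sum.inter_filter[OF finite_Idx])
  finally have "push m c (d - vdeg x) = (\<Sum>s\<in>Idx m d. if lk (snd s) x \<noteq> 0 then c (fst s) (snd s - sg x 1) else 0)" .
  moreover have "conv (1 - sg (vdeg x) 1) (push m c) d = push m c d - push m c (d - vdeg x)"
    by (simp add: conv_diff_left conv_single)
  ultimately show "conv (1 - sg (vdeg x) 1) (push m c) d = push m (dstep x c) d"
    by (simp add: push_def case_prod_unfold dstep_def sum_subtractf if_not_P cong: if_cong) (auto intro!: sum.cong)
qed

text \<open>\<open>S\<close> collects the variables already differenced. Constancy starts at
  exponent \<open>D\<close> but vanishing only above \<open>D\<close>, because a difference at
  exponent \<open>e\<close> compares \<open>e\<close> with \<open>e - 1\<close>.\<close>

definition stable_from :: "nat \<Rightarrow> nat \<Rightarrow> (nat \<times> nat) set \<Rightarrow> (nat \<Rightarrow> xmonom \<Rightarrow> int) \<Rightarrow> bool" where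
  "stable_from D m S c \<longleftrightarrow> (\<forall>k<q. \<forall>mo\<in>monoms m n.
     (\<forall>y\<in>{..<m} \<times> {..<n} - S. D \<le> lk mo y \<longrightarrow> c k (sg y 1 + mo) = c k mo) \<and>
     (\<forall>y\<in>S. D < lk mo y \<longrightarrow> c k mo = 0))"

lemma stable_from_dstep:
  assumes S: "S \<subseteq> {..<m} \<times> {..<n}" and x: "x \<in> {..<m} \<times> {..<n}" "x \<notin> S" and c: "stable_from D m S c"
  shows "stable_from D m (insert x S) (dstep x c)"
  unfolding stable_from_def
proof (intro allI impI ballI conjI)
  fix k mo y assume k: "k < q" and mo: "mo \<in> monoms m n"
  have sub: "mo - sg x 1 \<in> monoms m n" by (rule monoms_minus[OF mo])
  have c1: "c k (sg y 1 + mo) = c k mo" if "mo \<in> monoms m n" "y \<in> {..<m} \<times> {..<n} - S" "D \<le> lk mo y" for mo y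
    using c k that unfolding stable_from_def by blast
  have c2: "c k mo = 0" if "mo \<in> monoms m n" "y \<in> S" "D < lk mo y" for mo y
    using c k that unfolding stable_from_def by blast
  show "dstep x c k (sg y 1 + mo) = dstep x c k mo" if y: "y \<in> {..<m} \<times> {..<n} - insert x S" and D: "D \<le> lk mo y"
  proof -
    have yx: "y \<noteq> x" using y by auto
    have "c k (sg y 1 + mo) = c k mo" by (rule c1[OF mo _ D]) (use y in auto)
    moreover have "lk (sg y 1 + mo) x = lk mo x" using yx by (simp add: lookup_add lookup_single when_def)
    moreover have "c k (sg y 1 + mo - sg x 1) = c k (mo - sg x 1)" if "lk mo x \<noteq> 0"
    proof -
      have "sg y 1 + mo - sg x 1 = sg y 1 + (mo - sg x 1)"
        by (rule poly_mapping_eqI) (use that yx in \<open>auto simp: lookup_add lookup_minus lookup_single when_def\<close>)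
      moreover have "c k (sg y 1 + (mo - sg x 1)) = c k (mo - sg x 1)"
        by (rule c1[OF sub]) (use y D yx in \<open>auto simp: lookup_minus lookup_single when_def\<close>)
      ultimately show ?thesis by simp
    qed
    ultimately show ?thesis by (simp add: dstep_def)
  qed
  show "dstep x c k mo = 0" if y: "y \<in> insert x S" and D: "D < lk mo y"
  proof (cases "y = x")
    case True
    have "c k (sg x 1 + (mo - sg x 1)) = c k (mo - sg x 1)"
      by (rule c1[OF sub]) (use x True D in \<open>auto simp: lookup_minus\<close>)
    moreover have "sg x 1 + (mo - sg x 1) = mo" by (rule sg_add_minus) (use D True in simp)
    ultimately have "c k mo = c k (mo - sg x 1)" by metis
    then show ?thesis using D True by (simp add: dstep_def)
  next
    case False
    then have "y \<in> S" using y by simp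
    have "c k mo = 0" by (rule c2[OF mo \<open>y \<in> S\<close> D])
    moreover have "c k (mo - sg x 1) = 0"
      by (rule c2[OF sub \<open>y \<in> S\<close>]) (use False D in \<open>auto simp: lookup_minus lookup_single when_def\<close>)
    ultimately show ?thesis by (simp add: dstep_def)
  qed
qed

lemma push_prod:
  assumes "stable_from D m {} c" "finite S" "S \<subseteq> {..<m} \<times> {..<n}"
  shows "\<exists>c'. conv (\<Prod>x\<in>S. 1 - sg (vdeg x) 1) (push m c) = push m c' \<and> stable_from D m S c'"
  using assms(2,3)
proof (induction S rule: finite_induct)
  case empty
  then show ?case using assms(1) by auto
next
  case (insert x S)
  then obtain c' where c': "conv (\<Prod>x\<in>S. 1 - sg (vdeg x) 1) (push m c) = push m c'" "stable_from D m S c'" by auto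
  have x: "x \<in> {..<m} \<times> {..<n}" and S: "S \<subseteq> {..<m} \<times> {..<n}" using insert.prems by auto
  have "conv (\<Prod>x\<in>insert x S. 1 - sg (vdeg x) 1) (push m c) = conv (1 - sg (vdeg x) 1) (push m c')"
    using insert.hyps c'(1) by (simp add: conv_mult)
  also have "\<dots> = push m (dstep x c')" by (rule push_dstep[OF x])
  finally show ?case using stable_from_dstep[OF S x insert.hyps(2) c'(2)] by (intro exI conjI)
qed

lemma Pr_eq_prod: "Pr m n = (\<Prod>x\<in>{..<m} \<times> {..<n}. 1 - sg (vdeg x) 1)"
proof -
  have "Pr m n = (\<Prod>(i, j)\<in>{..<m} \<times> {..<n}. 1 - upow i 1 * tvar j)"
    unfolding Pr_def by (rule prod.cartesian_product)
  also have "\<dots> = (\<Prod>x\<in>{..<m} \<times> {..<n}. 1 - sg (vdeg x) 1)"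
    by (rule prod.cong) (auto simp: upow_def tvar_def mult_single vdeg_def)
  finally show ?thesis .
qed

text \<open>After one difference in every variable the function is supported in the box of exponents
  at most \<open>D\<close>, so the series is a Laurent polynomial.\<close>

lemma push_finite:
  assumes "stable_from D m {} c"
  shows "\<exists>K. lk K = conv (Pr m n) (push m c)"
proof -
  let ?X = "{..<m} \<times> {..<n}"
  obtain c' where c': "conv (Pr m n) (push m c) = push m c'" "stable_from D m ?X c'"
    using push_prod[OF assms, of ?X] by (auto simp: Pr_eq_prod)
  let ?B = "{mo :: xmonom. ky mo \<subseteq> ?X \<and> (\<forall>x\<in>?X. lk mo x \<in> {..D})}"
  have "{d. push m c' d \<noteq> 0} \<subseteq> (\<lambda>(k, mo). mdeg mo + (0, w k)) ` ({..<q} \<times> ?B)"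
  proof
    fix d assume "d \<in> {d. push m c' d \<noteq> 0}"
    then have "(\<Sum>(k, mo)\<in>Idx m d. c' k mo) \<noteq> 0" by (simp add: push_def)
    then obtain s where s: "s \<in> Idx m d" "(case s of (k, mo) \<Rightarrow> c' k mo) \<noteq> 0" by (meson sum.neutral)
    obtain k mo where km: "s = (k, mo)" by (cases s)
    have 1: "k < q" "mo \<in> monoms m n" "mdeg mo + (0, w k) = d" using s(1) by (auto simp: km Idx_def)
    have "lk mo x \<le> D" if "x \<in> ?X" for x
    proof (rule ccontr)
      assume "\<not> lk mo x \<le> D"
      then have "c' k mo = 0" using c'(2) 1 that unfolding stable_from_def by (meson not_le)
      then show False using s(2) km by simp
    qed
    then have "(k, mo) \<in> {..<q} \<times> ?B" using 1 by (auto simp: monoms_def)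
    then show "d \<in> (\<lambda>(k, mo). mdeg mo + (0, w k)) ` ({..<q} \<times> ?B)" using 1(3) by (intro image_eqI[of _ _ "(k, mo)"]) auto
  qed
  moreover have "finite ({..<q} \<times> ?B)"
    by (intro finite_cartesian_product finite_bounded_poly_mapping) auto
  ultimately have "finite {d. push m c' d \<noteq> 0}" by (metis (lifting) finite_imageI finite_subset)
  then have "lk (Abs_poly_mapping (push m c')) = push m c'" by (rule lookup_Abs_poly_mapping)
  then show ?thesis using c'(1) by metis
qed

text \<open>Numbering the variables by naturals turns monomials into elements of
  \<open>nat \<Rightarrow>\<^sub>0 nat\<close>, whose linear order is compatible with
  addition.\<close>

definition enc :: "xmonom \<Rightarrow> (nat \<Rightarrow>\<^sub>0 nat)" where "enc mo = Poly_Mapping.map_key prod_decode mo"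

lemma enc_add: "enc (a + b) = enc a + enc b"
  by (simp add: enc_def map_key_plus inj_prod_decode)

lemma enc_inj: "enc a = enc b \<Longrightarrow> a = b"
proof (rule poly_mapping_eqI)
  fix x assume "enc a = enc b"
  then have "lk (enc a) (prod_encode x) = lk (enc b) (prod_encode x)" by simp
  then show "lk a x = lk b x" by (simp add: enc_def lookup_map_key_inj inj_prod_decode)
qed

text \<open>Monomials are compared first and basis vectors only break ties: a term order on the free
  module (\<open>mless_add\<close>).\<close>

definition mless :: "nat \<times> xmonom \<Rightarrow> nat \<times> xmonom \<Rightarrow> bool" where
  "mless s t \<longleftrightarrow> enc (snd s) < enc (snd t) \<or> snd s = snd t \<and> fst s < fst t"

lemma mless_total: "s \<noteq> t \<Longrightarrow> mless s t \<noteq> mless t s"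
  unfolding mless_def using enc_inj[of "snd s" "snd t"] by (cases s; cases t) auto

lemma mless_trans: "mless s t \<Longrightarrow> mless t u \<Longrightarrow> mless s u"
  by (auto simp: mless_def)

lemma mless_irrefl: "\<not> mless s s"
  by (simp add: mless_def)

lemma mless_add: "mless (k, sg x 1 + mo) (k', sg x 1 + mo') \<longleftrightarrow> mless (k, mo) (k', mo')"
  by (auto simp: mless_def enc_add)

definition Lead :: "nat \<Rightarrow> 'k::comm_ring_1 fvec set \<Rightarrow> expo \<Rightarrow> (nat \<times> xmonom) set" where
  "Lead m W d = {s \<in> Idx m d. \<exists>x\<in>W \<inter> HD d. lk (x (fst s)) (snd s) \<noteq> 0 \<and> (\<forall>t\<in>Idx m d. mless s t \<longrightarrow> lk (x (fst t)) (snd t) = 0)}"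

lemma hd_Lead: "ksub W \<Longrightarrow> W \<subseteq> FM n q m \<Longrightarrow> hd W d = card (Lead m W d)"
  unfolding hd_def Lead_def
  by (rule conjunct1[OF dim_piece_leading]) (auto simp: mless_total mless_irrefl intro: mless_trans)

lemma Lead_FM: "Lead m (FM n q m :: 'k::field fvec set) d = Idx m d"
proof -
  have "s \<in> Lead m (FM n q m :: 'k fvec set) d" if s: "s \<in> Idx m d" for s
  proof -
    obtain k mo where km: "s = (k, mo)" by (cases s)
    let ?p = "\<lambda>i. if i = k then sg mo 1 else 0 :: 'k xpoly"
    have i: "k < q" "mo \<in> monoms m n" "mdeg mo + (0, w k) = d" using s by (auto simp: km Idx_def)
    have "hg (d - (0, w k)) (sg mo (1::'k))" using hg_single[of mo 1] i(3) by (metis add_diff_cancel_right')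
    then have "?p \<in> FM n q m \<inter> HD d" using i by (auto simp: FM_def HD_def cin_single)
    moreover have "lk (?p (fst t)) (snd t) = 0" if "mless s t" for t
      using that mless_irrefl[of s] by (cases t) (auto simp: km lookup_single when_def)
    ultimately show ?thesis using s unfolding Lead_def km by (auto intro!: bexI[of _ ?p])
  qed
  then show ?thesis by (auto simp: Lead_def)
qed

lemma HD_xvar_mult: "p \<in> HD d \<Longrightarrow> (\<lambda>k. xvar i j * p k) \<in> HD (d + vdeg (i, j))"
proof -
  assume p: "p \<in> HD d"
  have "hg (d + vdeg (i, j) - (0, w k)) (xvar i j * p k)" for k
  proof -
    have "hg ((sg i 1, sg j 1) + (d - (0, w k))) (xvar i j * p k)"
      by (rule hg_mult[OF hg_var]) (use p in \<open>simp add: HD_def\<close>)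
    moreover have "(sg i 1, sg j 1) + (d - (0, w k)) = d + vdeg (i, j) - (0, w k)" by (simp add: vdeg_def add.commute add_diff_eq)
    ultimately show ?thesis by metis
  qed
  then show ?thesis by (simp add: HD_def)
qed

text \<open>Dimensions of \<open>W\<close> count leading terms (\<open>hd_Lead\<close>), and the
  leading monomials at each basis vector are closed under multiplication by variables. The indicator
  function of the other terms is therefore eventually constant in each variable, and
  \<open>push_finite\<close> applies.\<close>

theorem K_polynomial_exists:
  fixes W :: "'k::field fvec set"
  assumes W: "ksub W" "W \<subseteq> FM n q m"
    and mult: "\<And>i j p. i < m \<Longrightarrow> j < n \<Longrightarrow> p \<in> W \<Longrightarrow> (\<lambda>k. xvar i j * p k) \<in> W"
  shows "\<exists>K. lk K = conv (Pr m n) (\<lambda>d. int (hd (FM n q m :: 'k fvec set) d) - int (hd W d))"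
proof -
  let ?X = "{..<m} \<times> {..<n}"
  define I where "I k = {mo \<in> monoms m n. (k, mo) \<in> Lead m W (mdeg mo + (0, w k))}" for k
  have up: "sg x 1 + mo \<in> I k" if mo: "mo \<in> I k" and x: "x \<in> ?X" for x mo k
  proof -
    obtain i j where ij: "x = (i, j)" "i < m" "j < n" using x by auto
    let ?d = "mdeg mo + (0, w k)"
    obtain p where p: "p \<in> W \<inter> HD ?d" "lk (p k) mo \<noteq> 0" and ld: "\<And>t. t \<in> Idx m ?d \<Longrightarrow> mless (k, mo) t \<Longrightarrow> lk (p (fst t)) (snd t) = 0"
      and kI: "(k, mo) \<in> Idx m ?d"
      using mo by (auto simp: I_def Lead_def)
    let ?p = "\<lambda>k. xvar i j * p k"
    have d': "mdeg (sg x 1 + mo) + (0, w k) = ?d + vdeg x" unfolding mdeg_sg_add by (simp add: add_ac)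
    have pW: "?p \<in> W \<inter> HD (?d + vdeg x)" using HD_xvar_mult[of p ?d i j] mult[OF ij(2,3)] p(1) ij(1) by blast
    have idx: "(k, sg x 1 + mo) \<in> Idx m (?d + vdeg x)" by (rule Idx_add[OF x kI])
    have nz: "lk (?p k) (sg x 1 + mo) \<noteq> 0" using p(2) by (simp add: lookup_xvar_mult lookup_add ij(1))
    have z: "lk (?p (fst t)) (snd t) = 0" if t: "t \<in> Idx m (?d + vdeg x)" "mless (k, sg x 1 + mo) t" for t
    proof (cases "lk (snd t) x = 0")
      case False
      have e: "snd t = sg x 1 + (snd t - sg x 1)" using sg_add_minus[OF False] by simp
      have "(fst t, snd t - sg x 1) \<in> Idx m (?d + vdeg x - vdeg x)" by (rule Idx_minus) (use t(1) False in auto)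
      then have 1: "(fst t, snd t - sg x 1) \<in> Idx m ?d" by simp
      have "mless (k, sg x 1 + mo) (fst t, sg x 1 + (snd t - sg x 1))" using t(2) e by (metis prod.collapse)
      then have 2: "mless (k, mo) (fst t, snd t - sg x 1)" by (simp only: mless_add)
      show ?thesis using ld[OF 1 2] by (simp add: lookup_xvar_mult ij(1))
    qed (simp add: lookup_xvar_mult ij(1))
    have "(k, sg x 1 + mo) \<in> Lead m W (?d + vdeg x)"
      unfolding Lead_def using idx pW nz z by (auto intro!: bexI[of _ ?p])
    moreover have "sg x 1 + mo \<in> monoms m n" using idx by (simp add: Idx_def)
    ultimately show ?thesis unfolding I_def by (simp only: d' mem_Collect_eq simp_thms)
  qed
  have "\<forall>k. \<exists>D. \<forall>D'\<ge>D. \<forall>mo x. ky mo \<subseteq> ?X \<longrightarrow> x \<in> ?X \<longrightarrow> D' \<le> lk mo x \<longrightarrow> (sg x 1 + mo \<in> I k \<longleftrightarrow> mo \<in> I k)"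
  proof (intro allI upset_stabilizes)
    show "ky mo \<subseteq> ?X" if "mo \<in> I k" for k mo using that by (auto simp: I_def monoms_def)
    show "sg x 1 + mo \<in> I k" if "mo \<in> I k" "x \<in> ?X" for k mo x by (rule up[OF that])
  qed simp
  from choice[OF this] obtain D where D: "\<forall>k. \<forall>D'\<ge>D k. \<forall>mo x. ky mo \<subseteq> ?X \<longrightarrow> x \<in> ?X \<longrightarrow> D' \<le> lk mo x \<longrightarrow> (sg x 1 + mo \<in> I k \<longleftrightarrow> mo \<in> I k)"
    by (elim exE)
  \<comment> \<open>One bound for all \<open>q\<close> basis vectors.\<close>
  define DD where "DD = (\<Sum>k<q. D k)"
  define c where "c k mo = (if mo \<in> I k then 0 else 1 :: int)" for k mo
  have "stable_from DD m {} c"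
    unfolding stable_from_def
  proof (intro allI impI ballI conjI)
    fix k mo y assume k: "k < q" and mo: "mo \<in> monoms m n" and y: "y \<in> ?X - {}" "DD \<le> lk mo y"
    have "D k \<le> DD" unfolding DD_def using k by (intro member_le_sum) auto
    moreover have "ky mo \<subseteq> ?X" using mo by (simp add: monoms_def)
    ultimately have "sg y 1 + mo \<in> I k \<longleftrightarrow> mo \<in> I k" using D y by blast
    then show "c k (sg y 1 + mo) = c k mo" by (simp add: c_def)
  qed simp
  from push_finite[OF this] obtain K where K: "lk K = conv (Pr m n) (push m c)" by blast
  have "push m c d = int (hd (FM n q m :: 'k fvec set) d) - int (hd W d)" for d
  proof -
    have sub: "Lead m W d \<subseteq> Idx m d" by (auto simp: Lead_def)
    have "push m c d = (\<Sum>s\<in>Idx m d. if s \<in> Lead m W d then 0 else 1)"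
      unfolding push_def by (rule sum.cong) (auto simp: c_def I_def Idx_def)
    also have "\<dots> = int (card (Idx m d - Lead m W d))"
      using finite_Idx by (simp add: sum.If_cases Diff_eq)
    also have "\<dots> = int (card (Idx m d)) - int (card (Lead m W d))"
      using sub finite_Idx card_mono[OF finite_Idx sub] by (simp add: card_Diff_subset finite_subset of_nat_diff)
    finally show ?thesis by (simp add: hd_Lead[OF W] hd_Lead[OF ksub_FM subset_refl] Lead_FM)
  qed
  then have "push m c = (\<lambda>d. int (hd (FM n q m :: 'k fvec set) d) - int (hd W d))" by (rule ext)
  then show ?thesis using K by metis
qed

end

section \<open>Linear substitutions\<close>

text \<open>\<open>R\<close> counts the rows of the target and may differ from the number of rows of
  the source; group elements, row permutations and the projection that forgets the last row are all
  of this form.\<close>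

definition sb :: "nat \<Rightarrow> (nat \<Rightarrow> nat \<Rightarrow> 'k::comm_ring_1) \<Rightarrow> (nat \<Rightarrow> 'k) \<Rightarrow> 'k xpoly \<Rightarrow> 'k xpoly" where
  "sb R A t = peval xconst (\<lambda>(i, j). \<Sum>l<R. xconst (A i l * t j) * xvar l j)"

lemma sb_add: "sb R A t (f + g) = sb R A t f + sb R A t g"
  and sb_mult: "sb R A t (f * g) = sb R A t f * sb R A t g"
  and sb_const [simp]: "sb R A t (xconst a) = xconst a"
  and sb_var: "sb R A t (xvar i j) = (\<Sum>l<R. xconst (A i l * t j) * xvar l j)"
  and sb_0 [simp]: "sb R A t 0 = 0"
  and sb_sum: "sb R A t (\<Sum>x\<in>S. F x) = (\<Sum>x\<in>S. sb R A t (F x))"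
  by (simp_all add: sb_def peval_add peval_mult peval_const peval_var peval_sum xconst_hom)

lemma sb_1 [simp]: "sb R A t 1 = 1"
  using sb_const[of R A t 1] by simp

lemma sb_of_int [simp]: "sb R A t (of_int k) = of_int k"
  using sb_const[of R A t "of_int k"] by (simp add: xconst_of_int)

lemma sb_prod: "sb R A t (\<Prod>x\<in>S. F x) = (\<Prod>x\<in>S. sb R A t (F x))"
  by (induction S rule: infinite_finite_induct) (auto simp: sb_mult)

lemma sb_cin: "cin m n f \<Longrightarrow> cin R n (sb R A t f)"
  unfolding sb_def by (rule cin_peval) (auto intro!: cin_sum cin_mult cin_var)

lemma sb_comp:
  "sb R A t (sb R' B s f) = sb R (\<lambda>i k. \<Sum>l<R'. B i l * A l k) (\<lambda>j. s j * t j) f"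
proof (induction f rule: xpoly_induct)
  case (var i j g)
  have "sb R A t (sb R' B s (xvar i j)) = (\<Sum>l<R'. \<Sum>k<R. xconst (B i l * A l k * (s j * t j)) * xvar k j)"
    by (simp add: sb_var sb_sum sb_mult sum_distrib_left xconst_mult mult_ac)
  also have "\<dots> = (\<Sum>k<R. \<Sum>l<R'. xconst (B i l * A l k * (s j * t j)) * xvar k j)" by (rule sum.swap)
  also have "\<dots> = sb R (\<lambda>i k. \<Sum>l<R'. B i l * A l k) (\<lambda>j. s j * t j) (xvar i j)"
    by (simp add: sb_var xconst_sum sum_distrib_right sum_distrib_left xconst_mult)
  finally show ?case using var by (simp add: sb_mult)
qed (auto simp: sb_add)

lemma sb_cong:
  assumes "cin m n f" "\<And>i l. i < m \<Longrightarrow> l < R \<Longrightarrow> A i l = B i l" "\<And>j. j < n \<Longrightarrow> s j = t j"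
  shows "sb R A s f = sb R B t f"
  by (rule hom_unique[OF sb_add sb_mult sb_add sb_mult _ _ assms(1)]) (auto simp: sb_var assms intro!: sum.cong)

lemma sb_id:
  assumes "cin m n f"
  shows "sb m (\<lambda>i l. if i = l then 1 else 0) (\<lambda>_. 1) f = f"
proof (rule hom_unique[OF sb_add sb_mult _ _ _ _ assms, where B = "\<lambda>f. f"])
  fix i j assume i: "i < m"
  have "sb m (\<lambda>i l. if i = l then 1 else 0) (\<lambda>_. 1) (xvar i j) = (\<Sum>l<m. if i = l then xvar l j else 0 :: 'a xpoly)"
    unfolding sb_var by (rule sum.cong) auto
  then show "sb m (\<lambda>i l. if i = l then 1 else 0) (\<lambda>_. 1) (xvar i j) = (xvar i j :: 'a xpoly)" using i by simp
qed simp_all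

section \<open>Characters of the diagonal torus\<close>

definition chi :: "nat \<Rightarrow> nat \<Rightarrow> (nat \<Rightarrow> 'k::field) \<Rightarrow> (nat \<Rightarrow> 'k) \<Rightarrow> expo \<Rightarrow> 'k" where
  "chi m n a t d = (\<Prod>i<m. a i powi lk (fst d) i) * (\<Prod>j<n. t j powi lk (snd d) j)"

lemma chi_add:
  assumes "\<And>i. i < m \<Longrightarrow> a i \<noteq> 0" "\<And>j. j < n \<Longrightarrow> t j \<noteq> 0"
  shows "chi m n a t (d + e) = chi m n a t d * chi m n a t e"
proof -
  have "(\<Prod>i<m. a i powi lk (fst (d + e)) i) = (\<Prod>i<m. a i powi lk (fst d) i) * (\<Prod>i<m. a i powi lk (fst e) i)"
    unfolding prod.distrib[symmetric] by (rule prod.cong) (auto simp: lookup_add power_int_add assms)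
  moreover have "(\<Prod>j<n. t j powi lk (snd (d + e)) j) = (\<Prod>j<n. t j powi lk (snd d) j) * (\<Prod>j<n. t j powi lk (snd e) j)"
    unfolding prod.distrib[symmetric] by (rule prod.cong) (auto simp: lookup_add power_int_add assms)
  ultimately show ?thesis by (simp add: chi_def)
qed

lemma chi_0 [simp]: "chi m n a t 0 = 1"
  by (simp add: chi_def)

lemma chi_single:
  assumes "i < m" "j < n"
  shows "chi m n a t (sg i 1, sg j 1) = a i * t j"
proof -
  have "(\<Prod>x<m. a x powi lk (sg i 1) x) = (\<Prod>x<m. if x = i then a i else 1)"
    by (rule prod.cong) (auto simp: lookup_single when_def)
  moreover have "(\<Prod>x<n. t x powi lk (sg j 1) x) = (\<Prod>x<n. if x = j then t j else 1)"
    by (rule prod.cong) (auto simp: lookup_single when_def)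
  ultimately show ?thesis using assms by (simp add: chi_def)
qed

definition diagf :: "(nat \<Rightarrow> 'k::zero) \<Rightarrow> nat \<Rightarrow> nat \<Rightarrow> 'k" where
  "diagf a = (\<lambda>i l. if i = l then a i else 0)"

lemma sb_diag_single:
  assumes nz: "\<And>i. i < m \<Longrightarrow> a i \<noteq> 0" "\<And>j. j < n \<Longrightarrow> t j \<noteq> 0" and mo: "mo \<in> monoms m n"
  shows "sb m (diagf a) t (sg mo c) = xconst (chi m n a t (mdeg mo)) * sg mo c"
  using mo
proof (induction mo rule: monom_induct)
  case zero
  then show ?case using sb_const[of m "diagf a" t c] by (simp add: xconst_def mult_single)
next
  case (add i j mo)
  have v: "sb m (diagf a) t (xvar i j) = xconst (a i * t j) * xvar i j"
  proof -
    have "sb m (diagf a) t (xvar i j) = (\<Sum>l<m. if l = i then xconst (a i * t j) * xvar i j else 0)"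
      unfolding sb_var by (rule sum.cong) (auto simp: diagf_def)
    then show ?thesis using add by simp
  qed
  have "mdeg (sg (i, j) 1 + mo) = (sg i 1, sg j 1) + mdeg mo" by (simp add: mdeg_add)
  then have "chi m n a t (mdeg (sg (i, j) 1 + mo)) = a i * t j * chi m n a t (mdeg mo)"
    using add by (simp only: chi_add[OF nz] chi_single)
  then show ?case unfolding xvar_times_single[symmetric] sb_mult v add.IH by (simp only: xconst_mult mult_ac)
qed

lemma lookup_sb_diag:
  assumes nz: "\<And>i. i < m \<Longrightarrow> a i \<noteq> 0" "\<And>j. j < n \<Longrightarrow> t j \<noteq> 0" and f: "cin m n f"
  shows "lk (sb m (diagf a) t f) mo = chi m n a t (mdeg mo) * lk f mo"
proof -
  have "sb m (diagf a) t f = (\<Sum>e\<in>ky f. xconst (chi m n a t (mdeg e)) * sg e (lk f e))"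
    by (subst poly_mapping_sum_single[of f], subst sb_sum) (use f in \<open>auto simp: cin_def intro!: sum.cong sb_diag_single[OF nz]\<close>)
  then have "lk (sb m (diagf a) t f) mo = (\<Sum>e\<in>ky f. chi m n a t (mdeg e) * (if e = mo then lk f e else 0))"
    by (simp add: lookup_sum lookup_xconst_mult lookup_single when_def)
  also have "\<dots> = (\<Sum>e\<in>ky f. if e = mo then chi m n a t (mdeg mo) * lk f mo else 0)" by (rule sum.cong) auto
  finally have "lk (sb m (diagf a) t f) mo = (\<Sum>e\<in>ky f. if e = mo then chi m n a t (mdeg mo) * lk f mo else 0)" .
  then show ?thesis by (auto simp: in_keys_iff)
qed

lemma power_int_2_inj:
  assumes "(2::'k::field_char_0) powi x = 2 powi y" shows "x = y"
proof -
  have *: "y \<le> x \<Longrightarrow> (2::'k) powi x = 2 powi y \<Longrightarrow> x = y" for x y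
  proof -
    assume le: "y \<le> x" and eq: "(2::'k) powi x = 2 powi y"
    have "(2::'k) powi (x - y) = 1" using eq by (simp add: power_int_diff)
    moreover have "(2::'k) powi (x - y) = 2 ^ nat (x - y)" using le by (simp add: power_int_def)
    ultimately have "(2::'k) ^ nat (x - y) = 1" by metis
    then have "of_nat (2 ^ nat (x - y)) = (of_nat 1 :: 'k)" by simp
    then have "2 ^ nat (x - y) = (1::nat)" by (simp only: of_nat_eq_iff)
    then show "x = y" using le by simp
  qed
  show ?thesis
  proof (cases "y \<le> x")
    case True then show ?thesis using *[of y x] assms by blast
  next
    case False then show ?thesis using *[of x y] assms by simp
  qed
qed

text \<open>Two bidegrees differ in some coordinate; the torus element with 2 there and 1 elsewhere
  separates them, as 2 has infinite multiplicative order in characteristic zero.\<close>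

lemma chi_separates:
  assumes d: "gdeg' d" and e: "gdeg' e" and ne: "d \<noteq> e"
    and gd: "\<And>d. gdeg' d \<Longrightarrow> ky (fst d) \<subseteq> {..<m} \<and> ky (snd d) \<subseteq> {..<n}"
  shows "\<exists>a t. (\<forall>i. a i \<noteq> 0) \<and> (\<forall>j. t j \<noteq> 0) \<and> chi m n a t d \<noteq> (chi m n a t e :: 'k::field_char_0)"
proof (cases "fst d = fst e")
  case False
  then obtain i where i: "lk (fst d) i \<noteq> lk (fst e) i" by (metis poly_mapping_eqI)
  then have "i \<in> ky (fst d) \<union> ky (fst e)" by (auto simp: in_keys_iff)
  then have im: "i < m" using gd[OF d] gd[OF e] by auto
  have c: "chi m n (\<lambda>x. if x = i then 2 else 1) (\<lambda>_. 1) d = (2::'k) powi lk (fst d) i" for d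
  proof -
    have "(\<Prod>x<m. (if x = i then 2 else 1 :: 'k) powi lk (fst d) x) = (\<Prod>x<m. if x = i then 2 powi lk (fst d) i else 1)"
      by (rule prod.cong) auto
    then show ?thesis using im by (simp add: chi_def)
  qed
  have "chi m n (\<lambda>x. if x = i then 2 else 1) (\<lambda>_. 1) d \<noteq> (chi m n (\<lambda>x. if x = i then 2 else 1) (\<lambda>_. 1) e :: 'k)"
    unfolding c using i power_int_2_inj by blast
  then show ?thesis by (intro exI[of _ "\<lambda>x. if x = i then 2 else 1"] exI[of _ "\<lambda>_. 1"]) auto
next
  case True
  then have "snd d \<noteq> snd e" using ne by (metis prod.collapse)
  then obtain i where i: "lk (snd d) i \<noteq> lk (snd e) i" by (metis poly_mapping_eqI)
  then have "i \<in> ky (snd d) \<union> ky (snd e)" by (auto simp: in_keys_iff)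
  then have im: "i < n" using gd[OF d] gd[OF e] by auto
  have c: "chi m n (\<lambda>_. 1) (\<lambda>x. if x = i then 2 else 1) d = (2::'k) powi lk (snd d) i" for d
  proof -
    have "(\<Prod>x<n. (if x = i then 2 else 1 :: 'k) powi lk (snd d) x) = (\<Prod>x<n. if x = i then 2 powi lk (snd d) i else 1)"
      by (rule prod.cong) auto
    then show ?thesis using im by (simp add: chi_def)
  qed
  have "chi m n (\<lambda>_. 1) (\<lambda>x. if x = i then 2 else 1) d \<noteq> (chi m n (\<lambda>_. 1) (\<lambda>x. if x = i then 2 else 1) e :: 'k)"
    unfolding c using i power_int_2_inj by blast
  then show ?thesis by (intro exI[of _ "\<lambda>x. if x = i then 2 else 1"] exI[of _ "\<lambda>_. 1"]) auto
qed

section \<open>One-parameter families\<close>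

lemma scl_sum_right: "scl c (\<Sum>x\<in>S. f x) = (\<Sum>x\<in>S. scl c (f x))"
  by (rule ext) (simp add: scl_def fun_sum_apply sum_distrib_left)

text \<open>The divided difference of the curve at a fixed parameter \<open>s0\<close> has lower
  degree, stays in the subspace and has the same leading coefficient; removing the leading term then
  allows the induction to continue.\<close>

lemma ksub_poly_coeffs:
  fixes c :: "nat \<Rightarrow> 'k::field fvec"
  assumes W: "ksub W" and S: "infinite S" and in_W: "\<And>s. s \<in> S \<Longrightarrow> (\<Sum>e\<le>N. scl (s ^ e) (c e)) \<in> W"
  shows "\<forall>e\<le>N. c e \<in> W"
  using S in_W
proof (induction N arbitrary: c S)
  case 0
  then obtain s where "s \<in> S" using infinite_imp_nonempty by blast
  then show ?case using 0(2)[of s] by simp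
next
  case (Suc N)
  obtain s0 where s0: "s0 \<in> S" using Suc.prems(1) infinite_imp_nonempty by blast
  \<comment> \<open>The coefficients of \<open>(P(s) - P(s0)) / (s - s0)\<close> for the curve
    \<open>P(s) = \<Sum>e. s^e c_e\<close>.\<close>
  define d where "d i = (\<Sum>e\<in>{Suc i..Suc N}. scl (s0 ^ (e - Suc i)) (c e))" for i
  have "(\<Sum>i\<le>N. scl (s ^ i) (d i)) \<in> W" if s: "s \<in> S - {s0}" for s
  proof -
    have ne: "s - s0 \<noteq> 0" using s by auto
    have "(\<Sum>i\<le>N. scl (s ^ i) (d i)) = (\<Sum>i\<le>N. \<Sum>e\<in>{Suc i..Suc N}. scl (s ^ i * s0 ^ (e - Suc i)) (c e))"
      by (simp only: d_def scl_sum_right scl_scl)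
    also have "\<dots> = (\<Sum>e\<in>{1..Suc N}. \<Sum>i<e. scl (s ^ i * s0 ^ (e - Suc i)) (c e))"
    proof -
      have "(\<Sum>i\<le>N. \<Sum>e\<in>{Suc i..Suc N}. scl (s ^ i * s0 ^ (e - Suc i)) (c e)) = (\<Sum>(i, e)\<in>(SIGMA i:{..N}. {Suc i..Suc N}). scl (s ^ i * s0 ^ (e - Suc i)) (c e))"
        by (rule sum.Sigma) auto
      also have "\<dots> = (\<Sum>(e, i)\<in>(SIGMA e:{1..Suc N}. {..<e}). scl (s ^ i * s0 ^ (e - Suc i)) (c e))"
        by (rule sum.reindex_bij_witness[where i = "\<lambda>(e, i). (i, e)" and j = "\<lambda>(i, e). (e, i)"]) auto
      also have "\<dots> = (\<Sum>e\<in>{1..Suc N}. \<Sum>i<e. scl (s ^ i * s0 ^ (e - Suc i)) (c e))"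
        by (rule sum.Sigma[symmetric]) auto
      finally show ?thesis .
    qed
    also have "\<dots> = (\<Sum>e\<in>{1..Suc N}. scl (inverse (s - s0)) (scl (s ^ e) (c e) - scl (s0 ^ e) (c e)))"
    proof (rule sum.cong[OF refl])
      fix e
      have "(\<Sum>i<e. scl (s ^ i * s0 ^ (e - Suc i)) (c e)) = scl (\<Sum>i<e. s ^ i * s0 ^ (e - Suc i)) (c e)"
        by (rule ext) (simp add: fun_sum_apply scl_def xconst_sum sum_distrib_right)
      also have "(\<Sum>i<e. s ^ i * s0 ^ (e - Suc i)) = inverse (s - s0) * (s ^ e - s0 ^ e)"
        using ne by (simp add: power_diff_sumr2 mult.commute)
      finally show "(\<Sum>i<e. scl (s ^ i * s0 ^ (e - Suc i)) (c e)) = scl (inverse (s - s0)) (scl (s ^ e) (c e) - scl (s0 ^ e) (c e))"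
        by (simp only: scl_scl scl_diff_left[symmetric])
    qed
    also have "\<dots> = (\<Sum>e\<le>Suc N. scl (inverse (s - s0)) (scl (s ^ e) (c e) - scl (s0 ^ e) (c e)))"
      by (rule sum.mono_neutral_left) (auto simp: not_le less_Suc_eq_le)
    also have "\<dots> = scl (inverse (s - s0)) ((\<Sum>e\<le>Suc N. scl (s ^ e) (c e)) - (\<Sum>e\<le>Suc N. scl (s0 ^ e) (c e)))"
      by (simp only: scl_sum_right flip: sum_subtractf)
    also have "\<dots> \<in> W" using s by (intro ksub_scl[OF W] ksub_diff[OF W] Suc.prems(2) s0) simp
    finally show ?thesis .
  qed
  then have "\<forall>i\<le>N. d i \<in> W" by (intro Suc.IH[of "S - {s0}"]) (use Suc.prems(1) in auto)
  then have "d N \<in> W" by simp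
  then have top: "c (Suc N) \<in> W" by (simp add: d_def)
  have "\<forall>e\<le>N. c e \<in> W"
  proof (rule Suc.IH[OF Suc.prems(1)])
    fix s assume s: "s \<in> S"
    have "(\<Sum>e\<le>Suc N. scl (s ^ e) (c e)) - scl (s ^ Suc N) (c (Suc N)) \<in> W"
      by (rule ksub_diff[OF W Suc.prems(2)[OF s] ksub_scl[OF W top]])
    then show "(\<Sum>e\<le>N. scl (s ^ e) (c e)) \<in> W" by simp
  qed
  then show ?case using top by (simp add: le_Suc_eq)
qed

text \<open>Substitution by the matrix \<open>A + s B\<close> with a formal parameter
  \<open>s\<close>, so that single coefficients in \<open>s\<close> can be extracted.\<close>

definition fam :: "nat \<Rightarrow> (nat \<Rightarrow> nat \<Rightarrow> 'k::comm_ring_1) \<Rightarrow> (nat \<Rightarrow> nat \<Rightarrow> 'k) \<Rightarrow> 'k xpoly \<Rightarrow> 'k xpoly poly" where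
  "fam R A B = peval (\<lambda>a. [:xconst a:]) (\<lambda>(i, j). [:\<Sum>l<R. xconst (A i l) * xvar l j, \<Sum>l<R. xconst (B i l) * xvar l j:])"

lemma poly_fam: "poly (fam R A B f) (xconst s) = sb R (\<lambda>i l. A i l + s * B i l) (\<lambda>_. 1) f"
proof (induction f rule: xpoly_induct)
  case (const a) then show ?case by (simp add: fam_def peval_const pconst_hom)
next
  case (add f g) then show ?case by (simp add: fam_def peval_add pconst_hom sb_add)
next
  case (var i j g)
  then have g: "poly (peval (\<lambda>a. [:xconst a:]) (\<lambda>(i, j). [:\<Sum>l<R. xconst (A i l) * xvar l j, \<Sum>l<R. xconst (B i l) * xvar l j:]) g) (xconst s)
     = sb R (\<lambda>i l. A i l + s * B i l) (\<lambda>_. 1) g" by (simp add: fam_def)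
  show ?case
    by (simp add: fam_def peval_mult peval_var pconst_hom sb_mult g sb_var)
       (simp add: xconst_add xconst_mult distrib_right sum.distrib mult.assoc flip: sum_distrib_left)
qed

lemma fam_coeff0: "coeff (fam R A B f) 0 = sb R A (\<lambda>_. 1) f"
  using poly_fam[of R A B f 0] by (simp add: poly_0_coeff_0)

text \<open>The identity plus \<open>s\<close> times the matrix unit at \<open>(j, i)\<close>
  replaces row \<open>j\<close> by row \<open>j\<close> plus \<open>s\<close> times row
  \<open>i\<close>; this is the perturbation that defines \<open>Eop n i j\<close>.\<close>

lemma fam_coeff1_Eop:
  assumes "cin m n f" "i < m"
  shows "coeff (fam m (\<lambda>a b. if a = b then 1 else 0) (\<lambda>a b. if a = j \<and> b = i then 1 else 0) f) 1 = Eop n i j f"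
proof -
  have "fam m (\<lambda>a b. if a = b then 1 else 0) (\<lambda>a b. if a = j \<and> b = i then 1 else 0) f = pev1 (\<lambda>(a, l). if a = j \<and> l < n then xvar i l else 0) f"
  proof (rule hom_unique[OF _ _ _ _ _ _ assms(1)])
    fix a b assume ab: "a < m" "b < n"
    have "(\<Sum>l<m. xconst (if a = l then 1 else 0) * xvar l b) = (\<Sum>l<m. if l = a then xvar a b else 0 :: 'a xpoly)"
      by (rule sum.cong) auto
    moreover have "(\<Sum>l<m. xconst (if a = j \<and> l = i then 1 else 0) * xvar l b) = (\<Sum>l<m. if l = i then (if a = j then xvar i b else 0) else 0 :: 'a xpoly)"
      by (rule sum.cong) auto
    ultimately show "fam m (\<lambda>a b. if a = b then 1 else 0) (\<lambda>a b. if a = j \<and> b = i then 1 else 0) (xvar a b) = pev1 (\<lambda>(a, l). if a = j \<and> l < n then xvar i l else 0) (xvar a b :: 'a xpoly)"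
      using ab assms(2) by (simp add: fam_def pev1_def peval_var pconst_hom)
  qed (simp_all add: fam_def pev1_def peval_add peval_mult peval_const pconst_hom)
  then show ?thesis by (simp add: Eop_def Dv_def)
qed

section \<open>Equivariant submodules in coordinates\<close>

context fmod
begin

definition tch :: "(nat \<Rightarrow>\<^sub>0 int) \<Rightarrow> (nat \<Rightarrow> 'k::field) \<Rightarrow> 'k" where
  "tch b t = (\<Prod>j<n. t j powi lk b j)"

text \<open>\<open>A\<close> stands for the inverse of the group element, as in
  \<open>f(g^(-1) v t)\<close>; the factor \<open>tch (w k) t\<close> is the torus acting on the
  \<open>k\<close>-th basis vector of \<open>V\<close>.\<close>

definition mact :: "nat \<Rightarrow> (nat \<Rightarrow> nat \<Rightarrow> 'k::field) \<Rightarrow> (nat \<Rightarrow> 'k) \<Rightarrow> 'k fvec \<Rightarrow> 'k fvec" where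
  "mact m A t p = (\<lambda>k. xconst (tch (w k) t) * sb m A t (p k))"

definition dt :: "nat \<Rightarrow> (nat \<Rightarrow> nat \<Rightarrow> 'k::field) \<Rightarrow> 'k" where
  "dt m A = det (mat m m (\<lambda>(i, j). A i j))"

text \<open>Equivariant submodules in coordinates. Invertible matrices \<open>A\<close> are used in
  place of inverses of group elements, which form the same set.\<close>

definition eqs :: "nat \<Rightarrow> 'k::field fvec set \<Rightarrow> bool" where
  "eqs m W \<longleftrightarrow> W \<subseteq> FM n q m \<and> 0 \<in> W \<and> (\<forall>p\<in>W. \<forall>p'\<in>W. p + p' \<in> W) \<and>
     (\<forall>f. cin m n f \<longrightarrow> (\<forall>p\<in>W. (\<lambda>k. f * p k) \<in> W)) \<and>
     (\<forall>A t. dt m A \<noteq> 0 \<longrightarrow> (\<forall>j<n. t j \<noteq> 0) \<longrightarrow> (\<forall>p\<in>W. mact m A t p \<in> W))"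

lemma eqs_FM: "eqs m W \<Longrightarrow> W \<subseteq> FM n q m"
  and eqs_mult: "eqs m W \<Longrightarrow> cin m n f \<Longrightarrow> p \<in> W \<Longrightarrow> (\<lambda>k. f * p k) \<in> W"
  and eqs_act: "eqs m W \<Longrightarrow> dt m A \<noteq> 0 \<Longrightarrow> (\<And>j. j < n \<Longrightarrow> t j \<noteq> 0) \<Longrightarrow> p \<in> W \<Longrightarrow> mact m A t p \<in> W"
  by (auto simp: eqs_def)

lemma eqs_ksub: "eqs m W \<Longrightarrow> ksub W"
  unfolding ksub_def scl_def using cin_const by (auto simp: eqs_def)

lemma mact_FM: "p \<in> FM n q m \<Longrightarrow> mact m A t p \<in> FM n q m"
  by (auto simp: FM_def mact_def intro!: cin_mult sb_cin)

lemma tch_one [simp]: "tch b (\<lambda>_. 1) = 1"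
  by (simp add: tch_def)

lemma mact_one: "mact m A (\<lambda>_. 1) p = (\<lambda>k. sb m A (\<lambda>_. 1) (p k))"
  by (simp add: mact_def)

lemma dt_diag: "dt m (diagf a) = (\<Prod>i<m. a i)"
proof -
  have "dt m (diagf a) = prod_list (diag_mat (mat m m (\<lambda>(i, j). diagf a i j)))"
    unfolding dt_def by (rule det_upper_triangular[of _ m]) (auto simp: diagf_def intro!: upper_triangularI)
  also have "\<dots> = (\<Prod>i<m. a i)" by (simp add: prod_list_diag_prod diagf_def atLeast0LessThan)
  finally show ?thesis .
qed

lemma lookup_mact_diag:
  assumes nz: "\<And>i. i < m \<Longrightarrow> a i \<noteq> 0" "\<And>j. j < n \<Longrightarrow> t j \<noteq> 0" and p: "p \<in> FM n q m"
  shows "lk (mact m (diagf a) t p k) mo = chi m n a t (mdeg mo + (0, w k)) * lk (p k) mo"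
proof -
  have "chi m n a t (0, w k) = tch (w k) t" by (simp add: chi_def tch_def)
  then show ?thesis
    using p by (simp add: mact_def lookup_xconst_mult lookup_sb_diag[OF nz] FM_def chi_add[OF nz])
qed

section \<open>Homogeneous components\<close>

definition comp :: "expo \<Rightarrow> 'k::comm_ring_1 fvec \<Rightarrow> 'k fvec" where
  "comp d p = (\<lambda>k. Poly_Mapping.mapp (\<lambda>mo c. if mdeg mo + (0, w k) = d then c else 0) (p k))"

lemma lookup_comp: "lk (comp d p k) mo = (if mdeg mo + (0, w k) = d then lk (p k) mo else 0)"
  by (simp add: comp_def lookup_mapp when_def in_keys_iff)

lemma comp_HD: "comp d p \<in> HD d"
proof -
  have "mdeg mo = d - (0, w k)" if "mo \<in> ky (comp d p k)" for mo k
  proof -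
    have "mdeg mo + (0, w k) = d" using that by (auto simp: in_keys_iff lookup_comp split: if_splits)
    then show ?thesis by (metis add_diff_cancel_right')
  qed
  then show ?thesis by (auto simp: HD_def hg_def)
qed

lemma comp_FM: "p \<in> FM n q m \<Longrightarrow> comp d p \<in> FM n q m"
proof -
  assume p: "p \<in> FM n q m"
  have "ky (comp d p k) \<subseteq> ky (p k)" for k by (auto simp: in_keys_iff lookup_comp split: if_splits)
  then have "cin m n (comp d p k)" for k using p by (auto simp: FM_def cin_def)
  moreover have "comp d p k = 0" if "k \<ge> q" for k
    by (rule poly_mapping_eqI) (use p that in \<open>simp add: lookup_comp FM_def\<close>)
  ultimately show ?thesis by (simp add: FM_def)
qed

lemma comp_of_HD: "p \<in> HD d \<Longrightarrow> comp e p = (if e = d then p else 0)"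
proof (rule ext, rule poly_mapping_eqI)
  fix k mo assume p: "p \<in> HD d"
  have "mdeg mo + (0, w k) = d" if "lk (p k) mo \<noteq> 0"
  proof -
    have "mdeg mo = d - (0, w k)" using p that by (auto simp: HD_def hg_def in_keys_iff)
    then show ?thesis by simp
  qed
  then show "lk (comp e p k) mo = lk ((if e = d then p else 0) k) mo" by (auto simp: lookup_comp)
qed

definition degs :: "'k::comm_ring_1 fvec \<Rightarrow> expo set" where
  "degs p = (\<Union>k<q. (\<lambda>mo. mdeg mo + (0, w k)) ` ky (p k))"

lemma finite_degs: "finite (degs p)"
  by (simp add: degs_def)

lemma degs_iff: "p \<in> FM n q m \<Longrightarrow> d \<in> degs p \<longleftrightarrow> (\<exists>k mo. mdeg mo + (0, w k) = d \<and> lk (p k) mo \<noteq> 0)"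
proof
  assume p: "p \<in> FM n q m" and "\<exists>k mo. mdeg mo + (0, w k) = d \<and> lk (p k) mo \<noteq> 0"
  then obtain k mo where km: "mdeg mo + (0, w k) = d" "lk (p k) mo \<noteq> 0" by blast
  then have "k < q" using p by (force simp: FM_def not_less[symmetric])
  then show "d \<in> degs p" using km by (force simp: degs_def in_keys_iff)
qed (auto simp: degs_def in_keys_iff)

lemma degs_supp: "p \<in> FM n q m \<Longrightarrow> d \<in> degs p \<Longrightarrow> ky (fst d) \<subseteq> {..<m} \<and> ky (snd d) \<subseteq> {..<n}"
proof -
  assume p: "p \<in> FM n q m" and "d \<in> degs p"
  then obtain k mo where km: "mo \<in> ky (p k)" "d = mdeg mo + (0, w k)" by (auto simp: degs_def)
  then have "gdeg m n (mdeg mo)" using p mdeg_gdeg[of mo m n] by (auto simp: FM_def cin_def)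
  moreover have "gdeg m n (0, w k)" using w[of k] by (simp add: gdeg_def nnexp_def)
  ultimately have "gdeg m n d" unfolding km(2) by (rule gdeg_add)
  then show ?thesis by (simp add: gdeg_def nnexp_def)
qed

lemma sum_comp:
  assumes "p \<in> FM n q m" "finite S" "degs p \<subseteq> S"
  shows "p = (\<Sum>d\<in>S. comp d p)"
proof (rule ext, rule poly_mapping_eqI)
  fix k mo
  have "lk ((\<Sum>d\<in>S. comp d p) k) mo = (\<Sum>d\<in>S. if mdeg mo + (0, w k) = d then lk (p k) mo else 0)"
    by (simp add: fun_sum_apply lookup_sum lookup_comp)
  also have "\<dots> = lk (p k) mo"
  proof (cases "lk (p k) mo = 0")
    case False
    then have "mdeg mo + (0, w k) \<in> degs p" using degs_iff[OF assms(1)] by blast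
    then show ?thesis using assms(2,3) by auto
  qed simp
  finally show "lk (p k) mo = lk ((\<Sum>d\<in>S. comp d p) k) mo" by simp
qed

text \<open>The homogeneous components of \<open>p\<close> other than the one of degree \<open>d\<close> are removed one by one, using
  an element of the diagonal torus that separates the two weights.\<close>

lemma graded_of_torus:
  fixes W :: "'k::field_char_0 fvec set"
  assumes W: "ksub W" "W \<subseteq> FM n q m"
    and act: "\<And>a t p. (\<forall>i. a i \<noteq> 0) \<Longrightarrow> (\<forall>j. t j \<noteq> 0) \<Longrightarrow> p \<in> W \<Longrightarrow> mact m (diagf a) t p \<in> W"
    and p: "p \<in> W"
  shows "comp d p \<in> W"
  using p
proof (induction "card (degs p - {d})" arbitrary: p rule: less_induct)
  case less
  have pF: "p \<in> FM n q m" using less.prems W(2) by auto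
  consider "d \<notin> degs p" | "degs p = {d}" | e where "d \<in> degs p" "e \<in> degs p" "e \<noteq> d" by blast
  then show ?case
  proof cases
    case 1
    then have "comp d p = 0"
      by (intro ext poly_mapping_eqI) (use degs_iff[OF pF] in \<open>auto simp: lookup_comp\<close>)
    then show ?thesis using ksub_0[OF W(1)] by simp
  next
    case 2
    then have "p = comp d p" using sum_comp[OF pF, of "{d}"] by simp
    then show ?thesis using less.prems by simp
  next
    case (3 e)
    note True = 3(1) and e = 3(2,3)
    obtain a t where at: "\<forall>i. a i \<noteq> 0" "\<forall>j. t j \<noteq> 0" "chi m n a t d \<noteq> (chi m n a t e :: 'k)"
      using chi_separates[of "\<lambda>d. d \<in> degs p" d e m n] True e degs_supp[OF pF] by metis
    \<comment> \<open>Scaled so that the component of degree \<open>d\<close> is kept while that of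
      degree \<open>e\<close> is killed.\<close>
    define p' where "p' = scl (inverse (chi m n a t d - chi m n a t e)) (mact m (diagf a) t p - scl (chi m n a t e) p)"
    have lkp': "lk (p' k) mo = inverse (chi m n a t d - chi m n a t e) * ((chi m n a t (mdeg mo + (0, w k)) - chi m n a t e) * lk (p k) mo)" for k mo
      using lookup_mact_diag[of m a t p k mo] at pF by (simp add: p'_def lookup_xconst_scl lookup_minus algebra_simps)
    have p'W: "p' \<in> W" unfolding p'_def by (intro ksub_scl[OF W(1)] ksub_diff[OF W(1)] act at less.prems)
    then have p'F: "p' \<in> FM n q m" using W(2) by auto
    have "degs p' \<subseteq> degs p - {e}"
    proof
      fix x assume "x \<in> degs p'"
      then obtain k mo where km: "mdeg mo + (0, w k) = x" "lk (p' k) mo \<noteq> 0" using degs_iff[OF p'F] by blast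
      then have "lk (p k) mo \<noteq> 0" "x \<noteq> e" by (auto simp: lkp')
      then show "x \<in> degs p - {e}" using degs_iff[OF pF] km(1) by blast
    qed
    then have "degs p' - {d} \<subseteq> (degs p - {d}) - {e}" by blast
    then have "degs p' - {d} \<subset> degs p - {d}" using e by blast
    then have "card (degs p' - {d}) < card (degs p - {d})" using finite_degs[of p] by (intro psubset_card_mono) auto
    from less.hyps[OF this p'W] have "comp d p' \<in> W" .
    moreover have "comp d p' = comp d p"
      by (intro ext poly_mapping_eqI) (use at(3) in \<open>auto simp: lookup_comp lkp'\<close>)
    ultimately show ?thesis by simp
  qed
qed

lemma eqs_graded:
  fixes W :: "'k::field_char_0 fvec set"
  assumes "eqs m W" "p \<in> W"
  shows "comp d p \<in> W"
proof (rule graded_of_torus[OF eqs_ksub[OF assms(1)] eqs_FM[OF assms(1)] _ assms(2)])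
  fix a t :: "nat \<Rightarrow> 'k" and p :: "'k fvec" assume "\<forall>i. a i \<noteq> 0" "\<forall>j. t j \<noteq> 0" "p \<in> W"
  then show "mact m (diagf a) t p \<in> W" by (intro eqs_act[OF assms(1)]) (auto simp: dt_diag)
qed

section \<open>Invariance under one-parameter families\<close>

lemma fam_expand:
  assumes "p \<in> FM n q m"
  shows "\<exists>N. \<forall>N'\<ge>N. \<forall>s. (\<lambda>k. sb R (\<lambda>i l. A i l + s * B i l) (\<lambda>_. 1) (p k)) = (\<Sum>e\<le>N'. scl (s ^ e) (\<lambda>k. coeff (fam R A B (p k)) e))"
proof (intro exI allI impI ext)
  fix s k N' assume N': "(\<Sum>k<q. degree (fam R A B (p k))) \<le> N'"
  have "degree (fam R A B (p k)) \<le> N'"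
  proof (cases "k < q")
    case True
    then have "degree (fam R A B (p k)) \<le> (\<Sum>k<q. degree (fam R A B (p k)))" by (intro member_le_sum) auto
    then show ?thesis using N' by simp
  next
    case False
    then have "p k = 0" using assms by (simp add: FM_def)
    then show ?thesis by (simp add: fam_def peval_0[OF pconst_hom])
  qed
  then have "poly (fam R A B (p k)) (xconst s) = (\<Sum>e\<le>N'. coeff (fam R A B (p k)) e * xconst s ^ e)"
    unfolding poly_altdef by (intro sum.mono_neutral_left) (auto simp: coeff_eq_0)
  moreover have "xconst s ^ e = xconst (s ^ e)" for e by (induction e) (auto simp: xconst_mult)
  ultimately show "sb R (\<lambda>i l. A i l + s * B i l) (\<lambda>_. 1) (p k) = (\<Sum>e\<le>N'. scl (s ^ e) (\<lambda>k. coeff (fam R A B (p k)) e)) k"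
    by (simp add: poly_fam fun_sum_apply scl_def mult.commute)
qed

text \<open>The curve meets \<open>W\<close> for infinitely many \<open>s\<close>, so
  \<open>ksub_poly_coeffs\<close> applies. The linear coefficient will give the Lie algebra action,
  the constant one substitutions by singular matrices.\<close>

lemma eqs_fam_coeff:
  fixes W :: "'k::field_char_0 fvec set"
  assumes W: "eqs m W" and p: "p \<in> W" and S: "infinite S" "\<And>s. s \<in> S \<Longrightarrow> dt m (\<lambda>i l. A i l + s * B i l) \<noteq> 0"
  shows "(\<lambda>k. coeff (fam m A B (p k)) e) \<in> W"
proof -
  have pF: "p \<in> FM n q m" using eqs_FM[OF W] p by auto
  obtain N where N: "\<And>s N'. N' \<ge> N \<Longrightarrow> (\<lambda>k. sb m (\<lambda>i l. A i l + s * B i l) (\<lambda>_. 1) (p k)) = (\<Sum>e\<le>N'. scl (s ^ e) (\<lambda>k. coeff (fam m A B (p k)) e))"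
    using fam_expand[OF pF, of m A B] by blast
  have eq: "(\<lambda>k. sb m (\<lambda>i l. A i l + s * B i l) (\<lambda>_. 1) (p k)) = (\<Sum>e\<le>max N e. scl (s ^ e) (\<lambda>k. coeff (fam m A B (p k)) e))" for s
    by (rule N) simp
  have "(\<Sum>e\<le>max N e. scl (s ^ e) (\<lambda>k. coeff (fam m A B (p k)) e)) \<in> W" if "s \<in> S" for s
    unfolding eq[symmetric] mact_one[symmetric] by (rule eqs_act[OF W S(2)[OF that] _ p]) simp
  from ksub_poly_coeffs[OF eqs_ksub[OF W] S(1) this] show ?thesis by simp
qed

lemma dt_triangular:
  assumes "\<And>i l. i < m \<Longrightarrow> l < m \<Longrightarrow> l < i \<Longrightarrow> A i l = 0"
  shows "dt m A = (\<Prod>i<m. A i i)"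
proof -
  have "dt m A = prod_list (diag_mat (mat m m (\<lambda>(i, j). A i j)))"
    unfolding dt_def by (rule det_upper_triangular[of _ m]) (use assms in \<open>auto intro!: upper_triangularI\<close>)
  also have "\<dots> = (\<Prod>i<m. A i i)" by (simp add: prod_list_diag_prod atLeast0LessThan)
  finally show ?thesis .
qed

lemma dt_transpose: "dt m (\<lambda>i l. A l i) = dt m A"
proof -
  have "mat m m (\<lambda>(i, j). A j i) = transpose_mat (mat m m (\<lambda>(i, j). A i j))" by (rule eq_matI) auto
  then show ?thesis by (simp add: dt_def det_transpose[of _ m])
qed

text \<open>Differentiation of the group action at the identity. The identity plus \<open>s\<close>
  times a matrix unit has determinant 1, or \<open>1 + s\<close> for a diagonal one, so only
  \<open>s = -1\<close> is excluded.\<close>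

lemma eqs_Estab:
  fixes W :: "'k::field_char_0 fvec set"
  assumes W: "eqs m W"
  shows "Estab m W"
  unfolding Estab_def
proof (intro allI impI ballI)
  fix i j p assume ij: "i < m" "j < m" and p: "p \<in> W"
  have pF: "p \<in> FM n q m" using eqs_FM[OF W] p by auto
  let ?A = "\<lambda>a b. if a = b then 1 else 0 :: 'k" and ?B = "\<lambda>a b. if a = j \<and> b = i then 1 else 0 :: 'k"
  have nz: "dt m (\<lambda>a b. ?A a b + s * ?B a b) \<noteq> 0" if s: "s \<in> UNIV - {-1}" for s
  proof -
    have ne: "(\<Prod>a<m. ?A a a + s * ?B a a) \<noteq> 0"
      using s by (auto simp: add_eq_0_iff)
    show ?thesis
    proof (cases "j \<le> i")
      case True
      then show ?thesis using ne by (subst dt_triangular) auto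
    next
      case False
      then show ?thesis using ne by (subst dt_transpose[symmetric], subst dt_triangular) auto
    qed
  qed
  have "infinite (UNIV - {-1 :: 'k})" by (simp add: infinite_UNIV_char_0)
  from eqs_fam_coeff[OF W p this nz, of 1] have "(\<lambda>k. coeff (fam m ?A ?B (p k)) 1) \<in> W" .
  moreover have "(\<lambda>k. coeff (fam m ?A ?B (p k)) 1) = Eo n i j p"
    using fam_coeff1_Eop[of m n _ i j] pF ij by (auto simp: Eo_def FM_def)
  ultimately show "Eo n i j p \<in> W" by simp
qed

text \<open>Density of the invertible matrices: \<open>A\<close> plus \<open>s\<close> times the
  identity is singular only at the finitely many roots of a characteristic polynomial, and at
  \<open>s = 0\<close> the curve passes through the substitution by \<open>A\<close>.\<close>

lemma eqs_all_matrices: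
  fixes W :: "'k::field_char_0 fvec set"
  assumes W: "eqs m W" and p: "p \<in> W"
  shows "(\<lambda>k. sb m A (\<lambda>_. 1) (p k)) \<in> W"
proof -
  let ?M = "mat m m (\<lambda>(i, j). A i j)" and ?B = "\<lambda>a b. if a = b then 1 else 0 :: 'k"
  have car: "- ?M \<in> carrier_mat m m" by simp
  have "char_poly (- ?M) \<noteq> 0" using degree_monic_char_poly[OF car] by auto
  then have "finite {s. poly (char_poly (- ?M)) s = 0}" by (rule poly_roots_finite)
  then have "infinite (UNIV - {s. poly (char_poly (- ?M)) s = 0})" by (simp add: infinite_UNIV_char_0 Diff_infinite_finite)
  moreover have "dt m (\<lambda>i l. A i l + s * ?B i l) \<noteq> 0" if "s \<in> UNIV - {s. poly (char_poly (- ?M)) s = 0}" for s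
  proof -
    have "mat m m (\<lambda>(i, l). A i l + s * ?B i l) = - (char_matrix (- ?M) s)"
      by (rule eq_matI) (auto simp: char_matrix_def)
    then show ?thesis using that by (simp add: dt_def char_poly_matrix[OF car])
  qed
  ultimately have "(\<lambda>k. coeff (fam m A ?B (p k)) 0) \<in> W" by (rule eqs_fam_coeff[OF W p])
  then show ?thesis by (simp only: fam_coeff0)
qed

end

section \<open>Permutations of the rows\<close>

definition permf :: "(nat \<Rightarrow> nat) \<Rightarrow> nat \<Rightarrow> nat \<Rightarrow> 'k::comm_ring_1" where
  "permf p = (\<lambda>i l. if l = p i then 1 else 0)"

lemma sb_perm_var:
  assumes "p permutes {..<m}" "i < m"
  shows "sb m (permf p) (\<lambda>_. 1) (xvar i j) = (xvar (p i) j :: 'k::comm_ring_1 xpoly)"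
proof -
  have "sb m (permf p) (\<lambda>_. 1) (xvar i j) = (\<Sum>l<m. if l = p i then xvar (p i) j else 0 :: 'k xpoly)"
    unfolding sb_var by (rule sum.cong) (auto simp: permf_def)
  moreover have "p i < m" using permutes_in_image[OF assms(1)] assms(2) by auto
  ultimately show ?thesis by simp
qed

lemma sb_perm_single:
  assumes p: "p permutes {..<m}" and "mo \<in> monoms m n"
  shows "\<exists>mo'. sb m (permf p) (\<lambda>_. 1) (sg mo (c :: 'k::comm_ring_1)) = sg mo' c \<and> mdeg mo = pe p (mdeg mo')"
  using assms(2)
proof (induction mo rule: monom_induct)
  case zero
  have "sb m (permf p) (\<lambda>_. 1) (sg 0 c) = sg 0 c" using sb_const[of m "permf p" "\<lambda>_. 1" c] by (simp add: xconst_def)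
  moreover have "mdeg 0 = pe p (mdeg 0)" using permutes_inj[OF p] by (simp add: zero_prod_def)
  ultimately show ?case by blast
next
  case (add i j mo)
  then obtain mo' where mo': "sb m (permf p) (\<lambda>_. 1) (sg mo c) = sg mo' c" "mdeg mo = pe p (mdeg mo')" by blast
  have "sb m (permf p) (\<lambda>_. 1) (sg (sg (i, j) 1 + mo) c) = sg (sg (p i, j) 1 + mo') c"
    unfolding xvar_times_single[symmetric] sb_mult sb_perm_var[OF p add(1)] mo'(1) ..
  moreover have "(sg i 1, sg j 1) = pe p (sg (p i) 1 :: nat \<Rightarrow>\<^sub>0 int, sg j 1 :: nat \<Rightarrow>\<^sub>0 int)"
    using permutes_inj[OF p] by (auto intro!: poly_mapping_eqI simp: lookup_map_key_inj lookup_single when_def inj_eq)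
  then have "mdeg (sg (i, j) 1 + mo) = pe p (mdeg (sg (p i, j) 1 + mo'))"
    by (simp only: mdeg_add mdeg_single fst_conv snd_conv of_nat_1 pe_add[OF permutes_inj[OF p]] mo'(2))
  ultimately show ?case by blast
qed

lemma sb_perm_hg:
  assumes p: "p permutes {..<m}" and "hg (pe p d) f" "cin m n f"
  shows "hg d (sb m (permf p) (\<lambda>_. 1) (f :: 'k::comm_ring_1 xpoly))"
proof (rule hg_induct_single[OF assms(2,3)])
  fix mm and a :: 'k assume mm: "mm \<in> monoms m n" "mdeg mm = pe p d"
  obtain mo' where mo': "sb m (permf p) (\<lambda>_. 1) (sg mm a) = sg mo' a" "mdeg mm = pe p (mdeg mo')"
    using sb_perm_single[OF p mm(1)] by blast
  have "mdeg mo' = d" using mo'(2) mm(2) inj_pe[OF p] by (simp add: inj_eq)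
  then show "hg d (sb m (permf p) (\<lambda>_. 1) (sg mm a))" using hg_single[of mo' a] by (simp add: mo'(1))
qed (auto simp: sb_add intro: hg_add)

lemma sb_perm_inv:
  assumes p: "p permutes {..<m}" and p': "p' permutes {..<m}" "\<And>i. p (p' i) = i" and f: "cin m n f"
  shows "sb m (permf p) (\<lambda>_. 1) (sb m (permf p') (\<lambda>_. 1) f) = (f :: 'k::comm_ring_1 xpoly)"
proof -
  have "sb m (permf p) (\<lambda>_. 1) (sb m (permf p') (\<lambda>_. 1) f) = sb m (\<lambda>i l. if i = l then 1 else 0) (\<lambda>_. 1) f"
    unfolding sb_comp
  proof (rule sb_cong[OF f])
    fix i l assume il: "i < m" "l < m"
    have "(\<Sum>k<m. permf p' i k * permf p k l) = (\<Sum>k<m. if k = p' i then (if i = l then 1 else 0) else 0 :: 'k)"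
      by (rule sum.cong) (use p'(2) in \<open>auto simp: permf_def\<close>)
    moreover have "p' i < m" using permutes_in_image[OF p'(1)] il(1) by auto
    ultimately show "(\<Sum>k<m. permf p' i k * permf p k l) = (if i = l then 1 else 0 :: 'k)" by simp
  qed simp
  then show ?thesis by (simp only: sb_id[OF f])
qed

context fmod
begin

text \<open>A row permutation maps the piece of degree \<open>pe p d\<close> onto that of degree
  \<open>d\<close>. Both dimensions are traces of the identity, which \<open>trc_cyc\<close>
  identifies as field elements; characteristic zero gives equality of naturals.\<close>

lemma hd_perm:
  fixes W :: "'k::field_char_0 fvec set"
  assumes W: "ksub W" "W \<subseteq> FM n q m" and st: "\<And>A x. x \<in> W \<Longrightarrow> (\<lambda>k. sb m A (\<lambda>_. 1) (x k)) \<in> W"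
    and p: "p permutes {..<m}"
  shows "hd W (pe p d) = hd W d"
proof -
  define T where "T p = (\<lambda>x :: 'k fvec. (\<lambda>k. sb m (permf p) (\<lambda>_. 1) (x k)) :: 'k fvec)" for p
  let ?p' = "inv_into UNIV p"
  have p': "?p' permutes {..<m}" by (rule permutes_inv[OF p])
  have inv: "p (?p' i) = i" "?p' (p i) = i" for i using permutes_inverses[OF p] by simp_all
  have lin: "Vector_Spaces.linear scl scl (T p)" for p
    by (rule fv.linearI_scale) (auto simp: T_def sb_add sb_mult scl_def)
  have map: "T p x \<in> W \<inter> HD d" if "p permutes {..<m}" "x \<in> W \<inter> HD (pe p d)" for p x d
  proof -
    have "hg (d - (0, w k)) (sb m (permf p) (\<lambda>_. 1) (x k))" for k
    proof (rule sb_perm_hg[OF that(1), of _ _ n])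
      show "hg (pe p (d - (0, w k))) (x k)"
        using that(2) unfolding HD_def pe_diff[OF permutes_inj[OF that(1)]] pe_zero_fst[OF permutes_inj[OF that(1)]] by simp
      show "cin m n (x k)" using that(2) W(2) by (auto simp: FM_def)
    qed
    then show ?thesis using st that(2) by (simp add: T_def HD_def)
  qed
  have cin: "cin m n (x k)" if "x \<in> W" for x k using that W(2) by (auto simp: FM_def)
  have TT: "T p (T ?p' x) = x" "T ?p' (T p x) = x" if "x \<in> W" for x
    using sb_perm_inv[OF p p' inv(1) cin[OF that]] sb_perm_inv[OF p' p inv(2) cin[OF that]] by (simp_all add: T_def)
  have d: "pe ?p' (pe p d) = d"
    using permutes_inj[OF p] permutes_inj[OF p'] by (simp add: pe_comp permutes_inv_o[OF p] del: pe_pair)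
  have "fv.trc (W \<inter> HD (pe p d)) (\<lambda>x. T ?p' (T p x)) = fv.trc (W \<inter> HD d) (\<lambda>x. T p (T ?p' x))"
    by (rule fv.trc_cyc[OF subspace_piece[OF W(1)] fd_piece[OF W] subspace_piece[OF W(1)] fd_piece[OF W] lin map[OF p] lin map[OF p']])
       (simp_all add: d)
  moreover have "fv.trc (W \<inter> HD (pe p d)) (\<lambda>x. T ?p' (T p x)) = 1 * of_nat (hd W (pe p d))"
    unfolding hd_def by (rule fv.trc_scale[OF subspace_piece[OF W(1)]]) (simp add: TT)
  moreover have "fv.trc (W \<inter> HD d) (\<lambda>x. T p (T ?p' x)) = 1 * of_nat (hd W d)"
    unfolding hd_def by (rule fv.trc_scale[OF subspace_piece[OF W(1)]]) (simp add: TT)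
  ultimately show ?thesis by (simp add: of_nat_eq_iff)
qed

end

section \<open>The ideal of maximal minors\<close>

lemma zero_in_monoms [simp]: "0 \<in> monoms m n"
  by (simp add: monoms_def)

lemma coord_ring_cring: "cring (coord_ring m n :: 'k::comm_ring_1 xpoly ring)"
proof (rule cringI)
  show "abelian_group (coord_ring m n :: 'k xpoly ring)"
  proof (rule abelian_groupI)
    fix x :: "'k xpoly" assume "x \<in> carrier (coord_ring m n)"
    then show "\<exists>y\<in>carrier (coord_ring m n). y \<oplus>\<^bsub>coord_ring m n\<^esub> x = \<zero>\<^bsub>coord_ring m n\<^esub>"
      by (intro bexI[of _ "- x"]) (auto simp: coord_ring_def)
  qed (auto simp: cin_carrier cin_add, auto simp: coord_ring_def cin_def add_ac intro: subsetD[OF cin_add[unfolded cin_def]])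
  show "Group.comm_monoid (coord_ring m n :: 'k xpoly ring)"
    by (rule comm_monoidI) (auto simp: coord_ring_def cin_def mult_ac cin_1[unfolded cin_def] intro: subsetD[OF cin_mult[unfolded cin_def]])
qed (auto simp: coord_ring_def distrib_right)

text \<open>The rows of this matrix are columns of the generic matrix, in the order of the list and
  with repetition allowed: the form in which the Capelli argument produces minors.\<close>

definition Dm :: "nat \<Rightarrow> nat list \<Rightarrow> 'k::comm_ring_1 xpoly" where
  "Dm m ls = det (mat m m (\<lambda>(c, i). xvar i (ls ! c)))"

definition col_lists :: "nat \<Rightarrow> nat \<Rightarrow> nat list set" where
  "col_lists m n = {ls. set ls \<subseteq> {..<n} \<and> length ls = m}"

definition mJ :: "nat \<Rightarrow> nat \<Rightarrow> 'k::comm_ring_1 xpoly set" where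
  "mJ m n = {f. \<exists>h. (\<forall>ls\<in>col_lists m n. cin m n (h ls)) \<and> f = (\<Sum>ls\<in>col_lists m n. h ls * Dm m ls)}"

lemma finite_col_lists: "finite (col_lists m n)"
  unfolding col_lists_def by (rule finite_lists_length_eq) simp

lemma cin_of_int [simp]: "cin m n (of_int k)"
  using cin_const[of m n "of_int k"] by (simp add: xconst_of_int)

lemma cin_det:
  assumes "A \<in> carrier_mat k k" "\<And>i j. i < k \<Longrightarrow> j < k \<Longrightarrow> cin m n (A $$ (i, j))"
  shows "cin m n (det A)"
  unfolding det_def'[OF assms(1)]
proof (rule cin_sum)
  fix p assume "p \<in> {p. p permutes {0..<k}}"
  then have p: "p permutes {0..<k}" by simp
  have "cin m n (\<Prod>i = 0..<k. A $$ (i, p i))"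
    by (rule cin_prod) (use permutes_in_image[OF p] in \<open>auto intro: assms(2)\<close>)
  then show "cin m n (signof p * (\<Prod>i = 0..<k. A $$ (i, p i)))" by (intro cin_mult) auto
qed

lemma sb_det:
  assumes "A \<in> carrier_mat k k"
  shows "sb R B t (det A) = det (map_mat (sb R B t) A)"
proof -
  have "sb R B t (signof p * (\<Prod>i = 0..<k. A $$ (i, p i))) = signof p * (\<Prod>i = 0..<k. map_mat (sb R B t) A $$ (i, p i))"
    if "p permutes {0..<k}" for p
  proof -
    have "(\<Prod>i = 0..<k. sb R B t (A $$ (i, p i))) = (\<Prod>i = 0..<k. map_mat (sb R B t) A $$ (i, p i))"
      by (rule prod.cong) (use assms permutes_in_image[OF that] in auto)
    then show ?thesis by (simp add: sb_mult sb_prod)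
  qed
  then show ?thesis using assms by (simp add: det_def'[of _ k] sb_sum)
qed

lemma Dm_cin: "ls \<in> col_lists m n \<Longrightarrow> cin m n (Dm m ls)"
  unfolding Dm_def by (rule cin_det[of _ m]) (use nth_mem in \<open>fastforce simp: col_lists_def intro!: cin_var\<close>)+

lemma mJ_cin: "f \<in> mJ m n \<Longrightarrow> cin m n f"
  by (auto simp: mJ_def intro!: cin_sum cin_mult Dm_cin)

lemma mJ_0: "0 \<in> mJ m n"
  unfolding mJ_def by (auto intro!: exI[of _ "\<lambda>_. 0"])

lemma mJ_add: "f \<in> mJ m n \<Longrightarrow> g \<in> mJ m n \<Longrightarrow> f + g \<in> mJ m n"
  unfolding mJ_def
proof clarify
  fix h h' :: "nat list \<Rightarrow> 'a xpoly" assume h: "\<forall>ls\<in>col_lists m n. cin m n (h ls)" "\<forall>ls\<in>col_lists m n. cin m n (h' ls)"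
  show "\<exists>h''. (\<forall>ls\<in>col_lists m n. cin m n (h'' ls)) \<and> (\<Sum>ls\<in>col_lists m n. h ls * Dm m ls) + (\<Sum>ls\<in>col_lists m n. h' ls * Dm m ls) = (\<Sum>ls\<in>col_lists m n. h'' ls * Dm m ls)"
    by (rule exI[of _ "\<lambda>ls. h ls + h' ls"]) (use h in \<open>auto simp: cin_add distrib_right sum.distrib\<close>)
qed

lemma mJ_mult: "cin m n g \<Longrightarrow> f \<in> mJ m n \<Longrightarrow> g * f \<in> mJ m n"
  unfolding mJ_def
proof clarify
  fix h :: "nat list \<Rightarrow> 'a xpoly" assume h: "cin m n g" "\<forall>ls\<in>col_lists m n. cin m n (h ls)"
  show "\<exists>h''. (\<forall>ls\<in>col_lists m n. cin m n (h'' ls)) \<and> g * (\<Sum>ls\<in>col_lists m n. h ls * Dm m ls) = (\<Sum>ls\<in>col_lists m n. h'' ls * Dm m ls)"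
    by (rule exI[of _ "\<lambda>ls. g * h ls"]) (use h in \<open>auto simp: cin_mult sum_distrib_left mult.assoc\<close>)
qed

lemma mJ_Dm: "ls \<in> col_lists m n \<Longrightarrow> Dm m ls \<in> mJ m n"
  unfolding mJ_def
proof clarify
  assume ls: "ls \<in> col_lists m n"
  have "(\<Sum>l\<in>col_lists m n. (if l = ls then 1 else 0) * Dm m l) = (\<Sum>l\<in>col_lists m n. if l = ls then Dm m ls else 0 :: 'a xpoly)"
    by (rule sum.cong) auto
  then show "\<exists>h. (\<forall>l\<in>col_lists m n. cin m n (h l)) \<and> (Dm m ls :: 'a xpoly) = (\<Sum>l\<in>col_lists m n. h l * Dm m l)"
    using ls finite_col_lists by (intro exI[of _ "\<lambda>l. if l = ls then 1 else 0"]) auto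
qed

text \<open>The substituted matrix is a constant diagonal matrix times the old one times a constant
  matrix.\<close>

lemma sb_Dm: "\<exists>a. sb m A t (Dm m ls) = xconst a * (Dm m ls :: 'k::comm_ring_1 xpoly)"
proof -
  let ?M = "mat m m (\<lambda>(c, i). xvar i (ls ! c)) :: 'k xpoly mat"
  let ?T = "mat m m (\<lambda>(c, c'). if c = c' then xconst (t (ls ! c)) else 0) :: 'k xpoly mat"
  let ?B = "mat m m (\<lambda>(l, i). xconst (A i l)) :: 'k xpoly mat"
  have "map_mat (sb m A t) ?M = (?T * ?M) * ?B"
  proof (rule eq_matI)
    fix c i assume ci: "c < dim_row ((?T * ?M) * ?B)" "i < dim_col ((?T * ?M) * ?B)"
    have TM: "(?T * ?M) $$ (c, l) = xconst (t (ls ! c)) * xvar l (ls ! c)" if "l < m" for l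
    proof -
      have "(?T * ?M) $$ (c, l) = (\<Sum>k\<in>{0..<m}. (if c = k then xconst (t (ls ! c)) else 0) * xvar l (ls ! k))"
        using that ci by (simp add: scalar_prod_def)
      also have "\<dots> = (\<Sum>k\<in>{0..<m}. if c = k then xconst (t (ls ! c)) * xvar l (ls ! c) else 0)"
        by (rule sum.cong) auto
      finally show ?thesis using ci by simp
    qed
    have "((?T * ?M) * ?B) $$ (c, i) = (\<Sum>l\<in>{0..<m}. (?T * ?M) $$ (c, l) * xconst (A i l))"
      using ci by (simp add: scalar_prod_def)
    also have "\<dots> = (\<Sum>l<m. xconst (A i l * t (ls ! c)) * xvar l (ls ! c))"
      unfolding atLeast0LessThan by (rule sum.cong) (simp_all add: TM xconst_mult mult_ac)
    finally show "map_mat (sb m A t) ?M $$ (c, i) = ((?T * ?M) * ?B) $$ (c, i)" using ci by (simp add: sb_var)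
  qed auto
  moreover have c: "?T \<in> carrier_mat m m" "?M \<in> carrier_mat m m" "?B \<in> carrier_mat m m" by auto
  ultimately have sb: "sb m A t (Dm m ls) = det ?T * det ?M * det ?B"
    unfolding Dm_def by (simp only: sb_det[OF c(2)] det_mult[OF mult_carrier_mat[OF c(1,2)] c(3)] det_mult[OF c(1,2)])
  have ex: "\<exists>a. det (mat m m (\<lambda>x. xconst (f x))) = (xconst a :: 'k xpoly)" for f
  proof -
    interpret comm_ring_hom "xconst :: 'k \<Rightarrow> 'k xpoly" by unfold_locales (simp_all add: xconst_add xconst_mult)
    have "mat m m (\<lambda>x. xconst (f x)) = map_mat xconst (mat m m f)" by (rule eq_matI) auto
    then show ?thesis using hom_det by metis
  qed
  have eqT: "?T = mat m m (\<lambda>x. xconst (case x of (c, c') \<Rightarrow> if c = c' then t (ls ! c) else 0))" by (rule eq_matI) auto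
  have eqB: "?B = mat m m (\<lambda>x. xconst (case x of (l, i) \<Rightarrow> A i l))" by (rule eq_matI) auto
  obtain a b where "det ?T = xconst a" "det ?B = xconst b" unfolding eqT eqB using ex by blast
  then have "sb m A t (Dm m ls) = xconst a * det ?M * xconst b" by (simp only: sb)
  then show ?thesis by (intro exI[of _ "a * b"]) (simp add: xconst_mult Dm_def mult_ac)
qed

lemma mJ_sb: "f \<in> mJ m n \<Longrightarrow> sb m A t f \<in> mJ m n"
proof -
  assume "f \<in> mJ m n"
  then obtain h where h: "\<forall>ls\<in>col_lists m n. cin m n (h ls)" "f = (\<Sum>ls\<in>col_lists m n. h ls * Dm m ls)" by (auto simp: mJ_def)
  have "\<forall>ls. \<exists>a. sb m A t (Dm m ls) = xconst a * (Dm m ls :: 'a xpoly)" using sb_Dm by blast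
  then obtain a where a: "\<And>ls. sb m A t (Dm m ls) = xconst (a ls) * (Dm m ls :: 'a xpoly)" by metis
  have "sb m A t f = (\<Sum>ls\<in>col_lists m n. (sb m A t (h ls) * xconst (a ls)) * Dm m ls)"
    by (simp add: h(2) sb_sum sb_mult a mult.assoc)
  then show ?thesis using h(1) unfolding mJ_def by (auto intro!: exI[of _ "\<lambda>ls. sb m A t (h ls) * xconst (a ls)"] cin_mult sb_cin)
qed

text \<open>Row \<open>i\<close> of the generic matrix is replaced by zero, and each Leibniz term of
  a maximal minor contains a factor from that row.\<close>

lemma sb_zero_row_mJ:
  assumes "f \<in> mJ m n" "i < m" "\<And>l. l < R \<Longrightarrow> A i l = 0"
  shows "sb R A t f = 0"
proof -
  have "sb R A t (Dm m ls) = 0" for ls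
  proof -
    let ?M = "map_mat (sb R A t) (mat m m (\<lambda>(c, i). xvar i (ls ! c)))"
    have "(\<Prod>c = 0..<m. ?M $$ (c, p c)) = 0" if p: "p permutes {0..<m}" for p
    proof (rule prod_zero)
      obtain c where c: "i = p c" using permutes_surj[OF p] by blast
      then have cm: "c < m" using permutes_in_image[OF p, of c] assms(2) by simp
      have "?M $$ (c, p c) = 0" using cm assms(2,3) c[symmetric] by (simp add: sb_var)
      then show "\<exists>c\<in>{0..<m}. ?M $$ (c, p c) = 0" using cm by auto
    qed simp
    then show ?thesis unfolding Dm_def by (subst sb_det[of _ m], simp, subst det_def'[of _ m]) auto
  qed
  then show ?thesis using assms(1) by (auto simp: mJ_def sb_sum sb_mult)
qed

lemma pick_col_list: "J \<subseteq> {..<n} \<Longrightarrow> card J = m \<Longrightarrow> map (pick J) [0..<m] \<in> col_lists m n"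
  using pick_in_set_le[of _ J] by (fastforce simp: col_lists_def)

lemma det_submatrix_maximal:
  assumes J: "J \<subseteq> {..<n}" "card J = m"
  shows "det (submatrix (mat m n (\<lambda>(i, j). xvar i j)) {..<m} J) = (Dm m (map (pick J) [0..<m]) :: 'k::comm_ring_1 xpoly)"
proof -
  let ?X = "mat m n (\<lambda>(i, j). xvar i j) :: 'k xpoly mat" and ?Y = "mat m m (\<lambda>(c, i). xvar i (map (pick J) [0..<m] ! c)) :: 'k xpoly mat"
  have i1: "{i. i < m \<and> i \<in> {..<m}} = {..<m}" and j1: "{j. j < n \<and> j \<in> J} = J" using J by auto
  have "submatrix ?X {..<m} J = transpose_mat ?Y"
  proof (rule eq_matI)
    show "dim_row (submatrix ?X {..<m} J) = dim_row (transpose_mat ?Y)" "dim_col (submatrix ?X {..<m} J) = dim_col (transpose_mat ?Y)"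
      using i1 j1 J by (simp_all add: dim_submatrix)
    fix i j assume "i < dim_row (transpose_mat ?Y)" "j < dim_col (transpose_mat ?Y)"
    then have ij: "i < m" "j < m" by auto
    have "submatrix ?X {..<m} J $$ (i, j) = ?X $$ (pick {..<m} i, pick J j)"
      by (rule submatrix_index) (use i1 j1 J ij in simp_all)
    moreover have "{a \<in> {..<m}. a < i} = {..<i}" using ij by auto
    then have "pick {..<m} i = i" using pick_card_in_set[of i "{..<m}"] ij by simp
    moreover have "pick J j < n" using pick_in_set_le[of j J] J ij by auto
    ultimately show "submatrix ?X {..<m} J $$ (i, j) = transpose_mat ?Y $$ (i, j)" using ij by simp
  qed
  then show ?thesis by (simp add: Dm_def det_transpose[of _ m])
qed

text \<open>A repeated column gives determinant 0; a list without repetition is a rearrangement of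
  an increasing one and gives a genuine minor up to sign.\<close>

lemma Dm_in_ideal:
  assumes I: "ideal I (coord_ring (r + 1) n :: 'k::comm_ring_1 xpoly ring)"
    and sub: "minors (r + 1) (mat (r + 1) n (\<lambda>(i, j). xvar i j)) \<subseteq> I" and ls: "ls \<in> col_lists (r + 1) n"
  shows "Dm (r + 1) ls \<in> I"
proof -
  let ?m = "r + 1"
  interpret I: ideal I "coord_ring (r + 1) n :: 'k xpoly ring" by fact
  have len: "length ls = ?m" using ls by (simp add: col_lists_def)
  show ?thesis
  proof (cases "distinct ls")
    case False
    then obtain a b where ab: "a < ?m" "b < ?m" "a \<noteq> b" "ls ! a = ls ! b" using len by (auto simp: distinct_conv_nth)
    have "Dm ?m ls = (0 :: 'k xpoly)" unfolding Dm_def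
      by (rule det_identical_rows[of _ ?m a b]) (use ab in \<open>auto intro!: eq_vecI\<close>)
    then show ?thesis using additive_subgroup.zero_closed[OF I.additive_subgroup_axioms] by (simp add: coord_ring_def)
  next
    case True
    let ?J = "set ls" and ?X = "mat ?m n (\<lambda>(i, j). xvar i j) :: 'k xpoly mat"
    have J: "?J \<subseteq> {..<n}" "card ?J = ?m" using ls True len by (auto simp: col_lists_def distinct_card)
    define ss where "ss = map (pick ?J) [0..<?m]"
    have pJ: "pick ?J c \<in> ?J" if "c < ?m" for c using pick_in_set_le[of c ?J] that J by simp
    have "distinct ss" unfolding ss_def distinct_map
    proof (intro conjI inj_onI)
      fix x y assume xy: "x \<in> set [0..<?m]" "y \<in> set [0..<?m]" "pick ?J x = pick ?J y"
      then have "x < card ?J" "y < card ?J" using J(2) by auto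
      then show "x = y" using pick_mono_le[of x ?J y] pick_mono_le[of y ?J x] xy(3) by (cases x y rule: linorder_cases) simp_all
    qed simp
    moreover have "set ss \<subseteq> ?J" using pJ by (auto simp: ss_def)
    then have "set ss = ?J"
      using card_subset_eq[of ?J "set ss"] J(2) distinct_card[OF \<open>distinct ss\<close>] by (simp add: ss_def)
    ultimately have "mset ls = mset ss" using True set_eq_iff_mset_eq_distinct by metis
    then obtain p where p: "p permutes {..<length ss}" "permute_list p ss = ls" by (rule mset_eq_permutation)
    have p': "p permutes {0..<?m}" using p(1) by (simp add: ss_def atLeast0LessThan)
    have "det (submatrix ?X {..<?m} ?J) \<in> minors ?m ?X"
      unfolding minors_def mem_Collect_eq by (intro exI[of _ "{..<?m}"] exI[of _ ?J]) (use J in simp)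
    then have ssI: "Dm ?m ss \<in> I" using sub det_submatrix_maximal[OF J, where 'k = 'k] unfolding ss_def by auto
    have "Dm ?m ls = (signof p * Dm ?m ss :: 'k xpoly)"
    proof -
      let ?S = "mat ?m ?m (\<lambda>(c, i). xvar i (ss ! c)) :: 'k xpoly mat"
      have "mat ?m ?m (\<lambda>(c, i). xvar i (ls ! c)) = mat ?m ?m (\<lambda>(c, i). ?S $$ (p c, i))"
      proof (rule eq_matI)
        fix c i assume "c < dim_row (mat ?m ?m (\<lambda>(c, i). ?S $$ (p c, i)))" "i < dim_col (mat ?m ?m (\<lambda>(c, i). ?S $$ (p c, i)))"
        then have ci: "c < ?m" "i < ?m" by auto
        have "p c < ?m" using permutes_in_image[OF p'] ci by auto
        moreover have "ls ! c = ss ! p c" unfolding p(2)[symmetric] using permute_list_nth[OF p(1), of c] ci by (simp add: ss_def)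
        ultimately show "mat ?m ?m (\<lambda>(c, i). xvar i (ls ! c)) $$ (c, i) = mat ?m ?m (\<lambda>(c, i). ?S $$ (p c, i)) $$ (c, i)" using ci by simp
      qed auto
      then show ?thesis unfolding Dm_def using det_permute_rows[OF _ p', of ?S] by simp
    qed
    moreover have "signof p \<in> carrier (coord_ring ?m n :: 'k xpoly ring)" by (simp add: cin_carrier)
    ultimately show ?thesis using I.I_l_closed[OF ssI] by (simp add: coord_ring_def)
  qed
qed

lemma minor_ideal_eq: "minor_ideal r n = (mJ (r + 1) n :: 'k::field xpoly set)"
proof
  let ?X = "mat (r + 1) n (\<lambda>(i, j). xvar i j) :: 'k xpoly mat" and ?R = "coord_ring (r + 1) n :: 'k xpoly ring"
  interpret R: cring ?R by (rule coord_ring_cring)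
  have "minors (r + 1) ?X \<subseteq> mJ (r + 1) n"
  proof
    fix f assume "f \<in> minors (r + 1) ?X"
    then obtain I J where IJ: "f = det (submatrix ?X I J)" "I \<subseteq> {..<r + 1}" "J \<subseteq> {..<n}" "card I = r + 1" "card J = r + 1"
      by (auto simp: minors_def)
    have I: "I = {..<r + 1}" using IJ(2,4) by (intro card_subset_eq) auto
    show "f \<in> mJ (r + 1) n"
      unfolding IJ(1) I det_submatrix_maximal[OF IJ(3,5)] by (rule mJ_Dm[OF pick_col_list[OF IJ(3,5)]])
  qed
  moreover have "ideal (mJ (r + 1) n) ?R"
  proof (rule idealI[OF R.ring_axioms])
    show "subgroup (mJ (r + 1) n) (add_monoid ?R)"
    proof
      fix f assume f: "f \<in> (mJ (r + 1) n :: 'k xpoly set)"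
      have c: "f \<in> carrier ?R" "- f \<in> carrier ?R" using mJ_cin[OF f] by (auto simp: cin_carrier cin_uminus)
      have "\<ominus>\<^bsub>?R\<^esub> f = - f" by (rule R.minus_equality[OF _ c]) (simp add: coord_ring_def)
      moreover have "- f \<in> mJ (r + 1) n" using mJ_mult[OF cin_const f, of "- 1"] by (simp add: xconst_minus)
      ultimately show "inv\<^bsub>add_monoid ?R\<^esub> f \<in> mJ (r + 1) n" by (simp add: a_inv_def)
    qed (auto simp: coord_ring_def mJ_0 mJ_add dest: mJ_cin[unfolded cin_def])
  next
    fix a x assume a: "a \<in> (mJ (r + 1) n :: 'k xpoly set)" and "x \<in> carrier ?R"
    then have "x * a \<in> mJ (r + 1) n" by (intro mJ_mult) (simp only: cin_carrier)
    then show "x \<otimes>\<^bsub>?R\<^esub> a \<in> mJ (r + 1) n" "a \<otimes>\<^bsub>?R\<^esub> x \<in> mJ (r + 1) n" by (simp_all add: coord_ring_def mult.commute)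
  qed
  ultimately show "minor_ideal r n \<subseteq> (mJ (r + 1) n :: 'k xpoly set)"
    unfolding minor_ideal_def by (intro R.genideal_minimal)
  have X: "minors (r + 1) ?X \<subseteq> carrier ?R" unfolding subset_iff cin_carrier using \<open>minors (r + 1) ?X \<subseteq> mJ (r + 1) n\<close> mJ_cin by blast
  have I: "ideal (minor_ideal r n) ?R" unfolding minor_ideal_def by (rule R.genideal_ideal[OF X])
  interpret I: ideal "minor_ideal r n" ?R by fact
  have D: "Dm (r + 1) ls \<in> (minor_ideal r n :: 'k xpoly set)" if "ls \<in> col_lists (r + 1) n" for ls
    by (rule Dm_in_ideal[OF I _ that]) (unfold minor_ideal_def, rule R.genideal_self[OF X])
  have s: "finite S \<Longrightarrow> S \<subseteq> col_lists (r + 1) n \<Longrightarrow> \<forall>ls\<in>col_lists (r + 1) n. cin (r + 1) n (h ls) \<Longrightarrow> (\<Sum>ls\<in>S. h ls * Dm (r + 1) ls) \<in> (minor_ideal r n :: 'k xpoly set)" for S h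
  proof (induction S rule: finite_induct)
    case empty
    then show ?case using additive_subgroup.zero_closed[OF I.additive_subgroup_axioms] by (simp add: coord_ring_def)
  next
    case (insert l S)
    have "h l * Dm (r + 1) l \<in> minor_ideal r n"
      using I.I_l_closed[OF D, of l "h l"] insert.prems by (simp add: cin_carrier) (simp add: coord_ring_def)
    then show ?case using additive_subgroup.a_closed[OF I.additive_subgroup_axioms, of "h l * Dm (r + 1) l" "\<Sum>ls\<in>S. h ls * Dm (r + 1) ls"] insert by (simp add: coord_ring_def)
  qed
  show "mJ (r + 1) n \<subseteq> (minor_ideal r n :: 'k xpoly set)" using s[OF finite_col_lists order_refl] by (auto simp: mJ_def)
qed

section \<open>Stabilization in coordinates\<close>

context fmod
begin

definition JF :: "nat \<Rightarrow> 'k::comm_ring_1 fvec set" where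
  "JF m = {p \<in> FM n q m. \<forall>k. p k \<in> mJ m n}"

definition splus :: "'k::comm_ring_1 fvec set \<Rightarrow> 'k fvec set \<Rightarrow> 'k fvec set" where
  "splus A B = {a + b | a b. a \<in> A \<and> b \<in> B}"

definition eqs_gen :: "nat \<Rightarrow> 'k::field fvec set \<Rightarrow> 'k fvec set" where
  "eqs_gen m N = \<Inter>{W. eqs m W \<and> N \<subseteq> W}"

lemma mact_add: "mact m A t (p + p') = mact m A t p + mact m A t p'"
  by (auto simp: mact_def sb_add distrib_left)

lemma eqs_FM_top: "eqs m (FM n q m)"
  unfolding eqs_def
proof (intro conjI ballI allI impI)
  show "(\<lambda>k. f * p k) \<in> FM n q m" if "cin m n f" "p \<in> FM n q m" for f and p :: "'a fvec"
    using that by (auto simp: FM_def intro: cin_mult)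
qed (simp_all add: mact_FM ksub_0[OF ksub_FM] ksub_add[OF ksub_FM] del: plus_fun_apply zero_fun_apply)

lemma eqs_JF: "eqs m (JF m)"
  unfolding eqs_def
  using eqs_FM_top[of m] by (auto simp: eqs_def JF_def mJ_0 intro!: mJ_add mJ_mult mJ_sb cin_const simp: mact_def)

lemma eqs_splus:
  fixes A B :: "'k::field fvec set"
  assumes A: "eqs m A" and B: "eqs m B"
  shows "eqs m (splus A B)"
proof -
  note 0 = ksub_0[OF eqs_ksub[OF A]] ksub_0[OF eqs_ksub[OF B]]
  note add = ksub_add[OF eqs_ksub[OF A]] ksub_add[OF eqs_ksub[OF B]]
  have FM: "x + y \<in> FM n q m" if "x \<in> A" "y \<in> B" for x y
    by (rule ksub_add[OF ksub_FM subsetD[OF eqs_FM[OF A] that(1)] subsetD[OF eqs_FM[OF B] that(2)]])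
  show ?thesis unfolding eqs_def
  proof (intro conjI ballI allI impI)
    show "splus A B \<subseteq> FM n q m" unfolding splus_def by (auto simp: FM simp del: plus_fun_apply)
    have "0 + 0 \<in> splus A B" using 0 unfolding splus_def by blast
    then show "0 \<in> splus A B" by (simp only: add_0)
  next
    fix p p' assume "p \<in> splus A B" "p' \<in> splus A B"
    then obtain a b a' b' where ab: "p = a + b" "p' = a' + b'" "a \<in> A" "b \<in> B" "a' \<in> A" "b' \<in> B" unfolding splus_def by blast
    have "p + p' = (a + a') + (b + b')" unfolding ab by (simp only: add_ac)
    then show "p + p' \<in> splus A B" unfolding splus_def using add ab by blast
  next
    fix f :: "'k xpoly" and p assume f: "cin m n f" and "p \<in> splus A B"
    then obtain a b where ab: "p = a + b" "a \<in> A" "b \<in> B" unfolding splus_def by blast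
    have "(\<lambda>k. f * p k) = (\<lambda>k. f * a k) + (\<lambda>k. f * b k)" unfolding ab by (auto simp: distrib_left)
    then show "(\<lambda>k. f * p k) \<in> splus A B" unfolding splus_def using eqs_mult[OF A f ab(2)] eqs_mult[OF B f ab(3)] by blast
  next
    fix A' :: "nat \<Rightarrow> nat \<Rightarrow> 'k" and t :: "nat \<Rightarrow> 'k" and p assume At: "dt m A' \<noteq> 0" "\<forall>j<n. t j \<noteq> 0" and "p \<in> splus A B"
    then obtain a b where ab: "p = a + b" "a \<in> A" "b \<in> B" unfolding splus_def by blast
    have "mact m A' t a \<in> A" "mact m A' t b \<in> B" using At(2) by (auto intro: eqs_act[OF A At(1) _ ab(2)] eqs_act[OF B At(1) _ ab(3)])
    then show "mact m A' t p \<in> splus A B" unfolding ab(1) mact_add splus_def by blast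
  qed
qed

lemma eqs_eqs_gen: "N \<subseteq> FM n q m \<Longrightarrow> eqs m (eqs_gen m N)"
  unfolding eqs_def
proof (intro conjI ballI allI impI)
  assume "N \<subseteq> FM n q m"
  then show "eqs_gen m N \<subseteq> FM n q m" unfolding eqs_gen_def using eqs_FM_top by blast
qed (auto simp: eqs_gen_def eqs_def simp del: plus_fun_apply zero_fun_apply)

lemma eqs_gen_subset: "N \<subseteq> eqs_gen m N"
  by (auto simp: eqs_gen_def)

lemma FM_mono: "m \<le> m' \<Longrightarrow> FM n q m \<subseteq> FM n q m'"
  unfolding FM_def cin_def monoms_def by fastforce

text \<open>An element of the generated submodule is sent into \<open>N\<close> by every substitution of linear forms in
  the first \<open>r\<close> rows, and the substitution that kills the last row also kills the maximal minors.\<close>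

lemma stab_restrict:
  fixes N :: "'k::field_char_0 fvec set"
  assumes N: "eqs r N"
  shows "splus (eqs_gen (r + 1) N) (JF (r + 1)) \<inter> FM n q r = N"
proof
  have NF: "N \<subseteq> FM n q (r + 1)" using eqs_FM[OF N] FM_mono[of r "r + 1"] by auto
  have "a \<in> splus (eqs_gen (r + 1) N) (JF (r + 1))" if "a \<in> N" for a
  proof -
    have "a + 0 \<in> splus (eqs_gen (r + 1) N) (JF (r + 1))"
      unfolding splus_def using that eqs_gen_subset[of N "r + 1"] ksub_0[OF eqs_ksub[OF eqs_JF]] by blast
    then show ?thesis by (simp only: add_0_right)
  qed
  then show "N \<subseteq> splus (eqs_gen (r + 1) N) (JF (r + 1)) \<inter> FM n q r" using eqs_FM[OF N] by blast
  let ?I = "\<lambda>i l. if i = l then 1 else 0 :: 'k"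
  define S where "S A p = (\<lambda>k. sb r A (\<lambda>_. 1) (p k))" for A and p :: "'k fvec"
  \<comment> \<open>Elements all of whose substitutions by forms in \<open>r\<close> rows lie in
    \<open>N\<close>. With singular substitutions included this is stable under the larger group,
    because composition with a group element is again such a substitution.\<close>
  define N'' where "N'' = {p \<in> FM n q (r + 1). \<forall>A. S A p \<in> N}"
  have SFM: "S A p \<in> FM n q r" if "p \<in> FM n q (r + 1)" for A p using that by (auto simp: S_def FM_def intro: sb_cin)
  have N'': "eqs (r + 1) N''" unfolding eqs_def
  proof (intro conjI ballI allI impI)
    have "S A 0 = 0" for A by (simp add: S_def zero_fun_def)
    then show "0 \<in> N''" using ksub_0[OF ksub_FM] ksub_0[OF eqs_ksub[OF N]] by (simp add: N''_def)
    fix p p' assume p: "p \<in> N''" "p' \<in> N''"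
    have "S A (p + p') = S A p + S A p'" for A by (auto simp: S_def sb_add)
    then show "p + p' \<in> N''" using p ksub_add[OF ksub_FM, of p "r + 1" p'] ksub_add[OF eqs_ksub[OF N]] by (simp add: N''_def del: plus_fun_apply)
  next
    fix f :: "'k xpoly" and p assume f: "cin (r + 1) n f" and p: "p \<in> N''"
    have "S A (\<lambda>k. f * p k) = (\<lambda>k. sb r A (\<lambda>_. 1) f * S A p k)" for A by (auto simp: S_def sb_mult)
    moreover have "(\<lambda>k. sb r A (\<lambda>_. 1) f * S A p k) \<in> N" for A
      by (rule eqs_mult[OF N sb_cin[OF f]]) (use p in \<open>simp add: N''_def\<close>)
    moreover have "(\<lambda>k. f * p k) \<in> FM n q (r + 1)" by (rule eqs_mult[OF eqs_FM_top f]) (use p in \<open>simp add: N''_def\<close>)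
    ultimately show "(\<lambda>k. f * p k) \<in> N''" by (simp add: N''_def)
  next
    fix B :: "nat \<Rightarrow> nat \<Rightarrow> 'k" and t :: "nat \<Rightarrow> 'k" and p assume t: "\<forall>j<n. t j \<noteq> 0" and p: "p \<in> N''"
    have pF: "p \<in> FM n q (r + 1)" using p by (simp add: N''_def)
    have "S A (mact (r + 1) B t p) \<in> N" for A
    proof -
      \<comment> \<open>The group element is absorbed into the substitution as a matrix product; the
        torus factor remains and acts on \<open>N\<close>.\<close>
      let ?C = "\<lambda>i l. \<Sum>k<r + 1. B i k * A k l"
      have "dt r (diagf (\<lambda>_. 1)) \<noteq> 0" by (simp add: dt_diag)
      then have m1: "mact r (diagf (\<lambda>_. 1)) t (S ?C p) \<in> N" using t p by (intro eqs_act[OF N]) (auto simp: N''_def)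
      have m2: "mact r (diagf (\<lambda>_. 1)) t (S ?C p) k = S A (mact (r + 1) B t p) k" for k
      proof -
        have c: "cin (r + 1) n (p k)" using pF by (simp add: FM_def)
        have "sb r (diagf (\<lambda>_. 1)) t (sb r ?C (\<lambda>_. 1) (p k)) = sb r A (\<lambda>_. 1) (sb (r + 1) B t (p k))"
          unfolding sb_comp
        proof (rule sb_cong[OF c])
          fix i l assume l: "l < r"
          have "(\<Sum>x<r. ?C i x * diagf (\<lambda>_. 1) x l) = (\<Sum>x<r. if x = l then ?C i l else 0)"
            by (rule sum.cong) (auto simp: diagf_def)
          then show "(\<Sum>x<r. ?C i x * diagf (\<lambda>_. 1) x l) = ?C i l" using l by simp
        qed simp
        then show ?thesis by (simp add: mact_def S_def sb_mult)
      qed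
      have "mact r (diagf (\<lambda>_. 1)) t (S ?C p) = S A (mact (r + 1) B t p)" by (rule ext) (rule m2)
      then show ?thesis using m1 by (simp only:)
    qed
    then show "mact (r + 1) B t p \<in> N''" using mact_FM[OF pF] by (simp add: N''_def)
  qed (auto simp: N''_def)
  have "N \<subseteq> N''" using NF eqs_all_matrices[OF N] by (auto simp: N''_def S_def)
  then have gen: "eqs_gen (r + 1) N \<subseteq> N''" unfolding eqs_gen_def using N'' by blast
  show "splus (eqs_gen (r + 1) N) (JF (r + 1)) \<inter> FM n q r \<subseteq> N"
  proof
    fix p assume p: "p \<in> splus (eqs_gen (r + 1) N) (JF (r + 1)) \<inter> FM n q r"
    then obtain a b where ab: "p = a + b" "a \<in> eqs_gen (r + 1) N" "b \<in> JF (r + 1)" unfolding splus_def by blast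
    \<comment> \<open>Read as a substitution from \<open>r + 1\<close> rows into \<open>r\<close>
      rows, the identity pattern sends the last row to 0.\<close>
    have "S ?I p k = S ?I a k" for k
    proof -
      have "sb r ?I (\<lambda>_. 1) (b k) = 0"
        by (rule sb_zero_row_mJ[of _ "r + 1" n r]) (use ab(3) in \<open>auto simp: JF_def\<close>)
      then show ?thesis by (simp add: ab(1) S_def sb_add)
    qed
    moreover have "S ?I p k = p k" for k using p by (simp add: S_def FM_def sb_id[of r n])
    ultimately have "p = S ?I a" by auto
    moreover have "S ?I a \<in> N" using gen ab(2) by (auto simp: N''_def)
    ultimately show "p \<in> N" by simp
  qed
qed

lemma FM_HD_restrict:
  assumes "ky (fst d) \<subseteq> {..<r}"
  shows "FM n q m \<inter> HD d \<subseteq> FM n q r"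
proof
  fix p :: "'k::comm_ring_1 fvec" assume p: "p \<in> FM n q m \<inter> HD d"
  have "mo \<in> monoms r n" if "mo \<in> ky (p k)" for k mo
  proof -
    have mo: "mo \<in> monoms m n" "mdeg mo = d - (0, w k)" using p that by (auto simp: FM_def cin_def HD_def hg_def)
    have "i < r" if "(i, j) \<in> ky mo" for i j
    proof (rule ccontr)
      assume "\<not> i < r"
      then have "lk (fst (mdeg mo)) i = 0" using assms by (auto simp: mo(2) in_keys_iff)
      then show False using lookup_fst_mdeg_ge[of mo i j] that by (simp add: in_keys_iff)
    qed
    then show ?thesis using mo(1) by (force simp: monoms_def)
  qed
  then show "p \<in> FM n q r" using p by (auto simp: FM_def cin_def)
qed

text \<open>In degrees without the last \<open>u\<close> variable no variable of the last row can
  occur, so the pieces lie in \<open>FM n q r\<close>, where \<open>stab_restrict\<close> identifies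
  the relations.\<close>

lemma hd_stab:
  fixes N :: "'k::field_char_0 fvec set"
  assumes N: "eqs r N" and d: "ky (fst d) \<subseteq> {..<r}"
  shows "hd (FM n q (r + 1) :: 'k fvec set) d = hd (FM n q r :: 'k fvec set) d"
    "hd (splus (eqs_gen (r + 1) N) (JF (r + 1))) d = hd N d"
proof -
  have FF: "FM n q r \<subseteq> (FM n q (r + 1) :: 'k fvec set)" by (rule FM_mono) simp
  have "FM n q (r + 1) \<inter> HD d = (FM n q r \<inter> HD d :: 'k fvec set)" using FM_HD_restrict[OF d, of "r + 1"] FF by blast
  then show "hd (FM n q (r + 1) :: 'k fvec set) d = hd (FM n q r :: 'k fvec set) d" by (simp add: hd_def)
  let ?K = "splus (eqs_gen (r + 1) N) (JF (r + 1))"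
  have "N \<subseteq> FM n q (r + 1)" using eqs_FM[OF N] FF by blast
  then have "?K \<subseteq> FM n q (r + 1)" using eqs_FM[OF eqs_splus[OF eqs_eqs_gen eqs_JF]] by blast
  then have "?K \<inter> HD d = N \<inter> HD d" using stab_restrict[OF N] FM_HD_restrict[OF d, of "r + 1"] by blast
  then show "hd ?K d = hd N d" by (simp add: hd_def)
qed

text \<open>The two inputs of \<open>stable_series\<close> are \<open>hd_stab\<close> and
  \<open>no_long_components\<close>; the latter applies because the relations contain all multiples
  of maximal minors and are closed under the Lie algebra.\<close>

theorem stab_series:
  fixes N :: "'k::{alg_closed_field, field_char_0} fvec set"
  assumes N: "eqs r N" and K: "lk K = conv (Pr r n) (\<lambda>d. int (hd (FM n q r :: 'k fvec set) d) - int (hd N d))"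
  shows "lk (rho r n K) = conv (Pr (r + 1) n)
    (\<lambda>d. int (hd (FM n q (r + 1) :: 'k fvec set) d) - int (hd (splus (eqs_gen (r + 1) N) (JF (r + 1))) d))"
proof -
  let ?F = "FM n q (r + 1) :: 'k fvec set" and ?K = "splus (eqs_gen (r + 1) N) (JF (r + 1))"
  have N0: "N \<subseteq> ?F" using eqs_FM[OF N] FM_mono[of r "r + 1"] by auto
  have eK: "eqs (r + 1) ?K" by (rule eqs_splus[OF eqs_eqs_gen[OF N0] eqs_JF])
  have perm: "hd W (pe p d) = hd W d" if "eqs m W" "p permutes {..<m}" for W :: "'k fvec set" and p d m
    by (rule hd_perm[OF eqs_ksub[OF that(1)] eqs_FM[OF that(1)] eqs_all_matrices[OF that(1)] that(2)])
  have supp: "gdeg m n d" if "int (hd (FM n q m :: 'k fvec set) d) - int (hd W d) \<noteq> 0" "eqs m W" for W :: "'k fvec set" and d m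
  proof -
    have "hd (FM n q m :: 'k fvec set) d \<noteq> 0 \<or> hd W d \<noteq> 0" using that(1) by auto
    then show ?thesis using hd_gdeg[OF order_refl ksub_FM] hd_gdeg[OF eqs_FM[OF that(2)] eqs_ksub[OF that(2)]] by blast
  qed
  show ?thesis
  proof (rule stable_series[symmetric, where H = "\<lambda>d. int (hd (FM n q r :: 'k fvec set) d) - int (hd N d)"])
    fix d :: expo assume pos: "\<And>i. i < r + 1 \<Longrightarrow> 0 < lk (fst d) i"
    show "conv (vand (r + 1)) (\<lambda>d. int (hd ?F d) - int (hd ?K d)) d = 0"
    proof (rule no_long_components[OF eqs_ksub[OF eK] eqs_FM[OF eK] eqs_Estab[OF eK]])
      fix ls and g :: "'k fvec" assume ls: "length ls = r + 1" "set ls \<subseteq> {..<n}" and g: "g \<in> ?F"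
      have D: "Dm (r + 1) ls \<in> mJ (r + 1) n" using ls by (intro mJ_Dm) (simp add: col_lists_def)
      have "(\<lambda>k. Dm (r + 1) ls * g k) \<in> JF (r + 1)"
        unfolding JF_def using eqs_mult[OF eqs_FM_top mJ_cin[OF D] g] mJ_mult[OF _ D] g by (auto simp: FM_def mult.commute)
      moreover have "0 \<in> eqs_gen (r + 1) N" by (rule ksub_0[OF eqs_ksub[OF eqs_eqs_gen[OF N0]]])
      ultimately have "0 + (\<lambda>k. Dm (r + 1) ls * g k) \<in> ?K" unfolding splus_def by blast
      then show "(\<lambda>k. det (mat (r + 1) (r + 1) (\<lambda>(c, i). xvar i (ls ! c))) * g k) \<in> ?K" by (simp only: add_0 Dm_def)
    qed (simp_all only: perm[OF eqs_FM_top] perm[OF eK] pos)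
  qed (use supp[OF _ N] supp[OF _ eK] in \<open>simp_all only: perm[OF eqs_FM_top] perm[OF N] perm[OF eK] K hd_stab[OF N]\<close>)
qed

end

section \<open>Hilbert series of equivariant quotients\<close>

text \<open>Weight vectors of the quotient lift to homogeneous elements: if \<open>x\<close> has
  weight \<open>d\<close> modulo \<open>W\<close>, a component of another degree \<open>e\<close> is
  scaled modulo \<open>W\<close> by two different characters and hence lies in
  \<open>W\<close>.\<close>

lemma (in fmod) Hilb_quotient:
  fixes W :: "'k::field_char_0 fvec set" and M :: "('k, 'm) equiv_mod" and g :: "'k fvec \<Rightarrow> 'm"
  assumes W: "eqs m W"
    and carr: "carrier M = g ` FM n q m"
    and g_add: "\<And>x y. x \<in> FM n q m \<Longrightarrow> y \<in> FM n q m \<Longrightarrow> g (x + y) = g x \<oplus>\<^bsub>M\<^esub> g y"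
    and g_0: "\<zero>\<^bsub>M\<^esub> = g 0"
    and g_scl: "\<And>c x. x \<in> FM n q m \<Longrightarrow> xconst c \<odot>\<^bsub>M\<^esub> g x = g (scl c x)"
    and g_act: "\<And>a t x. a \<in> carrier (torus m) \<Longrightarrow> t \<in> carrier (torus n) \<Longrightarrow> x \<in> FM n q m \<Longrightarrow>
      act M (mat_diag m (\<lambda>i. a $ i), t) (g x) = g (mact m (diagf (\<lambda>i. inverse (a $ i))) (\<lambda>j. t $ j) x)"
    and g_eq: "\<And>x y. x \<in> FM n q m \<Longrightarrow> y \<in> FM n q m \<Longrightarrow> g x = g y \<longleftrightarrow> x - y \<in> W"
  shows "Hilb m n M d = int (hd (FM n q m :: 'k fvec set) d) - int (hd W d)"
proof (cases "ky (fst d) \<subseteq> {..<m} \<and> ky (snd d) \<subseteq> {..<n}")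
  case False
  then have "\<not> gdeg m n d" by (auto simp: gdeg_def nnexp_def)
  then have "hd (FM n q m :: 'k fvec set) d = 0" "hd W d = 0"
    using hd_gdeg[OF order_refl ksub_FM] hd_gdeg[OF eqs_FM[OF W] eqs_ksub[OF W]] by blast+
  then show ?thesis using False by (auto simp: Hilb_def split: prod.split)
next
  case True
  let ?F = "FM n q m :: 'k fvec set"
  have kF: "ksub ?F" by (rule ksub_FM)
  have kW: "ksub W" and WF: "W \<subseteq> ?F" using eqs_ksub[OF W] eqs_FM[OF W] by auto
  define P where "P = graded_piece m n M (fst d) (snd d)"
  define Fd where "Fd = ?F \<inter> HD d"
  define Wd where "Wd = W \<inter> HD d"
  have sF: "fv.subspace Fd" and sW: "fv.subspace Wd" unfolding Fd_def Wd_def by (rule subspace_piece[OF kF], rule subspace_piece[OF kW])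
  have FdF: "x \<in> ?F" if "x \<in> Fd" for x using that by (simp add: Fd_def)
  have WdFd: "Wd \<subseteq> Fd" using WF by (auto simp: Wd_def Fd_def)
  define ch where "ch a t = torus_char m (- fst d) a * torus_char n (snd d) t" for a t :: "'k vec"
  \<comment> \<open>The weight \<open>-a\<close> attached to degree \<open>a\<close> and the inverse
    in the action on functions cancel.\<close>
  have ch: "ch a t = chi m n (\<lambda>i. inverse (a $ i)) (\<lambda>j. t $ j) d" for a t
    by (simp add: ch_def chi_def torus_char_def power_int_minus power_int_inverse)
  have mcomp: "comp e (mact m (diagf a) t x) = scl (chi m n a t e) (comp e x)"
    if "\<And>i. i < m \<Longrightarrow> a i \<noteq> 0" "\<And>j. j < n \<Longrightarrow> t j \<noteq> 0" "x \<in> ?F" for a t x e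
    by (intro ext poly_mapping_eqI) (simp add: lookup_comp lookup_mact_diag[OF that] lookup_xconst_scl)
  have mHD: "mact m (diagf a) t x = scl (chi m n a t d) x"
    if "\<And>i. i < m \<Longrightarrow> a i \<noteq> 0" "\<And>j. j < n \<Longrightarrow> t j \<noteq> 0" "x \<in> Fd" for a t x
  proof -
    have xF: "x \<in> ?F" and x: "comp d x = x" using that(3) by (auto simp: Fd_def comp_of_HD)
    have "lk (mact m (diagf a) t x k) mo = lk (scl (chi m n a t d) x k) mo" for k mo
      using arg_cong[OF x, of "\<lambda>x. lk (x k) mo"] by (auto simp: lookup_mact_diag[OF that(1,2) xF] lookup_xconst_scl lookup_comp split: if_splits)
    then show ?thesis by (intro ext poly_mapping_eqI)
  qed
  have carP: "carrier P = g ` Fd"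
  proof
    show "g ` Fd \<subseteq> carrier P"
    proof
      fix y assume "y \<in> g ` Fd"
      then obtain x where x: "x \<in> Fd" "y = g x" by blast
      have "act M (mat_diag m (\<lambda>i. a $ i), t) y = xconst (ch a t) \<odot>\<^bsub>M\<^esub> y" if at: "a \<in> carrier (torus m)" "t \<in> carrier (torus n)" for a t
      proof -
        have "mact m (diagf (\<lambda>i. inverse (a $ i))) (\<lambda>j. t $ j) x = scl (ch a t) x"
          unfolding ch by (rule mHD) (use at x in \<open>auto simp: torus_def\<close>)
        then show ?thesis using g_act[OF at FdF[OF x(1)]] g_scl[OF FdF[OF x(1)]] by (simp add: x(2))
      qed
      then show "y \<in> carrier P" using x FdF by (auto simp: P_def graded_piece_def carr ch_def)
    qed
    show "carrier P \<subseteq> g ` Fd"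
    proof
      fix y assume y: "y \<in> carrier P"
      then obtain x where x: "x \<in> ?F" "y = g x" by (auto simp: P_def graded_piece_def carr)
      have other: "comp e x \<in> W" if e: "e \<in> degs x" "e \<noteq> d" for e
      proof -
        obtain a t where at: "\<forall>i. a i \<noteq> 0" "\<forall>j. t j \<noteq> 0" "chi m n a t d \<noteq> (chi m n a t e :: 'k)"
          using chi_separates[of "\<lambda>e'. e' \<in> degs x \<or> e' = d" d e m n, where 'k = 'k] e degs_supp[OF x(1)] True by metis
        define a' where "a' = vec m (\<lambda>i. inverse (a i))"
        define t' where "t' = vec n t"
        have c: "a' \<in> carrier (torus m)" "t' \<in> carrier (torus n)" using at by (auto simp: torus_def a'_def t'_def)
        have nz: "i < m \<Longrightarrow> inverse (a' $ i) \<noteq> 0" "j < n \<Longrightarrow> t' $ j \<noteq> 0" for i j using at by (auto simp: a'_def t'_def)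
        have chc: "chi m n (\<lambda>i. inverse (a' $ i)) (\<lambda>j. t' $ j) e' = chi m n a t e'" for e' by (simp add: chi_def a'_def t'_def)
        let ?x = "mact m (diagf (\<lambda>i. inverse (a' $ i))) (\<lambda>j. t' $ j) x"
        have "act M (mat_diag m (\<lambda>i. a' $ i), t') y = xconst (ch a' t') \<odot>\<^bsub>M\<^esub> y" using y c by (simp add: P_def graded_piece_def ch_def)
        then have "g ?x = g (scl (ch a' t') x)" unfolding x(2) g_act[OF c x(1)] g_scl[OF x(1)] .
        then have "?x - scl (ch a' t') x \<in> W" using g_eq[OF mact_FM[OF x(1)] ksub_scl[OF kF x(1)]] by blast
        then have "comp e (?x - scl (ch a' t') x) \<in> W" by (rule eqs_graded[OF W])
        moreover have "comp e (?x - scl (ch a' t') x) = comp e ?x - scl (ch a' t') (comp e x)"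
          by (intro ext poly_mapping_eqI) (simp add: lookup_comp lookup_minus lookup_xconst_scl)
        moreover have "\<dots> = scl (chi m n a t e - chi m n a t d) (comp e x)"
          by (simp only: mcomp[OF nz x(1)] ch chc scl_diff_left)
        ultimately have "scl (chi m n a t e - chi m n a t d) (comp e x) \<in> W" by simp
        from ksub_scl[OF kW this, of "inverse (chi m n a t e - chi m n a t d)"] show ?thesis using at(3) by (simp add: scl_scl)
      qed
      have "x = (\<Sum>e\<in>insert d (degs x). comp e x)" by (rule sum_comp[OF x(1)]) (auto simp: finite_degs)
      also have "\<dots> = comp d x + (\<Sum>e\<in>degs x - {d}. comp e x)" by (rule sum.insert_remove) (rule finite_degs)
      finally have "x - comp d x = (\<Sum>e\<in>degs x - {d}. comp e x)" by (metis add_diff_cancel_left')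
      moreover have "(\<Sum>e\<in>degs x - {d}. comp e x) \<in> W" by (rule ksub_sum[OF kW]) (use other in auto)
      ultimately have "g x = g (comp d x)" using g_eq[OF x(1) comp_FM[OF x(1)]] by simp
      moreover have "comp d x \<in> Fd" using comp_FM[OF x(1)] comp_HD by (simp add: Fd_def)
      ultimately show "y \<in> g ` Fd" using x(2) by simp
    qed
  qed
  have P: "\<zero>\<^bsub>P\<^esub> = g 0" "add P = add M" "(\<odot>\<^bsub>P\<^esub>) = (\<lambda>c x. xconst c \<odot>\<^bsub>M\<^esub> x)" by (simp_all add: P_def graded_piece_def g_0)
  have Padd: "g x \<oplus>\<^bsub>P\<^esub> g y = g (x + y)" if "x \<in> Fd" "y \<in> Fd" for x y using g_add FdF that by (simp add: P(2))
  have Pscl: "c \<odot>\<^bsub>P\<^esub> g x = g (scl c x)" if "x \<in> Fd" for c x using g_scl FdF that by (simp add: P(3))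
  have mem: "0 \<in> Fd" "x \<in> Fd \<Longrightarrow> y \<in> Fd \<Longrightarrow> x + y \<in> Fd" "x \<in> Fd \<Longrightarrow> scl c x \<in> Fd" "x \<in> Fd \<Longrightarrow> - x \<in> Fd" for x y c
    using fv.subspace_0[OF sF] fv.subspace_add[OF sF] fv.subspace_scale[OF sF] fv.subspace_neg[OF sF] by blast+
  have agP: "abelian_group P"
  proof (rule abelian_groupI; (unfold carP)?)
    show "\<zero>\<^bsub>P\<^esub> \<in> g ` Fd" using mem(1) P(1) by blast
    show "\<exists>y\<in>g ` Fd. y \<oplus>\<^bsub>P\<^esub> x = \<zero>\<^bsub>P\<^esub>" if "x \<in> g ` Fd" for x
    proof -
      obtain x' where x': "x' \<in> Fd" "x = g x'" using \<open>x \<in> g ` Fd\<close> by blast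
      have "g (- x') \<oplus>\<^bsub>P\<^esub> x = \<zero>\<^bsub>P\<^esub>" unfolding x'(2) Padd[OF mem(4)[OF x'(1)] x'(1)] P(1) by (simp only: ab_left_minus)
      then show ?thesis using mem(4)[OF x'(1)] by blast
    qed
  qed (use mem in \<open>auto simp: Padd P(1) add_ac simp del: plus_fun_apply zero_fun_apply\<close>)
  have vs: "vectorspace class_ring P"
  proof (rule vectorspace.intro[OF _ class_field])
    show "Module.module class_ring P"
    proof (rule moduleI[OF class_cring.is_cring agP]; (unfold carP)?)
    qed (auto simp: Padd Pscl mem scl_add scl_scl simp del: plus_fun_apply zero_fun_apply)
  qed
  interpret P: vectorspace class_ring P by (rule vs)
  obtain B where B: "fv.bas Wd \<subseteq> B" "B \<subseteq> Fd" "fv.independent B" "Fd \<subseteq> fv.span B"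
    using fv.maximal_independent_subset_extend[of "fv.bas Wd" Fd] fv.bas[of Wd] WdFd by (metis subset_trans)
  have fdF: "fv.fd Fd" unfolding Fd_def by (rule fd_piece[OF kF order_refl])
  have finB: "finite B" by (rule fv.finite_independent[OF fdF B(3,2)])
  \<comment> \<open>The part of a basis of the degree piece that extends a basis of
    \<open>Wd\<close>; its image is a basis of the graded piece of the quotient.\<close>
  define C where "C = B - fv.bas Wd"
  have finC: "finite C" and CF: "C \<subseteq> Fd" using finB B(2) by (auto simp: C_def)
  have sumF: "(\<Sum>c\<in>S. scl (u c) c) \<in> Fd" if "S \<subseteq> Fd" for S and u :: "'k fvec \<Rightarrow> 'k"
    using that by (intro fv.subspace_sum[OF sF] fv.subspace_scale[OF sF]) auto
  have CW: "\<forall>c\<in>C. u c = 0" if "(\<Sum>c\<in>C. scl (u c) c) \<in> Wd" for u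
  proof -
    have "(\<Sum>c\<in>C. scl (u c) c) \<in> fv.span (fv.bas Wd)" using that fv.span_bas[OF sW] by simp
    then obtain v where v: "(\<Sum>c\<in>C. scl (u c) c) = (\<Sum>b\<in>fv.bas Wd. scl (v b) b)"
      using fv.span_finite[of "fv.bas Wd"] finite_subset[OF B(1) finB] by auto
    define z where "z b = (if b \<in> C then u b else - v b)" for b
    have Bu: "B = fv.bas Wd \<union> C" "fv.bas Wd \<inter> C = {}" using B(1) by (auto simp: C_def)
    have "(\<Sum>b\<in>B. scl (z b) b) = (\<Sum>b\<in>fv.bas Wd. scl (z b) b) + (\<Sum>b\<in>C. scl (z b) b)"
      unfolding Bu(1) by (rule sum.union_disjoint) (use Bu(2) finite_subset[OF B(1) finB] finC in auto)
    also have "(\<Sum>b\<in>fv.bas Wd. scl (z b) b) = (\<Sum>b\<in>fv.bas Wd. - scl (v b) b)"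
      by (rule sum.cong) (auto simp: z_def C_def)
    also have "(\<Sum>b\<in>C. scl (z b) b) = (\<Sum>c\<in>C. scl (u c) c)" by (rule sum.cong) (auto simp: z_def)
    finally have "(\<Sum>b\<in>B. scl (z b) b) = 0" unfolding v by (simp only: sum_negf ab_left_minus)
    then have z: "z b = 0" if "b \<in> B" for b using fv.independentD[OF B(3) finB order_refl] that by blast
    show ?thesis
    proof
      fix c assume c: "c \<in> C"
      then have "z c = 0" by (intro z) (simp add: C_def)
      then show "u c = 0" using c by (simp add: z_def)
    qed
  qed
  have inj: "inj_on g C"
  proof (rule inj_onI, rule ccontr)
    fix x y assume xy: "x \<in> C" "y \<in> C" "g x = g y" "x \<noteq> y"
    have F: "x \<in> Fd" "y \<in> Fd" using xy CF by auto
    then have "x - y \<in> W" using g_eq[OF FdF FdF] xy(3) by blast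
    then have d: "x - y \<in> Wd" using fv.subspace_diff[OF sF F] by (simp add: Wd_def Fd_def)
    have "(\<Sum>c\<in>C. scl (if c = x then 1 else if c = y then - 1 else 0) c) = x - y"
    proof -
      have "(\<Sum>c\<in>C. scl (if c = x then 1 else if c = y then - 1 else 0) c) = (\<Sum>c\<in>C. (if c = x then x else 0) - (if c = y then y else 0))"
        by (rule sum.cong) (use xy(4) in \<open>auto simp: scl_minus1\<close>)
      then show ?thesis using finC xy(1,2) by (simp add: sum_subtractf)
    qed
    then have "(\<Sum>c\<in>C. scl (if c = x then 1 else if c = y then - 1 else 0) c) \<in> Wd" using d by (simp only:)
    from bspec[OF CW[OF this] xy(1)] show False by simp
  qed
  have lincomb: "finsum P (\<lambda>v. a v \<odot>\<^bsub>P\<^esub> v) (g ` S) = g (\<Sum>c\<in>S. scl (a (g c)) c)" if "S \<subseteq> C" for S a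
    using finite_subset[OF that finC] that
  proof (induction S rule: finite_induct)
    case empty
    show ?case by (simp only: image_empty P.finsum_empty sum.empty P(1))
  next
    case (insert x S)
    have S: "S \<subseteq> C" "x \<in> C" using insert.prems by auto
    have xF: "x \<in> Fd" and SF: "S \<subseteq> Fd" using S CF by auto
    have "g x \<notin> g ` S" using inj_on_image_mem_iff[OF inj S(2,1)] insert.hyps by simp
    moreover have "(\<lambda>v. a v \<odot>\<^bsub>P\<^esub> v) \<in> g ` S \<rightarrow> carrier P" using SF mem(3) by (auto simp: Pscl carP subset_iff)
    moreover have "a (g x) \<odot>\<^bsub>P\<^esub> g x \<in> carrier P" using xF mem(3) by (auto simp: Pscl carP)
    ultimately have "finsum P (\<lambda>v. a v \<odot>\<^bsub>P\<^esub> v) (insert (g x) (g ` S)) = a (g x) \<odot>\<^bsub>P\<^esub> g x \<oplus>\<^bsub>P\<^esub> finsum P (\<lambda>v. a v \<odot>\<^bsub>P\<^esub> v) (g ` S)"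
      using insert.hyps(1) by (intro P.finsum_insert) auto
    also have "\<dots> = g (scl (a (g x)) x + (\<Sum>c\<in>S. scl (a (g c)) c))"
      unfolding insert.IH[OF S(1)] Pscl[OF xF] by (rule Padd[OF mem(3)[OF xF] sumF[OF SF]])
    finally show ?case unfolding image_insert sum.insert[OF insert.hyps] .
  qed
  have lc: "P.lincomb a (g ` C) = g (\<Sum>c\<in>C. scl (a (g c)) c)" for a
    unfolding P.lincomb_def by (rule lincomb) simp
  have gC: "finite (g ` C)" "g ` C \<subseteq> carrier P" using finC CF by (auto simp: carP)
  have "P.basis (g ` C)" unfolding P.basis_def
  proof (intro conjI gC(2))
    show "P.lin_indpt (g ` C)"
    proof (rule P.finite_lin_indpt2[OF gC])
      fix a assume z: "P.lincomb a (g ` C) = \<zero>\<^bsub>P\<^esub>"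
      let ?s = "\<Sum>c\<in>C. scl (a (g c)) c"
      have sF': "?s \<in> Fd" by (rule sumF[OF CF])
      have "g ?s = g 0" using z by (simp only: lc P(1))
      then have "?s - 0 \<in> W" using g_eq[OF FdF[OF sF'] FdF[OF mem(1)]] by blast
      then have "?s \<in> Wd" using sF' by (simp add: Wd_def Fd_def del: zero_fun_apply)
      from CW[OF this] show "\<forall>v\<in>g ` C. a v = \<zero>\<^bsub>class_ring\<^esub>" by simp
    qed
    have "carrier P \<subseteq> P.span (g ` C)"
    proof
      fix y assume "y \<in> carrier P"
      then obtain x where x: "x \<in> Fd" "y = g x" by (auto simp: carP)
      then have "x \<in> fv.span B" using B(4) by blast
      then obtain u where u: "x = (\<Sum>b\<in>B. scl (u b) b)" using fv.span_finite[OF finB] by auto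
      have Bu: "B = fv.bas Wd \<union> C" "fv.bas Wd \<inter> C = {}" using B(1) by (auto simp: C_def)
      have "(\<Sum>b\<in>B. scl (u b) b) = (\<Sum>b\<in>fv.bas Wd. scl (u b) b) + (\<Sum>c\<in>C. scl (u c) c)"
        unfolding Bu(1) by (rule sum.union_disjoint) (use Bu(2) finite_subset[OF B(1) finB] finC in auto)
      then have xs: "x = (\<Sum>b\<in>fv.bas Wd. scl (u b) b) + (\<Sum>c\<in>C. scl (u c) c)" using u by (rule trans[rotated])
      have "(\<Sum>b\<in>fv.bas Wd. scl (u b) b) \<in> Wd" using fv.bas(1)[of Wd] by (intro fv.subspace_sum[OF sW] fv.subspace_scale[OF sW]) auto
      then have "x - (\<Sum>c\<in>C. scl (u c) c) \<in> W" unfolding xs add_diff_cancel_right' Wd_def by (rule IntD1)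
      then have "y = g (\<Sum>c\<in>C. scl (u c) c)" using g_eq[OF FdF[OF x(1)] FdF[OF sumF[OF CF]]] x(2) by blast
      also have "(\<Sum>c\<in>C. scl (u c) c) = (\<Sum>c\<in>C. scl ((u \<circ> the_inv_into C g) (g c)) c)"
        by (rule sum.cong) (simp_all add: the_inv_into_f_f[OF inj])
      also have "g \<dots> = P.lincomb (u \<circ> the_inv_into C g) (g ` C)" by (rule lc[symmetric])
      finally show "y \<in> P.span (g ` C)" unfolding P.finite_span[OF gC] by auto
    qed
    then show "P.gen_set (g ` C)" using P.span_is_subset2[OF gC(2)] by blast
  qed
  then have "vectorspace.dim class_ring P = card (g ` C)" by (rule P.dim_basis[OF gC(1)])
  also have "\<dots> = card C" by (rule card_image[OF inj])
  also have "int \<dots> = int (card B) - int (card (fv.bas Wd))"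
    unfolding C_def using card_Diff_subset[OF finite_subset[OF B(1) finB] B(1)] card_mono[OF finB B(1)] by simp
  also have "card B = hd ?F d" unfolding hd_def Fd_def[symmetric] by (rule fv.dim_unique[OF B(2,4,3) refl, symmetric])
  also have "card (fv.bas Wd) = hd W d" by (simp add: hd_def Wd_def fv.dim_bas)
  finally show ?thesis using True by (cases d) (simp add: Hilb_def P_def)
qed

section \<open>Weight coordinates of a torus representation\<close>

lemma torus_char_mult:
  assumes "s \<in> carrier (torus n)" "t \<in> carrier (torus n)"
  shows "torus_char n b (s \<otimes>\<^bsub>torus n\<^esub> t) = torus_char n b s * torus_char n b t"
  using assms unfolding torus_char_def prod.distrib[symmetric]
  by (intro prod.cong) (auto simp: torus_def power_int_mult_distrib)

lemma torus_char_one: "torus_char n b \<one>\<^bsub>torus n\<^esub> = 1"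
  by (simp add: torus_char_def torus_def)

lemma torus_mult_closed: "s \<in> carrier (torus n) \<Longrightarrow> t \<in> carrier (torus n) \<Longrightarrow> s \<otimes>\<^bsub>torus n\<^esub> t \<in> carrier (torus n)"
  and torus_one_closed: "\<one>\<^bsub>torus n\<^esub> \<in> carrier (torus n)"
  by (auto simp: torus_def)

lemma torus_char_separates:
  assumes "ky b \<subseteq> {..<n}" "ky b' \<subseteq> {..<n}" "b \<noteq> b'"
  shows "\<exists>t\<in>carrier (torus n). torus_char n b t \<noteq> (torus_char n b' t :: 'k::field_char_0)"
proof -
  have "\<exists>a t. (\<forall>i. a i \<noteq> (0::'k)) \<and> (\<forall>j. t j \<noteq> 0) \<and> chi 0 n a t (0, b) \<noteq> chi 0 n a t (0, b')"
    by (rule chi_separates[where gdeg' = "\<lambda>d. d = (0, b) \<or> d = (0, b')"]) (use assms in auto)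
  then obtain a t where at: "\<forall>j. t j \<noteq> (0::'k)" "chi 0 n a t (0, b) \<noteq> chi 0 n a t (0, b')" by blast
  have "vec n t \<in> carrier (torus n)" using at(1) by (auto simp: torus_def)
  moreover have "torus_char n b (vec n t) = chi 0 n a t (0, b)" for b by (simp add: torus_char_def chi_def)
  ultimately show ?thesis using at(2) by metis
qed

text \<open>Artin's argument: the relation at the product of \<open>s\<close> and \<open>t\<close>,
  minus the relation at \<open>t\<close> scaled by the value of \<open>b0\<close> at
  \<open>s\<close>, no longer involves \<open>b0\<close>; a suitable \<open>s\<close> keeps the
  coefficient of a given \<open>b\<close> nonzero.\<close>

lemma characters_independent:
  fixes sV :: "'k::field_char_0 \<Rightarrow> 'v::ab_group_add \<Rightarrow> 'v"
  assumes V: "vector_space sV" and "finite S" "\<And>b. b \<in> S \<Longrightarrow> ky b \<subseteq> {..<n}"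
    and "\<And>t. t \<in> carrier (torus n) \<Longrightarrow> (\<Sum>b\<in>S. sV (torus_char n b t) (y b)) = 0"
  shows "\<forall>b\<in>S. y b = 0"
  using assms(2-4)
proof (induction S arbitrary: y rule: finite_induct)
  case (insert b0 S)
  interpret vector_space sV by (rule V)
  have other: "y b = 0" if b: "b \<in> S" for b
  proof -
    obtain s where s: "s \<in> carrier (torus n)" "torus_char n b s \<noteq> (torus_char n b0 s :: 'k)"
      using torus_char_separates[of b n b0] insert.prems(1) b insert.hyps(2) by auto
    have z: "(\<Sum>b\<in>S. sV (torus_char n b t) (sV (torus_char n b s - torus_char n b0 s) (y b))) = 0" if t: "t \<in> carrier (torus n)" for t
    proof -
      have 1: "(\<Sum>b\<in>insert b0 S. sV (torus_char n b t) (sV (torus_char n b s) (y b))) = 0"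
        using insert.prems(2)[OF torus_mult_closed[OF s(1) t]] by (simp only: torus_char_mult[OF s(1) t] scale_scale mult.commute)
      have 2: "(\<Sum>b\<in>insert b0 S. sV (torus_char n b t) (sV (torus_char n b0 s) (y b))) = 0"
      proof -
        have "(\<Sum>b\<in>insert b0 S. sV (torus_char n b t) (sV (torus_char n b0 s) (y b))) = sV (torus_char n b0 s) (\<Sum>b\<in>insert b0 S. sV (torus_char n b t) (y b))"
          by (simp only: scale_sum_right scale_scale mult.commute)
        then show ?thesis using insert.prems(2)[OF t] by simp
      qed
      have "(\<Sum>b\<in>insert b0 S. sV (torus_char n b t) (sV (torus_char n b s - torus_char n b0 s) (y b))) = 0"
        using 1 2 by (simp only: scale_left_diff_distrib scale_right_diff_distrib sum_subtractf diff_self)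
      then show ?thesis using insert.hyps by simp
    qed
    have "\<forall>b\<in>S. sV (torus_char n b s - torus_char n b0 s) (y b) = 0"
      by (rule insert.IH[OF _ z]) (use insert.prems(1) in auto)
    from bspec[OF this b] s(2) show ?thesis by simp
  qed
  have "(\<Sum>b\<in>insert b0 S. sV (torus_char n b \<one>\<^bsub>torus n\<^esub>) (y b)) = 0" by (rule insert.prems(2)[OF torus_one_closed])
  then have "y b0 = 0" using insert.hyps other by (simp add: torus_char_one)
  then show ?case using other by simp
qed simp

definition weight_vec :: "nat \<Rightarrow> ('k::field \<Rightarrow> 'v::ab_group_add \<Rightarrow> 'v) \<Rightarrow> ('k vec \<Rightarrow> 'v \<Rightarrow> 'v) \<Rightarrow> (nat \<Rightarrow>\<^sub>0 int) \<Rightarrow> 'v \<Rightarrow> bool" where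
  "weight_vec n sV \<pi> b x \<longleftrightarrow> ky b \<subseteq> {..<n} \<and> (\<forall>t\<in>carrier (torus n). \<pi> t x = sV (torus_char n b t) x)"

text \<open>Rationality writes \<open>\<pi> t v\<close> as a finite combination of characters.
  Comparing \<open>\<pi> s (\<pi> t v)\<close> with the value at the product, independence of
  characters makes each coefficient a weight vector; at the identity they add up to
  \<open>v\<close>.\<close>

lemma weight_decomposition:
  fixes sV :: "'k::field_char_0 \<Rightarrow> 'v::ab_group_add \<Rightarrow> 'v"
  assumes V: "vector_space sV" and T: "torus_rep n sV \<pi>"
  shows "\<exists>S x. finite S \<and> (\<forall>b\<in>S. weight_vec n sV \<pi> b (x b)) \<and> v = (\<Sum>b\<in>S. x b)"
proof -
  interpret vector_space sV by (rule V)
  have lin: "Vector_Spaces.linear sV sV (\<pi> t)" if "t \<in> carrier (torus n)" for t using T that by (auto simp: torus_rep_def)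
  have one: "\<pi> \<one>\<^bsub>torus n\<^esub> v = v" for v using T by (simp add: torus_rep_def)
  have mult: "\<pi> (s \<otimes>\<^bsub>torus n\<^esub> t) v = \<pi> s (\<pi> t v)" if "s \<in> carrier (torus n)" "t \<in> carrier (torus n)" for s t v
    using T that by (auto simp: torus_rep_def)
  have "\<exists>c :: (nat \<Rightarrow>\<^sub>0 int) \<Rightarrow>\<^sub>0 'v. \<forall>t\<in>carrier (torus n). \<pi> t v = (\<Sum>b\<in>ky c. sV (torus_char n b t) (lk c b))"
    using T unfolding torus_rep_def by blast
  then obtain c :: "(nat \<Rightarrow>\<^sub>0 int) \<Rightarrow>\<^sub>0 'v" where c: "\<And>t. t \<in> carrier (torus n) \<Longrightarrow> \<pi> t v = (\<Sum>b\<in>ky c. sV (torus_char n b t) (lk c b))" by blast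
  \<comment> \<open>Exponents at indices from \<open>n\<close> on do not affect the character. They
    are cut off and terms with the same character collected, so that the characters compared are
    distinct.\<close>
  define rs where "rs = Poly_Mapping.mapp (\<lambda>j (a::int). if j < n then a else 0)"
  have lrs: "lk (rs b) j = (if j < n then lk b j else 0)" for b j by (simp add: rs_def lookup_mapp when_def in_keys_iff)
  have krs: "ky (rs b) \<subseteq> {..<n}" for b by (auto simp: in_keys_iff lrs split: if_splits)
  have crs: "torus_char n (rs b) t = torus_char n b t" for b and t :: "'k vec" by (simp add: torus_char_def lrs)
  define S where "S = rs ` ky c"
  define x where "x \<beta> = (\<Sum>b\<in>{b \<in> ky c. rs b = \<beta>}. lk c b)" for \<beta>
  have fS: "finite S" by (simp add: S_def)
  have dec: "\<pi> t v = (\<Sum>\<beta>\<in>S. sV (torus_char n \<beta> t) (x \<beta>))" if t: "t \<in> carrier (torus n)" for t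
  proof -
    have "(\<Sum>b\<in>ky c. sV (torus_char n b t) (lk c b)) = (\<Sum>\<beta>\<in>S. \<Sum>b\<in>{b \<in> ky c. rs b = \<beta>}. sV (torus_char n b t) (lk c b))"
      unfolding S_def by (rule sum.image_gen) simp
    also have "\<dots> = (\<Sum>\<beta>\<in>S. sV (torus_char n \<beta> t) (x \<beta>))"
    proof (rule sum.cong[OF refl])
      fix \<beta>
      have "(\<Sum>b\<in>{b \<in> ky c. rs b = \<beta>}. sV (torus_char n b t) (lk c b)) = (\<Sum>b\<in>{b \<in> ky c. rs b = \<beta>}. sV (torus_char n \<beta> t) (lk c b))"
        by (rule sum.cong) (auto simp: crs)
      then show "(\<Sum>b\<in>{b \<in> ky c. rs b = \<beta>}. sV (torus_char n b t) (lk c b)) = sV (torus_char n \<beta> t) (x \<beta>)"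
        by (simp only: x_def scale_sum_right)
    qed
    finally show ?thesis using c[OF t] by simp
  qed
  have kS: "ky b \<subseteq> {..<n}" if "b \<in> S" for b using that krs by (auto simp: S_def)
  have w: "\<pi> s (x b) = sV (torus_char n b s) (x b)" if s: "s \<in> carrier (torus n)" and b: "b \<in> S" for s b
  proof -
    interpret L: Vector_Spaces.linear sV sV "\<pi> s" by (rule lin[OF s])
    have "(\<Sum>b\<in>S. sV (torus_char n b t) (\<pi> s (x b) - sV (torus_char n b s) (x b))) = 0" if t: "t \<in> carrier (torus n)" for t
    proof -
      have "(\<Sum>b\<in>S. sV (torus_char n b t) (\<pi> s (x b))) = \<pi> s (\<pi> t v)" by (simp only: dec[OF t] L.sum L.scale)
      also have "\<dots> = (\<Sum>b\<in>S. sV (torus_char n b t) (sV (torus_char n b s) (x b)))"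
        by (simp only: mult[OF s t, symmetric] dec[OF torus_mult_closed[OF s t]] torus_char_mult[OF s t] scale_scale mult.commute)
      finally show ?thesis by (simp add: scale_right_diff_distrib sum_subtractf)
    qed
    from characters_independent[OF V fS kS this] show ?thesis using b by auto
  qed
  have "v = (\<Sum>b\<in>S. x b)" using dec[OF torus_one_closed] by (simp add: one torus_char_one)
  moreover have "\<forall>b\<in>S. weight_vec n sV \<pi> b (x b)" using w kS by (auto simp: weight_vec_def)
  ultimately show ?thesis using fS by blast
qed

text \<open>Diagonalizing the torus action on \<open>V\<close> lets \<open>R \<otimes> V\<close> be
  treated entry by entry in \<open>fmod\<close>.\<close>

locale coords = fmod n q w for n q w +
  fixes sV :: "'k::field_char_0 \<Rightarrow> 'v::ab_group_add \<Rightarrow> 'v" and \<pi> :: "'k vec \<Rightarrow> 'v \<Rightarrow> 'v" and co :: "'v \<Rightarrow> nat \<Rightarrow> 'k"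
  assumes co_add: "co (u + v) k = co u k + co v k" and co_scale: "co (sV a v) k = a * co v k"
    and co_inj: "(\<And>k. co u k = co v k) \<Longrightarrow> u = v" and co_surj: "\<exists>v. \<forall>k. co v k = (if k < q then c k else 0)"
    and co_ge: "k \<ge> q \<Longrightarrow> co v k = 0"
    and co_\<pi>: "t \<in> carrier (torus n) \<Longrightarrow> co (\<pi> t v) k = torus_char n (w k) t * co v k"

text \<open>Weight vectors span by \<open>weight_decomposition\<close>, so a maximal independent set
  of them is a basis.\<close>

lemma coords_exist:
  fixes sV :: "'k::field_char_0 \<Rightarrow> 'v::ab_group_add \<Rightarrow> 'v"
  assumes T: "torus_rep n sV \<pi>"
  shows "\<exists>q w co. coords n q w sV \<pi> co"
proof -
  obtain B0 where "finite_dimensional_vector_space sV B0" using T by (auto simp: torus_rep_def)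
  then interpret finite_dimensional_vector_space sV B0 .
  have V: "vector_space sV" by unfold_locales
  define Wt where "Wt = {x. \<exists>b. weight_vec n sV \<pi> b x}"
  obtain Bs where Bs: "Bs \<subseteq> Wt" "independent Bs" "Wt \<subseteq> span Bs" by (rule maximal_independent_subset[of Wt])
  have fin: "finite Bs" by (rule finiteI_independent[OF Bs(2)])
  have sp: "v \<in> span Bs" for v
  proof -
    obtain S x where S: "\<forall>b\<in>S. weight_vec n sV \<pi> b (x b)" "v = (\<Sum>b\<in>S. x b)" using weight_decomposition[OF V T] by blast
    have "x b \<in> span Bs" if "b \<in> S" for b using S(1) that Bs(3) by (auto simp: Wt_def)
    then show ?thesis unfolding S(2) by (rule span_sum)
  qed
  define q where "q = card Bs"
  obtain h where h: "bij_betw h {0..<q} Bs" using ex_bij_betw_nat_finite[OF fin] by (auto simp: q_def)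
  have hB: "h k \<in> Bs" if "k < q" for k using h that by (auto simp: bij_betw_def)
  have "\<exists>b. ky b \<subseteq> {..<n} \<and> (k < q \<longrightarrow> weight_vec n sV \<pi> b (h k))" for k
  proof (cases "k < q")
    case True
    then obtain b where "weight_vec n sV \<pi> b (h k)" using hB[OF True] Bs(1) by (auto simp: Wt_def)
    then show ?thesis by (auto simp: weight_vec_def)
  qed (auto intro!: exI[of _ 0])
  then obtain w where w: "\<And>k. ky (w k) \<subseteq> {..<n}" "\<And>k. k < q \<Longrightarrow> weight_vec n sV \<pi> (w k) (h k)" by metis
  define co where "co v k = (if k < q then representation Bs v (h k) else 0)" for v k
  have expand: "v = (\<Sum>k<q. sV (co v k) (h k))" for v
  proof -
    have "(\<Sum>k<q. sV (co v k) (h k)) = (\<Sum>k\<in>{0..<q}. sV (representation Bs v (h k)) (h k))"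
      unfolding atLeast0LessThan by (rule sum.cong) (auto simp: co_def)
    also have "\<dots> = (\<Sum>b\<in>Bs. sV (representation Bs v b) b)" by (rule sum.reindex_bij_betw[OF h])
    also have "\<dots> = v" by (rule sum_representation_eq[OF Bs(2) sp fin order_refl])
    finally show ?thesis ..
  qed
  have coS: "co (\<Sum>k<q. sV (c k) (h k)) j = (if j < q then c j else 0)" for c j
  proof (cases "j < q")
    case True
    have "representation Bs (\<Sum>k<q. sV (c k) (h k)) (h j) = (\<Sum>k<q. representation Bs (sV (c k) (h k)) (h j))"
      by (subst representation_sum[OF Bs(2) sp]) simp
    also have "\<dots> = (\<Sum>k<q. if k = j then c j else 0)"
    proof (rule sum.cong[OF refl])
      fix k assume k: "k \<in> {..<q}"
      have "h j = h k \<longleftrightarrow> j = k" using h k True by (auto simp: bij_betw_def inj_on_eq_iff)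
      then show "representation Bs (sV (c k) (h k)) (h j) = (if k = j then c j else 0)"
        using k by (auto simp: representation_scale[OF Bs(2) sp] representation_basis[OF Bs(2) hB])
    qed
    finally show ?thesis using True by (simp add: co_def)
  qed (simp add: co_def)
  have "coords n q w sV \<pi> co"
  proof
    fix u v k a
    show "ky (w k) \<subseteq> {..<n}" by (rule w(1))
    show "co (u + v) k = co u k + co v k" by (simp add: co_def representation_add[OF Bs(2) sp sp])
    show "co (sV a v) k = a * co v k" by (simp add: co_def representation_scale[OF Bs(2) sp])
    show "k \<ge> q \<Longrightarrow> co v k = 0" by (simp add: co_def)
    show "\<exists>v. \<forall>k. co v k = (if k < q then c k else 0)" for c using coS by blast
    show "u = v" if eq: "\<And>k. co u k = co v k" using expand[of u] expand[of v] by (simp only: eq)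
    show "co (\<pi> t v) k = torus_char n (w k) t * co v k" if t: "t \<in> carrier (torus n)" for t
    proof -
      interpret L: Vector_Spaces.linear sV sV "\<pi> t" using T t by (auto simp: torus_rep_def)
      have "\<pi> t v = \<pi> t (\<Sum>k<q. sV (co v k) (h k))" using expand[of v] by (rule arg_cong)
      also have "\<dots> = (\<Sum>k<q. sV (co v k) (\<pi> t (h k)))" by (simp only: L.sum L.scale)
      also have "\<dots> = (\<Sum>k<q. sV (torus_char n (w k) t * co v k) (h k))"
        by (rule sum.cong) (use w(2) t in \<open>auto simp: weight_vec_def mult.commute\<close>)
      finally have "co (\<pi> t v) k = (if k < q then torus_char n (w k) t * co v k else 0)" by (simp only: coS)
      then show ?thesis by (simp add: co_def)
    qed
  qed
  then show ?thesis by blast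
qed

section \<open>Transport to coordinates\<close>

lemma GL_group: "group (GL m :: 'k::field mat monoid)"
proof -
  interpret semiring "ring_mat TYPE('k) m ()" by (rule semiring_mat)
  show ?thesis unfolding GL_def by (rule units_group)
qed

lemma GL_carrier: "g \<in> carrier (GL m) \<longleftrightarrow> g \<in> carrier_mat m m \<and> det g \<noteq> (0 :: 'k::field)"
  using det_non_zero_imp_unit[of g m "()"] unit_imp_det_non_zero[of g m "()"]
  by (auto simp: GL_def units_of_carrier) (auto simp: Units_def ring_mat_def)

lemma GL_mat: "fmod.dt m A \<noteq> 0 \<longleftrightarrow> mat m m (\<lambda>(i, j). A i j) \<in> carrier (GL m)"
  for A :: "nat \<Rightarrow> nat \<Rightarrow> 'k::field"
  by (simp add: GL_carrier fmod.dt_def[OF fmod.intro[of "\<lambda>_. 0" 0]])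

lemma chi_inverse:
  assumes "\<And>i. i < m \<Longrightarrow> a i \<noteq> 0" "\<And>j. j < n \<Longrightarrow> t j \<noteq> 0"
  shows "chi m n a t d * chi m n (\<lambda>i. inverse (a i)) (\<lambda>j. inverse (t j)) d = 1"
proof -
  have "(\<Prod>i<m. a i powi lk (fst d) i) * (\<Prod>i<m. inverse (a i) powi lk (fst d) i) = 1"
    unfolding prod.distrib[symmetric] by (rule prod.neutral) (use assms in \<open>auto simp: power_int_inverse\<close>)
  moreover have "(\<Prod>j<n. t j powi lk (snd d) j) * (\<Prod>j<n. inverse (t j) powi lk (snd d) j) = 1"
    unfolding prod.distrib[symmetric] by (rule prod.neutral) (use assms in \<open>auto simp: power_int_inverse\<close>)
  ultimately show ?thesis by (simp add: chi_def) (metis (no_types, lifting) mult.assoc mult.commute mult.right_neutral)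
qed

lemma mat_diag_GL:
  assumes "a \<in> carrier (torus m)"
  shows "mat_diag m (\<lambda>i. a $ i) \<in> carrier (GL m)"
    "inv\<^bsub>GL m\<^esub> (mat_diag m (\<lambda>i. a $ i)) = mat_diag m (\<lambda>i. inverse (a $ i :: 'k::field))"
proof -
  have D: "mat_diag m (\<lambda>i. b i * c i) = 1\<^sub>m m" if "\<And>i. i < m \<Longrightarrow> b i * c i = (1 :: 'k)" for b c
    by (rule eq_matI) (use that in \<open>auto simp: mat_diag_def\<close>)
  have nz: "a $ i * inverse (a $ i) = 1" "inverse (a $ i) * a $ i = 1" if "i < m" for i using assms that by (auto simp: torus_def)
  let ?A = "mat_diag m (\<lambda>i. a $ i)" and ?B = "mat_diag m (\<lambda>i. inverse (a $ i))"
  have AB: "?A * ?B = 1\<^sub>m m" unfolding mat_diag_diag by (rule D) (rule nz(1))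
  have BA: "?B * ?A = 1\<^sub>m m" unfolding mat_diag_diag by (rule D) (rule nz(2))
  have c: "?A \<in> carrier_mat m m" "?B \<in> carrier_mat m m" by (rule mat_diag_dim)+
  have U: "?A \<in> Units (ring_mat TYPE('k) m ())" "?B \<in> Units (ring_mat TYPE('k) m ())"
    unfolding Units_def ring_mat_simps mem_Collect_eq using AB BA c by blast+
  then show 1: "mat_diag m (\<lambda>i. a $ i) \<in> carrier (GL m)" by (simp add: GL_def units_of_carrier)
  show "inv\<^bsub>GL m\<^esub> (mat_diag m (\<lambda>i. a $ i)) = mat_diag m (\<lambda>i. inverse (a $ i))"
    by (rule group.inv_equality[OF GL_group _ 1]) (use U BA in \<open>simp_all add: GL_def units_of_def ring_mat_simps del: mat_diag_diag\<close>)
qed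

context coords
begin

abbreviation Fr :: "nat \<Rightarrow> ('k, xmonom \<Rightarrow>\<^sub>0 'v) equiv_mod" where
  "Fr m \<equiv> free_module m n sV \<pi>"

text \<open>Coordinates coefficient by coefficient; \<open>Fr_carrier\<close>,
  \<open>Ph_surj\<close>, \<open>Ph_smult\<close> and \<open>Ph_act\<close> make this an
  identification of the free module with \<open>FM n q m\<close>.\<close>

definition Ph :: "(xmonom \<Rightarrow>\<^sub>0 'v) \<Rightarrow> 'k fvec" where
  "Ph p = (\<lambda>k. Poly_Mapping.map (\<lambda>v. co v k) p)"

lemma co_0 [simp]: "co 0 k = 0"
  using co_add[of 0 0 k] by simp

lemma lk_Ph: "lk (Ph p k) mo = co (lk p mo) k"
  by (auto simp: Ph_def map.rep_eq when_def)

lemma Ph_add: "Ph (p + p') = Ph p + Ph p'"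
  by (intro ext poly_mapping_eqI) (simp add: lk_Ph lookup_add co_add)

lemma Ph_0: "Ph 0 = 0"
  by (intro ext poly_mapping_eqI) (simp add: lk_Ph)

lemma Ph_diff: "Ph (p - p') = Ph p - Ph p'"
  using Ph_add[of "p - p'" p'] by (metis add_diff_cancel_right' diff_add_cancel)

lemma Ph_sum: "Ph (\<Sum>x\<in>S. f x) k = (\<Sum>x\<in>S. Ph (f x) k)"
  by (induction S rule: infinite_finite_induct) (auto simp: Ph_0 Ph_add)

lemma Ph_single: "Ph (sg mo v) k = sg mo (co v k)"
  by (rule poly_mapping_eqI) (simp add: lk_Ph lookup_single when_def)

lemma Ph_inj: "Ph p = Ph p' \<Longrightarrow> p = p'"
proof (rule poly_mapping_eqI, rule co_inj)
  fix mo k assume "Ph p = Ph p'"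
  then have "lk (Ph p k) mo = lk (Ph p' k) mo" by simp
  then show "co (lk p mo) k = co (lk p' mo) k" by (simp only: lk_Ph)
qed

lemma Fr_carrier: "p \<in> carrier (Fr m) \<longleftrightarrow> Ph p \<in> FM n q m"
proof
  assume "p \<in> carrier (Fr m)"
  moreover have "ky (Ph p k) \<subseteq> ky p" for k by (auto simp: in_keys_iff lk_Ph)
  moreover have "Ph p k = 0" if "k \<ge> q" for k by (rule poly_mapping_eqI) (simp add: lk_Ph co_ge[OF that])
  ultimately show "Ph p \<in> FM n q m" by (auto simp: free_module_def FM_def cin_def)
next
  assume p: "Ph p \<in> FM n q m"
  have "mo \<in> monoms m n" if "mo \<in> ky p" for mo
  proof -
    have "\<exists>k. co (lk p mo) k \<noteq> 0"
    proof (rule ccontr)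
      assume "\<not> ?thesis"
      then have "lk p mo = 0" by (intro co_inj) simp
      then show False using that by (simp add: in_keys_iff)
    qed
    then obtain k where "mo \<in> ky (Ph p k)" by (auto simp: in_keys_iff lk_Ph)
    then show ?thesis using p by (auto simp: FM_def cin_def)
  qed
  then show "p \<in> carrier (Fr m)" by (auto simp: free_module_def)
qed

lemma Ph_tensor: "Ph (tensor sV f v) k = xconst (co v k) * f"
proof -
  have "Ph (tensor sV f v) k = (\<Sum>mo\<in>ky f. xconst (co v k) * sg mo (lk f mo))"
    by (simp add: tensor_def Ph_sum Ph_single co_scale xconst_def mult_single mult.commute)
  also have "\<dots> = xconst (co v k) * (\<Sum>mo\<in>ky f. sg mo (lk f mo))" by (rule sum_distrib_left[symmetric])
  finally show ?thesis by (simp flip: poly_mapping_sum_single)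
qed

lemma Ph_expand: "Ph p k = (\<Sum>mo\<in>ky p. xconst (co (lk p mo) k) * sg mo 1)"
proof -
  have "Ph p k = Ph (\<Sum>mo\<in>ky p. sg mo (lk p mo)) k" by (simp flip: poly_mapping_sum_single)
  also have "\<dots> = (\<Sum>mo\<in>ky p. sg mo (co (lk p mo) k))" by (simp only: Ph_sum Ph_single)
  finally show ?thesis by (simp add: xconst_def mult_single)
qed

lemma vb: "\<exists>v. \<forall>k. co v k = (if k = l \<and> k < q then 1 else 0)"
proof -
  obtain v where v: "\<forall>k. co v k = (if k < q then if k = l then 1 else 0 else 0)"
    using co_surj[of "\<lambda>k. if k = l then 1 else 0"] by blast
  show ?thesis by (intro exI[of _ v] allI) (simp add: v)
qed

lemma Ph_decompose:
  assumes x: "x \<in> FM n q m" and vb: "\<And>l k. co (vb l) k = (if k = l \<and> k < q then 1 else 0)"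
  shows "Ph (\<Sum>l<q. tensor sV (x l) (vb l)) = x"
proof
  fix k
  have "Ph (\<Sum>l<q. tensor sV (x l) (vb l)) k = (\<Sum>l<q. if l = k then x k else 0)"
    unfolding Ph_sum Ph_tensor vb by (rule sum.cong) auto
  then show "Ph (\<Sum>l<q. tensor sV (x l) (vb l)) k = x k" using x by (auto simp: FM_def)
qed

lemma Ph_surj: "x \<in> FM n q m \<Longrightarrow> \<exists>p\<in>carrier (Fr m). Ph p = x"
proof -
  assume x: "x \<in> FM n q m"
  obtain vb where vb: "\<And>l k. co (vb l) k = (if k = l \<and> k < q then 1 else 0)" using vb by metis
  show ?thesis using Ph_decompose[OF x vb] x by (intro bexI[of _ "\<Sum>l<q. tensor sV (x l) (vb l)"]) (simp_all only: Fr_carrier)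
qed

lemma Ph_smult: "Ph (f \<odot>\<^bsub>Fr m\<^esub> p) = (\<lambda>k. f * Ph p k)"
proof
  fix k
  have "Ph (f \<odot>\<^bsub>Fr m\<^esub> p) k = (\<Sum>mo\<in>ky p. xconst (co (lk p mo) k) * (f * sg mo 1))"
    by (simp add: free_module_def Ph_sum Ph_tensor)
  then show "Ph (f \<odot>\<^bsub>Fr m\<^esub> p) k = f * Ph p k" by (simp add: Ph_expand[of p] sum_distrib_left mult_ac)
qed

lemma Ph_act:
  assumes "t \<in> carrier (torus n)"
  shows "Ph (act (Fr m) (g, t) p) = mact m (\<lambda>i l. (inv\<^bsub>GL m\<^esub> g) $$ (i, l)) (\<lambda>j. t $ j) (Ph p)"
proof
  fix k
  let ?s = "sb m (\<lambda>i l. (inv\<^bsub>GL m\<^esub> g) $$ (i, l)) (\<lambda>j. t $ j)"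
  have pa: "poly_act m (g, t) = ?s" by (simp add: poly_act_def xsubst_peval sb_def)
  have "Ph (act (Fr m) (g, t) p) k = (\<Sum>mo\<in>ky p. xconst (tch (w k) (\<lambda>j. t $ j)) * (xconst (co (lk p mo) k) * ?s (sg mo 1)))"
    by (simp add: free_module_def Ph_sum Ph_tensor pa co_\<pi>[OF assms] xconst_mult tch_def torus_char_def mult.assoc)
  also have "\<dots> = xconst (tch (w k) (\<lambda>j. t $ j)) * ?s (Ph p k)"
    by (simp add: Ph_expand[of p] sb_sum sb_mult sum_distrib_left)
  finally show "Ph (act (Fr m) (g, t) p) k = mact m (\<lambda>i l. (inv\<^bsub>GL m\<^esub> g) $$ (i, l)) (\<lambda>j. t $ j) (Ph p) k" by (simp add: mact_def)
qed

lemma mact_cong: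
  assumes "x \<in> FM n q m" "\<And>i l. i < m \<Longrightarrow> l < m \<Longrightarrow> A i l = B i l" "\<And>j. j < n \<Longrightarrow> s j = t j"
  shows "mact m A s x = mact m B t x"
proof
  fix k
  have "sb m A s (x k) = sb m B t (x k)" by (rule sb_cong[of m n]) (use assms in \<open>auto simp: FM_def\<close>)
  moreover have "tch (w k) s = tch (w k) t" unfolding tch_def using assms(3) by simp
  ultimately show "mact m A s x k = mact m B t x k" by (simp add: mact_def)
qed

lemma Fr_simps: "\<zero>\<^bsub>Fr m\<^esub> = 0" "p \<oplus>\<^bsub>Fr m\<^esub> p' = p + p'"
  by (simp_all add: free_module_def)

lemma Fr_closed: "0 \<in> carrier (Fr m)" "p \<in> carrier (Fr m) \<Longrightarrow> p' \<in> carrier (Fr m) \<Longrightarrow> p + p' \<in> carrier (Fr m)"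
  "p \<in> carrier (Fr m) \<Longrightarrow> - p \<in> carrier (Fr m)" "p \<in> carrier (Fr m) \<Longrightarrow> p' \<in> carrier (Fr m) \<Longrightarrow> p - p' \<in> carrier (Fr m)"
proof -
  show "0 \<in> carrier (Fr m)" "p \<in> carrier (Fr m) \<Longrightarrow> - p \<in> carrier (Fr m)" by (simp_all add: free_module_def)
  show "p \<in> carrier (Fr m) \<Longrightarrow> p' \<in> carrier (Fr m) \<Longrightarrow> p + p' \<in> carrier (Fr m)"
    "p \<in> carrier (Fr m) \<Longrightarrow> p' \<in> carrier (Fr m) \<Longrightarrow> p - p' \<in> carrier (Fr m)"
    unfolding Fr_carrier Ph_add Ph_diff by (rule ksub_add[OF ksub_FM], assumption+, rule ksub_diff[OF ksub_FM], assumption+)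
qed

lemma Fr_group: "abelian_group (Fr m)"
proof (rule abelian_groupI)
  fix p assume "p \<in> carrier (Fr m)"
  then show "\<exists>p'\<in>carrier (Fr m). p' \<oplus>\<^bsub>Fr m\<^esub> p = \<zero>\<^bsub>Fr m\<^esub>"
    using Fr_closed(3) by (intro bexI[of _ "- p"]) (simp_all add: Fr_simps)
qed (simp_all add: Fr_simps Fr_closed add_ac)

lemma Fr_inv: "p \<in> carrier (Fr m) \<Longrightarrow> inv\<^bsub>add_monoid (Fr m)\<^esub> p = - p"
proof -
  assume p: "p \<in> carrier (Fr m)"
  interpret abelian_group "Fr m" by (rule Fr_group)
  have "\<ominus>\<^bsub>Fr m\<^esub> p = - p" by (rule minus_equality[OF _ p Fr_closed(3)[OF p]]) (simp add: Fr_simps)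
  then show ?thesis by (simp add: a_inv_def)
qed

section \<open>Equivariant submodules correspond to their coordinate versions\<close>

lemma eqs_image:
  assumes sub: "N \<subseteq> carrier (Fr m)" and z: "0 \<in> N" and add: "\<And>p p'. p \<in> N \<Longrightarrow> p' \<in> N \<Longrightarrow> p + p' \<in> N"
    and mult: "\<And>f p. f \<in> carrier (coord_ring m n) \<Longrightarrow> p \<in> N \<Longrightarrow> f \<odot>\<^bsub>Fr m\<^esub> p \<in> N"
    and act: "\<And>\<gamma> p. \<gamma> \<in> carrier (GLT m n) \<Longrightarrow> p \<in> N \<Longrightarrow> act (Fr m) \<gamma> p \<in> N"
  shows "eqs m (Ph ` N)"
  unfolding eqs_def
proof (intro conjI ballI allI impI)
  show "Ph ` N \<subseteq> FM n q m" using sub Fr_carrier by blast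
  show "0 \<in> Ph ` N" using z Ph_0 by (metis image_eqI)
next
  fix x x' assume "x \<in> Ph ` N" "x' \<in> Ph ` N"
  then obtain p p' where "x = Ph p" "x' = Ph p'" "p \<in> N" "p' \<in> N" by blast
  then show "x + x' \<in> Ph ` N" using add by (simp only: Ph_add[symmetric] imageI)
next
  fix f :: "'k xpoly" and x assume f: "cin m n f" and "x \<in> Ph ` N"
  then obtain p where p: "x = Ph p" "p \<in> N" by blast
  have "(\<lambda>k. f * x k) = Ph (f \<odot>\<^bsub>Fr m\<^esub> p)" unfolding p(1) Ph_smult ..
  then show "(\<lambda>k. f * x k) \<in> Ph ` N" using mult[of f p] f p(2) by (simp only: cin_carrier imageI)
next
  fix A :: "nat \<Rightarrow> nat \<Rightarrow> 'k" and t :: "nat \<Rightarrow> 'k" and x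
  assume A: "dt m A \<noteq> 0" and t: "\<forall>j<n. t j \<noteq> 0" and "x \<in> Ph ` N"
  then obtain p where p: "x = Ph p" "p \<in> N" by blast
  interpret G: group "GL m :: 'k mat monoid" by (rule GL_group)
  have M: "mat m m (\<lambda>(i, j). A i j) \<in> carrier (GL m)" using A by (simp add: GL_carrier dt_def)
  \<comment> \<open>The action substitutes by the inverse of the group element, so the inverse of
    the given matrix is taken.\<close>
  define g where "g = inv\<^bsub>GL m\<^esub> (mat m m (\<lambda>(i, j). A i j))"
  have g: "g \<in> carrier (GL m)" "inv\<^bsub>GL m\<^esub> g = mat m m (\<lambda>(i, j). A i j)" using M by (simp_all add: g_def)
  have tc: "vec n t \<in> carrier (torus n)" using t by (auto simp: torus_def)
  have "Ph (act (Fr m) (g, vec n t) p) = mact m A t x"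
    unfolding Ph_act[OF tc] p(1) by (rule mact_cong) (use p sub Fr_carrier in \<open>auto simp: g(2)\<close>)
  moreover have "(g, vec n t) \<in> carrier (GLT m n)" using g(1) tc by (simp add: GLT_def)
  ultimately show "mact m A t x \<in> Ph ` N" using act[OF _ p(2)] by (metis imageI)
qed

lemma eqs_of_equivariant:
  assumes "equivariant_submodule m n N (Fr m)"
  shows "N \<subseteq> carrier (Fr m)" "eqs m (Ph ` N)"
proof -
  have s: "subgroup N (add_monoid (Fr m))" and mult: "\<And>f p. f \<in> carrier (coord_ring m n) \<Longrightarrow> p \<in> N \<Longrightarrow> f \<odot>\<^bsub>Fr m\<^esub> p \<in> N"
    and act: "\<And>\<gamma> p. \<gamma> \<in> carrier (GLT m n) \<Longrightarrow> p \<in> N \<Longrightarrow> act (Fr m) \<gamma> p \<in> N"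
    using assms by (auto simp: equivariant_submodule_def Module.submodule_def Module.submodule_axioms_def)
  show sub: "N \<subseteq> carrier (Fr m)" using subgroup.subset[OF s] by simp
  show "eqs m (Ph ` N)"
    by (rule eqs_image[OF sub _ _ mult act]) (use subgroup.one_closed[OF s] subgroup.m_closed[OF s] in \<open>auto simp: Fr_simps\<close>)
qed

lemma act_eqs:
  assumes W: "eqs m W" and \<gamma>: "\<gamma> \<in> carrier (GLT m n)" and p: "Ph p \<in> W"
  shows "Ph (act (Fr m) \<gamma> p) \<in> W"
proof -
  obtain g t where gt: "\<gamma> = (g, t)" "g \<in> carrier (GL m)" "t \<in> carrier (torus n)" using \<gamma> by (auto simp: GLT_def)
  interpret G: group "GL m :: 'k mat monoid" by (rule GL_group)
  have i: "inv\<^bsub>GL m\<^esub> g \<in> carrier (GL m)" using gt(2) by simp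
  then have c: "inv\<^bsub>GL m\<^esub> g \<in> carrier_mat m m" "det (inv\<^bsub>GL m\<^esub> g) \<noteq> 0" by (simp_all add: GL_carrier)
  have "mat m m (\<lambda>(i, j). (inv\<^bsub>GL m\<^esub> g) $$ (i, j)) = inv\<^bsub>GL m\<^esub> g" by (rule eq_matI) (use c(1) in auto)
  then have "dt m (\<lambda>i l. (inv\<^bsub>GL m\<^esub> g) $$ (i, l)) \<noteq> 0" using c(2) by (simp add: dt_def)
  then show ?thesis unfolding gt(1) Ph_act[OF gt(3)] by (intro eqs_act[OF W _ _ p]) (use gt(3) in \<open>auto simp: torus_def\<close>)
qed

lemma equivariant_of_eqs:
  assumes W: "eqs m W"
  shows "equivariant_submodule m n {p \<in> carrier (Fr m). Ph p \<in> W} (Fr m)"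
proof -
  note kW = eqs_ksub[OF W] and WF = eqs_FM[OF W]
  have mem: "p \<in> {p \<in> carrier (Fr m). Ph p \<in> W} \<longleftrightarrow> Ph p \<in> W" for p using WF by (auto simp: Fr_carrier)
  have "subgroup {p \<in> carrier (Fr m). Ph p \<in> W} (add_monoid (Fr m))"
  proof
    show "inv\<^bsub>add_monoid (Fr m)\<^esub> p \<in> {p \<in> carrier (Fr m). Ph p \<in> W}" if "p \<in> {p \<in> carrier (Fr m). Ph p \<in> W}" for p
    proof -
      have p: "p \<in> carrier (Fr m)" "Ph p \<in> W" using that by auto
      have "Ph (- p) = - Ph p" using Ph_diff[of 0 p] by (simp only: Ph_0 diff_0)
      then show ?thesis unfolding Fr_inv[OF p(1)] mem using ksub_uminus[OF kW p(2)] by simp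
    qed
  next
    fix p p' assume "p \<in> {p \<in> carrier (Fr m). Ph p \<in> W}" "p' \<in> {p \<in> carrier (Fr m). Ph p \<in> W}"
    then have "Ph (p + p') \<in> W" unfolding mem Ph_add by (rule ksub_add[OF kW])
    then show "p \<otimes>\<^bsub>add_monoid (Fr m)\<^esub> p' \<in> {p \<in> carrier (Fr m). Ph p \<in> W}" using mem[of "p + p'"] by (simp add: Fr_simps)
  next
    have "Ph 0 \<in> W" unfolding Ph_0 by (rule ksub_0[OF kW])
    then show "\<one>\<^bsub>add_monoid (Fr m)\<^esub> \<in> {p \<in> carrier (Fr m). Ph p \<in> W}" using mem[of 0] by (simp add: Fr_simps)
  qed auto
  moreover have "Ph (f \<odot>\<^bsub>Fr m\<^esub> p) \<in> W" if "f \<in> carrier (coord_ring m n)" "Ph p \<in> W" for f p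
    unfolding Ph_smult using that by (intro eqs_mult[OF W]) (simp_all add: cin_carrier)
  ultimately show ?thesis
    unfolding equivariant_submodule_def Module.submodule_def Module.submodule_axioms_def using mem act_eqs[OF W] by blast
qed

text \<open>Equivariant submodules on both sides correspond under \<open>Ph\<close>
  (\<open>eqs_of_equivariant\<close>, \<open>equivariant_of_eqs\<close>), hence so do their
  intersections.\<close>

lemma Ph_stab:
  assumes "N \<subseteq> carrier (Fr r)"
  shows "stab_submodule r n sV \<pi> N = {p \<in> carrier (Fr (r + 1)). Ph p \<in> eqs_gen (r + 1) (Ph ` N)}"
proof (intro equalityI subsetI)
  have "Ph ` N \<subseteq> FM n q r" using assms Fr_carrier by blast
  then have N: "Ph ` N \<subseteq> FM n q (r + 1)" using FM_mono[of r "r + 1"] by auto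
  fix p assume p: "p \<in> stab_submodule r n sV \<pi> N"
  have *: "p \<in> carrier (Fr (r + 1)) \<and> Ph p \<in> W" if W: "eqs (r + 1) W" "Ph ` N \<subseteq> W" for W
  proof -
    have "N \<subseteq> {p \<in> carrier (Fr (r + 1)). Ph p \<in> W}" using W(2) eqs_FM[OF W(1)] by (auto simp: Fr_carrier)
    then show ?thesis using p equivariant_of_eqs[OF W(1)] unfolding stab_submodule_def by blast
  qed
  show "p \<in> {p \<in> carrier (Fr (r + 1)). Ph p \<in> eqs_gen (r + 1) (Ph ` N)}"
    using *[OF eqs_FM_top N] * by (auto simp: eqs_gen_def)
next
  fix p assume p: "p \<in> {p \<in> carrier (Fr (r + 1)). Ph p \<in> eqs_gen (r + 1) (Ph ` N)}"
  show "p \<in> stab_submodule r n sV \<pi> N" unfolding stab_submodule_def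
  proof (rule InterI)
    fix N' assume "N' \<in> {N'. equivariant_submodule (r + 1) n N' (Fr (r + 1)) \<and> N \<subseteq> N'}"
    then have "eqs (r + 1) (Ph ` N')" "Ph ` N \<subseteq> Ph ` N'" using eqs_of_equivariant by blast+
    then have "Ph p \<in> Ph ` N'" using p by (auto simp: eqs_gen_def)
    then show "p \<in> N'" using Ph_inj by blast
  qed
qed

text \<open>One inclusion is checked on generators; for the other, an element is the sum of its
  coordinates tensored with the basis vectors of \<open>V\<close>.\<close>

lemma Ph_ideal_tensor: "ideal_tensor m n sV \<pi> (mJ m n) = {p \<in> carrier (Fr m). Ph p \<in> JF m}"
proof (intro equalityI subsetI)
  let ?J = "{p \<in> carrier (Fr m). Ph p \<in> JF m}"
  have s: "subgroup ?J (add_monoid (Fr m))"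
    using equivariant_of_eqs[OF eqs_JF, of m] by (auto simp: equivariant_submodule_def Module.submodule_def)
  have t: "tensor sV f v \<in> ?J" if "f \<in> mJ m n" for f v
  proof -
    have "Ph (tensor sV f v) \<in> JF m" unfolding JF_def FM_def
      using mJ_mult[OF cin_const that] mJ_cin[OF that] by (auto simp: Ph_tensor co_ge intro: cin_mult)
    then show ?thesis by (simp add: Fr_carrier JF_def)
  qed
  fix p assume "p \<in> ideal_tensor m n sV \<pi> (mJ m n)"
  then show "p \<in> ?J" unfolding ideal_tensor_def
  proof (induction rule: generate.induct)
    case one then show ?case by (rule subgroup.one_closed[OF s])
  next
    case (incl h) then show ?case using t by blast
  next
    case (inv h) then show ?case using t by (intro subgroup.m_inv_closed[OF s]) blast
  next
    case (eng h1 h2) then show ?case by (intro subgroup.m_closed[OF s])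
  qed
next
  fix p assume p: "p \<in> {p \<in> carrier (Fr m). Ph p \<in> JF m}"
  obtain vb where vb: "\<And>l k. co (vb l) k = (if k = l \<and> k < q then 1 else 0)" using vb by metis
  have "p = (\<Sum>l<q. tensor sV (Ph p l) (vb l))"
    using p by (intro Ph_inj Ph_decompose[OF _ vb, symmetric]) (auto simp: Fr_carrier)
  moreover have "(\<Sum>l\<in>S. tensor sV (Ph p l) (vb l)) \<in> ideal_tensor m n sV \<pi> (mJ m n)" if "finite S" for S
    using that
  proof (induction S rule: finite_induct)
    case empty
    then show ?case using generate.one[of "add_monoid (Fr m)"] by (simp add: ideal_tensor_def Fr_simps)
  next
    case (insert l S)
    have "tensor sV (Ph p l) (vb l) \<in> ideal_tensor m n sV \<pi> (mJ m n)"
      unfolding ideal_tensor_def using p by (intro generate.incl) (auto simp: JF_def)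
    then show ?case using generate.eng[OF _ insert.IH[unfolded ideal_tensor_def], of "tensor sV (Ph p l) (vb l)"] insert.hyps
      by (simp add: ideal_tensor_def Fr_simps)
  qed
  ultimately show "p \<in> ideal_tensor m n sV \<pi> (mJ m n)" by (metis finite_lessThan)
qed

lemma Ph_set_add:
  assumes A: "A \<subseteq> FM n q m" and B: "B \<subseteq> FM n q m"
  shows "{p \<in> carrier (Fr m). Ph p \<in> A} <+>\<^bsub>Fr m\<^esub> {p \<in> carrier (Fr m). Ph p \<in> B} = {p \<in> carrier (Fr m). Ph p \<in> splus A B}"
proof (intro equalityI subsetI)
  fix p assume "p \<in> {p \<in> carrier (Fr m). Ph p \<in> A} <+>\<^bsub>Fr m\<^esub> {p \<in> carrier (Fr m). Ph p \<in> B}"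
  then obtain a b where ab: "p = a + b" "a \<in> carrier (Fr m)" "b \<in> carrier (Fr m)" "Ph a \<in> A" "Ph b \<in> B"
    by (auto simp: set_add_def' Fr_simps)
  have "Ph p \<in> splus A B" unfolding ab(1) Ph_add splus_def using ab(4,5) by blast
  then show "p \<in> {p \<in> carrier (Fr m). Ph p \<in> splus A B}" using Fr_closed(2)[OF ab(2,3)] ab(1) by simp
next
  fix p assume "p \<in> {p \<in> carrier (Fr m). Ph p \<in> splus A B}"
  then obtain x y where xy: "Ph p = x + y" "x \<in> A" "y \<in> B" by (auto simp: splus_def simp del: plus_fun_apply)
  obtain a where a: "a \<in> carrier (Fr m)" "Ph a = x" using Ph_surj A xy(2) by blast
  obtain b where b: "b \<in> carrier (Fr m)" "Ph b = y" using Ph_surj B xy(3) by blast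
  have "p = a + b" by (rule Ph_inj) (simp only: xy(1) Ph_add a(2) b(2))
  then show "p \<in> {p \<in> carrier (Fr m). Ph p \<in> A} <+>\<^bsub>Fr m\<^esub> {p \<in> carrier (Fr m). Ph p \<in> B}"
    using a b xy by (auto simp: set_add_def' Fr_simps)
qed

section \<open>Hilbert series through coordinates\<close>

lemma Hilb_image:
  fixes M :: "('k, 'm) equiv_mod" and \<phi> :: "(xmonom \<Rightarrow>\<^sub>0 'v) \<Rightarrow> 'm"
  assumes W: "eqs m W" and carr: "carrier M = \<phi> ` carrier (Fr m)"
    and add: "\<And>p p'. p \<in> carrier (Fr m) \<Longrightarrow> p' \<in> carrier (Fr m) \<Longrightarrow> \<phi> (p + p') = \<phi> p \<oplus>\<^bsub>M\<^esub> \<phi> p'"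
    and zero: "\<zero>\<^bsub>M\<^esub> = \<phi> 0"
    and smult: "\<And>c p. p \<in> carrier (Fr m) \<Longrightarrow> xconst c \<odot>\<^bsub>M\<^esub> \<phi> p = \<phi> (xconst c \<odot>\<^bsub>Fr m\<^esub> p)"
    and act: "\<And>a t p. a \<in> carrier (torus m) \<Longrightarrow> t \<in> carrier (torus n) \<Longrightarrow> p \<in> carrier (Fr m) \<Longrightarrow>
      act M (mat_diag m (\<lambda>i. a $ i), t) (\<phi> p) = \<phi> (act (Fr m) (mat_diag m (\<lambda>i. a $ i), t) p)"
    and eq: "\<And>p p'. p \<in> carrier (Fr m) \<Longrightarrow> p' \<in> carrier (Fr m) \<Longrightarrow> \<phi> p = \<phi> p' \<longleftrightarrow> Ph (p - p') \<in> W"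
  shows "Hilb m n M d = int (hd (FM n q m :: 'k fvec set) d) - int (hd W d)"
proof (rule Hilb_quotient[OF W, where g = "\<lambda>x. \<phi> (inv_into UNIV Ph x)"])
  have inj: "inj Ph" by (rule injI) (rule Ph_inj)
  have iP: "inv_into UNIV Ph (Ph p) = p" for p by (rule inv_f_f[OF inj])
  have ex: "\<exists>p. x = Ph p \<and> p \<in> carrier (Fr m)" if "x \<in> FM n q m" for x using Ph_surj[OF that] by blast
  have im: "FM n q m = Ph ` carrier (Fr m)" using ex Fr_carrier by blast
  show "carrier M = (\<lambda>x. \<phi> (inv_into UNIV Ph x)) ` FM n q m" unfolding carr im image_image iP ..
  show "\<zero>\<^bsub>M\<^esub> = \<phi> (inv_into UNIV Ph 0)" unfolding zero using iP[of 0] by (simp only: Ph_0)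
  fix x :: "'k fvec" assume "x \<in> FM n q m"
  then obtain p where p: "x = Ph p" "p \<in> carrier (Fr m)" using ex by blast
  show "xconst c \<odot>\<^bsub>M\<^esub> \<phi> (inv_into UNIV Ph x) = \<phi> (inv_into UNIV Ph (scl c x))" for c
  proof -
    have "scl c x = Ph (xconst c \<odot>\<^bsub>Fr m\<^esub> p)" by (simp add: scl_def Ph_smult p(1))
    then show ?thesis by (simp only: p(1) iP smult[OF p(2)])
  qed
  show "act M (mat_diag m (\<lambda>i. a $ i), t) (\<phi> (inv_into UNIV Ph x))
      = \<phi> (inv_into UNIV Ph (mact m (diagf (\<lambda>i. inverse (a $ i))) (\<lambda>j. t $ j) x))"
    if at: "a \<in> carrier (torus m)" "t \<in> carrier (torus n)" for a t
  proof -
    have "mact m (diagf (\<lambda>i. inverse (a $ i))) (\<lambda>j. t $ j) x = Ph (act (Fr m) (mat_diag m (\<lambda>i. a $ i), t) p)"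
      unfolding Ph_act[OF at(2)] p(1) mat_diag_GL(2)[OF at(1)]
      by (rule mact_cong) (use p(2) in \<open>auto simp: Fr_carrier mat_diag_def diagf_def\<close>)
    then show ?thesis by (simp only: p(1) iP act[OF at p(2)])
  qed
  fix y :: "'k fvec" assume "y \<in> FM n q m"
  then obtain p' where p': "y = Ph p'" "p' \<in> carrier (Fr m)" using ex by blast
  show "\<phi> (inv_into UNIV Ph (x + y)) = \<phi> (inv_into UNIV Ph x) \<oplus>\<^bsub>M\<^esub> \<phi> (inv_into UNIV Ph y)"
    unfolding p(1) p'(1) Ph_add[symmetric] iP by (rule add[OF p(2) p'(2)])
  show "\<phi> (inv_into UNIV Ph x) = \<phi> (inv_into UNIV Ph y) \<longleftrightarrow> x - y \<in> W"
    unfolding p(1) p'(1) Ph_diff[symmetric] iP by (rule eq[OF p(2) p'(2)])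
qed

lemma Hilb_quotient_module:
  assumes W: "eqs m W" and L: "L = {p \<in> carrier (Fr m). Ph p \<in> W}"
  shows "Hilb m n (quotient_module (Fr m) L) d = int (hd (FM n q m :: 'k fvec set) d) - int (hd W d)"
proof (rule Hilb_image[OF W, where \<phi> = "\<lambda>p. L +>\<^bsub>Fr m\<^esub> p"])
  note kW = eqs_ksub[OF W]
  have Lm: "p \<in> L \<longleftrightarrow> Ph p \<in> W" for p using eqs_FM[OF W] by (auto simp: L Fr_carrier)
  have L0: "0 \<in> L" unfolding Lm Ph_0 by (rule ksub_0[OF kW])
  have Ladd: "p + p' \<in> L" if "p \<in> L" "p' \<in> L" for p p' using that unfolding Lm Ph_add by (rule ksub_add[OF kW])
  have Ldiff: "p - p' \<in> L" if "p \<in> L" "p' \<in> L" for p p' using that unfolding Lm Ph_diff by (rule ksub_diff[OF kW])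
  have cos: "x \<in> L +>\<^bsub>Fr m\<^esub> p \<longleftrightarrow> x - p \<in> L" for x p
  proof
    assume "x - p \<in> L"
    then have "(x - p) + p \<in> L +>\<^bsub>Fr m\<^esub> p" unfolding a_r_coset_def' Fr_simps by blast
    then show "x \<in> L +>\<^bsub>Fr m\<^esub> p" by simp
  qed (auto simp: a_r_coset_def' Fr_simps)
  show "carrier (quotient_module (Fr m) L) = (\<lambda>p. L +>\<^bsub>Fr m\<^esub> p) ` carrier (Fr m)"
    by (auto simp: quotient_module_def A_RCOSETS_def')
  show "\<zero>\<^bsub>quotient_module (Fr m) L\<^esub> = L +>\<^bsub>Fr m\<^esub> 0" by (auto simp: quotient_module_def cos)
  fix p
  show "xconst c \<odot>\<^bsub>quotient_module (Fr m) L\<^esub> (L +>\<^bsub>Fr m\<^esub> p) = L +>\<^bsub>Fr m\<^esub> (xconst c \<odot>\<^bsub>Fr m\<^esub> p)" for c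
  proof -
    have sm: "xconst c \<odot>\<^bsub>Fr m\<^esub> (x - p) = xconst c \<odot>\<^bsub>Fr m\<^esub> x - xconst c \<odot>\<^bsub>Fr m\<^esub> p" for x p
      by (rule Ph_inj, rule ext) (simp add: Ph_smult Ph_diff right_diff_distrib)
    have smL: "xconst c \<odot>\<^bsub>Fr m\<^esub> x \<in> L" if "x \<in> L" for x using eqs_mult[OF W cin_const, of "Ph x" c] that by (simp only: Lm Ph_smult)
    have step: "y - xconst c \<odot>\<^bsub>Fr m\<^esub> p \<in> L" if x: "x - p \<in> L" and y: "y - xconst c \<odot>\<^bsub>Fr m\<^esub> x \<in> L" for x y
      using Ladd[OF y smL[OF x]] by (simp add: sm)
    have pp: "p - p \<in> L" using L0 by simp
    have "(\<Union>x\<in>L +>\<^bsub>Fr m\<^esub> p. L +>\<^bsub>Fr m\<^esub> (xconst c \<odot>\<^bsub>Fr m\<^esub> x)) = L +>\<^bsub>Fr m\<^esub> (xconst c \<odot>\<^bsub>Fr m\<^esub> p)"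
    proof (intro equalityI subsetI)
      fix y assume "y \<in> (\<Union>x\<in>L +>\<^bsub>Fr m\<^esub> p. L +>\<^bsub>Fr m\<^esub> (xconst c \<odot>\<^bsub>Fr m\<^esub> x))"
      then obtain x where "x - p \<in> L" "y - xconst c \<odot>\<^bsub>Fr m\<^esub> x \<in> L" by (auto simp: cos)
      then show "y \<in> L +>\<^bsub>Fr m\<^esub> (xconst c \<odot>\<^bsub>Fr m\<^esub> p)" unfolding cos by (rule step)
    next
      have "p \<in> L +>\<^bsub>Fr m\<^esub> p" using pp by (simp only: cos)
      then show "y \<in> (\<Union>x\<in>L +>\<^bsub>Fr m\<^esub> p. L +>\<^bsub>Fr m\<^esub> (xconst c \<odot>\<^bsub>Fr m\<^esub> x))"
        if "y \<in> L +>\<^bsub>Fr m\<^esub> (xconst c \<odot>\<^bsub>Fr m\<^esub> p)" for y using that by blast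
    qed
    then show ?thesis by (simp add: quotient_module_def)
  qed
  show "act (quotient_module (Fr m) L) (mat_diag m (\<lambda>i. a $ i), t) (L +>\<^bsub>Fr m\<^esub> p) = L +>\<^bsub>Fr m\<^esub> (act (Fr m) (mat_diag m (\<lambda>i. a $ i), t) p)"
    if at: "a \<in> carrier (torus m)" "t \<in> carrier (torus n)" and p: "p \<in> carrier (Fr m)" for a t
  proof -
    let ?\<gamma> = "(mat_diag m (\<lambda>i. a $ i), t)"
    \<comment> \<open>The action on a coset is its image as a set, so a full coset is reached only
      if preimages exist; the inverse torus element provides them.\<close>
    define a' where "a' = vec m (\<lambda>i. inverse (a $ i))"
    define t' where "t' = vec n (\<lambda>j. inverse (t $ j))"
    let ?\<gamma>' = "(mat_diag m (\<lambda>i. a' $ i), t')"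
    have at': "a' \<in> carrier (torus m)" "t' \<in> carrier (torus n)" using at by (auto simp: torus_def a'_def t'_def)
    have G: "?\<gamma> \<in> carrier (GLT m n)" "?\<gamma>' \<in> carrier (GLT m n)" using at at' mat_diag_GL(1)[OF at(1)] mat_diag_GL(1)[OF at'(1)] by (simp_all add: GLT_def)
    have add: "act (Fr m) ?\<gamma> (x + y) = act (Fr m) ?\<gamma> x + act (Fr m) ?\<gamma> y" for x y
      by (rule Ph_inj) (simp only: Ph_act[OF at(2)] Ph_add mact_add)
    have diag: "Ph (act (Fr m) (mat_diag m (\<lambda>i. b $ i), s) x) = mact m (diagf (\<lambda>i. inverse (b $ i))) (\<lambda>j. s $ j) (Ph x)"
      if "b \<in> carrier (torus m)" "s \<in> carrier (torus n)" "Ph x \<in> FM n q m" for b s x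
      unfolding Ph_act[OF that(2)] mat_diag_GL(2)[OF that(1)]
      by (rule mact_cong) (use that(3) in \<open>auto simp: mat_diag_def diagf_def\<close>)
    have inv: "act (Fr m) ?\<gamma> (act (Fr m) ?\<gamma>' x) = x" if x: "x \<in> L" for x
    proof (rule Ph_inj, rule ext, rule poly_mapping_eqI)
      fix k mo
      have xF: "Ph x \<in> FM n q m" using x by (auto simp: L Fr_carrier)
      have yF: "Ph (act (Fr m) ?\<gamma>' x) \<in> FM n q m" unfolding diag[OF at' xF] by (rule mact_FM[OF xF])
      have nz: "i < m \<Longrightarrow> inverse (a $ i) \<noteq> 0" "j < n \<Longrightarrow> t $ j \<noteq> 0" "i < m \<Longrightarrow> inverse (a' $ i) \<noteq> 0" "j < n \<Longrightarrow> t' $ j \<noteq> 0" for i j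
        using at at' by (auto simp: torus_def)
      let ?d = "mdeg mo + (0, w k)"
      have "lk (Ph (act (Fr m) ?\<gamma> (act (Fr m) ?\<gamma>' x)) k) mo
        = chi m n (\<lambda>i. inverse (a $ i)) (\<lambda>j. t $ j) ?d * lk (Ph (act (Fr m) ?\<gamma>' x) k) mo"
        unfolding diag[OF at yF] by (rule lookup_mact_diag[OF nz(1,2) yF])
      also have "lk (Ph (act (Fr m) ?\<gamma>' x) k) mo = chi m n (\<lambda>i. inverse (a' $ i)) (\<lambda>j. t' $ j) ?d * lk (Ph x k) mo"
        unfolding diag[OF at' xF] by (rule lookup_mact_diag[OF nz(3,4) xF])
      also have "chi m n (\<lambda>i. inverse (a' $ i)) (\<lambda>j. t' $ j) ?d = chi m n (\<lambda>i. inverse (inverse (a $ i))) (\<lambda>j. inverse (t $ j)) ?d"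
        by (simp add: chi_def a'_def t'_def)
      finally show "lk (Ph (act (Fr m) ?\<gamma> (act (Fr m) ?\<gamma>' x)) k) mo = lk (Ph x k) mo"
        using chi_inverse[where m = m and n = n and a = "\<lambda>i. inverse (a $ i)" and t = "\<lambda>j. t $ j" and d = ?d] nz by (simp add: mult.assoc[symmetric])
    qed
    have AL: "act (Fr m) \<gamma> x \<in> L" if "\<gamma> \<in> carrier (GLT m n)" "x \<in> L" for \<gamma> x using act_eqs[OF W that(1)] that(2) by (simp only: Lm)
    have "act (Fr m) ?\<gamma> ` (L +>\<^bsub>Fr m\<^esub> p) = L +>\<^bsub>Fr m\<^esub> (act (Fr m) ?\<gamma> p)"
    proof (intro equalityI subsetI)
      fix y assume "y \<in> act (Fr m) ?\<gamma> ` (L +>\<^bsub>Fr m\<^esub> p)"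
      then obtain l where "l \<in> L" "y = act (Fr m) ?\<gamma> (l + p)" by (auto simp: a_r_coset_def' Fr_simps)
      then show "y \<in> L +>\<^bsub>Fr m\<^esub> (act (Fr m) ?\<gamma> p)" using AL[OF G(1)] by (simp add: cos add)
    next
      fix y assume "y \<in> L +>\<^bsub>Fr m\<^esub> (act (Fr m) ?\<gamma> p)"
      then have y: "y - act (Fr m) ?\<gamma> p \<in> L" by (simp only: cos)
      let ?l = "act (Fr m) ?\<gamma>' (y - act (Fr m) ?\<gamma> p)"
      have "act (Fr m) ?\<gamma> (?l + p) = y" by (simp only: add inv[OF y] diff_add_cancel)
      moreover have "?l + p \<in> L +>\<^bsub>Fr m\<^esub> p" using AL[OF G(2) y] by (simp add: cos)
      ultimately show "y \<in> act (Fr m) ?\<gamma> ` (L +>\<^bsub>Fr m\<^esub> p)" by (metis imageI)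
    qed
    then show ?thesis by (simp add: quotient_module_def)
  qed
  fix p'
  show "L +>\<^bsub>Fr m\<^esub> (p + p') = (L +>\<^bsub>Fr m\<^esub> p) \<oplus>\<^bsub>quotient_module (Fr m) L\<^esub> (L +>\<^bsub>Fr m\<^esub> p')"
  proof -
    have "(L +>\<^bsub>Fr m\<^esub> p) <+>\<^bsub>Fr m\<^esub> (L +>\<^bsub>Fr m\<^esub> p') = L +>\<^bsub>Fr m\<^esub> (p + p')"
    proof (intro equalityI subsetI)
      fix y assume "y \<in> (L +>\<^bsub>Fr m\<^esub> p) <+>\<^bsub>Fr m\<^esub> (L +>\<^bsub>Fr m\<^esub> p')"
      then obtain a b where ab: "y = a + b" "a - p \<in> L" "b - p' \<in> L" by (auto simp: set_add_def' Fr_simps cos)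
      then show "y \<in> L +>\<^bsub>Fr m\<^esub> (p + p')" using Ladd[OF ab(2,3)] by (simp add: cos algebra_simps)
    next
      fix y assume "y \<in> L +>\<^bsub>Fr m\<^esub> (p + p')"
      then have "(y - p') - p \<in> L" by (simp add: cos algebra_simps)
      then have "y - p' \<in> L +>\<^bsub>Fr m\<^esub> p" "p' \<in> L +>\<^bsub>Fr m\<^esub> p'" using L0 by (simp_all add: cos)
      moreover have "y = (y - p') + p'" by simp
      ultimately show "y \<in> (L +>\<^bsub>Fr m\<^esub> p) <+>\<^bsub>Fr m\<^esub> (L +>\<^bsub>Fr m\<^esub> p')" unfolding set_add_def' Fr_simps by blast
    qed
    then show ?thesis by (simp add: quotient_module_def)
  qed
  show "L +>\<^bsub>Fr m\<^esub> p = L +>\<^bsub>Fr m\<^esub> p' \<longleftrightarrow> Ph (p - p') \<in> W"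
  proof
    assume "L +>\<^bsub>Fr m\<^esub> p = L +>\<^bsub>Fr m\<^esub> p'"
    moreover have "p \<in> L +>\<^bsub>Fr m\<^esub> p" using L0 by (simp add: cos)
    ultimately show "Ph (p - p') \<in> W" by (simp only: cos Lm)
  next
    assume "Ph (p - p') \<in> W"
    then have d: "p - p' \<in> L" by (simp only: Lm)
    have "x - p \<in> L \<longleftrightarrow> x - p' \<in> L" for x
      using Ladd[OF _ d, of "x - p"] Ldiff[OF _ d, of "x - p'"] by (auto simp: algebra_simps)
    then show "L +>\<^bsub>Fr m\<^esub> p = L +>\<^bsub>Fr m\<^esub> p'" by (auto simp: cos)
  qed
qed

text \<open>Equivariance of \<open>\<phi>\<close> makes its kernel an equivariant submodule, and
  \<open>M\<close> can then be treated as the quotient of the free module by it.\<close>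

lemma presentation_kernel:
  fixes M :: "('k, 'm) equiv_mod"
  assumes M: "equivariant_module r n M" and pres: "equivariant_presentation r n sV \<pi> N \<phi> M"
  shows "N \<subseteq> carrier (Fr r)" "eqs r (Ph ` N)" "Hilb r n M d = int (hd (FM n q r :: 'k fvec set) d) - int (hd (Ph ` N) d)"
proof -
  interpret M: Module.module "coord_ring r n" M using M by (simp add: equivariant_module_def)
  interpret F: abelian_group "Fr r" by (rule Fr_group)
  have \<phi>: "\<phi> \<in> hom (add_monoid (Fr r)) (add_monoid M)"
    and sm: "\<And>f x. f \<in> carrier (coord_ring r n) \<Longrightarrow> x \<in> carrier (Fr r) \<Longrightarrow> \<phi> (f \<odot>\<^bsub>Fr r\<^esub> x) = f \<odot>\<^bsub>M\<^esub> \<phi> x"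
    and ac: "\<And>\<gamma> x. \<gamma> \<in> carrier (GLT r n) \<Longrightarrow> x \<in> carrier (Fr r) \<Longrightarrow> \<phi> (act (Fr r) \<gamma> x) = act M \<gamma> (\<phi> x)"
    and onto: "\<phi> ` carrier (Fr r) = carrier M" and N: "N = {x \<in> carrier (Fr r). \<phi> x = \<zero>\<^bsub>M\<^esub>}"
    using pres by (auto simp: equivariant_presentation_def equivariant_hom_def a_kernel_def')
  have add: "\<phi> (p + p') = \<phi> p \<oplus>\<^bsub>M\<^esub> \<phi> p'" if "p \<in> carrier (Fr r)" "p' \<in> carrier (Fr r)" for p p'
    using hom_mult[OF \<phi>, of p p'] that by (simp add: Fr_simps)
  have cl: "\<phi> p \<in> carrier M" if "p \<in> carrier (Fr r)" for p using onto that by blast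
  have zero: "\<phi> 0 = \<zero>\<^bsub>M\<^esub>" using hom_one[OF \<phi> F.a_group M.a_group] by (simp add: Fr_simps)
  have actM: "act M \<gamma> \<zero>\<^bsub>M\<^esub> = \<zero>\<^bsub>M\<^esub>" if "\<gamma> \<in> carrier (GLT r n)" for \<gamma>
  proof -
    have "act M \<gamma> \<in> hom (add_monoid M) (add_monoid M)" using M that by (simp add: equivariant_module_def)
    from hom_one[OF this M.a_group M.a_group] show ?thesis by simp
  qed
  have FrcI: "x \<in> carrier (Fr r)" if "Ph x \<in> FM n q r" for x using that by (simp only: Fr_carrier)
  show sub: "N \<subseteq> carrier (Fr r)" by (auto simp: N)
  show e: "eqs r (Ph ` N)"
  proof (rule eqs_image[OF sub])
    show "0 \<in> N" using zero Fr_closed(1) by (simp add: N)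
    show "p + p' \<in> N" if "p \<in> N" "p' \<in> N" for p p' using that add Fr_closed(2) by (simp add: N)
    show "f \<odot>\<^bsub>Fr r\<^esub> p \<in> N" if f: "f \<in> carrier (coord_ring r n)" and p: "p \<in> N" for f p
    proof -
      have pF: "p \<in> carrier (Fr r)" "\<phi> p = \<zero>\<^bsub>M\<^esub>" using p by (auto simp: N)
      have "f \<odot>\<^bsub>Fr r\<^esub> p \<in> carrier (Fr r)"
        by (rule FrcI, unfold Ph_smult, rule eqs_mult[OF eqs_FM_top]) (use f pF in \<open>simp_all only: cin_carrier Fr_carrier\<close>)
      then show ?thesis using sm[OF f pF(1)] pF(2) M.smult_r_null[OF f] by (simp add: N)
    qed
    show "act (Fr r) \<gamma> p \<in> N" if g: "\<gamma> \<in> carrier (GLT r n)" and p: "p \<in> N" for \<gamma> p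
    proof -
      have pF: "p \<in> carrier (Fr r)" "\<phi> p = \<zero>\<^bsub>M\<^esub>" using p by (auto simp: N)
      have "act (Fr r) \<gamma> p \<in> carrier (Fr r)" by (rule FrcI, rule act_eqs[OF eqs_FM_top g]) (use pF in \<open>simp only: Fr_carrier\<close>)
      then show ?thesis using ac[OF g pF(1)] pF(2) actM[OF g] by (simp add: N)
    qed
  qed
  show "Hilb r n M d = int (hd (FM n q r :: 'k fvec set) d) - int (hd (Ph ` N) d)"
  proof (rule Hilb_image[OF e onto[symmetric] add zero[symmetric]])
    show "xconst c \<odot>\<^bsub>M\<^esub> \<phi> p = \<phi> (xconst c \<odot>\<^bsub>Fr r\<^esub> p)" if "p \<in> carrier (Fr r)" for c p
      by (rule sm[symmetric, OF _ that]) (simp add: cin_carrier)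
    show "act M (mat_diag r (\<lambda>i. a $ i), t) (\<phi> p) = \<phi> (act (Fr r) (mat_diag r (\<lambda>i. a $ i), t) p)"
      if "a \<in> carrier (torus r)" "t \<in> carrier (torus n)" "p \<in> carrier (Fr r)" for a t p
      by (rule ac[symmetric, OF _ that(3)]) (use that mat_diag_GL(1)[OF that(1)] in \<open>simp add: GLT_def\<close>)
    show "\<phi> p = \<phi> p' \<longleftrightarrow> Ph (p - p') \<in> Ph ` N" if p: "p \<in> carrier (Fr r)" "p' \<in> carrier (Fr r)" for p p'
    proof -
      have d: "p - p' \<in> carrier (Fr r)" by (rule Fr_closed(4)[OF p])
      have "\<phi> p = \<phi> (p - p') \<oplus>\<^bsub>M\<^esub> \<phi> p'" using add[OF d p(2)] by simp
      then have "\<phi> p = \<phi> p' \<longleftrightarrow> \<phi> (p - p') = \<zero>\<^bsub>M\<^esub>"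
        using M.add.r_cancel_one[OF cl[OF p(2)] cl[OF d]] by simp
      moreover have "Ph (p - p') \<in> Ph ` N \<longleftrightarrow> p - p' \<in> N" using Ph_inj by blast
      ultimately show ?thesis using d by (simp add: N)
    qed
  qed
qed

end

text \<open>\<open>K_polynomial\<close> prescribes all coefficients of \<open>K\<close> through the
  product with the denominator, so uniqueness is immediate and only the existence of a finite
  support has content.\<close>

lemma K_polynomial_eq:
  assumes "lk K = conv (Pr r n) (Hilb r n M)"
  shows "K_polynomial r n M = K"
proof -
  have c: "(let P = (\<Prod>i<r. \<Prod>j<n. 1 - upow i 1 * tvar j) in \<Sum>e\<in>ky P. lk P e * Hilb r n M (d - e)) = conv (Pr r n) (Hilb r n M) d" for d
    by (simp add: Let_def conv_def Pr_def)
  show ?thesis unfolding K_polynomial_def c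
  proof (rule the_equality)
    show "\<forall>d. conv (Pr r n) (Hilb r n M) d = lk K d" by (simp add: assms)
    show "K' = K" if "\<forall>d. conv (Pr r n) (Hilb r n M) d = lk K' d" for K'
      by (rule poly_mapping_eqI) (simp only: assms spec[OF that, symmetric])
  qed
qed

theorem proposition6p6:
  fixes r n :: nat
    and M :: "('k::{alg_closed_field, field_char_0}, 'm) equiv_mod"
    and sV :: "'k \<Rightarrow> 'v::ab_group_add \<Rightarrow> 'v"
    and \<pi> :: "'k vec \<Rightarrow> 'v \<Rightarrow> 'v"
    and N :: "(xmonom \<Rightarrow>\<^sub>0 'v) set"
    and \<phi> :: "(xmonom \<Rightarrow>\<^sub>0 'v) \<Rightarrow> 'm"
  assumes "torus_rep n sV \<pi>"
    and "equivariant_module r n M"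
    and "equivariant_presentation r n sV \<pi> N \<phi> M"
  shows "K_polynomial (r + 1) n (stabilization r n sV \<pi> N) = rho r n (K_polynomial r n M)"
proof -
  obtain q w co where "coords n q w sV \<pi> co" using coords_exist[OF assms(1)] by blast
  then interpret coords n q w sV \<pi> co .
  note N = presentation_kernel[OF assms(2,3)]
  let ?W = "Ph ` N"
  have "\<exists>K. lk K = conv (Pr r n) (\<lambda>d. int (hd (FM n q r :: 'k fvec set) d) - int (hd ?W d))"
    by (rule K_polynomial_exists[OF eqs_ksub[OF N(2)] eqs_FM[OF N(2)]]) (rule eqs_mult[OF N(2) cin_var])
  then obtain K where K: "lk K = conv (Pr r n) (\<lambda>d. int (hd (FM n q r :: 'k fvec set) d) - int (hd ?W d))" by blast
  have "Hilb r n M = (\<lambda>d. int (hd (FM n q r :: 'k fvec set) d) - int (hd ?W d))" by (rule ext) (rule N(3))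
  then have KM: "K_polynomial r n M = K" using K by (intro K_polynomial_eq) simp
  let ?G = "eqs_gen (r + 1) ?W" and ?J = "JF (r + 1) :: 'k fvec set"
  have "?W \<subseteq> FM n q (r + 1)" using eqs_FM[OF N(2)] FM_mono[of r "r + 1"] by auto
  then have G: "eqs (r + 1) ?G" by (rule eqs_eqs_gen)
  \<comment> \<open>Both summands of the relations are full preimages under \<open>Ph\<close>, so
    their sum is the preimage of the sum.\<close>
  have "stabilization r n sV \<pi> N = quotient_module (Fr (r + 1)) {p \<in> carrier (Fr (r + 1)). Ph p \<in> splus ?G ?J}"
    unfolding stabilization_def minor_ideal_eq Ph_stab[OF N(1)] Ph_ideal_tensor Ph_set_add[OF eqs_FM[OF G] eqs_FM[OF eqs_JF]] ..
  then have "Hilb (r + 1) n (stabilization r n sV \<pi> N) = (\<lambda>d. int (hd (FM n q (r + 1) :: 'k fvec set) d) - int (hd (splus ?G ?J) d))"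
    using Hilb_quotient_module[OF eqs_splus[OF G eqs_JF] refl] by (intro ext) simp
  then have "K_polynomial (r + 1) n (stabilization r n sV \<pi> N) = rho r n K"
    using stab_series[OF N(2) K] by (intro K_polynomial_eq) simp
  then show ?thesis by (simp only: KM)
qed

end
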